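(* Let $\Omega$ be a bounded convex open subset of $\mathbb{R}^d$. Let $\mathcal{A}$ be a (nonempty) compact metric space, let $a\in C(\overline{\Omega}\times\mathcal{A};\mathbb{R}^{d\times d}_{\mathrm{sym},+})$ be such that there exist constants $\overline{\nu}\geq\underline{\nu}>0$ and $\varepsilon\in(0,1]$ with $a(x,\alpha)\in\mathcal{C}(\underline{\nu},\overline{\nu},\varepsilon)$ for all $x\in\overline{\Omega}$ and $\alpha\in\mathcal{A}$, and let $f\in C(\overline{\Omega}\times\mathcal{A})$. Let the Hamiltonian be $H(x,M):=\sup_{\alpha\in\mathcal{A}}\{-a(x,\alpha):M-f(x,\alpha)\}$. Let $G\in V^*$ be nonnegative in the sense of distributions. Suppose that the operator $F\colon L^2(\Omega)\to L^2(\Omega)$ is strictly monotone on $L^2_+(\Omega)$, i.e. for all $m_1,m_2\in L^2_+(\Omega)$, if $(F[m_1]-F[m_2],m_1-m_2)_\Omega\leq 0$ then $m_1=m_2$. Then any solution $(u,m)\in V\times L^2(\Omega)$ of the PDI problem and, equivalently, of the VI problem, is unique (i.e. there is at most one solution).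
   Context: Notation: $d\ge1$; $\mathbb{R}^{d\times d}_{\mathrm{sym}}$ is the space of real symmetric $d\times d$ matrices, $\mathbb{R}^{d\times d}_{\mathrm{sym},+}$ its subset of positive semidefinite matrices; $A:B=\sum_{i,j}A_{ij}B_{ij}$; $|\cdot|$ is the Frobenius norm. $(\cdot,\cdot)_\Omega$ is the inner product of $L^2(\Omega)$ and $L^2_+(\Omega)$ is the set of functions in $L^2(\Omega)$ that are nonnegative a.e. in $\Omega$. $V:=H^2(\Omega)\cap H^1_0(\Omega)$ with the norm and inner product of $H^2(\Omega)$; $V^*$ is its dual, with duality pairing $\langle\cdot,\cdot\rangle_{V^*\times V}$. $G\in V^*$ is nonnegative in the sense of distributions if $\langle G,v\rangle_{V^*\times V}\geq 0$ for all $v\in V$ with $v\ge 0$ a.e. in $\Omega$. Cordes class: for $\overline{\nu}\geq\underline{\nu}>0$ and $\varepsilon\in(0,1]$, $\mathcal{C}(\underline{\nu},\overline{\nu},\varepsilon)$ is the set of all $\overline{a}\in\mathbb{R}^{d\times d}_{\mathrm{sym},+}$ such that $\underline{\nu}|\xi|^2\leq\xi^T\overline{a}\xi\leq\overline{\nu}|\xi|^2$ for all $\xi\in\mathbb{R}^d$ and $\frac{|\overline{a}|}{\mathrm{Tr}\,\overline{a}}\leq\frac{1}{\sqrt{d-1+\varepsilon}}$. For $v\in V$, $H[v]\in L^2(\Omega)$ is given by $H[v](x):=H(x,D^2v(x))$ for a.e. $x\in\Omega$. The partial subdifferential is $\partial_M H(x,M):=\{A\in\mathbb{R}^{d\times d}_{\mathrm{sym}}: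 H(x,M)+A:(\widetilde M-M)\leq H(x,\widetilde M)\ \forall \widetilde M\in\mathbb{R}^{d\times d}_{\mathrm{sym}}\}$. For $v\in V$, $\mathcal{D}H[v]:=\{A\in L^\infty(\Omega;\mathbb{R}^{d\times d}_{\mathrm{sym}}): A(x)\in\partial_M H(x,D^2v(x))\text{ for a.e. }x\in\Omega\}$. PDI problem: $(u,m)\in V\times L^2(\Omega)$ is a solution of the PDI problem if $H[u]=F[m]$ a.e. in $\Omega$ and there exists $-\overline{a}\in\mathcal{D}H[u]$ such that $(m,-\overline{a}:D^2v)_\Omega=\langle G,v\rangle_{V^*\times V}$ for all $v\in V$. VI problem: $(u,m)\in V\times L^2_+(\Omega)$ is a solution of the VI problem if $H[u]=F[m]$ a.e. in $\Omega$ and $\langle G,v-u\rangle_{V^*\times V}\leq (m,H[v]-H[u])_\Omega$ for all $v\in V$. *)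

theory Defs
  imports "HOL-Analysis.Analysis"
begin

text \<open>
  Elements of \<open>L\<^sup>2(\<Omega>)\<close> and of Sobolev spaces on \<open>\<Omega>\<close> are represented by functions on the whole of
  \<open>\<real>\<^sup>d\<close> of which only the values in \<open>\<Omega>\<close>, up to \<open>lebesgue_on \<Omega>\<close>-null sets, matter. Equality
  in these spaces is \<open>ae_eq\<close>. On \<open>real^'d^'d\<close> the library's \<open>norm\<close> is the Frobenius norm and
  \<open>A \<bullet> B\<close> is \<open>A : B\<close>, the sum of all \<open>A\<^sub>i\<^sub>j * B\<^sub>i\<^sub>j\<close>.
\<close>

definition ae_eq :: "(real^'d) set \<Rightarrow> (real^'d \<Rightarrow> real) \<Rightarrow> (real^'d \<Rightarrow> real) \<Rightarrow> bool" where
  "ae_eq \<Omega> f g \<longleftrightarrow> (AE x in lebesgue_on \<Omega>. f x = g x)"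

definition L2 :: "(real^'d) set \<Rightarrow> (real^'d \<Rightarrow> real) set" where
  "L2 \<Omega> = {f. f \<in> borel_measurable (lebesgue_on \<Omega>) \<and> integrable (lebesgue_on \<Omega>) (\<lambda>x. (f x)\<^sup>2)}"

definition L2_plus :: "(real^'d) set \<Rightarrow> (real^'d \<Rightarrow> real) set" where
  "L2_plus \<Omega> = {f \<in> L2 \<Omega>. AE x in lebesgue_on \<Omega>. 0 \<le> f x}"

definition L2_inner :: "(real^'d) set \<Rightarrow> (real^'d \<Rightarrow> real) \<Rightarrow> (real^'d \<Rightarrow> real) \<Rightarrow> real" where
  "L2_inner \<Omega> f g = (LINT x|lebesgue_on \<Omega>. f x * g x)"

definition L2_norm :: "(real^'d) set \<Rightarrow> (real^'d \<Rightarrow> real) \<Rightarrow> real" where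
  "L2_norm \<Omega> f = sqrt (L2_inner \<Omega> f f)"

text \<open>
  The second conjunct says that \<open>F\<close>, given on representatives, is well defined on \<open>L\<^sup>2(\<Omega>)\<close>.
  No linearity or continuity is required.
\<close>
definition L2_operator ::
    "(real^'d) set \<Rightarrow> ((real^'d \<Rightarrow> real) \<Rightarrow> real^'d \<Rightarrow> real) \<Rightarrow> bool" where
  "L2_operator \<Omega> F \<longleftrightarrow>
     (\<forall>m \<in> L2 \<Omega>. F m \<in> L2 \<Omega>) \<and>
     (\<forall>m1 \<in> L2 \<Omega>. \<forall>m2 \<in> L2 \<Omega>. ae_eq \<Omega> m1 m2 \<longrightarrow> ae_eq \<Omega> (F m1) (F m2))"

definition strictly_monotone_on_L2_plus ::
    "(real^'d) set \<Rightarrow> ((real^'d \<Rightarrow> real) \<Rightarrow> real^'d \<Rightarrow> real) \<Rightarrow> bool" where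
  "strictly_monotone_on_L2_plus \<Omega> F \<longleftrightarrow>
     (\<forall>m1 \<in> L2_plus \<Omega>. \<forall>m2 \<in> L2_plus \<Omega>.
        L2_inner \<Omega> (\<lambda>x. F m1 x - F m2 x) (\<lambda>x. m1 x - m2 x) \<le> 0 \<longrightarrow> ae_eq \<Omega> m1 m2)"

definition pderiv_at :: "'d::finite \<Rightarrow> (real^'d \<Rightarrow> real) \<Rightarrow> real^'d \<Rightarrow> real" where
  "pderiv_at i f x = frechet_derivative f (at x) (axis i 1)"

fun iterated_pderiv :: "'d::finite list \<Rightarrow> (real^'d \<Rightarrow> real) \<Rightarrow> real^'d \<Rightarrow> real" where
  "iterated_pderiv [] f = f"
| "iterated_pderiv (i # is) f = pderiv_at i (iterated_pderiv is f)"

text \<open>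
  \<open>C\<^sup>\<infinity>(\<real>\<^sup>d)\<close>: partial derivatives of all orders are Frechet differentiable, hence continuous.
\<close>
definition smooth :: "(real^'d \<Rightarrow> real) \<Rightarrow> bool" where
  "smooth f \<longleftrightarrow> (\<forall>is. iterated_pderiv is f differentiable_on UNIV)"

definition test_functions :: "(real^'d) set \<Rightarrow> (real^'d \<Rightarrow> real) set" where
  "test_functions \<Omega> = {\<phi>. smooth \<phi> \<and> (\<exists>K. compact K \<and> K \<subseteq> \<Omega> \<and> (\<forall>x. x \<notin> K \<longrightarrow> \<phi> x = 0))}"

definition has_weak_pderiv ::
    "(real^'d) set \<Rightarrow> 'd \<Rightarrow> (real^'d \<Rightarrow> real) \<Rightarrow> (real^'d \<Rightarrow> real) \<Rightarrow> bool" where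
  "has_weak_pderiv \<Omega> i u g \<longleftrightarrow> u \<in> L2 \<Omega> \<and> g \<in> L2 \<Omega> \<and>
     (\<forall>\<phi> \<in> test_functions \<Omega>. L2_inner \<Omega> u (pderiv_at i \<phi>) = - L2_inner \<Omega> g \<phi>)"

text \<open>
  A representative of the \<open>L\<^sup>2\<close> weak derivative, which is determined up to \<open>ae_eq\<close> when it exists;
  unspecified otherwise.
\<close>
definition weak_pderiv :: "(real^'d) set \<Rightarrow> 'd \<Rightarrow> (real^'d \<Rightarrow> real) \<Rightarrow> real^'d \<Rightarrow> real" where
  "weak_pderiv \<Omega> i u = (SOME g. has_weak_pderiv \<Omega> i u g)"

definition H1 :: "(real^'d) set \<Rightarrow> (real^'d \<Rightarrow> real) set" where
  "H1 \<Omega> = {u \<in> L2 \<Omega>. \<forall>i. \<exists>g. has_weak_pderiv \<Omega> i u g}"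

definition H1_norm :: "(real^'d) set \<Rightarrow> (real^'d \<Rightarrow> real) \<Rightarrow> real" where
  "H1_norm \<Omega> u = sqrt ((L2_norm \<Omega> u)\<^sup>2 + (\<Sum>i\<in>UNIV. (L2_norm \<Omega> (weak_pderiv \<Omega> i u))\<^sup>2))"

definition H1_0 :: "(real^'d) set \<Rightarrow> (real^'d \<Rightarrow> real) set" where
  "H1_0 \<Omega> = {u \<in> H1 \<Omega>. \<exists>\<phi> :: nat \<Rightarrow> real^'d \<Rightarrow> real.
     (\<forall>n. \<phi> n \<in> test_functions \<Omega>) \<and> (\<lambda>n. H1_norm \<Omega> (\<lambda>x. \<phi> n x - u x)) \<longlonglongrightarrow> 0}"

definition H2 :: "(real^'d) set \<Rightarrow> (real^'d \<Rightarrow> real) set" where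
  "H2 \<Omega> = {u \<in> H1 \<Omega>. \<forall>i. weak_pderiv \<Omega> i u \<in> H1 \<Omega>}"

definition weak_hessian :: "(real^'d) set \<Rightarrow> (real^'d \<Rightarrow> real) \<Rightarrow> real^'d \<Rightarrow> real^'d^'d" where
  "weak_hessian \<Omega> u x = (\<chi> i j. weak_pderiv \<Omega> j (weak_pderiv \<Omega> i u) x)"

definition H2_norm :: "(real^'d) set \<Rightarrow> (real^'d \<Rightarrow> real) \<Rightarrow> real" where
  "H2_norm \<Omega> u = sqrt ((L2_norm \<Omega> u)\<^sup>2 + (\<Sum>i\<in>UNIV. (L2_norm \<Omega> (weak_pderiv \<Omega> i u))\<^sup>2)
     + (\<Sum>i\<in>UNIV. \<Sum>j\<in>UNIV. (L2_norm \<Omega> (weak_pderiv \<Omega> j (weak_pderiv \<Omega> i u)))\<^sup>2))"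

definition V_space :: "(real^'d) set \<Rightarrow> (real^'d \<Rightarrow> real) set" where
  "V_space \<Omega> = H2 \<Omega> \<inter> H1_0 \<Omega>"

text \<open>
  Bounded linear functionals on \<open>V\<close>; invariance under \<open>ae_eq\<close> follows from boundedness.
\<close>
definition V_dual :: "(real^'d) set \<Rightarrow> ((real^'d \<Rightarrow> real) \<Rightarrow> real) set" where
  "V_dual \<Omega> = {G.
     (\<forall>v \<in> V_space \<Omega>. \<forall>w \<in> V_space \<Omega>. G (\<lambda>x. v x + w x) = G v + G w) \<and>
     (\<forall>c. \<forall>v \<in> V_space \<Omega>. G (\<lambda>x. c * v x) = c * G v) \<and>
     (\<exists>C. \<forall>v \<in> V_space \<Omega>. \<bar>G v\<bar> \<le> C * H2_norm \<Omega> v)}"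

definition nonneg_distribution ::
    "(real^'d) set \<Rightarrow> ((real^'d \<Rightarrow> real) \<Rightarrow> real) \<Rightarrow> bool" where
  "nonneg_distribution \<Omega> G \<longleftrightarrow>
     (\<forall>v \<in> V_space \<Omega>. (AE x in lebesgue_on \<Omega>. 0 \<le> v x) \<longrightarrow> 0 \<le> G v)"

definition sym_matrices :: "(real^'d^'d) set" where
  "sym_matrices = {A. transpose A = A}"

definition sym_psd_matrices :: "(real^'d^'d) set" where
  "sym_psd_matrices = {A \<in> sym_matrices. \<forall>\<xi>. 0 \<le> \<xi> \<bullet> (A *v \<xi>)}"

definition cordes_class :: "real \<Rightarrow> real \<Rightarrow> real \<Rightarrow> (real^'d^'d) set" where
  "cordes_class \<nu>l \<nu>u \<epsilon> = {A \<in> sym_psd_matrices.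
     (\<forall>\<xi>. \<nu>l * (norm \<xi>)\<^sup>2 \<le> \<xi> \<bullet> (A *v \<xi>) \<and> \<xi> \<bullet> (A *v \<xi>) \<le> \<nu>u * (norm \<xi>)\<^sup>2) \<and>
     norm A / trace A \<le> 1 / sqrt (real CARD('d) - 1 + \<epsilon>)}"

definition hamiltonian ::
    "'a set \<Rightarrow> (real^'d \<Rightarrow> 'a \<Rightarrow> real^'d^'d) \<Rightarrow> (real^'d \<Rightarrow> 'a \<Rightarrow> real) \<Rightarrow> real^'d \<Rightarrow> real^'d^'d \<Rightarrow> real"
  where "hamiltonian \<A> a f x M = (SUP \<alpha>\<in>\<A>. - (a x \<alpha> \<bullet> M) - f x \<alpha>)"

definition hamiltonian_op ::
    "(real^'d) set \<Rightarrow> (real^'d \<Rightarrow> real^'d^'d \<Rightarrow> real) \<Rightarrow> (real^'d \<Rightarrow> real) \<Rightarrow> real^'d \<Rightarrow> real" where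
  "hamiltonian_op \<Omega> H v x = H x (weak_hessian \<Omega> v x)"

definition partial_subdifferential ::
    "(real^'d \<Rightarrow> real^'d^'d \<Rightarrow> real) \<Rightarrow> real^'d \<Rightarrow> real^'d^'d \<Rightarrow> (real^'d^'d) set" where
  "partial_subdifferential H x M =
     {A \<in> sym_matrices. \<forall>M' \<in> sym_matrices. H x M + A \<bullet> (M' - M) \<le> H x M'}"

definition Linf_sym :: "(real^'d) set \<Rightarrow> (real^'d \<Rightarrow> real^'d^'d) set" where
  "Linf_sym \<Omega> = {A. A \<in> borel_measurable (lebesgue_on \<Omega>) \<and>
     (AE x in lebesgue_on \<Omega>. A x \<in> sym_matrices) \<and>
     (\<exists>C. AE x in lebesgue_on \<Omega>. norm (A x) \<le> C)}"

definition DH ::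
    "(real^'d) set \<Rightarrow> (real^'d \<Rightarrow> real^'d^'d \<Rightarrow> real) \<Rightarrow> (real^'d \<Rightarrow> real) \<Rightarrow> (real^'d \<Rightarrow> real^'d^'d) set"
  where "DH \<Omega> H v = {A \<in> Linf_sym \<Omega>.
     AE x in lebesgue_on \<Omega>. A x \<in> partial_subdifferential H x (weak_hessian \<Omega> v x)}"

definition PDI_solution ::
    "(real^'d) set \<Rightarrow> (real^'d \<Rightarrow> real^'d^'d \<Rightarrow> real) \<Rightarrow> ((real^'d \<Rightarrow> real) \<Rightarrow> real^'d \<Rightarrow> real) \<Rightarrow>
     ((real^'d \<Rightarrow> real) \<Rightarrow> real) \<Rightarrow> (real^'d \<Rightarrow> real) \<Rightarrow> (real^'d \<Rightarrow> real) \<Rightarrow> bool" where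
  "PDI_solution \<Omega> H F G u m \<longleftrightarrow>
     u \<in> V_space \<Omega> \<and> m \<in> L2 \<Omega> \<and>
     ae_eq \<Omega> (hamiltonian_op \<Omega> H u) (F m) \<and>
     (\<exists>abar. (\<lambda>x. - abar x) \<in> DH \<Omega> H u \<and>
        (\<forall>v \<in> V_space \<Omega>. L2_inner \<Omega> m (\<lambda>x. - (abar x \<bullet> weak_hessian \<Omega> v x)) = G v))"

definition VI_solution ::
    "(real^'d) set \<Rightarrow> (real^'d \<Rightarrow> real^'d^'d \<Rightarrow> real) \<Rightarrow> ((real^'d \<Rightarrow> real) \<Rightarrow> real^'d \<Rightarrow> real) \<Rightarrow>
     ((real^'d \<Rightarrow> real) \<Rightarrow> real) \<Rightarrow> (real^'d \<Rightarrow> real) \<Rightarrow> (real^'d \<Rightarrow> real) \<Rightarrow> bool" where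
  "VI_solution \<Omega> H F G u m \<longleftrightarrow>
     u \<in> V_space \<Omega> \<and> m \<in> L2_plus \<Omega> \<and>
     ae_eq \<Omega> (hamiltonian_op \<Omega> H u) (F m) \<and>
     (\<forall>v \<in> V_space \<Omega>. G (\<lambda>x. v x - u x)
        \<le> L2_inner \<Omega> m (\<lambda>x. hamiltonian_op \<Omega> H v x - hamiltonian_op \<Omega> H u x))"

definition at_most_one_solution ::
    "(real^'d) set \<Rightarrow> ((real^'d \<Rightarrow> real) \<Rightarrow> (real^'d \<Rightarrow> real) \<Rightarrow> bool) \<Rightarrow> bool" where
  "at_most_one_solution \<Omega> S \<longleftrightarrow>
     (\<forall>u1 m1 u2 m2. S u1 m1 \<and> S u2 m2 \<longrightarrow> ae_eq \<Omega> u1 u2 \<and> ae_eq \<Omega> m1 m2)"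

end

theory Submission
  imports Defs
begin

text \<open>
  If \<open>-q\<close> is a measurable subgradient field of the Hamiltonian along \<open>u\<close>, convexity turns the equation for the
  density into the variational inequality as soon as \<open>m \<ge> 0\<close>. Adding the inequalities of two solutions, each
  tested with the other, gives \<open>(F[m\<^sub>1] - F[m\<^sub>2], m\<^sub>1 - m\<^sub>2) \<le> 0\<close>, hence \<open>m\<^sub>1 = m\<^sub>2\<close> and \<open>H[u\<^sub>1] = H[u\<^sub>2]\<close>. Then
  the Hessian \<open>D\<close> of \<open>u\<^sub>1 - u\<^sub>2\<close> satisfies, after scaling, \<open>\<bar>tr D\<bar> \<le> sqrt (1 - \<epsilon>) * \<bar>D\<bar>\<close> by the Cordes condition,
  so \<open>u\<^sub>1 = u\<^sub>2\<close> by the Miranda-Talenti inequality \<open>\<integral>\<bar>D\<^sup>2 v\<bar>\<^sup>2 \<le> \<integral>\<bar>\<Delta> v\<bar>\<^sup>2\<close>.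

  That \<open>m \<ge> 0\<close> holds follows by duality from \<open>G \<ge> 0\<close>, once \<open>- q : D\<^sup>2 v = f\<close> has a solution in \<open>V\<close> for every
  \<open>f \<ge> 0\<close>, and this solution is nonnegative. Existence follows from the Miranda-Talenti inequality by contraction.
  There is no maximum principle for measurable coefficients, so positivity is proved for smooth coefficients (for
  \<open>\<mu> z - q : D\<^sup>2 z = f\<close> with \<open>\<mu>\<close> large by an energy estimate, then down to \<open>\<mu> = 0\<close> in steps of fixed length)
  and passes to measurable ones by mollification, as the constants depend on the Cordes condition only.

  On a convex domain without boundary regularity the Miranda-Talenti inequality comes from an interior estimate for
  the mollified solution \<open>w\<close> of Poisson's equation: one integrates \<open>th(\<psi>) (\<bar>D\<^sup>2 w\<bar>\<^sup>2 - (\<Delta> w)\<^sup>2)\<close> by parts, where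
  \<open>\<psi>\<close> is a mollification of \<open>min(1, n dist(x, \<partial>U))\<close> and \<open>th(t) \<approx> t powr (1 + \<alpha>)\<close>. The error terms are controlled
  by the concavity of \<open>\<psi>\<close> and by \<open>\<bar>w\<bar> \<le> C \<psi>\<close>, a barrier argument, and they vanish as \<open>\<alpha> \<rightarrow> 0\<close>.
\<close>

text \<open>Strict monotonicity is assumed for nonnegative functions only, so in the PDI problem the
  sign of \<open>m\<close> has to be settled before two solutions can be compared. The scaling
  factor is c = tr A / |A|^2: it gives |c A - I|^2 = d - (tr A)^2 / |A|^2 <= 1 - \<epsilon>, a
  perturbation of the Laplacian of size below one. It yields a contraction only because the constant
  in the Miranda-Talenti inequality is exactly one; hence the errors of the interior estimate must
  vanish, not merely stay bounded. With the weight th(t) = t the integration by parts would leave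
  only a term with th' and the Hessian of \<psi>, whose sign is right by concavity. But \<psi> is
  concave only away from the boundary, so the weight has to vanish below a level \<delta>. The power
  1 + \<alpha>, cut off below \<delta>, does so at the price of terms with th''. These involve the
  gradient of w only in directions tangential to the level sets of \<psi>; one more integration by
  parts turns them into terms with w itself, where the barrier applies.\<close>

abbreviation usum (binder "\<Oplus>" 10) where "usum f \<equiv> sum f UNIV"
abbreviation pd where "pd \<equiv> pderiv_at"
abbreviation \<D> where "\<D> \<equiv> test_functions"
abbreviation \<L> where "\<L> \<equiv> lebesgue_on"

section \<open>Square integrable functions\<close>

definition sqint :: "'a measure \<Rightarrow> ('a \<Rightarrow> real) \<Rightarrow> bool" where
  "sqint M f \<longleftrightarrow> f \<in> borel_measurable M \<and> integrable M (\<lambda>x. (f x)\<^sup>2)"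

definition nL2 :: "'a measure \<Rightarrow> ('a \<Rightarrow> real) \<Rightarrow> real" where
  "nL2 M f = sqrt (LINT x|M. (f x)\<^sup>2)"

lemma sqint_measurable: "sqint M f \<Longrightarrow> f \<in> borel_measurable M"
  by (simp add: sqint_def)

lemma sqint_square: "sqint M f \<Longrightarrow> integrable M (\<lambda>x. (f x)\<^sup>2)"
  by (simp add: sqint_def)

lemma nL2_nonneg [simp]: "0 \<le> nL2 M f"
  by (simp add: nL2_def)

lemma nL2_sq: "(nL2 M f)\<^sup>2 = (LINT x|M. (f x)\<^sup>2)"
  by (simp add: nL2_def)

lemma abs_mult_le_squares: "\<bar>a * b\<bar> \<le> a\<^sup>2 + (b::real)\<^sup>2"
proof -
  have "0 \<le> (\<bar>a\<bar> - \<bar>b\<bar>)\<^sup>2" "0 \<le> \<bar>a\<bar> * \<bar>b\<bar>" by simp_all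
  then have "\<bar>a\<bar> * \<bar>b\<bar> \<le> a\<^sup>2 + b\<^sup>2" unfolding power2_diff mult.assoc power2_abs by linarith
  then show ?thesis by (simp add: abs_mult)
qed

lemma sqint_mult:
  assumes "sqint M f" "sqint M g"
  shows "integrable M (\<lambda>x. f x * g x)"
proof (rule Bochner_Integration.integrable_bound)
  show "integrable M (\<lambda>x. (f x)\<^sup>2 + (g x)\<^sup>2)" using assms by (simp add: sqint_def)
  show "(\<lambda>x. f x * g x) \<in> borel_measurable M" using assms by (intro borel_measurable_times sqint_measurable)
  show "AE x in M. norm (f x * g x) \<le> norm ((f x)\<^sup>2 + (g x)\<^sup>2)"
    using abs_mult_le_squares by (simp add: abs_of_nonneg)
qed

lemma sqint_add:
  assumes "sqint M f" "sqint M g" shows "sqint M (\<lambda>x. f x + g x)"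
proof -
  have "integrable M (\<lambda>x. (f x)\<^sup>2 + (g x)\<^sup>2 + 2 * (f x * g x))"
    using assms sqint_mult[OF assms] by (simp add: sqint_def)
  moreover have "(\<lambda>x. f x + g x) \<in> borel_measurable M"
    using assms by (intro borel_measurable_add sqint_measurable)
  ultimately show ?thesis by (simp add: sqint_def power2_sum mult.assoc)
qed

lemma sqint_scale: "sqint M f \<Longrightarrow> sqint M (\<lambda>x. c * f x)"
  by (auto simp: sqint_def power_mult_distrib)

lemma sqint_diff:
  assumes "sqint M f" "sqint M g" shows "sqint M (\<lambda>x. f x - g x)"
  using sqint_add[OF assms(1) sqint_scale[OF assms(2), of "-1"]] by simp

lemma sqint_zero [simp]: "sqint M (\<lambda>x. 0)"
  by (simp add: sqint_def)

lemma sqint_sum: "(\<And>i. i \<in> I \<Longrightarrow> sqint M (f i)) \<Longrightarrow> sqint M (\<lambda>x. \<Sum>i\<in>I. f i x)"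
  by (induction I rule: infinite_finite_induct) (auto intro: sqint_add)

lemma sqint_bound_mult:
  assumes f: "sqint M f" and [measurable]: "g \<in> borel_measurable M" and b: "AE x in M. \<bar>g x\<bar> \<le> C"
  shows "sqint M (\<lambda>x. g x * f x)"
proof -
  have [measurable]: "f \<in> borel_measurable M" using f by (simp add: sqint_def)
  have "integrable M (\<lambda>x. (g x * f x)\<^sup>2)"
  proof (rule Bochner_Integration.integrable_bound)
    show "integrable M (\<lambda>x. C\<^sup>2 * (f x)\<^sup>2)" using f by (simp add: sqint_def)
    show "AE x in M. norm ((g x * f x)\<^sup>2) \<le> norm (C\<^sup>2 * (f x)\<^sup>2)"
      using b
    proof eventually_elim
      case (elim x)
      then have "(g x)\<^sup>2 \<le> C\<^sup>2" using abs_le_square_iff[of "g x" C] by simp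
      then show ?case by (simp add: power_mult_distrib mult_right_mono)
    qed
  qed measurable
  then show ?thesis by (simp add: sqint_def)
qed

lemma sqint_cong_AE:
  assumes "sqint M f" "g \<in> borel_measurable M" "AE x in M. f x = g x"
  shows "sqint M g"
proof -
  have "integrable M (\<lambda>x. (f x)\<^sup>2) \<longleftrightarrow> integrable M (\<lambda>x. (g x)\<^sup>2)"
    by (rule integrable_cong_AE) (use assms in \<open>auto simp: sqint_def elim: eventually_mono\<close>)
  then show ?thesis using assms by (simp add: sqint_def)
qed

lemma nL2_mono:
  assumes "sqint M g" "f \<in> borel_measurable M" "AE x in M. \<bar>f x\<bar> \<le> \<bar>g x\<bar>"
  shows "nL2 M f \<le> nL2 M g"
  unfolding nL2_def
proof (rule real_sqrt_le_mono, rule integral_mono_AE)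
  show "integrable M (\<lambda>x. (g x)\<^sup>2)" using assms by (simp add: sqint_def)
  show "AE x in M. (f x)\<^sup>2 \<le> (g x)\<^sup>2" using assms(3) by eventually_elim (simp add: abs_le_square_iff)
  then show "integrable M (\<lambda>x. (f x)\<^sup>2)"
    by (intro Bochner_Integration.integrable_bound[OF sqint_square[OF assms(1)]])
      (use assms in \<open>auto elim: eventually_mono\<close>)
qed

lemma nL2_scale: "nL2 M (\<lambda>x. c * f x) = \<bar>c\<bar> * nL2 M f"
  by (simp add: nL2_def power_mult_distrib real_sqrt_mult)

lemma nL2_commute: "nL2 M (\<lambda>x. f x - g x) = nL2 M (\<lambda>x. g x - f x)"
  by (simp add: nL2_def power2_commute)

lemma nL2_cong_AE:
  assumes "f \<in> borel_measurable M" "g \<in> borel_measurable M" "AE x in M. f x = g x"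
  shows "nL2 M f = nL2 M g"
  unfolding nL2_def
  by (intro arg_cong[where f=sqrt] integral_cong_AE) (use assms in \<open>auto elim: eventually_mono\<close>)

lemma nL2_Cauchy_Schwarz:
  assumes "sqint M f" "sqint M g"
  shows "\<bar>LINT x|M. f x * g x\<bar> \<le> nL2 M f * nL2 M g"
proof -
  define a b c where "a = (LINT x|M. (f x)\<^sup>2)" "b = (LINT x|M. f x * g x)" "c = (LINT x|M. (g x)\<^sup>2)"
  note ints = sqint_mult[OF assms] sqint_square[OF assms(1)] sqint_square[OF assms(2)]
  have q: "0 \<le> s\<^sup>2 * a + 2 * s * t * b + t\<^sup>2 * c" for s t
  proof -
    have "0 \<le> (LINT x|M. (s * f x + t * g x)\<^sup>2)" by simp
    also have "\<dots> = (LINT x|M. s\<^sup>2 * (f x)\<^sup>2 + 2 * s * t * (f x * g x) + t\<^sup>2 * (g x)\<^sup>2)"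
      by (rule Bochner_Integration.integral_cong) (auto simp: power2_sum power_mult_distrib)
    finally show ?thesis using ints by (simp add: a_b_c_def)
  qed
  have ac: "0 \<le> a" "0 \<le> c" by (simp_all add: a_b_c_def)
  have "b\<^sup>2 \<le> a * c"
  proof (cases "c > 0")
    case True
    have "0 \<le> c\<^sup>2 * a + 2 * c * (- b) * b + (-b)\<^sup>2 * c" by (rule q)
    also have "\<dots> = c * (a * c - b\<^sup>2)" by (simp add: power2_eq_square algebra_simps)
    finally show ?thesis using True by (simp add: zero_le_mult_iff)
  next
    case False
    then have c0: "c = 0" using ac by simp
    have "b = 0"
    proof (rule ccontr)
      assume b: "b \<noteq> 0"
      \<comment> \<open>With \<open>c = 0\<close> the form is affine in \<open>t\<close>, and this
        \<open>t\<close> makes it equal to \<open>- a - 2\<close>.\<close>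
      have "0 \<le> 1\<^sup>2 * a + 2 * 1 * (-(a + 1) / b) * b + (-(a + 1) / b)\<^sup>2 * c" by (rule q)
      also have "\<dots> = a - 2 * (a + 1)" using b c0 by simp
      finally show False using ac by simp
    qed
    then show ?thesis using c0 by simp
  qed
  then have "sqrt (b\<^sup>2) \<le> sqrt (a * c)" by (rule real_sqrt_le_mono)
  then show ?thesis by (simp add: nL2_def a_b_c_def real_sqrt_mult)
qed

lemma nL2_triangle:
  assumes "sqint M f" "sqint M g"
  shows "nL2 M (\<lambda>x. f x + g x) \<le> nL2 M f + nL2 M g"
proof (rule power2_le_imp_le)
  note ints = sqint_mult[OF assms] sqint_square[OF assms(1)] sqint_square[OF assms(2)]
  have "(nL2 M (\<lambda>x. f x + g x))\<^sup>2 = (LINT x|M. (f x)\<^sup>2 + (g x)\<^sup>2 + 2 * (f x * g x))"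
    by (simp add: nL2_sq power2_sum mult.assoc)
  also have "\<dots> = (nL2 M f)\<^sup>2 + (nL2 M g)\<^sup>2 + 2 * (LINT x|M. f x * g x)"
    using ints by (simp add: nL2_sq)
  also have "\<dots> \<le> (nL2 M f + nL2 M g)\<^sup>2"
    using nL2_Cauchy_Schwarz[OF assms] by (simp add: power2_sum)
  finally show "(nL2 M (\<lambda>x. f x + g x))\<^sup>2 \<le> (nL2 M f + nL2 M g)\<^sup>2" .
qed simp

lemma nL2_triangle_diff:
  assumes "sqint M f" "sqint M g" "sqint M h"
  shows "nL2 M (\<lambda>x. f x - h x) \<le> nL2 M (\<lambda>x. f x - g x) + nL2 M (\<lambda>x. g x - h x)"
  using nL2_triangle[OF sqint_diff[OF assms(1,2)] sqint_diff[OF assms(2,3)]] by simp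

lemma nL2_diff_ge:
  assumes "sqint M f" "sqint M g"
  shows "\<bar>nL2 M f - nL2 M g\<bar> \<le> nL2 M (\<lambda>x. f x - g x)"
  using nL2_triangle[OF sqint_diff[OF assms] assms(2)]
    nL2_triangle[OF sqint_diff[OF assms(2,1)] assms(1)] nL2_commute[of M f g]
  by simp

lemma nL2_eq_0_AE:
  assumes "sqint M f" "nL2 M f = 0" shows "AE x in M. f x = 0"
proof -
  have "(LINT x|M. (f x)\<^sup>2) = 0" using assms(2) by (simp add: nL2_def)
  then have "AE x in M. (f x)\<^sup>2 = 0"
    using integral_nonneg_eq_0_iff_AE[OF sqint_square[OF assms(1)]] by simp
  then show ?thesis by simp
qed

lemma AE_eq_of_nL2:
  assumes "sqint M f" "sqint M g" "nL2 M (\<lambda>x. f x - g x) \<le> 0" shows "AE x in M. f x = g x"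
  using nL2_eq_0_AE[OF sqint_diff[OF assms(1,2)]] assms(3) nL2_nonneg[of M "\<lambda>x. f x - g x"] by auto

section \<open>Convergence, completeness and Riesz representation in L2\<close>

definition L2_conv :: "'a measure \<Rightarrow> (nat \<Rightarrow> 'a \<Rightarrow> real) \<Rightarrow> ('a \<Rightarrow> real) \<Rightarrow> bool" where
  "L2_conv M s f \<longleftrightarrow> (\<forall>n. sqint M (s n)) \<and> sqint M f \<and> (\<lambda>n. nL2 M (\<lambda>x. s n x - f x)) \<longlonglongrightarrow> 0"

lemma L2_convD:
  assumes "L2_conv M s f"
  shows "sqint M (s n)" "sqint M f" "(\<lambda>n. nL2 M (\<lambda>x. s n x - f x)) \<longlonglongrightarrow> 0"
  using assms by (auto simp: L2_conv_def)

lemma L2_conv_norm: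
  assumes "L2_conv M s f" shows "(\<lambda>n. nL2 M (s n)) \<longlonglongrightarrow> nL2 M f"
proof -
  have "(\<lambda>n. nL2 M (s n) - nL2 M f) \<longlonglongrightarrow> 0"
    by (rule tendsto_rabs_zero_cancel, rule tendsto_sandwich[OF _ _ tendsto_const L2_convD(3)[OF assms]])
      (auto intro!: always_eventually nL2_diff_ge L2_convD[OF assms])
  then show ?thesis by (simp add: LIM_zero_iff)
qed

lemma L2_conv_inner:
  assumes s: "L2_conv M s f" and t: "L2_conv M t g"
  shows "(\<lambda>n. LINT x|M. s n x * t n x) \<longlonglongrightarrow> (LINT x|M. f x * g x)"
proof -
  note S = L2_convD[OF s] and T = L2_convD[OF t]
  have "(\<lambda>n. (LINT x|M. s n x * t n x) - (LINT x|M. f x * g x)) \<longlonglongrightarrow> 0"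
  proof (rule tendsto_rabs_zero_cancel, rule tendsto_sandwich[OF _ _ tendsto_const])
    show "(\<lambda>n. nL2 M (\<lambda>x. s n x - f x) * nL2 M (t n) + nL2 M f * nL2 M (\<lambda>x. t n x - g x)) \<longlonglongrightarrow> 0"
      using tendsto_add[OF tendsto_mult[OF S(3) L2_conv_norm[OF t]] tendsto_mult[OF tendsto_const T(3)]]
      by simp
    show "\<forall>\<^sub>F n in sequentially. \<bar>(LINT x|M. s n x * t n x) - (LINT x|M. f x * g x)\<bar>
       \<le> nL2 M (\<lambda>x. s n x - f x) * nL2 M (t n) + nL2 M f * nL2 M (\<lambda>x. t n x - g x)"
    proof (rule always_eventually, rule)
      fix n
      have "(LINT x|M. s n x * t n x) - (LINT x|M. f x * g x)
          = (LINT x|M. (s n x - f x) * t n x) + (LINT x|M. f x * (t n x - g x))"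
        using sqint_mult[OF S(1) T(1)] sqint_mult[OF S(2) T(1)] sqint_mult[OF S(2) T(2)]
        by (simp add: algebra_simps)
      then show "\<bar>(LINT x|M. s n x * t n x) - (LINT x|M. f x * g x)\<bar>
       \<le> nL2 M (\<lambda>x. s n x - f x) * nL2 M (t n) + nL2 M f * nL2 M (\<lambda>x. t n x - g x)"
        using nL2_Cauchy_Schwarz[OF sqint_diff[OF S(1,2)] T(1), of n n]
          nL2_Cauchy_Schwarz[OF S(2) sqint_diff[OF T(1,2)], of n] by linarith
    qed
  qed auto
  then show ?thesis by (simp add: LIM_zero_iff)
qed

lemma L2_conv_const: "sqint M f \<Longrightarrow> L2_conv M (\<lambda>n. f) f"
  by (simp add: L2_conv_def nL2_def)

lemma L2_conv_add:
  assumes "L2_conv M s f" "L2_conv M t g"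
  shows "L2_conv M (\<lambda>n x. s n x + t n x) (\<lambda>x. f x + g x)"
  unfolding L2_conv_def
proof (intro conjI allI)
  note S = L2_convD[OF assms(1)] and T = L2_convD[OF assms(2)]
  show "sqint M (\<lambda>x. s n x + t n x)" "sqint M (\<lambda>x. f x + g x)" for n
    using S T by (auto intro: sqint_add)
  show "(\<lambda>n. nL2 M (\<lambda>x. s n x + t n x - (f x + g x))) \<longlonglongrightarrow> 0"
  proof (rule tendsto_sandwich[OF _ _ tendsto_const])
    show "(\<lambda>n. nL2 M (\<lambda>x. s n x - f x) + nL2 M (\<lambda>x. t n x - g x)) \<longlonglongrightarrow> 0"
      using tendsto_add[OF S(3) T(3)] by simp
    show "\<forall>\<^sub>F n in sequentially. nL2 M (\<lambda>x. s n x + t n x - (f x + g x))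
        \<le> nL2 M (\<lambda>x. s n x - f x) + nL2 M (\<lambda>x. t n x - g x)"
      using nL2_triangle[OF sqint_diff[OF S(1,2)] sqint_diff[OF T(1,2)]]
      by (intro always_eventually) (simp add: algebra_simps)
  qed auto
qed

lemma L2_conv_scale:
  assumes "L2_conv M s f" shows "L2_conv M (\<lambda>n x. c * s n x) (\<lambda>x. c * f x)"
proof -
  have "nL2 M (\<lambda>x. c * s n x - c * f x) = \<bar>c\<bar> * nL2 M (\<lambda>x. s n x - f x)" for n
    using nL2_scale[of M c "\<lambda>x. s n x - f x"] by (simp add: algebra_simps)
  moreover have "(\<lambda>n. \<bar>c\<bar> * nL2 M (\<lambda>x. s n x - f x)) \<longlonglongrightarrow> 0"
    using tendsto_mult[OF tendsto_const L2_convD(3)[OF assms]] by simp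
  ultimately show ?thesis using L2_convD[OF assms]
    unfolding L2_conv_def by (auto intro: sqint_scale)
qed

lemma L2_conv_diff:
  assumes "L2_conv M s f" "L2_conv M t g"
  shows "L2_conv M (\<lambda>n x. s n x - t n x) (\<lambda>x. f x - g x)"
  using L2_conv_add[OF assms(1) L2_conv_scale[OF assms(2), of "-1"]] by simp

lemma L2_conv_unique:
  assumes "L2_conv M s f" "L2_conv M s g" shows "AE x in M. f x = g x"
proof -
  have "(\<lambda>n. nL2 M (\<lambda>x. s n x - s n x)) \<longlonglongrightarrow> nL2 M (\<lambda>x. f x - g x)"
    by (rule L2_conv_norm[OF L2_conv_diff[OF assms]])
  then have "nL2 M (\<lambda>x. f x - g x) = 0" by (simp add: nL2_def LIMSEQ_const_iff)
  then show ?thesis using AE_eq_of_nL2 assms by (metis L2_convD(2) order.refl)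
qed

lemma L2_conv_AE_subseq:
  assumes "L2_conv M s f"
  obtains r :: "nat \<Rightarrow> nat" where "strict_mono r" "AE x in M. (\<lambda>n. s (r n) x) \<longlonglongrightarrow> f x"
proof -
  note S = L2_convD[OF assms]
  have int: "integrable M (\<lambda>x. (s n x - f x)\<^sup>2)" for n
    using sqint_square[OF sqint_diff[OF S(1,2)]] .
  have "(\<lambda>n. (nL2 M (\<lambda>x. s n x - f x))\<^sup>2) \<longlonglongrightarrow> 0"
    using tendsto_power[OF S(3), of 2] by simp
  then have "(\<lambda>n. LINT x|M. norm ((s n x - f x)\<^sup>2)) \<longlonglongrightarrow> 0" by (simp add: nL2_sq)
  from tendsto_L1_AE_subseq[OF int this]
  obtain r where r: "strict_mono r" "AE x in M. (\<lambda>n. (s (r n) x - f x)\<^sup>2) \<longlonglongrightarrow> 0" by blast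
  have "AE x in M. (\<lambda>n. s (r n) x) \<longlonglongrightarrow> f x"
    using r(2) by eventually_elim (simp add: LIM_zero_iff)
  then show thesis using that r(1) by blast
qed

lemma AE_nonneg_L2_limit:
  assumes "L2_conv M s f" "\<And>n. AE x in M. 0 \<le> s n x"
  shows "AE x in M. 0 \<le> f x"
proof -
  obtain r where r: "strict_mono r" "AE x in M. (\<lambda>n. s (r n) x) \<longlonglongrightarrow> f x"
    using L2_conv_AE_subseq[OF assms(1)] by blast
  have "AE x in M. \<forall>n. 0 \<le> s n x" using assms(2) by (simp add: AE_all_countable)
  with r(2) show ?thesis by eventually_elim (rule LIMSEQ_le_const, auto)
qed

text \<open>On a finite measure space an L2 Cauchy sequence is Cauchy in L1, which yields an almost
  everywhere convergent subsequence. Fatou's lemma along this subsequence bounds the L2 distance to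
  the pointwise limit.\<close>

lemma L2_complete:
  assumes "finite_measure M" and sq: "\<And>n. sqint M (s n)"
    and cau: "\<And>e. 0 < e \<Longrightarrow> \<exists>N. \<forall>m\<ge>N. \<forall>n\<ge>N. nL2 M (\<lambda>x. s m x - s n x) < e"
  obtains f where "L2_conv M s f"
proof -
  interpret finite_measure M by fact
  have one: "sqint M (\<lambda>x. 1)" by (simp add: sqint_def)
  \<comment> \<open>The \<open>+ 1\<close> keeps \<open>K\<close> positive when the measure is
    zero.\<close>
  define K where "K = nL2 M (\<lambda>x. 1) + 1"
  have K: "0 < K" "nL2 M (\<lambda>x. 1) \<le> K" by (simp_all add: K_def add_nonneg_pos)
  have abs: "sqint M (\<lambda>x. \<bar>h x\<bar>)" if "sqint M h" for h using that by (auto simp: sqint_def)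
  have i1: "integrable M h" if "sqint M h" for h using sqint_mult[OF that one] by simp
  have l1: "(LINT x|M. \<bar>h x\<bar>) \<le> nL2 M h * K" if "sqint M h" for h
  proof -
    have "(LINT x|M. \<bar>h x\<bar>) \<le> nL2 M (\<lambda>x. \<bar>h x\<bar>) * nL2 M (\<lambda>x. 1)"
      using nL2_Cauchy_Schwarz[OF abs[OF that] one] by simp
    also have "\<dots> \<le> nL2 M h * K" using K by (intro mult_mono) (auto simp: nL2_def)
    finally show ?thesis .
  qed
  have "\<exists>N. \<forall>i\<ge>N. \<forall>j\<ge>N. (LINT x|M. norm (s i x - s j x)) < e" if e: "0 < e" for e
  proof -
    obtain N where N: "\<And>m n. N \<le> m \<Longrightarrow> N \<le> n \<Longrightarrow> nL2 M (\<lambda>x. s m x - s n x) < e / K"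
      using cau[OF divide_pos_pos[OF e K(1)]] by blast
    have "(LINT x|M. norm (s i x - s j x)) < e" if "N \<le> i" "N \<le> j" for i j
      using l1[OF sqint_diff[OF sq[of i] sq[of j]]] N[OF that] K by (simp add: field_simps)
    then show ?thesis by blast
  qed
  from cauchy_L1_AE_cauchy_subseq[OF i1[OF sq] this]
  obtain r where r: "strict_mono r" "AE x in M. Cauchy (\<lambda>i. s (r i) x)" by blast
  define f where "f x = lim (\<lambda>i. s (r i) x)" for x
  have [measurable]: "s n \<in> borel_measurable M" for n using sq sqint_measurable by blast
  have fm [measurable]: "f \<in> borel_measurable M" unfolding f_def by measurable
  have lim: "AE x in M. (\<lambda>i. s (r i) x) \<longlonglongrightarrow> f x"
    using r(2) by eventually_elim (metis f_def real_Cauchy_convergent convergent_LIMSEQ_iff)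
  have key: "sqint M (\<lambda>x. s m x - f x) \<and> nL2 M (\<lambda>x. s m x - f x) \<le> e"
    if e: "0 < e" and N: "\<And>m n. N \<le> m \<Longrightarrow> N \<le> n \<Longrightarrow> nL2 M (\<lambda>x. s m x - s n x) < e" and m: "N \<le> m" for e N m
  proof -
    have b: "(\<integral>\<^sup>+x. ennreal ((s m x - f x)\<^sup>2) \<partial>M) \<le> ennreal (e\<^sup>2)"
    proof -
      have "(\<integral>\<^sup>+x. ennreal ((s m x - f x)\<^sup>2) \<partial>M) = (\<integral>\<^sup>+x. liminf (\<lambda>i. ennreal ((s m x - s (r i) x)\<^sup>2)) \<partial>M)"
      proof (rule nn_integral_cong_AE)
        show "AE x in M. ennreal ((s m x - f x)\<^sup>2) = liminf (\<lambda>i. ennreal ((s m x - s (r i) x)\<^sup>2))"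
          using lim
        proof eventually_elim
          case (elim x)
          have "(\<lambda>i. ennreal ((s m x - s (r i) x)\<^sup>2)) \<longlonglongrightarrow> ennreal ((s m x - f x)\<^sup>2)"
            by (intro tendsto_intros elim)
          from lim_imp_Liminf[OF sequentially_bot this] show ?case by (rule sym)
        qed
      qed
      also have "\<dots> \<le> liminf (\<lambda>i. \<integral>\<^sup>+x. ennreal ((s m x - s (r i) x)\<^sup>2) \<partial>M)"
        by (rule nn_integral_liminf) measurable
      also have "\<dots> \<le> limsup (\<lambda>i. \<integral>\<^sup>+x. ennreal ((s m x - s (r i) x)\<^sup>2) \<partial>M)"
        by (rule Liminf_le_Limsup) simp
      also have "\<dots> \<le> ennreal (e\<^sup>2)"
      proof (rule Limsup_bounded)
        show "\<forall>\<^sub>F i in sequentially. (\<integral>\<^sup>+x. ennreal ((s m x - s (r i) x)\<^sup>2) \<partial>M) \<le> ennreal (e\<^sup>2)"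
          unfolding eventually_sequentially
        proof (intro exI[of _ N] allI impI)
          fix i assume "N \<le> i"
          then have "N \<le> r i" using seq_suble[OF r(1), of i] by linarith
          then have "nL2 M (\<lambda>x. s m x - s (r i) x) < e" using N m by blast
          then have "(nL2 M (\<lambda>x. s m x - s (r i) x))\<^sup>2 \<le> e\<^sup>2" by (intro power_mono) auto
          then have "(LINT x|M. (s m x - s (r i) x)\<^sup>2) \<le> e\<^sup>2" by (simp add: nL2_sq)
          moreover have "(\<integral>\<^sup>+x. ennreal ((s m x - s (r i) x)\<^sup>2) \<partial>M) = ennreal (LINT x|M. (s m x - s (r i) x)\<^sup>2)"
            by (rule nn_integral_eq_integral) (use sqint_square[OF sqint_diff[OF sq sq]] in auto)
          ultimately show "(\<integral>\<^sup>+x. ennreal ((s m x - s (r i) x)\<^sup>2) \<partial>M) \<le> ennreal (e\<^sup>2)"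
            by (simp add: ennreal_leI)
        qed
      qed
      finally show ?thesis .
    qed
    have int: "integrable M (\<lambda>x. (s m x - f x)\<^sup>2)"
      proof (rule integrableI_nonneg)
      show "(\<integral>\<^sup>+x. ennreal ((s m x - f x)\<^sup>2) \<partial>M) < \<infinity>"
        unfolding infinity_ennreal_def by (rule le_less_trans[OF b]) simp
    qed auto
    have "ennreal (LINT x|M. (s m x - f x)\<^sup>2) \<le> ennreal (e\<^sup>2)"
      using b by (subst nn_integral_eq_integral[OF int, symmetric]) auto
    then have "(nL2 M (\<lambda>x. s m x - f x))\<^sup>2 \<le> e\<^sup>2"
      by (simp add: nL2_sq ennreal_le_iff)
    then have "nL2 M (\<lambda>x. s m x - f x) \<le> e" by (rule power2_le_imp_le[OF _ less_imp_le[OF e]])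
    moreover have "sqint M (\<lambda>x. s m x - f x)" unfolding sqint_def using int by auto
    ultimately show ?thesis by blast
  qed
  have f: "sqint M f"
  proof -
    obtain N where "\<And>m n. N \<le> m \<Longrightarrow> N \<le> n \<Longrightarrow> nL2 M (\<lambda>x. s m x - s n x) < 1"
      using cau[of 1] by auto
    then have "sqint M (\<lambda>x. s N x - f x)" using key[of 1 N N] by auto
    from sqint_diff[OF sq[of N] this] show ?thesis by simp
  qed
  have "(\<lambda>n. nL2 M (\<lambda>x. s n x - f x)) \<longlonglongrightarrow> 0"
  proof (rule LIMSEQ_I)
    fix e :: real assume "0 < e"
    then obtain N where N: "\<And>m n. N \<le> m \<Longrightarrow> N \<le> n \<Longrightarrow> nL2 M (\<lambda>x. s m x - s n x) < e / 2"
      using cau[of "e / 2"] by auto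
    have "nL2 M (\<lambda>x. s m x - f x) < e" if "N \<le> m" for m
      using key[of "e/2" N m] N that \<open>0 < e\<close> by auto
    then show "\<exists>no. \<forall>n\<ge>no. norm (nL2 M (\<lambda>x. s n x - f x) - 0) < e" by auto
  qed
  then show thesis using that f sq by (auto simp: L2_conv_def)
qed

text \<open>Riesz representation on a space such as the test functions, which is not complete:
  instead of a representing element it gives a minimizing sequence of the energy
  \<open>B f f - 2 * l f\<close>. The parallelogram identity makes the sequence Cauchy, and the
  first variation of the energy shows that it represents \<open>l\<close> in the limit.\<close>

lemma Riesz_sequence:
  fixes S :: "('a \<Rightarrow> real) set" and B :: "('a \<Rightarrow> real) \<Rightarrow> ('a \<Rightarrow> real) \<Rightarrow> real"
  assumes S0: "(\<lambda>x. 0) \<in> S"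
    and Sadd: "\<And>f g. f \<in> S \<Longrightarrow> g \<in> S \<Longrightarrow> (\<lambda>x. f x + g x) \<in> S"
    and Ssc: "\<And>c f. f \<in> S \<Longrightarrow> (\<lambda>x. c * f x) \<in> S"
    and Bsym: "\<And>f g. f \<in> S \<Longrightarrow> g \<in> S \<Longrightarrow> B f g = B g f"
    and Badd: "\<And>f g h. f \<in> S \<Longrightarrow> g \<in> S \<Longrightarrow> h \<in> S \<Longrightarrow> B (\<lambda>x. f x + g x) h = B f h + B g h"
    and Bsc: "\<And>c f h. f \<in> S \<Longrightarrow> h \<in> S \<Longrightarrow> B (\<lambda>x. c * f x) h = c * B f h"
    and Bpos: "\<And>f. f \<in> S \<Longrightarrow> 0 \<le> B f f"
    and ladd: "\<And>f g. f \<in> S \<Longrightarrow> g \<in> S \<Longrightarrow> l (\<lambda>x. f x + g x) = l f + l g"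
    and lsc: "\<And>c f. f \<in> S \<Longrightarrow> l (\<lambda>x. c * f x) = c * l f"
    and lb: "\<And>f. f \<in> S \<Longrightarrow> \<bar>l f\<bar> \<le> C * sqrt (B f f)"
  obtains s :: "nat \<Rightarrow> 'a \<Rightarrow> real" where "\<And>n. s n \<in> S"
    "\<And>e. 0 < e \<Longrightarrow> \<exists>N. \<forall>m\<ge>N. \<forall>n\<ge>N. B (\<lambda>x. s m x - s n x) (\<lambda>x. s m x - s n x) < e"
    "\<And>v. v \<in> S \<Longrightarrow> (\<lambda>n. B (s n) v) \<longlonglongrightarrow> l v"
proof -
  define E where "E f = B f f - 2 * l f" for f
  have expand: "B (\<lambda>x. a * f x + b * g x) (\<lambda>x. a * f x + b * g x) = a\<^sup>2 * B f f + 2 * a * b * B f g + b\<^sup>2 * B g g"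
    if "f \<in> S" "g \<in> S" for a b f g
  proof -
    have 1: "(\<lambda>x. a * f x) \<in> S" "(\<lambda>x. b * g x) \<in> S" using that Ssc by auto
    have 2: "(\<lambda>x. a * f x + b * g x) \<in> S" using 1 Sadd by auto
    have 3: "B h (\<lambda>x. a * f x + b * g x) = a * B h f + b * B h g" if "h \<in> S" for h
      using Bsym[OF that 2] Badd[OF 1 that] Bsc[OF \<open>f \<in> S\<close> that] Bsc[OF \<open>g \<in> S\<close> that]
        Bsym[OF that \<open>f \<in> S\<close>] Bsym[OF that \<open>g \<in> S\<close>] by simp
    show ?thesis
      using Badd[OF 1 2] Bsc[OF that(1) 2, of a] Bsc[OF that(2) 2, of b] 3[OF that(1)] 3[OF that(2)]
        Bsym[OF that] by (simp add: power2_eq_square algebra_simps)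
  qed
  have lexp: "l (\<lambda>x. a * f x + b * g x) = a * l f + b * l g" if "f \<in> S" "g \<in> S" for a b f g
    using ladd[OF Ssc[OF that(1)] Ssc[OF that(2)]] lsc that by simp
  have comb: "(\<lambda>x. a * f x + b * g x) \<in> S" if "f \<in> S" "g \<in> S" for a b f g
    using that Ssc Sadd by auto
  have Elow: "- C\<^sup>2 \<le> E f" if "f \<in> S" for f
  proof -
    have "l f \<le> C * sqrt (B f f)" using lb[OF that] by linarith
    moreover have "0 \<le> (sqrt (B f f) - C)\<^sup>2" by simp
    ultimately show ?thesis using Bpos[OF that] by (simp add: E_def power2_diff algebra_simps)
  qed
  have bdd: "bdd_below (E ` S)" using Elow by (auto intro!: bdd_belowI2)
  define I where "I = Inf (E ` S)"
  have IE: "I \<le> E f" if "f \<in> S" for f unfolding I_def using bdd that by (simp add: cInf_lower)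
  have "\<exists>f\<in>S. E f < I + 1 / real (Suc n)" for n
  proof -
    have "Inf (E ` S) < I + 1 / real (Suc n)" by (simp add: I_def)
    then show ?thesis using cInf_lessD[of "E ` S"] S0 by blast
  qed
  then obtain s where s: "\<And>n. s n \<in> S" "\<And>n. E (s n) < I + 1 / real (Suc n)" by metis
  have par: "B (\<lambda>x. s m x - s n x) (\<lambda>x. s m x - s n x) \<le> 2 / real (Suc m) + 2 / real (Suc n)" for m n
  proof -
    let ?h = "\<lambda>x. (1/2) * s m x + (1/2) * s n x"
    have "B (\<lambda>x. s m x - s n x) (\<lambda>x. s m x - s n x) = B (s m) (s m) - 2 * B (s m) (s n) + B (s n) (s n)"
      using expand[OF s(1)[of m] s(1)[of n], of 1 "-1"] by simp
    also have "\<dots> = 2 * E (s m) + 2 * E (s n) - 4 * E ?h"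
      using expand[OF s(1)[of m] s(1)[of n], of "1/2" "1/2"] lexp[OF s(1)[of m] s(1)[of n], of "1/2" "1/2"]
      by (simp add: E_def field_simps power2_eq_square)
    also have "\<dots> \<le> 2 / real (Suc m) + 2 / real (Suc n)"
      using IE[OF comb[OF s(1)[of m] s(1)[of n], of "1/2" "1/2"]] s(2)[of m] s(2)[of n] by simp
    finally show ?thesis .
  qed
  show thesis
  proof (rule that[of s])
    show "s n \<in> S" for n by (rule s)
    show "\<exists>N. \<forall>m\<ge>N. \<forall>n\<ge>N. B (\<lambda>x. s m x - s n x) (\<lambda>x. s m x - s n x) < e" if e: "0 < e" for e
    proof -
      obtain N where N: "1 / real (Suc N) < e / 4" using nat_approx_posE[of "e/4"] e by (metis zero_less_divide_iff zero_less_numeral)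
      have "B (\<lambda>x. s m x - s n x) (\<lambda>x. s m x - s n x) < e" if "N \<le> m" "N \<le> n" for m n
      proof -
        have "2 / real (Suc k) = 2 * (1 / real (Suc k))" for k by simp
        with par[of m n] have "B (\<lambda>x. s m x - s n x) (\<lambda>x. s m x - s n x)
          \<le> 2 * (1 / real (Suc m)) + 2 * (1 / real (Suc n))" by metis
        moreover have "1 / real (Suc m) \<le> 1 / real (Suc N)" "1 / real (Suc n) \<le> 1 / real (Suc N)"
          using that by (auto simp: frac_le)
        ultimately show ?thesis using N by linarith
      qed
      then show ?thesis by blast
    qed
    show "(\<lambda>n. B (s n) v) \<longlonglongrightarrow> l v" if v: "v \<in> S" for v
    proof -
      \<comment> \<open>The \<open>+ 1\<close> avoids a division by zero. The step
        \<open>t = - d / b\<close> towards \<open>v\<close> lowers the energy by at least d^2 / b,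
        and this cannot exceed the gap \<open>1 / real (Suc n)\<close> between
        \<open>E (s n)\<close> and the infimum.\<close>
      define b where "b = B v v + 1"
      have b: "0 < b" "B v v \<le> b" using Bpos[OF v] by (simp_all add: b_def)
      have d: "(B (s n) v - l v)\<^sup>2 \<le> b * (1 / real (Suc n))" for n
      proof -
        define d where "d = B (s n) v - l v"
        define t where "t = - d / b"
        have "I \<le> E (\<lambda>x. 1 * s n x + t * v x)" by (rule IE[OF comb[OF s(1) v]])
        also have "\<dots> = E (s n) + 2 * t * d + t\<^sup>2 * B v v"
          unfolding E_def expand[OF s(1) v] lexp[OF s(1) v] by (simp add: d_def algebra_simps)
        also have "\<dots> \<le> I + 1 / real (Suc n) + 2 * t * d + t\<^sup>2 * b"
          using s(2)[of n] mult_left_mono[OF b(2), of "t\<^sup>2"] by simp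
        also have "\<dots> = I + 1 / real (Suc n) - d\<^sup>2 / b"
        proof -
          have "2 * t * d = - 2 * (d\<^sup>2 / b)" "t\<^sup>2 * b = d\<^sup>2 / b"
            using b by (simp_all add: t_def power2_eq_square)
          then show ?thesis by linarith
        qed
        finally have "d\<^sup>2 / b \<le> 1 / real (Suc n)" by linarith
        then show ?thesis using b by (simp only: d_def divide_le_eq mult.commute)
      qed
      have "(\<lambda>n. (B (s n) v - l v)\<^sup>2) \<longlonglongrightarrow> 0"
      proof (rule tendsto_sandwich[OF _ _ tendsto_const])
        show "(\<lambda>n. b * (1 / real (Suc n))) \<longlonglongrightarrow> 0"
          using tendsto_mult[OF tendsto_const LIMSEQ_Suc[OF lim_1_over_n]] by simp
      qed (use d in \<open>auto intro: always_eventually\<close>)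
      then show ?thesis by (simp add: LIM_zero_iff)
    qed
  qed
qed

section \<open>Smooth functions and mollification\<close>

lemma sum_axis_nth: "(\<Oplus>i. h $ i *\<^sub>R axis i (1::real)) = (h::real^'d)"
  by (simp add: vec_eq_iff axis_def if_distrib[where f="\<lambda>u. _ * u"] cong: if_cong)

lemma pderiv_at_eq: "(f has_derivative f') (at x) \<Longrightarrow> pd i f x = f' (axis i 1)"
  unfolding pderiv_at_def using frechet_derivative_at by metis

lemma has_derivative_pderiv:
  assumes "f differentiable (at x)"
  shows "(f has_derivative (\<lambda>h. \<Oplus>i. h $ i * pd i f x)) (at x)"
proof -
  have D: "(f has_derivative frechet_derivative f (at x)) (at x)"
    using assms frechet_derivative_works by blast
  have "frechet_derivative f (at x) h = (\<Oplus>i. h $ i * pd i f x)" for h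
  proof -
    interpret linear "frechet_derivative f (at x)" using linear_frechet_derivative[OF assms] .
    have "frechet_derivative f (at x) (\<Oplus>i. h $ i *\<^sub>R axis i 1) = (\<Oplus>i. h $ i * pd i f x)"
      by (simp add: sum scale pderiv_at_def)
    then show ?thesis by (simp only: sum_axis_nth)
  qed
  then show ?thesis using D by presburger
qed

lemma pderiv_at_add:
  assumes "f differentiable (at x)" "g differentiable (at x)"
  shows "pd i (\<lambda>x. f x + g x) x = pd i f x + pd i g x"
  using pderiv_at_eq[OF has_derivative_add[OF assms[unfolded frechet_derivative_works]]]
  by (simp add: pderiv_at_def)

lemma pderiv_at_mult:
  assumes "f differentiable (at x)" "g differentiable (at x)"
  shows "pd i (\<lambda>x. f x * g x) x = f x * pd i g x + pd i f x * g x"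
  using pderiv_at_eq[OF has_derivative_mult[OF assms[unfolded frechet_derivative_works]]]
  by (simp add: pderiv_at_def)

lemma has_derivative_real_comp:
  fixes f :: "real^'d \<Rightarrow> real"
  assumes "f differentiable (at x)" "(h has_real_derivative h') (at (f x))"
  shows "((\<lambda>x. h (f x)) has_derivative (\<lambda>v. h' * frechet_derivative f (at x) v)) (at x)"
  using has_derivative_compose[OF assms(1)[unfolded frechet_derivative_works] assms(2)[unfolded has_field_derivative_def]]
  by simp

lemma pderiv_at_real_comp:
  assumes "f differentiable (at x)" "(h has_real_derivative h') (at (f x))"
  shows "pd i (\<lambda>x. h (f x)) x = h' * pd i f x"
  using pderiv_at_eq[OF has_derivative_real_comp[OF assms]] by (simp add: pderiv_at_def)

lemma pderiv_at_cong_open: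
  assumes "open S" "x \<in> S" "\<And>y. y \<in> S \<Longrightarrow> f y = g y"
  shows "pd i f x = pd i g x"
proof -
  have "(f has_derivative f') (at x) \<longleftrightarrow> (g has_derivative f') (at x)" for f'
    using assms has_derivative_transform_within_open[of f f' x UNIV S g]
      has_derivative_transform_within_open[of g f' x UNIV S f] by auto
  then show ?thesis by (simp add: pderiv_at_def frechet_derivative_def)
qed

lemma smooth_differentiable: "smooth f \<Longrightarrow> f differentiable (at x)"
  unfolding smooth_def by (metis differentiable_on_def iterated_pderiv.simps(1) UNIV_I)

lemma smooth_continuous: "smooth f \<Longrightarrow> continuous_on S f"
  by (meson continuous_at_imp_continuous_on differentiable_imp_continuous_within smooth_differentiable)

lemma iterated_pderiv_append: "iterated_pderiv (is @ [i]) f = iterated_pderiv is (pd i f)"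
  by (induction "is") auto

lemma smooth_pderiv: "smooth f \<Longrightarrow> smooth (pd i f)"
  unfolding smooth_def by (metis iterated_pderiv_append)

lemma smooth_coinduct:
  assumes "f \<in> S" "\<And>f. f \<in> S \<Longrightarrow> f differentiable_on UNIV"
    and "\<And>f i. f \<in> S \<Longrightarrow> pd i f \<in> S"
  shows "smooth f"
proof -
  have "iterated_pderiv is f \<in> S" for "is" by (induction "is") (use assms in auto)
  then show ?thesis unfolding smooth_def using assms(2) by blast
qed

text \<open>Differentiating one product or composition leads to a sum of others. Closing the smooth
  functions under sums, products and composition with a family \<open>\<H>\<close> that contains the
  derivatives of its members gives a class closed under \<open>pd\<close>, to which
  \<open>smooth_coinduct\<close> applies.\<close>

inductive_set smooth_alg :: "(real \<Rightarrow> real) set \<Rightarrow> (real^'d \<Rightarrow> real) set" for \<H> where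
  base: "smooth f \<Longrightarrow> f \<in> smooth_alg \<H>"
| add: "f \<in> smooth_alg \<H> \<Longrightarrow> g \<in> smooth_alg \<H> \<Longrightarrow> (\<lambda>x. f x + g x) \<in> smooth_alg \<H>"
| mult: "f \<in> smooth_alg \<H> \<Longrightarrow> g \<in> smooth_alg \<H> \<Longrightarrow> (\<lambda>x. f x * g x) \<in> smooth_alg \<H>"
| comp: "h \<in> \<H> \<Longrightarrow> f \<in> smooth_alg \<H> \<Longrightarrow> (\<lambda>x. h (f x)) \<in> smooth_alg \<H>"

lemma smooth_alg_smooth:
  assumes H: "\<And>h. h \<in> \<H> \<Longrightarrow> \<exists>h'\<in>\<H>. \<forall>t. (h has_real_derivative h' t) (at t)"
    and "f \<in> smooth_alg \<H>"
  shows "smooth f"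
proof -
  have key: "(\<forall>x. f differentiable (at x)) \<and> (\<forall>i. pd i f \<in> smooth_alg \<H>)" if "f \<in> smooth_alg \<H>"
    for f :: "real^'d \<Rightarrow> real"
    using that
  proof induction
    case (base f)
    then show ?case using smooth_differentiable smooth_pderiv smooth_alg.base by blast
  next
    case (add f g)
    have "pd i (\<lambda>x. f x + g x) = (\<lambda>x. pd i f x + pd i g x)" for i
      using add.IH by (intro ext pderiv_at_add) auto
    then show ?case using add by (auto intro: smooth_alg.add)
  next
    case (mult f g)
    have "pd i (\<lambda>x. f x * g x) = (\<lambda>x. f x * pd i g x + pd i f x * g x)" for i
      using mult.IH by (intro ext pderiv_at_mult) auto
    then show ?case using mult by (auto intro!: smooth_alg.add smooth_alg.mult)
  next
    case (comp h f)
    obtain h' where h': "h' \<in> \<H>" "\<And>t. (h has_real_derivative h' t) (at t)" using H comp by blast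
    have D: "((\<lambda>x. h (f x)) has_derivative (\<lambda>v. h' (f x) * frechet_derivative f (at x) v)) (at x)" for x
      using has_derivative_real_comp[OF _ h'(2)] comp.IH by blast
    have "pd i (\<lambda>x. h (f x)) = (\<lambda>x. h' (f x) * pd i f x)" for i
      using comp.IH h'(2) by (intro ext pderiv_at_real_comp) auto
    moreover have "(\<lambda>x. h' (f x) * pd i f x) \<in> smooth_alg \<H>" for i
      using smooth_alg.mult[OF smooth_alg.comp[OF h'(1) comp.hyps(2)]] comp.IH by blast
    moreover have "(\<lambda>x. h (f x)) differentiable (at x)" for x
      using D unfolding differentiable_def by blast
    ultimately show ?case by presburger
  qed
  show ?thesis
    by (rule smooth_coinduct[OF assms(2)])
      (use key in \<open>auto simp: differentiable_on_def differentiable_at_withinI\<close>)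
qed

lemma smooth_add: "smooth f \<Longrightarrow> smooth g \<Longrightarrow> smooth (\<lambda>x. f x + g x)"
  and smooth_mult: "smooth f \<Longrightarrow> smooth g \<Longrightarrow> smooth (\<lambda>x. f x * g x)"
  by (rule smooth_alg_smooth[of "{}"], auto intro: smooth_alg.base smooth_alg.add smooth_alg.mult)+

lemma smooth_comp:
  assumes "\<And>h. h \<in> \<H> \<Longrightarrow> \<exists>h'\<in>\<H>. \<forall>t. (h has_real_derivative h' t) (at t)" "h \<in> \<H>" "smooth f"
  shows "smooth (\<lambda>x. h (f x))"
  using smooth_alg_smooth[OF assms(1) smooth_alg.comp[OF assms(2) smooth_alg.base[OF assms(3)]]] by blast

lemma pderiv_at_const [simp]: "pd i (\<lambda>x. c) = (\<lambda>x. 0)"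
  by (simp add: pderiv_at_def fun_eq_iff)

lemma smooth_const [simp]: "smooth (\<lambda>x. c)"
  by (rule smooth_coinduct[of _ "range (\<lambda>c x. c)"]) (auto simp: image_def)

lemma smooth_scale: "smooth f \<Longrightarrow> smooth (\<lambda>x. c * f x)"
  using smooth_mult[OF smooth_const] .

lemma smooth_diff: "smooth f \<Longrightarrow> smooth g \<Longrightarrow> smooth (\<lambda>x. f x - g x)"
  using smooth_add[OF _ smooth_scale[of g "-1"]] by simp

lemma smooth_sum: "(\<And>i. i \<in> I \<Longrightarrow> smooth (f i)) \<Longrightarrow> smooth (\<lambda>x. \<Sum>i\<in>I. f i x)"
  by (induction I rule: infinite_finite_induct) (auto intro: smooth_add)

lemma smooth_coord [simp]: "smooth (\<lambda>x::real^'d. x $ j)"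
proof (rule smooth_coinduct[of _ "insert (\<lambda>x. x $ j) (range (\<lambda>c x. c))"])
  have D: "((\<lambda>x::real^'d. x $ j) has_derivative (\<lambda>h. h $ j)) (at x)" for x
    by (rule bounded_linear_imp_has_derivative) (rule bounded_linear_vec_nth)
  show "f differentiable_on UNIV" if "f \<in> insert (\<lambda>x. x $ j) (range (\<lambda>c x. c))" for f :: "real^'d \<Rightarrow> real"
    using that by (auto intro: bounded_linear_vec_nth bounded_linear_imp_differentiable_on)
  show "pd i f \<in> insert (\<lambda>x. x $ j) (range (\<lambda>c x. c))"
    if "f \<in> insert (\<lambda>x. x $ j) (range (\<lambda>c x. c))" for f :: "real^'d \<Rightarrow> real" and i
    using that pderiv_at_eq[OF D, of i] by auto
qed auto

lemma smooth_inner [simp]: "smooth (\<lambda>x::real^'d. a \<bullet> x)"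
  unfolding inner_vec_def inner_real_def by (intro smooth_sum smooth_scale smooth_coord)

lemma smooth_normsq [simp]: "smooth (\<lambda>x::real^'d. x \<bullet> x)"
  unfolding inner_vec_def by (intro smooth_sum) (auto intro: smooth_mult)

text \<open>The flat function exp(-1/t), extended by zero. Differentiation produces the factors
  1/t^k, so the whole family in \<open>k\<close> is treated at once; its linear span is closed under
  derivatives.\<close>

definition expinv :: "nat \<Rightarrow> real \<Rightarrow> real" where
  "expinv k t = (if 0 < t then exp (- (1 / t)) / t ^ k else 0)"

lemma expinv_pos: "0 < t \<Longrightarrow> 0 < expinv k t"
  and expinv_nonpos: "t \<le> 0 \<Longrightarrow> expinv k t = 0"
  by (auto simp: expinv_def)

text \<open>One term of the exponential series, (1/t)^(k+2) / (k+2)!, is at most exp(1/t). A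
  quadratic bound is what makes the derivative at the origin vanish.\<close>

lemma expinv_le_square: "\<bar>expinv k t\<bar> \<le> fact (k + 2) * t\<^sup>2"
proof (cases "0 < t")
  case True
  have "(\<Sum>n\<in>{k + 2}. (1 / t) ^ n /\<^sub>R fact n) \<le> (\<Sum>n. (1 / t) ^ n /\<^sub>R fact n)"
    using exp_converges[of "1 / t"] True by (intro sum_le_suminf) (auto simp: sums_iff)
  then have "(1 / t) ^ (k + 2) / fact (k + 2) \<le> exp (1 / t)"
    using exp_converges[of "1 / t"] by (simp add: sums_iff divide_inverse mult.commute del: fact_Suc power_Suc power_add)
  then have "(1 / t) ^ (k + 2) \<le> exp (1 / t) * fact (k + 2)"
    by (subst (asm) pos_divide_le_eq) (rule fact_gt_zero)
  then have "1 / t ^ (k + 2) \<le> fact (k + 2) * exp (1 / t)"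
    by (simp only: power_one_over mult.commute)
  then have "exp (- (1 / t)) \<le> fact (k + 2) * t ^ (k + 2)"
    using True by (simp add: exp_minus field_simps del: fact_Suc power_Suc power_add)
  then have "exp (- (1 / t)) / t ^ k \<le> fact (k + 2) * t\<^sup>2"
    using True by (simp add: field_simps power_add power2_eq_square del: fact_Suc)
  then show ?thesis using True by (simp add: expinv_def del: fact_Suc)
next
  case False
  then show ?thesis by (simp add: expinv_def)
qed

lemma DERIV_zero_of_square_bound:
  fixes h :: "real \<Rightarrow> real"
  assumes "h a = 0" "\<And>t. \<bar>h t\<bar> \<le> C * (t - a)\<^sup>2"
  shows "(h has_real_derivative 0) (at a)"
  unfolding DERIV_def
proof (rule tendsto_rabs_zero_cancel, rule tendsto_sandwich[OF _ _ tendsto_const])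
  show "((\<lambda>s. C * \<bar>s\<bar>) \<longlongrightarrow> 0) (at 0)"
    by (auto intro!: tendsto_eq_intros)
  show "\<forall>\<^sub>F s in at 0. \<bar>(h (a + s) - h a) / s\<bar> \<le> C * \<bar>s\<bar>"
  proof (rule eventually_mono[OF eventually_neq_at_within[of 0]])
    fix s :: real assume "s \<noteq> 0"
    then show "\<bar>(h (a + s) - h a) / s\<bar> \<le> C * \<bar>s\<bar>"
      using assms(2)[of "a + s"] assms(1)
      by (simp add: abs_divide divide_le_eq power2_eq_square abs_mult mult.assoc)
  qed
qed auto

lemma expinv_DERIV: "(expinv k has_real_derivative (expinv (k + 2) t - real k * expinv (k + 1) t)) (at t)"
proof -
  consider "0 < t" | "t = 0" | "t < 0" by linarith
  then show ?thesis
  proof cases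
    case 1
    have "((\<lambda>t. exp (- (1 / t)) / t ^ k) has_real_derivative (expinv (k + 2) t - real k * expinv (k + 1) t)) (at t)"
    proof (cases k)
      case 0
      then show ?thesis using 1
        by (auto intro!: derivative_eq_intros simp: expinv_def power2_eq_square field_simps)
    next
      case (Suc n)
      have "((\<lambda>t. exp (- (1 / t)) / t ^ k) has_real_derivative
          ((exp (- (1 / t)) * (1 / t\<^sup>2)) * t ^ k - exp (- (1 / t)) * (real k * t ^ n)) / (t ^ k * t ^ k)) (at t)"
      proof (rule DERIV_divide)
        show "((\<lambda>t. exp (- (1 / t))) has_real_derivative exp (- (1 / t)) * (1 / t\<^sup>2)) (at t)"
          using 1 by (auto intro!: derivative_eq_intros simp: power2_eq_square)
        show "((\<lambda>t. t ^ k) has_real_derivative real k * t ^ n) (at t)"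
          using DERIV_pow[of k t] Suc by simp
      qed (use 1 in simp)
      moreover have "((exp (- (1 / t)) * (1 / t\<^sup>2)) * t ^ k - exp (- (1 / t)) * (real k * t ^ n)) / (t ^ k * t ^ k)
          = expinv (k + 2) t - real k * expinv (k + 1) t"
        using 1 unfolding Suc by (simp add: expinv_def power2_eq_square field_simps)
      ultimately show ?thesis by simp
    qed
    then show ?thesis
      by (rule has_field_derivative_transform_within_open[where S="{0<..}"]) (use 1 in \<open>auto simp: expinv_def\<close>)
  next
    case 2
    have "(expinv k has_real_derivative 0) (at 0)"
      by (rule DERIV_zero_of_square_bound[where C="fact (k + 2)"])
        (use expinv_le_square[of k] in \<open>auto simp: expinv_nonpos simp del: fact_Suc\<close>)
    then show ?thesis using 2 by (simp add: expinv_nonpos)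
  next
    case 3
    have "((\<lambda>t. 0) has_real_derivative (expinv (k + 2) t - real k * expinv (k + 1) t)) (at t)"
      using 3 by (simp add: expinv_nonpos)
    then show ?thesis
      by (rule has_field_derivative_transform_within_open[where S="{..<0}"]) (use 3 in \<open>auto simp: expinv_def\<close>)
  qed
qed

inductive_set expinv_span :: "(real \<Rightarrow> real) set" where
  basis: "(\<lambda>t. c * expinv k t) \<in> expinv_span"
| plus: "f \<in> expinv_span \<Longrightarrow> g \<in> expinv_span \<Longrightarrow> (\<lambda>t. f t + g t) \<in> expinv_span"

lemma smooth_expinv: "smooth f \<Longrightarrow> smooth (\<lambda>x. expinv k (f x))"
proof (rule smooth_comp[of expinv_span "expinv k"])
  show "\<exists>h'\<in>expinv_span. \<forall>t. (h has_real_derivative h' t) (at t)" if "h \<in> expinv_span" for h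
    using that
  proof induction
    case (basis c k)
    have "((\<lambda>t. c * expinv k t) has_real_derivative c * expinv (k + 2) t + (- c * real k) * expinv (k + 1) t) (at t)" for t
      by (rule derivative_eq_intros expinv_DERIV refl)+ (simp add: algebra_simps)
    moreover have "(\<lambda>t. c * expinv (k + 2) t + (- c * real k) * expinv (k + 1) t) \<in> expinv_span"
      by (intro expinv_span.intros)
    ultimately show ?case
      by (intro bexI[of _ "\<lambda>t. c * expinv (k + 2) t + (- c * real k) * expinv (k + 1) t"] allI) auto
  next
    case (plus f g)
    then obtain f' g' where "f' \<in> expinv_span" "\<And>t. (f has_real_derivative f' t) (at t)"
      "g' \<in> expinv_span" "\<And>t. (g has_real_derivative g' t) (at t)" by blast
    then show ?case by (intro bexI[of _ "\<lambda>t. f' t + g' t"] allI DERIV_add expinv_span.plus)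
  qed
  show "expinv k \<in> expinv_span" using expinv_span.basis[of 1 k] by simp
qed

section \<open>Test functions\<close>

lemma continuous_measurable_lebesgue:
  fixes f :: "'a::euclidean_space \<Rightarrow> 'b::euclidean_space"
  assumes "continuous_on UNIV f" shows "f \<in> borel_measurable lebesgue"
  using continuous_imp_measurable_on_sets_lebesgue[OF assms] by simp

lemma integrable_continuous_compact_support:
  fixes f :: "'a::euclidean_space \<Rightarrow> real"
  assumes "continuous_on UNIV f" "compact K" "\<And>x. x \<notin> K \<Longrightarrow> f x = 0"
  shows "integrable lebesgue f"
proof -
  have "integrable lborel (\<lambda>x. indicator K x *\<^sub>R f x)"
    by (rule borel_integrable_compact[OF assms(2) continuous_on_subset[OF assms(1)]]) simp
  moreover have "(\<lambda>x. indicator K x *\<^sub>R f x) = f"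
    using assms(3) by (auto simp: indicator_def fun_eq_iff)
  ultimately have "integrable lborel f" by simp
  then show ?thesis by (rule integrable_completion[THEN iffD2, rotated]) (use assms(1) in \<open>simp add: borel_measurable_continuous_onI\<close>)
qed

lemma bounded_continuous_compact_support:
  fixes f :: "'a::euclidean_space \<Rightarrow> real"
  assumes "continuous_on UNIV f" "compact K" "\<And>x. x \<notin> K \<Longrightarrow> f x = 0"
  obtains B where "0 \<le> B" "\<And>x. \<bar>f x\<bar> \<le> B"
proof -
  have "bounded (f ` K)"
    by (intro compact_imp_bounded compact_continuous_image continuous_on_subset[OF assms(1)] assms(2)) simp
  then obtain B where "\<And>x. x \<in> K \<Longrightarrow> \<bar>f x\<bar> \<le> B" unfolding bounded_iff by auto
  then have "\<bar>f x\<bar> \<le> max B 0" for x using assms(3)[of x] by (cases "x \<in> K") (auto simp: le_max_iff_disj)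
  then show thesis using that[of "max B 0"] by auto
qed

lemma test_functionsE:
  assumes "\<phi> \<in> \<D> X"
  obtains K where "smooth \<phi>" "compact K" "K \<subseteq> X" "\<And>x. x \<notin> K \<Longrightarrow> \<phi> x = 0"
  using assms by (auto simp: test_functions_def)

lemma test_functionsI:
  "smooth \<phi> \<Longrightarrow> compact K \<Longrightarrow> K \<subseteq> X \<Longrightarrow> (\<And>x. x \<notin> K \<Longrightarrow> \<phi> x = 0) \<Longrightarrow> \<phi> \<in> \<D> X"
  by (auto simp: test_functions_def)

lemma test_smooth: "\<phi> \<in> \<D> X \<Longrightarrow> smooth \<phi>"
  by (auto simp: test_functions_def)

lemma test_zero_outside: "\<phi> \<in> \<D> X \<Longrightarrow> x \<notin> X \<Longrightarrow> \<phi> x = 0"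
  by (auto simp: test_functions_def)

lemma test_zero [simp]: "(\<lambda>x. 0) \<in> \<D> X"
  by (rule test_functionsI[of _ "{}"]) auto

lemma test_add:
  assumes "\<phi> \<in> \<D> X" "\<psi> \<in> \<D> X" shows "(\<lambda>x. \<phi> x + \<psi> x) \<in> \<D> X"
proof -
  obtain K L where "smooth \<phi>" "compact K" "K \<subseteq> X" "\<And>x. x \<notin> K \<Longrightarrow> \<phi> x = 0"
    "smooth \<psi>" "compact L" "L \<subseteq> X" "\<And>x. x \<notin> L \<Longrightarrow> \<psi> x = 0"
    using assms by (metis test_functionsE)
  then show ?thesis by (intro test_functionsI[of _ "K \<union> L"]) (auto intro: smooth_add)
qed

lemma test_smooth_mult:
  assumes "\<phi> \<in> \<D> X" "smooth h" shows "(\<lambda>x. h x * \<phi> x) \<in> \<D> X"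
  using assms(1)
proof (rule test_functionsE)
  fix K assume "smooth \<phi>" "compact K" "K \<subseteq> X" "\<And>x. x \<notin> K \<Longrightarrow> \<phi> x = 0"
  then show ?thesis by (intro test_functionsI[of _ K]) (auto intro: smooth_mult assms)
qed

lemma test_scale: "\<phi> \<in> \<D> X \<Longrightarrow> (\<lambda>x. c * \<phi> x) \<in> \<D> X"
  by (rule test_smooth_mult) simp_all

lemma test_diff:
  "\<phi> \<in> \<D> X \<Longrightarrow> \<psi> \<in> \<D> X \<Longrightarrow> (\<lambda>x. \<phi> x - \<psi> x) \<in> \<D> X"
  using test_add[OF _ test_scale[of \<psi> X "-1"]] by simp

lemma test_pderiv:
  assumes "\<phi> \<in> \<D> X" shows "pd i \<phi> \<in> \<D> X"
  using assms
proof (rule test_functionsE)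
  fix K assume K: "smooth \<phi>" "compact K" "K \<subseteq> X" "\<And>x. x \<notin> K \<Longrightarrow> \<phi> x = 0"
  have "pd i \<phi> x = 0" if "x \<notin> K" for x
    using pderiv_at_cong_open[of "-K" x \<phi> "\<lambda>x. 0" i] K that compact_imp_closed[OF K(2)]
    by (auto simp: open_Compl)
  then show ?thesis using K by (intro test_functionsI[of _ K]) (auto intro: smooth_pderiv)
qed

lemma test_continuous: "\<phi> \<in> \<D> X \<Longrightarrow> continuous_on S \<phi>"
  by (blast intro: smooth_continuous test_smooth)

lemma test_integrable: "\<phi> \<in> \<D> X \<Longrightarrow> integrable lebesgue \<phi>"
  by (erule test_functionsE) (auto intro: integrable_continuous_compact_support smooth_continuous)

lemma test_bounded:
  assumes "\<phi> \<in> \<D> X" obtains B where "0 \<le> B" "\<And>x. \<bar>\<phi> x\<bar> \<le> B"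
  using assms
  by (rule test_functionsE) (metis bounded_continuous_compact_support smooth_continuous)

lemma test_has_derivative:
  assumes "\<phi> \<in> \<D> X"
  shows "(\<phi> has_derivative (\<lambda>h. \<Oplus>i. h $ i * pd i \<phi> x)) (at x)"
  by (rule has_derivative_pderiv[OF smooth_differentiable[OF test_smooth[OF assms]]])

lemma linear_functional_bound:
  fixes h :: "real^'d"
  assumes "\<And>i. \<bar>c i\<bar> \<le> b i"
  shows "\<bar>\<Oplus>i. h $ i * c i\<bar> \<le> (\<Oplus>i. b i) * norm h"
proof -
  have "\<bar>\<Oplus>i. h $ i * c i\<bar> \<le> (\<Oplus>i. \<bar>h $ i\<bar> * \<bar>c i\<bar>)"
    using sum_abs[of "\<lambda>i. h $ i * c i" UNIV] by (simp add: abs_mult)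
  also have "\<dots> \<le> (\<Oplus>i. norm h * b i)"
    by (intro sum_mono mult_mono) (use assms component_le_norm_cart in auto)
  finally show ?thesis by (simp add: sum_distrib_left mult.commute)
qed

lemma test_Lipschitz:
  assumes "\<phi> \<in> \<D> X"
  obtains L where "0 \<le> L" "\<And>x y. \<bar>\<phi> x - \<phi> y\<bar> \<le> L * norm (x - y)"
proof -
  have "\<exists>B. \<forall>x. \<bar>pd i \<phi> x\<bar> \<le> B" for i
    using test_bounded[OF test_pderiv[OF assms]] by metis
  then obtain B where B: "\<And>i x. \<bar>pd i \<phi> x\<bar> \<le> B i" by metis
  have "norm (\<phi> x - \<phi> y) \<le> (\<Oplus>i. B i) * norm (x - y)" for x y
    by (rule differentiable_bound[OF convex_UNIV has_derivative_at_withinI[OF test_has_derivative[OF assms]]])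
      (auto intro!: onorm_le linear_functional_bound B)
  moreover have "0 \<le> (\<Oplus>i. B i)" using B by (intro sum_nonneg) (meson abs_ge_zero order.trans)
  ultimately show thesis using that by auto
qed

text \<open>The remainder is uniform in \<open>z\<close>, as differentiation under the integral of a
  convolution requires. It comes from the mean value inequality for \<open>\<phi>\<close> minus its
  linear part at \<open>z\<close>, since the first derivatives are Lipschitz.\<close>

lemma test_Taylor:
  assumes "\<phi> \<in> \<D> X"
  obtains C where "0 \<le> C" "\<And>z h. \<bar>\<phi> (z + h) - \<phi> z - (\<Oplus>i. h $ i * pd i \<phi> z)\<bar> \<le> C * (norm h)\<^sup>2"
proof -
  have "\<exists>L\<ge>0. \<forall>x y. \<bar>pd i \<phi> x - pd i \<phi> y\<bar> \<le> L * norm (x - y)" for i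
    using test_Lipschitz[OF test_pderiv[OF assms]] by metis
  then obtain L where L: "\<And>i. 0 \<le> L i" "\<And>i x y. \<bar>pd i \<phi> x - pd i \<phi> y\<bar> \<le> L i * norm (x - y)"
    by metis
  have "\<bar>\<phi> (z + h) - \<phi> z - (\<Oplus>i. h $ i * pd i \<phi> z)\<bar> \<le> (\<Oplus>i. L i) * (norm h)\<^sup>2" for z h
  proof -
    define k where "k y = \<phi> y - (\<Oplus>i. y $ i * pd i \<phi> z)" for y
    have D: "(k has_derivative (\<lambda>v. \<Oplus>i. v $ i * (pd i \<phi> y - pd i \<phi> z))) (at y within cball z (norm h))" for y
    proof -
      have "(k has_derivative (\<lambda>v. (\<Oplus>i. v $ i * pd i \<phi> y) - (\<Oplus>i. v $ i * pd i \<phi> z))) (at y within cball z (norm h))"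
        unfolding k_def
        by (intro has_derivative_diff has_derivative_at_withinI[OF test_has_derivative[OF assms]]
            bounded_linear_imp_has_derivative bounded_linear_sum bounded_linear_mult_const bounded_linear_vec_nth)
      then show ?thesis by (simp add: sum_subtractf algebra_simps)
    qed
    have "norm (k (z + h) - k z) \<le> ((\<Oplus>i. L i) * norm h) * norm (z + h - z)"
    proof (rule differentiable_bound[OF convex_cball D])
      fix y assume y: "y \<in> cball z (norm h)"
      have "\<bar>pd i \<phi> y - pd i \<phi> z\<bar> \<le> L i * norm h" for i
        using L(2)[of i y z] mult_left_mono[OF _ L(1), of "norm (y - z)" "norm h" i] y
        by (simp add: dist_norm norm_minus_commute)
      then show "onorm (\<lambda>v. \<Oplus>i. v $ i * (pd i \<phi> y - pd i \<phi> z)) \<le> (\<Oplus>i. L i) * norm h"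
        by (intro onorm_le) (use linear_functional_bound[of "\<lambda>i. pd i \<phi> y - pd i \<phi> z" "\<lambda>i. L i * norm h"]
            in \<open>simp add: sum_distrib_right\<close>)
    qed (auto simp: dist_norm)
    moreover have "k (z + h) - k z = \<phi> (z + h) - \<phi> z - (\<Oplus>i. h $ i * pd i \<phi> z)"
      by (simp add: k_def algebra_simps sum.distrib)
    ultimately show ?thesis by (simp add: power2_eq_square mult.assoc)
  qed
  moreover have "0 \<le> (\<Oplus>i. L i)" using L by (intro sum_nonneg) auto
  ultimately show thesis using that by blast
qed

section \<open>Convolution and mollifiers\<close>

definition conv :: "(real^'d \<Rightarrow> real) \<Rightarrow> (real^'d \<Rightarrow> real) \<Rightarrow> real^'d \<Rightarrow> real" where
  "conv f \<phi> x = (LINT y|lebesgue. f y * \<phi> (x - y))"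

lemma conv_integrable:
  assumes "integrable lebesgue f" "\<phi> \<in> \<D> X"
  shows "integrable lebesgue (\<lambda>y. f y * \<phi> (x - y))"
proof -
  obtain B where B: "\<And>x. \<bar>\<phi> x\<bar> \<le> B" using test_bounded[OF assms(2)] by metis
  have [measurable]: "(\<lambda>y. \<phi> (x - y)) \<in> borel_measurable lebesgue"
    by (intro continuous_measurable_lebesgue continuous_on_compose2[OF test_continuous[OF assms(2), of UNIV]] continuous_intros) auto
  have [measurable]: "f \<in> borel_measurable lebesgue" using assms(1) by auto
  show ?thesis
  proof (rule Bochner_Integration.integrable_bound)
    show "integrable lebesgue (\<lambda>y. f y * B)" using assms(1) by auto
    show "AE y in lebesgue. norm (f y * \<phi> (x - y)) \<le> norm (f y * B)"
      using B by (intro AE_I2) (auto simp: abs_mult intro!: mult_left_mono order.trans[OF B abs_ge_self])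
  qed measurable
qed

text \<open>The uniform Taylor remainder, integrated against the absolute value of \<open>f\<close>,
  is still quadratic in the increment.\<close>

lemma conv_has_derivative:
  assumes f: "integrable lebesgue f" and \<phi>: "\<phi> \<in> \<D> X"
  shows "(conv f \<phi> has_derivative (\<lambda>h. \<Oplus>i. h $ i * conv f (pd i \<phi>) x)) (at x)"
proof -
  obtain C where C: "0 \<le> C" "\<And>z h. \<bar>\<phi> (z + h) - \<phi> z - (\<Oplus>i. h $ i * pd i \<phi> z)\<bar> \<le> C * (norm h)\<^sup>2"
    using test_Taylor[OF \<phi>] by blast
  define D where "D = C * (LINT y|lebesgue. \<bar>f y\<bar>)"
  have bd: "\<bar>conv f \<phi> (x + h) - conv f \<phi> x - (\<Oplus>i. h $ i * conv f (pd i \<phi>) x)\<bar> \<le> D * (norm h)\<^sup>2" for h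
  proof -
    have ii: "integrable lebesgue (\<lambda>y. f y * \<phi> (z - y))" "integrable lebesgue (\<lambda>y. f y * pd i \<phi> (z - y))" for z i
      using conv_integrable[OF f] \<phi> test_pderiv by blast+
    have "conv f \<phi> (x + h) - conv f \<phi> x - (\<Oplus>i. h $ i * conv f (pd i \<phi>) x)
      = (LINT y|lebesgue. f y * \<phi> (x + h - y) - f y * \<phi> (x - y) - (\<Oplus>i. h $ i * (f y * pd i \<phi> (x - y))))"
      unfolding conv_def using ii by (simp add: Bochner_Integration.integral_sum)
    also have "\<bar>\<dots>\<bar> \<le> (LINT y|lebesgue. \<bar>f y\<bar> * (C * (norm h)\<^sup>2))"
    proof (rule integral_abs_bound_integral)
      show "integrable lebesgue (\<lambda>y. f y * \<phi> (x + h - y) - f y * \<phi> (x - y) - (\<Oplus>i. h $ i * (f y * pd i \<phi> (x - y))))"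
        using ii by auto
      show "integrable lebesgue (\<lambda>y. \<bar>f y\<bar> * (C * (norm h)\<^sup>2))" using f by auto
      fix y
      have "f y * \<phi> (x + h - y) - f y * \<phi> (x - y) - (\<Oplus>i. h $ i * (f y * pd i \<phi> (x - y)))
        = f y * (\<phi> ((x - y) + h) - \<phi> (x - y) - (\<Oplus>i. h $ i * pd i \<phi> (x - y)))"
        by (simp add: algebra_simps sum_distrib_left)
      then show "\<bar>f y * \<phi> (x + h - y) - f y * \<phi> (x - y) - (\<Oplus>i. h $ i * (f y * pd i \<phi> (x - y)))\<bar> \<le> \<bar>f y\<bar> * (C * (norm h)\<^sup>2)"
        using C(2)[of "x - y" h] by (simp only: abs_mult) (rule mult_left_mono, auto)
    qed
    finally show ?thesis by (simp add: D_def mult.commute mult.left_commute)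
  qed
  show ?thesis unfolding has_derivative_at
  proof
    show "bounded_linear (\<lambda>h. \<Oplus>i. h $ i * conv f (pd i \<phi>) x)"
      by (intro bounded_linear_sum bounded_linear_mult_const bounded_linear_vec_nth)
    show "(\<lambda>h. norm (conv f \<phi> (x + h) - conv f \<phi> x - (\<Oplus>i. h $ i * conv f (pd i \<phi>) x)) / norm h) \<midarrow>0\<rightarrow> 0"
    proof (rule tendsto_sandwich[OF _ _ tendsto_const])
      show "(\<lambda>h. D * norm h) \<midarrow>0\<rightarrow> 0" by (auto intro!: tendsto_eq_intros)
      show "\<forall>\<^sub>F h in at 0. norm (conv f \<phi> (x + h) - conv f \<phi> x - (\<Oplus>i. h $ i * conv f (pd i \<phi>) x)) / norm h \<le> D * norm h"
        by (rule eventually_mono[OF eventually_neq_at_within[of 0]])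
          (use bd in \<open>simp add: divide_le_eq power2_eq_square mult.assoc\<close>)
    qed auto
  qed
qed

lemma conv_pderiv:
  assumes "integrable lebesgue f" "\<phi> \<in> \<D> X"
  shows "pd i (conv f \<phi>) = conv f (pd i \<phi>)"
proof
  fix x
  have "pd i (conv f \<phi>) x = (\<Oplus>j. axis i 1 $ j * conv f (pd j \<phi>) x)"
    by (rule pderiv_at_eq[OF conv_has_derivative[OF assms]])
  also have "\<dots> = conv f (pd i \<phi>) x"
    by (simp add: axis_def if_distrib[where f="\<lambda>u. u * _"] cong: if_cong)
  finally show "pd i (conv f \<phi>) x = conv f (pd i \<phi>) x" .
qed

lemma conv_smooth:
  assumes "integrable lebesgue f" "\<phi> \<in> \<D> X"
  shows "smooth (conv f \<phi>)"
proof (rule smooth_coinduct[of _ "conv f ` \<D> X"])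
  show "g differentiable_on UNIV" if "g \<in> conv f ` \<D> X" for g
    using that conv_has_derivative[OF assms(1)] by (auto simp: differentiable_on_def differentiable_def)
  show "pd i g \<in> conv f ` \<D> X" if "g \<in> conv f ` \<D> X" for g i
  proof -
    obtain \<psi> where "\<psi> \<in> \<D> X" "g = conv f \<psi>" using \<open>g \<in> _\<close> by blast
    then show ?thesis using conv_pderiv[OF assms(1), of \<psi> X i] test_pderiv[of \<psi> X i] by simp
  qed
qed (use assms in auto)

definition bump :: "real \<Rightarrow> real^'d \<Rightarrow> real" where
  "bump \<rho> x = expinv 0 (\<rho>\<^sup>2 - x \<bullet> x)"

definition mol :: "real \<Rightarrow> real^'d \<Rightarrow> real" where
  "mol \<rho> x = bump \<rho> x / (LINT y|lebesgue. bump \<rho> (y::real^'d))"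

lemma bump_props:
  fixes x :: "real^'d"
  assumes "0 < \<rho>"
  shows "0 \<le> bump \<rho> x" "norm x < \<rho> \<Longrightarrow> 0 < bump \<rho> x" "\<rho> \<le> norm x \<Longrightarrow> bump \<rho> x = 0"
proof -
  show "0 \<le> bump \<rho> x" by (simp add: bump_def expinv_def)
  show "0 < bump \<rho> x" if "norm x < \<rho>"
    using power_strict_mono[OF that, of 2] by (auto simp: bump_def dot_square_norm intro!: expinv_pos)
  show "bump \<rho> x = 0" if "\<rho> \<le> norm x"
    using power_mono[OF that, of 2] assms by (auto simp: bump_def dot_square_norm intro!: expinv_nonpos)
qed

lemma bump_test: "0 < \<rho> \<Longrightarrow> bump \<rho> \<in> \<D> (UNIV :: (real^'d) set)"
proof (rule test_functionsI[of _ "cball 0 \<rho>"])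
  show "smooth (bump \<rho> :: real^'d \<Rightarrow> real)"
    unfolding bump_def by (intro smooth_expinv smooth_diff) auto
qed (auto simp: bump_props)

lemma bump_integral_pos:
  assumes "0 < \<rho>" shows "0 < (LINT y|lebesgue. bump \<rho> (y::real^'d))"
proof -
  note int = test_integrable[OF bump_test[OF assms, where 'd='d]]
  have "(LINT y|lebesgue. bump \<rho> (y::real^'d)) \<noteq> 0"
  proof
    assume "(LINT y|lebesgue. bump \<rho> (y::real^'d)) = 0"
    then have "AE y in lebesgue. bump \<rho> (y::real^'d) = 0"
      using integral_nonneg_eq_0_iff_AE[OF int] bump_props(1)[OF assms] by auto
    then have "AE y in lebesgue. y \<notin> ball (0::real^'d) \<rho>"
      by eventually_elim (use bump_props(2)[OF assms] in force)
    then have "ball (0::real^'d) \<rho> \<in> null_sets lebesgue"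
      by (subst (asm) AE_iff_null_sets[symmetric]) auto
    then have "negligible (ball (0::real^'d) \<rho>)" by (simp add: negligible_iff_null_sets)
    then show False using assms by (metis ball_eq_empty not_le open_ball open_not_negligible)
  qed
  moreover have "0 \<le> (LINT y|lebesgue. bump \<rho> (y::real^'d))"
    by (intro integral_nonneg_AE AE_I2 bump_props(1)[OF assms])
  ultimately show ?thesis by simp
qed

lemma mol_test: "0 < \<rho> \<Longrightarrow> mol \<rho> \<in> \<D> (UNIV :: (real^'d) set)"
  using test_scale[OF bump_test[where 'd='d], of \<rho> "inverse (LINT y|lebesgue. bump \<rho> (y::real^'d))"]
  unfolding mol_def divide_inverse by (simp add: mult.commute)

lemma mol_props:
  fixes x :: "real^'d"
  assumes "0 < \<rho>"
  shows "0 \<le> mol \<rho> x" "\<rho> \<le> norm x \<Longrightarrow> mol \<rho> x = 0" "mol \<rho> (- x) = mol \<rho> x"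
    "(LINT y|lebesgue. mol \<rho> (y::real^'d)) = 1"
  using bump_props[OF assms, of x] bump_integral_pos[OF assms, where 'd='d]
  by (auto simp: mol_def bump_def)

lemma mol_shift_integral:
  fixes x :: "real^'d"
  assumes "0 < \<rho>"
  shows "(LINT y|lebesgue. mol \<rho> (x - y)) = 1" "integrable lebesgue (\<lambda>y. mol \<rho> (x - y))"
proof -
  have "integrable lborel (mol \<rho> :: real^'d \<Rightarrow> real)"
    using test_integrable[OF mol_test[OF assms, where 'd='d]]
    by (subst (asm) integrable_completion) (auto intro!: borel_measurable_continuous_onI test_continuous[OF mol_test[OF assms]])
  have eq: "mol \<rho> (x - y) = mol \<rho> (- x + y)" for y
    using mol_props(3)[OF assms, of "x - y"] by simp
  have b: "(\<lambda>y. mol \<rho> (- x + y)) \<in> borel_measurable lborel" "(mol \<rho> :: real^'d \<Rightarrow> real) \<in> borel_measurable lborel"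
    by (auto intro!: borel_measurable_continuous_onI continuous_on_compose2[OF test_continuous[OF mol_test[OF assms], of UNIV]]
        continuous_intros test_continuous[OF mol_test[OF assms]])
  have "(LINT y|lborel. mol \<rho> (- x + y)) = (LINT y|distr lborel borel ((+) (- x)). mol \<rho> (y::real^'d))"
    by (subst integral_distr) (use b in auto)
  also have "\<dots> = (LINT y|lborel. mol \<rho> (y::real^'d))" unfolding lborel_distr_plus ..
  also have "\<dots> = 1" using mol_props(4)[OF assms, where 'd='d] b(2) by (simp add: integral_completion)
  finally show "(LINT y|lebesgue. mol \<rho> (x - y)) = 1" using b(1) by (simp add: eq integral_completion)
  then show "integrable lebesgue (\<lambda>y. mol \<rho> (x - y))" using not_integrable_integral_eq by fastforce
qed

text \<open>A mollification is an average over a ball. Later facts about mollified functions, such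
  as Lipschitz bounds, concavity and domination by a barrier, are instances of this for linear
  combinations of functions and their translates.\<close>

lemma conv_mol_bound:
  assumes r: "0 < \<rho>" and f: "integrable lebesgue f"
    and b: "AE y in lebesgue. norm (x - y) < \<rho> \<longrightarrow> f y \<le> c"
  shows "conv f (mol \<rho>) x \<le> c"
proof -
  have "conv f (mol \<rho>) x \<le> (LINT y|lebesgue. c * mol \<rho> (x - y))"
    unfolding conv_def
  proof (rule integral_mono_AE)
    show "AE y in lebesgue. f y * mol \<rho> (x - y) \<le> c * mol \<rho> (x - y)"
      using b
    proof eventually_elim
      case (elim y)
      then show ?case using mol_props(1)[OF r, of "x - y"] mol_props(2)[OF r, of "x - y"]
        by (cases "norm (x - y) < \<rho>") (auto intro: mult_right_mono)
    qed
  qed (use conv_integrable[OF f mol_test[OF r]] mol_shift_integral[OF r] in auto)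
  then show ?thesis using mol_shift_integral[OF r, of x] by simp
qed

lemma conv_minus: "conv (\<lambda>y. - f y) \<phi> x = - conv f \<phi> x"
  by (simp add: conv_def)

lemma conv_mol_close:
  assumes r: "0 < \<rho>" and f: "integrable lebesgue f"
    and b: "\<And>y. norm (x - y) < \<rho> \<Longrightarrow> \<bar>f y - f x\<bar> \<le> e"
  shows "\<bar>conv f (mol \<rho>) x - f x\<bar> \<le> e"
proof -
  have "conv f (mol \<rho>) x \<le> f x + e"
    by (rule conv_mol_bound[OF r f]) (use b in \<open>auto simp: abs_le_iff algebra_simps intro!: AE_I2\<close>)
  moreover have "conv (\<lambda>y. - f y) (mol \<rho>) x \<le> - f x + e"
    by (rule conv_mol_bound[OF r]) (use b f in \<open>auto simp: abs_le_iff algebra_simps intro!: AE_I2\<close>)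
  ultimately show ?thesis by (simp add: conv_minus)
qed

lemma conv_mol_support:
  assumes r: "0 < \<rho>" and "\<And>y. norm (x - y) < \<rho> \<Longrightarrow> f y = 0"
  shows "conv f (mol \<rho>) x = 0"
proof -
  have "f y * mol \<rho> (x - y) = 0" for y
    using assms(2)[of y] mol_props(2)[OF r, of "x - y"] by (cases "norm (x - y) < \<rho>") auto
  then have "(\<lambda>y. f y * mol \<rho> (x - y)) = (\<lambda>y. 0)" by blast
  then show ?thesis unfolding conv_def by simp
qed

section \<open>Integration by parts, Poincare's inequality and density of test functions\<close>

text \<open>The weights used below are composed with functions that have finitely many derivatives
  only, so they are not \<open>smooth\<close>. Differentiability along one coordinate direction is
  all that the integration by parts needs, and it obeys simple product and chain rules.\<close>

definition dirderiv :: "'d::finite \<Rightarrow> (real^'d \<Rightarrow> real) \<Rightarrow> (real^'d \<Rightarrow> real) \<Rightarrow> bool" where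
  "dirderiv i F F' \<longleftrightarrow> (\<forall>x. ((\<lambda>t. F (x + t *\<^sub>R axis i 1)) has_real_derivative F' x) (at 0))"

lemma dirderiv_DERIV:
  assumes "dirderiv i F F'"
  shows "((\<lambda>t. F (x + t *\<^sub>R axis i 1)) has_real_derivative F' (x + t *\<^sub>R axis i 1)) (at t)"
proof -
  have "((\<lambda>s. F ((x + t *\<^sub>R axis i 1) + s *\<^sub>R axis i 1)) has_real_derivative F' (x + t *\<^sub>R axis i 1)) (at 0)"
    using assms unfolding dirderiv_def by blast
  then have "((\<lambda>s. F (x + (s + t) *\<^sub>R axis i 1)) has_real_derivative F' (x + t *\<^sub>R axis i 1)) (at 0)"
    by (simp add: algebra_simps)
  then show ?thesis
    using DERIV_shift[of "\<lambda>t. F (x + t *\<^sub>R axis i 1)" _ 0 t] by simp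
qed

lemma dirderiv_zero_outside:
  assumes "dirderiv i F F'" "compact K" "\<And>x. x \<notin> K \<Longrightarrow> F x = 0" "x \<notin> K"
  shows "F' x = 0"
proof -
  have D: "((\<lambda>t. F (x + t *\<^sub>R axis i 1)) has_real_derivative F' x) (at 0)"
    using assms(1) by (auto simp: dirderiv_def)
  let ?S = "(\<lambda>t. x + t *\<^sub>R axis i 1) -` (- K)"
  have "open ?S" by (rule open_vimage) (use compact_imp_closed[OF assms(2)] in \<open>auto intro!: continuous_intros\<close>)
  moreover have "0 \<in> ?S" using assms by simp
  ultimately have "((\<lambda>t. 0) has_real_derivative F' x) (at 0)"
    using has_field_derivative_transform_within_open[OF D, of ?S "\<lambda>t. 0"] assms(3) by auto
  then show ?thesis using DERIV_unique[OF _ DERIV_const] by blast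
qed

lemma integral_translate:
  fixes F :: "real^'d \<Rightarrow> real"
  assumes "continuous_on UNIV F"
  shows "(LINT x|lebesgue. F (x + a)) = (LINT x|lebesgue. F x)"
proof -
  have b: "(\<lambda>x. F (x + a)) \<in> borel_measurable lborel" "F \<in> borel_measurable lborel"
    by (auto intro!: borel_measurable_continuous_onI continuous_on_compose2[OF assms] continuous_intros assms)
  have "(LINT y|lborel. F (y + a)) = (LINT y|distr lborel borel ((+) a). F y)"
    by (subst integral_distr) (use b in \<open>auto simp: add.commute\<close>)
  also have "\<dots> = (LINT y|lborel. F y)" unfolding lborel_distr_plus ..
  finally show ?thesis using b by (simp add: integral_completion)
qed

text \<open>The difference quotients of \<open>F\<close> have integral zero by translation
  invariance. The mean value theorem bounds them by the supremum of \<open>F'\<close> on a ball one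
  unit larger than the support, so dominated convergence applies.\<close>

lemma integral_dirderiv_0:
  fixes F :: "real^'d \<Rightarrow> real"
  assumes F: "continuous_on UNIV F" and F': "continuous_on UNIV F'" and D: "dirderiv i F F'"
    and K: "compact K" "\<And>x. x \<notin> K \<Longrightarrow> F x = 0"
  shows "integrable lebesgue F'" "(LINT x|lebesgue. F' x) = 0"
proof -
  have K': "F' x = 0" if "x \<notin> K" for x using dirderiv_zero_outside[OF D K that] .
  show "integrable lebesgue F'" by (rule integrable_continuous_compact_support[OF F' K(1) K'])
  obtain B where B: "0 \<le> B" "\<And>x. \<bar>F' x\<bar> \<le> B"
    using bounded_continuous_compact_support[OF F' K(1) K'] by blast
  let ?e = "axis i (1::real) :: real^'d"
  define h where "h n = 1 / real (Suc n)" for n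
  define s where "s n x = (F (x + h n *\<^sub>R ?e) - F x) / h n" for n x
  have h: "0 < h n" "h n \<le> 1" "h n \<noteq> 0" for n by (auto simp: h_def)
  have hl: "h \<longlonglongrightarrow> 0" unfolding h_def by (rule LIMSEQ_Suc[OF lim_1_over_n])
  obtain R where R: "\<And>x. x \<in> K \<Longrightarrow> norm x \<le> R" using K(1) compact_imp_bounded bounded_iff by metis
  define w where "w x = B * indicator (cball 0 (R + 1)) x" for x :: "real^'d"
  have intF: "integrable lebesgue (\<lambda>x. F (x + a))" for a
  proof (rule integrable_continuous_compact_support)
    show "continuous_on UNIV (\<lambda>x. F (x + a))"
      by (intro continuous_on_compose2[OF F] continuous_intros) auto
    show "compact ((\<lambda>x. x - a) ` K)" by (intro compact_continuous_image K continuous_intros)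
    show "F (x + a) = 0" if "x \<notin> (\<lambda>x. x - a) ` K" for x
    proof (rule K(2))
      show "x + a \<notin> K" using that by (metis add_diff_cancel_right' imageI)
    qed
  qed
  have s0: "(LINT x|lebesgue. s n x) = 0" for n
  proof -
    have "(LINT x|lebesgue. s n x) = ((LINT x|lebesgue. F (x + h n *\<^sub>R ?e)) - (LINT x|lebesgue. F x)) / h n"
      unfolding s_def using intF[of "h n *\<^sub>R ?e"] intF[of 0] by simp
    then show ?thesis using integral_translate[OF F] by simp
  qed
  have sb: "\<bar>s n x\<bar> \<le> w x" for n x
  proof (cases "x \<in> cball 0 (R + 1)")
    case True
    obtain z where "0 < z" "z < h n" "F (x + h n *\<^sub>R ?e) - F (x + 0 *\<^sub>R ?e) = (h n - 0) * F' (x + z *\<^sub>R ?e)"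
      using MVT2[OF h(1) dirderiv_DERIV[OF D]] by blast
    then have "s n x = F' (x + z *\<^sub>R ?e)" using h(3)[of n] by (simp add: s_def)
    then show ?thesis using B True by (simp add: w_def)
  next
    case False
    then have n: "R + 1 < norm x" by simp
    have "norm x \<le> norm (x + h n *\<^sub>R ?e) + norm (h n *\<^sub>R ?e)" using norm_triangle_ineq4[of "x + h n *\<^sub>R ?e" "h n *\<^sub>R ?e"] by simp
    also have "norm (h n *\<^sub>R ?e) \<le> 1" using h[of n] by simp
    finally have "R < norm (x + h n *\<^sub>R ?e)" using n by simp
    then have "x + h n *\<^sub>R ?e \<notin> K" "x \<notin> K" using R n by (force, force)
    then show ?thesis using K(2) B by (simp add: s_def w_def)
  qed
  have "(\<lambda>n. LINT x|lebesgue. s n x) \<longlonglongrightarrow> (LINT x|lebesgue. F' x)"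
  proof (rule integral_dominated_convergence)
    show "F' \<in> borel_measurable lebesgue" by (rule continuous_measurable_lebesgue[OF F'])
    show "s n \<in> borel_measurable lebesgue" for n unfolding s_def
      using intF[of "h n *\<^sub>R ?e"] intF[of 0] by auto
    show "integrable lebesgue w" unfolding w_def
      using emeasure_lborel_cball_finite[of "0::real^'d" "R + 1"]
      by (intro integrable_mult_right integrable_real_indicator) auto
    show "AE x in lebesgue. (\<lambda>n. s n x) \<longlonglongrightarrow> F' x"
    proof (rule AE_I2)
      fix x
      have "((\<lambda>t. (F (x + t *\<^sub>R ?e) - F x) / t) \<longlongrightarrow> F' x) (at 0)"
        using D by (simp add: dirderiv_def DERIV_def)
      moreover have "filterlim h (at 0) sequentially"
        using hl h by (auto simp: filterlim_at intro!: always_eventually)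
      ultimately show "(\<lambda>n. s n x) \<longlonglongrightarrow> F' x" unfolding s_def by (rule filterlim_compose)
    qed
    show "AE x in lebesgue. norm (s n x) \<le> w x" for n using sb by auto
  qed
  then show "(LINT x|lebesgue. F' x) = 0" by (simp add: s0 LIMSEQ_const_iff)
qed

lemma smooth_dirderiv:
  fixes f :: "real^'d \<Rightarrow> real"
  assumes "smooth f" shows "dirderiv i f (pd i f)"
  unfolding dirderiv_def
proof
  fix x :: "real^'d"
  have D: "(f has_derivative frechet_derivative f (at x)) (at (x + 0 *\<^sub>R axis i 1))"
    using smooth_differentiable[OF assms] frechet_derivative_works by auto
  have "((\<lambda>t. f (x + t *\<^sub>R axis i 1)) has_derivative (\<lambda>t. frechet_derivative f (at x) (t *\<^sub>R axis i 1))) (at 0)"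
    by (rule has_derivative_compose[of "\<lambda>t. x + t *\<^sub>R axis i 1" "\<lambda>t. t *\<^sub>R axis i 1" 0 UNIV f])
      (use D in \<open>auto intro!: derivative_eq_intros\<close>)
  moreover have "frechet_derivative f (at x) (t *\<^sub>R axis i 1) = t * pd i f x" for t
    using linear_frechet_derivative[OF smooth_differentiable[OF assms]] by (simp add: linear_cmul pderiv_at_def)
  ultimately show "((\<lambda>t. f (x + t *\<^sub>R axis i 1)) has_real_derivative pd i f x) (at 0)"
    by (simp add: has_field_derivative_def mult_commute_abs)
qed

lemma integral_pderiv_0:
  assumes "\<phi> \<in> \<D> X"
  shows "(LINT x|lebesgue. pd i \<phi> x) = 0"
  using assms
proof (rule test_functionsE)
  fix K assume "smooth \<phi>" "compact K" "\<And>x. x \<notin> K \<Longrightarrow> \<phi> x = 0"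
  then show ?thesis
    by (intro integral_dirderiv_0(2)[of \<phi>]) (auto intro: smooth_continuous smooth_pderiv smooth_dirderiv)
qed

lemma smooth_pderiv_mult:
  "smooth f \<Longrightarrow> smooth g \<Longrightarrow> pd i (\<lambda>x. f x * g x) = (\<lambda>x. f x * pd i g x + pd i f x * g x)"
  by (intro ext pderiv_at_mult smooth_differentiable)

lemma smooth_pderiv_add:
  "smooth f \<Longrightarrow> smooth g \<Longrightarrow> pd i (\<lambda>x. f x + g x) = (\<lambda>x. pd i f x + pd i g x)"
  by (intro ext pderiv_at_add smooth_differentiable)

lemma smooth_pderiv_scale:
  "smooth f \<Longrightarrow> pd i (\<lambda>x. c * f x) = (\<lambda>x. c * pd i f x)"
  using smooth_pderiv_mult[OF smooth_const, of f i c] by simp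

lemma smooth_pderiv_diff:
  "smooth f \<Longrightarrow> smooth g \<Longrightarrow> pd i (\<lambda>x. f x - g x) = (\<lambda>x. pd i f x - pd i g x)"
  using smooth_pderiv_add[of f "\<lambda>x. -1 * g x" i] smooth_pderiv_scale[of g i "-1"] smooth_scale[of g "-1"]
  by simp

lemma pderiv_coord: "pd i (\<lambda>x::real^'d. x $ j) x = (if i = j then 1 else 0)"
  using pderiv_at_eq[OF bounded_linear_imp_has_derivative[OF bounded_linear_vec_nth], of i j x]
  by (simp add: axis_def)

lemma test_mult_integrable:
  assumes "\<phi> \<in> \<D> X" "continuous_on UNIV h"
  shows "integrable lebesgue (\<lambda>x. h x * \<phi> x)"
  using assms(1)
  by (rule test_functionsE)
    (auto intro!: integrable_continuous_compact_support continuous_on_mult assms(2) test_continuous[OF assms(1)])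

lemma integral_by_parts_test:
  assumes "\<phi> \<in> \<D> X" "smooth h"
  shows "(LINT x|lebesgue. h x * pd i \<phi> x) = - (LINT x|lebesgue. pd i h x * \<phi> x)"
proof -
  have "(LINT x|lebesgue. h x * pd i \<phi> x + pd i h x * \<phi> x) = 0"
    using integral_pderiv_0[OF test_smooth_mult[OF assms], of i] smooth_pderiv_mult[OF assms(2) test_smooth[OF assms(1)]]
    by simp
  moreover have "integrable lebesgue (\<lambda>x. h x * pd i \<phi> x)" "integrable lebesgue (\<lambda>x. pd i h x * \<phi> x)"
    using test_mult_integrable test_pderiv assms smooth_continuous smooth_pderiv by blast+
  ultimately show ?thesis by simp
qed

text \<open>The second difference over a small square is symmetric in the two directions, and two
  applications of the mean value theorem express it through either mixed derivative at a nearby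
  point.\<close>

lemma pderiv_commute:
  fixes f :: "real^'d \<Rightarrow> real"
  assumes "smooth f"
  shows "pd i (pd j f) x = pd j (pd i f) x"
proof -
  have dd: "\<exists>u v. 0 < u \<and> u < t \<and> 0 < v \<and> v < t \<and>
      f (x + t *\<^sub>R axis k 1 + t *\<^sub>R axis l 1) - f (x + t *\<^sub>R axis k 1) - f (x + t *\<^sub>R axis l 1) + f x
      = t * (t * pd l (pd k f) (x + u *\<^sub>R axis k 1 + v *\<^sub>R axis l 1))"
    if t: "0 < t" for t k l
  proof -
    let ?k = "axis k 1 :: real^'d" and ?l = "axis l 1 :: real^'d"
    have D: "((\<lambda>s. f (x + t *\<^sub>R ?l + s *\<^sub>R ?k) - f (x + s *\<^sub>R ?k)) has_real_derivative
        pd k f (x + t *\<^sub>R ?l + s *\<^sub>R ?k) - pd k f (x + s *\<^sub>R ?k)) (at s)" for s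
      by (intro DERIV_diff dirderiv_DERIV smooth_dirderiv assms)
    obtain u where u: "0 < u" "u < t" "(f (x + t *\<^sub>R ?l + t *\<^sub>R ?k) - f (x + t *\<^sub>R ?k)) - (f (x + t *\<^sub>R ?l + 0 *\<^sub>R ?k) - f (x + 0 *\<^sub>R ?k))
        = (t - 0) * (pd k f (x + t *\<^sub>R ?l + u *\<^sub>R ?k) - pd k f (x + u *\<^sub>R ?k))"
      using MVT2[OF t D] by blast
    have D': "((\<lambda>s. pd k f (x + u *\<^sub>R ?k + s *\<^sub>R ?l)) has_real_derivative
        pd l (pd k f) (x + u *\<^sub>R ?k + s *\<^sub>R ?l)) (at s)" for s
      by (intro dirderiv_DERIV smooth_dirderiv smooth_pderiv assms)
    obtain v where v: "0 < v" "v < t" "pd k f (x + u *\<^sub>R ?k + t *\<^sub>R ?l) - pd k f (x + u *\<^sub>R ?k + 0 *\<^sub>R ?l)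
        = (t - 0) * pd l (pd k f) (x + u *\<^sub>R ?k + v *\<^sub>R ?l)"
      using MVT2[OF t D'] by blast
    from u(3) v(3) have "f (x + t *\<^sub>R ?k + t *\<^sub>R ?l) - f (x + t *\<^sub>R ?k) - f (x + t *\<^sub>R ?l) + f x
        = t * (t * pd l (pd k f) (x + u *\<^sub>R ?k + v *\<^sub>R ?l))"
      by (simp add: algebra_simps)
    with u(1,2) v(1,2) show ?thesis by blast
  qed
  have "\<bar>pd i (pd j f) x - pd j (pd i f) x\<bar> \<le> e" if e: "0 < e" for e
  proof -
    have cont: "\<exists>d>0. \<forall>y. dist y x < d \<longrightarrow> dist (pd l (pd k f) y) (pd l (pd k f) x) < e / 2" for k l
      using smooth_continuous[OF smooth_pderiv[OF smooth_pderiv[OF assms]], of UNIV l k] e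
      unfolding continuous_on_iff by (metis UNIV_I half_gt_zero)
    obtain d1 where d1: "0 < d1" "\<And>y. dist y x < d1 \<Longrightarrow> dist (pd i (pd j f) y) (pd i (pd j f) x) < e / 2"
      using cont by blast
    obtain d2 where d2: "0 < d2" "\<And>y. dist y x < d2 \<Longrightarrow> dist (pd j (pd i f) y) (pd j (pd i f) x) < e / 2"
      using cont by blast
    define t where "t = min d1 d2 / 2"
    have t: "0 < t" "2 * t \<le> d1" "2 * t \<le> d2" using d1(1) d2(1) by (auto simp: t_def)
    have close: "dist (x + u *\<^sub>R axis k 1 + v *\<^sub>R axis l 1) x < 2 * t" if "0 < u" "u < t" "0 < v" "v < t" for u v k l
      using norm_triangle_ineq[of "u *\<^sub>R axis k (1::real) :: real^'d" "v *\<^sub>R axis l 1"] that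
      by (simp add: dist_norm add.assoc)
    obtain u v where uv: "0 < u" "u < t" "0 < v" "v < t" "f (x + t *\<^sub>R axis i 1 + t *\<^sub>R axis j 1) - f (x + t *\<^sub>R axis i 1) - f (x + t *\<^sub>R axis j 1) + f x
      = t * (t * pd j (pd i f) (x + u *\<^sub>R axis i 1 + v *\<^sub>R axis j 1))" using dd[OF t(1)] by blast
    obtain u' v' where uv': "0 < u'" "u' < t" "0 < v'" "v' < t" "f (x + t *\<^sub>R axis j 1 + t *\<^sub>R axis i 1) - f (x + t *\<^sub>R axis j 1) - f (x + t *\<^sub>R axis i 1) + f x
      = t * (t * pd i (pd j f) (x + u' *\<^sub>R axis j 1 + v' *\<^sub>R axis i 1))" using dd[OF t(1)] by blast
    have "f (x + t *\<^sub>R axis j 1 + t *\<^sub>R axis i 1) = f (x + t *\<^sub>R axis i 1 + t *\<^sub>R axis j 1)" by (simp add: add_ac)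
    then have "t * (t * pd j (pd i f) (x + u *\<^sub>R axis i 1 + v *\<^sub>R axis j 1))
        = t * (t * pd i (pd j f) (x + u' *\<^sub>R axis j 1 + v' *\<^sub>R axis i 1))"
      using uv(5) uv'(5) by linarith
    then have eq: "pd j (pd i f) (x + u *\<^sub>R axis i 1 + v *\<^sub>R axis j 1)
        = pd i (pd j f) (x + u' *\<^sub>R axis j 1 + v' *\<^sub>R axis i 1)"
      using t(1) by simp
    show ?thesis
      using d2(2)[OF less_le_trans[OF close[OF uv(1-4)] t(3)], of i j]
        d1(2)[OF less_le_trans[OF close[OF uv'(1-4)] t(2)], of j i] eq
      by (simp add: dist_real_def abs_if split: if_splits)
  qed
  then have "\<bar>pd i (pd j f) x - pd j (pd i f) x\<bar> \<le> 0"
    by (rule field_le_epsilon) simp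
  then show ?thesis by simp
qed

section \<open>Poincare's inequality for test functions\<close>

lemma lebesgue_on_finite:
  assumes "bounded U" "open U" shows "finite_measure (\<L> U)"
  by (rule finite_measure_lebesgue_on) (use assms in \<open>simp add: lmeasurable_open\<close>)

lemma integral_zero_extend:
  fixes h :: "real^'d \<Rightarrow> real"
  assumes "open U" "\<And>x. x \<notin> U \<Longrightarrow> h x = 0"
  shows "(LINT x|\<L> U. h x) = (LINT x|lebesgue. h x)"
    "integrable (\<L> U) h \<longleftrightarrow> integrable lebesgue h"
proof -
  have [simp]: "U \<in> sets lebesgue" using assms(1) by (simp add: borel_open)
  have "(\<lambda>x. indicator U x *\<^sub>R h x) = h" using assms(2) by (auto simp: indicator_def fun_eq_iff)
  then show "(LINT x|\<L> U. h x) = (LINT x|lebesgue. h x)"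
    "integrable (\<L> U) h \<longleftrightarrow> integrable lebesgue h"
    by (simp_all add: integral_restrict_space integrable_restrict_space)
qed

lemma open_sets_lebesgue: "open U \<Longrightarrow> U \<in> sets lebesgue"
  by (simp add: borel_open)

lemma continuous_measurable_lebesgue_on:
  fixes f :: "real^'d \<Rightarrow> real"
  assumes "open U" "continuous_on U f" shows "f \<in> borel_measurable (\<L> U)"
  using continuous_imp_measurable_on_sets_lebesgue[OF assms(2) open_sets_lebesgue[OF assms(1)]] .

lemma sqint_bounded:
  fixes f :: "real^'d \<Rightarrow> real"
  assumes "bounded U" "open U" "f \<in> borel_measurable (\<L> U)" "AE x in \<L> U. \<bar>f x\<bar> \<le> B"
  shows "sqint (\<L> U) f"
proof -
  interpret finite_measure "\<L> U" by (rule lebesgue_on_finite[OF assms(1,2)])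
  have "sqint (\<L> U) (\<lambda>x. 1)" by (simp add: sqint_def)
  from sqint_bound_mult[OF this assms(3,4)] show ?thesis by simp
qed

lemma test_sqint:
  assumes "bounded U" "open U" "\<phi> \<in> \<D> X" shows "sqint (\<L> U) \<phi>"
proof -
  obtain B where "\<And>x. \<bar>\<phi> x\<bar> \<le> B" using test_bounded[OF assms(3)] by metis
  then show ?thesis
    using sqint_bounded[OF assms(1,2) continuous_measurable_lebesgue_on[OF assms(2) test_continuous[OF assms(3)]]] by blast
qed

lemma test_inner_lebesgue:
  assumes "open U" "\<phi> \<in> \<D> U"
  shows "(LINT x|\<L> U. h x * \<phi> x) = (LINT x|lebesgue. h x * \<phi> x)"
  using integral_zero_extend(1)[OF assms(1)] test_zero_outside[OF assms(2)] by auto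

text \<open>Since x_i has derivative 1 in direction i, the integral of \<phi>^2 equals minus the
  integral of 2 x_i \<phi> d_i \<phi>, and x_i is bounded on the domain.\<close>

lemma Poincare_test:
  fixes U :: "(real^'d) set" and i :: 'd
  assumes U: "bounded U" "open U" and R: "0 \<le> R" "\<And>x. x \<in> U \<Longrightarrow> norm x \<le> R"
    and \<phi>: "\<phi> \<in> \<D> U"
  shows "nL2 (\<L> U) \<phi> \<le> 2 * R * nL2 (\<L> U) (pd i \<phi>)"
proof -
  let ?M = "\<L> U"
  note \<phi>s = test_smooth[OF \<phi>]
  have sq: "sqint ?M \<phi>" "sqint ?M (pd i \<phi>)" using test_sqint[OF U] \<phi> test_pderiv by blast+
  have xm: "(\<lambda>x::real^'d. x $ i) \<in> borel_measurable ?M"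
    by (intro continuous_measurable_lebesgue_on U continuous_intros)
  have xb: "AE x in ?M. \<bar>x $ i\<bar> \<le> R"
    using R component_le_norm_cart order.trans by (intro AE_I2) (fastforce simp: space_restrict_space)
  have sqx: "sqint ?M (\<lambda>x. x $ i * pd i \<phi> x)" using sqint_bound_mult[OF sq(2) xm xb] .
  have t2: "(\<lambda>x. \<phi> x * \<phi> x) \<in> \<D> U" using test_smooth_mult[OF \<phi> \<phi>s] .
  have "(LINT x|lebesgue. x $ i * (\<phi> x * pd i \<phi> x + pd i \<phi> x * \<phi> x)) = - (LINT x|lebesgue. 1 * (\<phi> x * \<phi> x))"
    using integral_by_parts_test[OF t2 smooth_coord, of i i] smooth_pderiv_mult[OF \<phi>s \<phi>s, of i]
    by (simp add: pderiv_coord)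
  then have "(LINT x|lebesgue. (\<phi> x)\<^sup>2) = - (LINT x|lebesgue. 2 * ((x $ i * pd i \<phi> x) * \<phi> x))"
    by (simp add: power2_eq_square algebra_simps)
  also have "\<dots> = - 2 * (LINT x|lebesgue. (x $ i * pd i \<phi> x) * \<phi> x)" by simp
  also have "\<dots> = - 2 * (LINT x|?M. (x $ i * pd i \<phi> x) * \<phi> x)"
    using test_inner_lebesgue[OF U(2) \<phi>, of "\<lambda>x. x $ i * pd i \<phi> x"] by simp
  also have "\<dots> \<le> 2 * (nL2 ?M (\<lambda>x. x $ i * pd i \<phi> x) * nL2 ?M \<phi>)"
    using nL2_Cauchy_Schwarz[OF sqx sq(1)] by linarith
  also have "nL2 ?M (\<lambda>x. x $ i * pd i \<phi> x) \<le> nL2 ?M (\<lambda>x. R * pd i \<phi> x)"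
  proof (rule nL2_mono[OF sqint_scale[OF sq(2)] sqint_measurable[OF sqx]])
    show "AE x in ?M. \<bar>x $ i * pd i \<phi> x\<bar> \<le> \<bar>R * pd i \<phi> x\<bar>"
      using xb by eventually_elim (use R(1) in \<open>simp add: abs_mult mult_right_mono\<close>)
  qed
  also have "nL2 ?M (\<lambda>x. R * pd i \<phi> x) = R * nL2 ?M (pd i \<phi>)"
    using nL2_scale[of ?M R] R(1) by simp
  finally have "(LINT x|lebesgue. (\<phi> x)\<^sup>2) \<le> 2 * (R * nL2 ?M (pd i \<phi>) * nL2 ?M \<phi>)"
    by (simp add: mult_right_mono)
  moreover have "(LINT x|lebesgue. (\<phi> x)\<^sup>2) = nL2 ?M \<phi> * nL2 ?M \<phi>"
    using test_inner_lebesgue[OF U(2) \<phi>, of \<phi>] nL2_sq[of ?M \<phi>] by (simp add: power2_eq_square)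
  ultimately have "nL2 ?M \<phi> * nL2 ?M \<phi> \<le> (2 * R * nL2 ?M (pd i \<phi>)) * nL2 ?M \<phi>" by (simp add: mult_ac)
  then show ?thesis
    using R(1) by (cases "nL2 ?M \<phi> = 0") (auto simp: mult_le_cancel_right order_less_le)
qed

section \<open>Neighbourhoods of compact sets, cutoffs, and mollification as a symmetric
  operator\<close>

lemma compact_infdist_le:
  fixes K :: "(real^'d) set"
  assumes "compact K" "K \<noteq> {}" shows "compact {x. infdist x K \<le> s}"
proof -
  obtain b where b: "\<And>x. x \<in> K \<Longrightarrow> norm x \<le> b" using assms(1) compact_imp_bounded bounded_iff by metis
  have "norm x \<le> s + b" if "infdist x K \<le> s" for x
  proof -
    obtain y where y: "y \<in> K" "infdist x K = dist x y"
      using infdist_attains_inf[OF compact_imp_closed[OF assms(1)] assms(2)] by blast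
    then show ?thesis using b[OF y(1)] that norm_triangle_ineq2[of x y] by (simp add: dist_norm)
  qed
  then have "bounded {x. infdist x K \<le> s}" by (auto simp: bounded_iff)
  moreover have "closed {x. infdist x K \<le> s}" by (intro closed_Collect_le continuous_intros)
  ultimately show ?thesis by (simp add: compact_eq_bounded_closed)
qed

lemma compact_infdist_nbhd:
  fixes K X :: "(real^'d) set"
  assumes "compact K" "open X" "K \<subseteq> X" "K \<noteq> {}"
  obtains r where "0 < r" "{x. infdist x K \<le> r} \<subseteq> X"
proof -
  obtain e where e: "0 < e" "(\<Union>x\<in>K. cball x e) \<subseteq> X"
    using compact_subset_open_imp_cball_epsilon_subset[OF assms(1-3)] by blast
  have "x \<in> X" if x: "infdist x K \<le> e" for x
  proof -
    obtain y where "y \<in> K" "infdist x K = dist x y"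
      using infdist_attains_inf[OF compact_imp_closed[OF assms(1)] assms(4)] by blast
    then have "x \<in> cball y e" using x by (auto simp: dist_commute)
    then show "x \<in> X" using e(2) \<open>y \<in> K\<close> by blast
  qed
  then show thesis using that[OF e(1)] by blast
qed

lemma conv_mol_support_infdist:
  assumes "0 < r" "\<And>y. s < infdist y K \<Longrightarrow> f y = 0" "s + r < infdist x K"
  shows "conv f (mol r) x = 0"
proof (rule conv_mol_support[OF assms(1)])
  fix y assume "norm (x - y) < r"
  then show "f y = 0"
    using assms(3) infdist_triangle[of x K y] by (intro assms(2)) (simp add: dist_norm)
qed

lemma cutoff_exists:
  fixes K X :: "(real^'d) set"
  assumes "compact K" "open X" "K \<subseteq> X"
  obtains c where "c \<in> \<D> X" "\<And>x. 0 \<le> c x" "\<And>x. c x \<le> 1" "\<And>x. x \<in> K \<Longrightarrow> c x = 1"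
proof (cases "K = {}")
  case True
  then show thesis using that[of "\<lambda>x. 0"] by auto
next
  case False
  obtain e where e: "0 < e" "{x. infdist x K \<le> e} \<subseteq> X" using compact_infdist_nbhd[OF assms False] by blast
  \<comment> \<open>The indicator of the \<open>r\<close>-neighbourhood is mollified at scale
    \<open>r\<close>: this leaves the value 1 on \<open>K\<close> and a support inside the
    \<open>2 * r\<close>-neighbourhood, hence inside \<open>X\<close>.\<close>
  define r where "r = e / 3"
  have r: "0 < r" "e = 3 * r" using e by (auto simp: r_def)
  define L where "L = {x. infdist x K \<le> r}"
  define L2 where "L2 = {x. infdist x K \<le> 2 * r}"
  note comp = compact_infdist_le[OF assms(1) False]
  have L2U: "L2 \<subseteq> X" using e r by (force simp: L2_def)
  have iL: "integrable lebesgue (indicator L :: real^'d \<Rightarrow> real)"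
  proof -
    have "L \<in> lmeasurable" unfolding L_def by (rule lmeasurable_compact[OF comp])
    then show ?thesis unfolding fmeasurable_def by (intro integrable_real_indicator) blast+
  qed
  let ?c = "conv (indicator L) (mol r)"
  show thesis
  proof (rule that[of ?c])
    show "?c \<in> \<D> X"
    proof (rule test_functionsI[OF conv_smooth[OF iL mol_test[OF r(1)]] _ L2U])
      show "compact L2" unfolding L2_def by (rule comp)
      show "?c x = 0" if "x \<notin> L2" for x
        by (rule conv_mol_support_infdist[OF r(1), of r K]) (use that in \<open>auto simp: L_def L2_def\<close>)
    qed
    show "?c x \<le> 1" for x
      by (rule conv_mol_bound[OF r(1) iL]) (auto simp: indicator_def)
    have "conv (\<lambda>y. - indicator L y) (mol r) x \<le> 0" for x
      by (rule conv_mol_bound[OF r(1) integrable_minus[OF iL]]) simp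
    then show "0 \<le> ?c x" for x by (simp add: conv_minus)
    show "?c x = 1" if "x \<in> K" for x
    proof -
      have inL: "y \<in> L" if "norm (x - y) < r" for y
        using infdist_le[OF \<open>x \<in> K\<close>, of y] that by (simp add: L_def dist_norm norm_minus_commute)
      have "\<bar>?c x - indicator L x\<bar> \<le> 0"
        by (rule conv_mol_close[OF r(1) iL]) (use inL inL[of x] r in \<open>auto simp: indicator_def\<close>)
      then show ?thesis using inL[of x] r by simp
    qed
  qed
qed

lemma conv_mol_Lipschitz:
  assumes "0 < \<rho>" "integrable lebesgue f" "0 \<le> L" "\<And>x y. \<bar>f x - f y\<bar> \<le> L * norm (x - y)"
  shows "\<bar>conv f (mol \<rho>) x - f x\<bar> \<le> L * \<rho>"
proof (rule conv_mol_close[OF assms(1,2)])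
  fix y assume "norm (x - y) < \<rho>"
  then show "\<bar>f y - f x\<bar> \<le> L * \<rho>"
    using assms(4)[of y x] mult_left_mono[OF less_imp_le assms(3), of "norm (x - y)" \<rho>]
    by (simp add: norm_minus_commute)
qed

text \<open>The kernel is even, so exchanging the integrals moves the mollification to the other
  factor.\<close>

lemma conv_Fubini:
  fixes f :: "real^'d \<Rightarrow> real"
  assumes r: "0 < \<rho>" and f: "integrable lebesgue f" and \<phi>: "\<phi> \<in> \<D> X"
  shows "(LINT x|lebesgue. conv f (mol \<rho>) x * \<phi> x) = (LINT y|lebesgue. f y * conv \<phi> (mol \<rho>) y)"
proof -
  note mt = mol_test[OF r, where 'd='d]
  \<comment> \<open>\<open>f\<close> is only Lebesgue measurable. A Borel representative makes the
    integrand measurable on the product of the Borel measures, where Fubini's theorem is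
    applied.\<close>
  obtain g where g: "g \<in> borel_measurable lborel" "AE x in lborel. f x = g x"
    using completion_ex_borel_measurable_real[of f lborel] f by auto
  then have ae: "AE x in lebesgue. f x = g x" by (simp add: AE_completion)
  have fm: "f \<in> borel_measurable lebesgue" using f by auto
  have gm: "g \<in> borel_measurable lebesgue" using g(1) by (simp add: measurable_completion)
  have gi: "integrable lebesgue g" using f ae integrable_cong_AE[OF fm gm] by simp
  then have gi': "integrable lborel g" using g(1) by (simp add: integrable_completion)
  have \<phi>i: "integrable lborel \<phi>" "\<phi> \<in> borel_measurable lborel"
  proof -
    show "\<phi> \<in> borel_measurable lborel" using test_continuous[OF \<phi>] by (simp add: borel_measurable_continuous_onI)
    then show "integrable lborel \<phi>" using test_integrable[OF \<phi>] by (simp add: integrable_completion)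
  qed
  have sm: "(\<lambda>y. h (x - y)) \<in> borel_measurable lborel" if "h \<in> \<D> V" for h x and V :: "(real^'d) set"
    by (auto intro!: borel_measurable_continuous_onI continuous_on_compose2[OF test_continuous[OF that, of UNIV]] continuous_intros)
  have sm': "(\<lambda>x. mol \<rho> (x - y)) \<in> borel_measurable lborel" for y :: "real^'d"
    by (auto intro!: borel_measurable_continuous_onI continuous_on_compose2[OF test_continuous[OF mt, of UNIV]] continuous_intros)
  obtain B where B: "0 \<le> B" "\<And>x::real^'d. \<bar>mol \<rho> x\<bar> \<le> B" using test_bounded[OF mt] by metis
  have mg: "(\<lambda>z. mol \<rho> (fst z - snd z :: real^'d)) \<in> borel_measurable (lborel \<Otimes>\<^sub>M lborel)"
    unfolding lborel_prod
    by (auto intro!: borel_measurable_continuous_onI continuous_on_compose2[OF test_continuous[OF mt, of UNIV]] continuous_intros)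
  define h where "h x y = g y * mol \<rho> (x - y) * \<phi> x" for x y
  have hm: "(\<lambda>(x, y). h x y) \<in> borel_measurable (lborel \<Otimes>\<^sub>M lborel)"
    using mg g(1) \<phi>i(2) unfolding h_def by (simp add: case_prod_beta)
  have hint: "integrable lborel (\<lambda>y. h x y)" for x
    using conv_integrable[OF gi mt, of x] g(1) sm[OF mt, of x]
    unfolding h_def by (simp add: integrable_completion)
  have int: "integrable (lborel \<Otimes>\<^sub>M lborel) (\<lambda>(x, y). h x y)"
  proof (rule lborel_pair.Fubini_integrable[OF hm])
    show "AE x in lborel. integrable lborel (\<lambda>y. case (x, y) of (x, y) \<Rightarrow> h x y)" using hint by simp
    show "integrable lborel (\<lambda>x. LINT y|lborel. norm (case (x, y) of (x, y) \<Rightarrow> h x y))"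
    proof (rule Bochner_Integration.integrable_bound)
      show "integrable lborel (\<lambda>x. (B * (LINT y|lborel. \<bar>g y\<bar>)) * \<phi> x)" using \<phi>i by auto
      show "(\<lambda>x. LINT y|lborel. norm (case (x, y) of (x, y) \<Rightarrow> h x y)) \<in> borel_measurable lborel"
        using hm by measurable
      show "AE x in lborel. norm (LINT y|lborel. norm (case (x, y) of (x, y) \<Rightarrow> h x y)) \<le> norm ((B * (LINT y|lborel. \<bar>g y\<bar>)) * \<phi> x)"
      proof (rule AE_I2)
        fix x
        have "(LINT y|lborel. \<bar>h x y\<bar>) \<le> (LINT y|lborel. (B * \<bar>\<phi> x\<bar>) * \<bar>g y\<bar>)"
        proof (rule integral_mono)
          show "integrable lborel (\<lambda>y. \<bar>h x y\<bar>)" using hint by auto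
          show "integrable lborel (\<lambda>y. B * \<bar>\<phi> x\<bar> * \<bar>g y\<bar>)" using gi' by auto
          fix y
          have "\<bar>h x y\<bar> = (\<bar>\<phi> x\<bar> * \<bar>g y\<bar>) * \<bar>mol \<rho> (x - y)\<bar>" by (simp add: h_def abs_mult)
          also have "\<dots> \<le> (\<bar>\<phi> x\<bar> * \<bar>g y\<bar>) * B" using B by (intro mult_left_mono) auto
          finally show "\<bar>h x y\<bar> \<le> B * \<bar>\<phi> x\<bar> * \<bar>g y\<bar>" by (simp add: mult_ac)
        qed
        then show "norm (LINT y|lborel. norm (case (x, y) of (x, y) \<Rightarrow> h x y)) \<le> norm ((B * (LINT y|lborel. \<bar>g y\<bar>)) * \<phi> x)"
          using B by (simp add: abs_mult mult_ac)
      qed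
    qed
  qed
  have cg: "conv f (mol \<rho>) x = (LINT y|lborel. g y * mol \<rho> (x - y))" for x
  proof -
    have m: "(\<lambda>y. mol \<rho> (x - y)) \<in> borel_measurable lebesgue" using sm[OF mt, of x] by (simp add: measurable_completion)
    have "conv f (mol \<rho>) x = conv g (mol \<rho>) x" unfolding conv_def
      by (rule integral_cong_AE) (use fm gm m ae in \<open>auto elim: eventually_mono\<close>)
    then show ?thesis using g(1) sm[OF mt, of x] by (simp add: conv_def integral_completion)
  qed
  have cc: "continuous_on UNIV (conv f (mol \<rho>))" by (rule smooth_continuous[OF conv_smooth[OF f mt]])
  have cp: "continuous_on UNIV (conv \<phi> (mol \<rho>))" by (rule smooth_continuous[OF conv_smooth[OF test_integrable[OF \<phi>] mt]])
  have "(LINT x|lebesgue. conv f (mol \<rho>) x * \<phi> x) = (LINT x|lborel. conv f (mol \<rho>) x * \<phi> x)"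
    using borel_measurable_continuous_onI[OF cc] \<phi>i(2) by (intro integral_completion) simp
  also have "\<dots> = (LINT x|lborel. LINT y|lborel. h x y)"
    unfolding cg h_def by simp
  also have "\<dots> = (LINT y|lborel. LINT x|lborel. h x y)"
    using lborel_pair.Fubini_integral[OF int] by simp
  also have "\<dots> = (LINT y|lborel. g y * conv \<phi> (mol \<rho>) y)"
  proof (rule Bochner_Integration.integral_cong[OF refl])
    fix y
    have "(LINT x|lborel. h x y) = g y * (LINT x|lborel. \<phi> x * mol \<rho> (x - y))"
      unfolding h_def by (subst integral_mult_right_zero[symmetric]) (simp add: mult_ac)
    also have "(LINT x|lborel. \<phi> x * mol \<rho> (x - y)) = (LINT x|lborel. \<phi> x * mol \<rho> (y - x))"
      using mol_props(3)[OF r, of "_ - _"] by (metis minus_diff_eq)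
    also have "\<dots> = conv \<phi> (mol \<rho>) y"
      unfolding conv_def by (rule integral_completion[symmetric]) (use \<phi>i sm[OF mt] in simp)
    finally show "(LINT x|lborel. h x y) = g y * conv \<phi> (mol \<rho>) y" .
  qed
  also have "\<dots> = (LINT y|lebesgue. g y * conv \<phi> (mol \<rho>) y)"
    using borel_measurable_continuous_onI[OF cp] g(1) by (intro integral_completion[symmetric]) simp
  also have "\<dots> = (LINT y|lebesgue. f y * conv \<phi> (mol \<rho>) y)"
    using fm gm continuous_measurable_lebesgue[OF cp] ae by (intro integral_cong_AE) (auto elim: eventually_mono)
  finally show ?thesis .
qed

section \<open>Weak derivatives and weak solutions\<close>

lemma L2_iff: "f \<in> L2 U \<longleftrightarrow> sqint (\<L> U) f"
  by (simp add: L2_def sqint_def)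

lemma L2_norm_eq: "L2_norm U f = nL2 (\<L> U) f"
  by (simp add: L2_norm_def L2_inner_def nL2_def power2_eq_square)

lemma L2_inner_commute: "L2_inner U f g = L2_inner U g f"
  by (simp add: L2_inner_def mult.commute)

lemma L2_inner_self: "L2_inner U f f = (nL2 (\<L> U) f)\<^sup>2"
  by (simp add: L2_inner_def nL2_sq flip: power2_eq_square)

lemma L2_inner_add:
  assumes "sqint (\<L> U) f" "sqint (\<L> U) g" "sqint (\<L> U) h"
  shows "L2_inner U (\<lambda>x. f x + g x) h = L2_inner U f h + L2_inner U g h"
  using sqint_mult[OF assms(1,3)] sqint_mult[OF assms(2,3)] by (simp add: L2_inner_def distrib_right)

lemma L2_inner_scale: "L2_inner U (\<lambda>x. c * f x) h = c * L2_inner U f h"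
  by (simp add: L2_inner_def mult.assoc)

lemma L2_inner_diff:
  assumes "sqint (\<L> U) f" "sqint (\<L> U) g" "sqint (\<L> U) h"
  shows "L2_inner U (\<lambda>x. f x - g x) h = L2_inner U f h - L2_inner U g h"
  using sqint_mult[OF assms(1,3)] sqint_mult[OF assms(2,3)] by (simp add: L2_inner_def left_diff_distrib)

lemma L2_inner_sum:
  assumes "\<And>i. i \<in> I \<Longrightarrow> sqint (\<L> U) (f i)" "sqint (\<L> U) h"
  shows "L2_inner U (\<lambda>x. \<Sum>i\<in>I. f i x) h = (\<Sum>i\<in>I. L2_inner U (f i) h)"
  using sqint_mult[OF assms(1) assms(2)] by (simp add: L2_inner_def sum_distrib_right)

lemma L2_inner_cong_AE:
  assumes "f \<in> borel_measurable (\<L> U)" "f' \<in> borel_measurable (\<L> U)"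
    "h \<in> borel_measurable (\<L> U)" "AE x in \<L> U. f x = f' x"
  shows "L2_inner U f h = L2_inner U f' h"
  unfolding L2_inner_def by (rule integral_cong_AE) (use assms in \<open>auto elim: eventually_mono\<close>)

lemma L2_inner_limit:
  assumes "L2_conv (\<L> U) s f" "L2_conv (\<L> U) t g"
  shows "(\<lambda>n. L2_inner U (s n) (t n)) \<longlonglongrightarrow> L2_inner U f g"
  using L2_conv_inner[OF assms] by (simp add: L2_inner_def)

lemma L2_inner_bound:
  assumes "sqint (\<L> U) f" "sqint (\<L> U) g"
  shows "\<bar>L2_inner U f g\<bar> \<le> nL2 (\<L> U) f * nL2 (\<L> U) g"
  using nL2_Cauchy_Schwarz[OF assms] by (simp add: L2_inner_def)

lemma L2_conv_dominated:
  assumes m: "\<And>n. s n \<in> borel_measurable M" "f \<in> borel_measurable M" and w: "sqint M w"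
    and b: "\<And>n. AE x in M. \<bar>s n x\<bar> \<le> w x" and l: "AE x in M. (\<lambda>n. s n x) \<longlonglongrightarrow> f x"
  shows "L2_conv M s f"
proof -
  have wabs: "sqint M (\<lambda>x. \<bar>w x\<bar>)" using w by (auto simp: sqint_def)
  have bb: "AE x in M. \<forall>n. \<bar>s n x\<bar> \<le> w x" using b by (simp add: AE_all_countable)
  have fb: "AE x in M. \<bar>f x\<bar> \<le> w x"
    using bb l by eventually_elim (rule LIMSEQ_le_const2[OF tendsto_rabs], auto)
  have sq: "sqint M h" if "h \<in> borel_measurable M" "AE x in M. \<bar>h x\<bar> \<le> w x" for h
    unfolding sqint_def
  proof
    show "integrable M (\<lambda>x. (h x)\<^sup>2)"
    proof (rule Bochner_Integration.integrable_bound[OF sqint_square[OF w]])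
      show "AE x in M. norm ((h x)\<^sup>2) \<le> norm ((w x)\<^sup>2)"
        using that(2) by eventually_elim (use abs_le_square_iff order.trans[OF _ abs_ge_self] in force)
    qed (use that in measurable)
  qed (use that in simp)
  have S: "sqint M (s n)" "sqint M f" for n using sq m b fb by blast+
  have "(\<lambda>n. LINT x|M. (s n x - f x)\<^sup>2) \<longlonglongrightarrow> (LINT x|M. 0)"
  proof (rule integral_dominated_convergence)
    show "integrable M (\<lambda>x. 4 * (w x)\<^sup>2)" using sqint_square[OF w] by simp
    show "(\<lambda>x. (s n x - f x)\<^sup>2) \<in> borel_measurable M" for n using m by measurable
    show "AE x in M. (\<lambda>n. (s n x - f x)\<^sup>2) \<longlonglongrightarrow> 0"
      using l
    proof eventually_elim
      case (elim x)
      then have "(\<lambda>n. s n x - f x) \<longlonglongrightarrow> 0" by (simp add: LIM_zero_iff)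
      from tendsto_power[OF this, of 2] show ?case by simp
    qed
    show "AE x in M. norm ((s n x - f x)\<^sup>2) \<le> 4 * (w x)\<^sup>2" for n
      using bb fb
    proof eventually_elim
      case (elim x)
      then have "\<bar>s n x\<bar> \<le> w x" by blast
      then have "\<bar>s n x - f x\<bar> \<le> \<bar>2 * w x\<bar>" using elim(2) by linarith
      then have "(s n x - f x)\<^sup>2 \<le> (2 * w x)\<^sup>2" by (rule abs_le_square_iff[THEN iffD1])
      then show ?case by (simp add: power_mult_distrib)
    qed
  qed simp
  then have "(\<lambda>n. sqrt (LINT x|M. (s n x - f x)\<^sup>2)) \<longlonglongrightarrow> sqrt 0"
    by (intro tendsto_real_sqrt) simp
  then show ?thesis using S by (simp add: L2_conv_def nL2_def)
qed

text \<open>Membership in the L2 closure of the test functions. Since it is stable under L2 limits,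
  density can be reached in stages: continuous functions of compact support, bounded functions, all
  functions.\<close>

definition test_approx :: "(real^'d) set \<Rightarrow> (real^'d \<Rightarrow> real) \<Rightarrow> bool" where
  "test_approx U f \<longleftrightarrow> sqint (\<L> U) f \<and>
     (\<forall>e>0. \<exists>\<phi>\<in>\<D> U. nL2 (\<L> U) (\<lambda>x. \<phi> x - f x) < e)"

lemma test_approx_limit:
  assumes U: "bounded U" "open U" and s: "\<And>n. test_approx U (s n)" and c: "L2_conv (\<L> U) s f"
  shows "test_approx U f"
  unfolding test_approx_def
proof (intro conjI allI impI)
  show f: "sqint (\<L> U) f" using L2_convD[OF c] by blast
  fix e :: real assume e: "0 < e"
  obtain N where "norm (nL2 (\<L> U) (\<lambda>x. s N x - f x) - 0) < e / 2"
    using LIMSEQ_D[OF L2_convD(3)[OF c], of "e/2"] e by auto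
  then have 1: "nL2 (\<L> U) (\<lambda>x. s N x - f x) < e / 2" by simp
  obtain \<phi> where \<phi>: "\<phi> \<in> \<D> U" "nL2 (\<L> U) (\<lambda>x. \<phi> x - s N x) < e / 2"
    using s[of N] e unfolding test_approx_def by (meson half_gt_zero)
  have "nL2 (\<L> U) (\<lambda>x. \<phi> x - f x) < e"
    using nL2_triangle_diff[OF test_sqint[OF U \<phi>(1)] L2_convD(1)[OF c, of N] f] 1 \<phi>(2) by linarith
  then show "\<exists>\<phi>\<in>\<D> U. nL2 (\<L> U) (\<lambda>x. \<phi> x - f x) < e" using \<phi>(1) by blast
qed

lemma conv_mol_pointwise:
  assumes f: "continuous_on UNIV f" "integrable lebesgue f" and r: "\<And>n. 0 < r n" "r \<longlonglongrightarrow> 0"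
  shows "(\<lambda>n. conv f (mol (r n)) x) \<longlonglongrightarrow> f x"
proof (rule LIMSEQ_I)
  fix d :: real assume d: "0 < d"
  obtain k where k: "0 < k" "\<And>y. dist y x < k \<Longrightarrow> dist (f y) (f x) < d / 2"
    using f(1) d unfolding continuous_on_iff by (metis UNIV_I half_gt_zero)
  obtain N where N: "\<And>n. N \<le> n \<Longrightarrow> r n < k" using LIMSEQ_D[OF r(2) k(1)] by force
  have "\<bar>conv f (mol (r n)) x - f x\<bar> \<le> d / 2" if "N \<le> n" for n
    using k(2) N[OF that] by (intro conv_mol_close[OF r(1) f(2)])
      (auto simp: dist_norm norm_minus_commute intro!: less_imp_le)
  then show "\<exists>no. \<forall>n\<ge>no. norm (conv f (mol (r n)) x - f x) < d" using d by (intro exI[of _ N]) force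
qed

lemma test_approx_continuous:
  fixes f :: "real^'d \<Rightarrow> real"
  assumes U: "bounded U" "open U" and f: "continuous_on UNIV f" and K: "compact K" "K \<subseteq> U" "\<And>x. x \<notin> K \<Longrightarrow> f x = 0"
  shows "test_approx U f"
proof (cases "K = {}")
  case True
  then have "f = (\<lambda>x. 0)" using K by auto
  then show ?thesis by (auto simp: test_approx_def nL2_def intro!: bexI[of _ "\<lambda>x. 0"])
next
  case False
  obtain e where e: "0 < e" "{x. infdist x K \<le> e} \<subseteq> U" using compact_infdist_nbhd[OF K(1) U(2) K(2) False] by blast
  define r where "r n = e / real (Suc n)" for n
  have r: "0 < r n" "r n \<le> e" for n
    using e by (auto simp: r_def divide_le_eq algebra_simps)
  have rl: "r \<longlonglongrightarrow> 0"
    unfolding r_def using tendsto_mult[OF tendsto_const LIMSEQ_Suc[OF lim_1_over_n]] by (simp add: divide_inverse)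
  have fi: "integrable lebesgue f" by (rule integrable_continuous_compact_support[OF f K(1,3)])
  obtain B where B: "0 \<le> B" "\<And>x. \<bar>f x\<bar> \<le> B" using bounded_continuous_compact_support[OF f K(1,3)] by blast
  let ?s = "\<lambda>n. conv f (mol (r n))"
  have t: "?s n \<in> \<D> U" for n
  proof (rule test_functionsI[OF conv_smooth[OF fi mol_test[OF r(1)]] compact_infdist_le[OF K(1) False] e(2)])
    fix x assume "x \<notin> {x. infdist x K \<le> e}"
    moreover have "f y = 0" if "0 < infdist y K" for y
      using that infdist_zero[of y K] by (intro K(3)) auto
    ultimately show "?s n x = 0"
      using r(2)[of n] by (intro conv_mol_support_infdist[OF r(1), of 0 K]) auto
  qed
  have sb: "\<bar>?s n x\<bar> \<le> B" for n x
  proof -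
    have "conv f (mol (r n)) x \<le> B"
      using B(2) by (intro conv_mol_bound[OF r(1) fi]) (auto simp: abs_le_iff)
    moreover have "conv (\<lambda>y. - f y) (mol (r n)) x \<le> B"
      using B(2) by (intro conv_mol_bound[OF r(1) integrable_minus[OF fi]]) (auto simp: abs_le_iff)
    ultimately show ?thesis by (simp add: conv_minus)
  qed
  have lim: "(\<lambda>n. ?s n x) \<longlonglongrightarrow> f x" for x by (rule conv_mol_pointwise[OF f fi r(1) rl])
  have c: "L2_conv (\<L> U) ?s f"
  proof (rule L2_conv_dominated)
    show "?s n \<in> borel_measurable (\<L> U)" for n
      by (intro continuous_measurable_lebesgue_on[OF U(2)] test_continuous[OF t])
    show "f \<in> borel_measurable (\<L> U)"
      by (rule continuous_measurable_lebesgue_on[OF U(2) continuous_on_subset[OF f]]) simp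
    show "sqint (\<L> U) (\<lambda>x. B)" by (rule sqint_bounded[OF U]) auto
  qed (use sb lim in auto)
  have "test_approx U (?s n)" for n
    using t[of n] test_sqint[OF U] by (auto simp: test_approx_def nL2_def intro!: bexI[of _ "?s n"])
  then show ?thesis using test_approx_limit[OF U _ c] by blast
qed

lemma interior_cutoffs:
  fixes U :: "(real^'d) set"
  assumes U: "bounded U" "open U"
  obtains c :: "nat \<Rightarrow> real^'d \<Rightarrow> real" and K where "\<And>n. continuous_on UNIV (c n)" "\<And>n. compact (K n)" "\<And>n. K n \<subseteq> U"
    "\<And>n x. x \<notin> K n \<Longrightarrow> c n x = 0" "\<And>n x. 0 \<le> c n x" "\<And>n x. c n x \<le> 1" "\<And>x. x \<in> U \<Longrightarrow> (\<lambda>n. c n x) \<longlonglongrightarrow> 1"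
proof -
  have ne: "- U \<noteq> {}" using U(1) not_bounded_UNIV by (metis Compl_UNIV_eq double_complement)
  have cl: "closed (- U)" using U(2) by (rule closed_Compl)
  define K where "K n = closure U \<inter> {x. 1 / real (Suc n) \<le> infdist x (- U)}" for n
  define c where "c n x = min 1 (max 0 (real (Suc n) * infdist x (- U) - 1))" for n and x :: "real^'d"
  show thesis
  proof (rule that[of c K])
    show "continuous_on UNIV (c n)" for n unfolding c_def by (intro continuous_intros)
    show "compact (K n)" for n unfolding K_def
      by (intro compact_Int_closed closed_Collect_le continuous_intros) (use U in \<open>simp add: compact_closure\<close>)
    show "K n \<subseteq> U" for n
    proof
      fix x assume "x \<in> K n"
      then have "1 / real (Suc n) \<le> infdist x (- U)" by (simp add: K_def)
      moreover have "0 < 1 / real (Suc n)" by simp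
      ultimately have "infdist x (- U) \<noteq> 0" by linarith
      then show "x \<in> U" using infdist_zero[of x "- U"] by blast
    qed
    show "c n x = 0" if "x \<notin> K n" for n x
    proof (cases "x \<in> U")
      case True
      then have "infdist x (- U) < 1 / real (Suc n)" using that closure_subset[of U] by (auto simp: K_def)
      then have "real (Suc n) * infdist x (- U) < 1" by (simp add: pos_less_divide_eq mult.commute del: of_nat_Suc)
      then show ?thesis by (simp add: c_def del: of_nat_Suc)
    qed (simp add: c_def infdist_zero)
    show "0 \<le> c n x" "c n x \<le> 1" for n x by (simp_all add: c_def)
    show "(\<lambda>n. c n x) \<longlonglongrightarrow> 1" if "x \<in> U" for x
    proof (rule tendsto_eventually)
      have d: "0 < infdist x (- U)" using that in_closed_iff_infdist_zero[OF cl ne, of x] infdist_nonneg[of x "- U"] by fastforce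
      obtain N where N: "2 / infdist x (- U) < real N" using reals_Archimedean2 by blast
      show "\<forall>\<^sub>F n in sequentially. c n x = 1" unfolding eventually_sequentially
      proof (intro exI[of _ N] allI impI)
        fix n assume "N \<le> n"
        then have "2 / infdist x (- U) \<le> real (Suc n)" using N by linarith
        then have "2 \<le> real (Suc n) * infdist x (- U)" using d by (simp add: pos_divide_le_eq del: of_nat_Suc)
        then show "c n x = 1" by (simp add: c_def del: of_nat_Suc)
      qed
    qed
  qed
qed

lemma continuous_approximation:
  fixes f :: "real^'d \<Rightarrow> real"
  assumes "open U" "f \<in> borel_measurable (\<L> U)"
  obtains g :: "nat \<Rightarrow> real^'d \<Rightarrow> real" where "\<And>n. continuous_on UNIV (g n)" "AE x in \<L> U. (\<lambda>n. g n x) \<longlonglongrightarrow> f x"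
proof -
  have "f measurable_on U" using measurable_on_iff_borel_measurable[OF open_sets_lebesgue[OF assms(1)]] assms(2) by blast
  then obtain N g where N: "negligible N" "\<And>n. continuous_on UNIV (g n)"
    "\<And>x. x \<notin> N \<Longrightarrow> (\<lambda>n. g n x) \<longlonglongrightarrow> (if x \<in> U then f x else 0)"
    unfolding measurable_on_def by metis
  have "AE x in lebesgue. x \<notin> N" using N(1) by (simp add: AE_not_in negligible_iff_null_sets)
  then have "AE x in \<L> U. x \<notin> N"
    by (simp add: AE_restrict_space_iff open_sets_lebesgue[OF assms(1)] eventually_mono)
  then have "AE x in \<L> U. (\<lambda>n. g n x) \<longlonglongrightarrow> f x"
  proof (rule AE_mp, intro AE_I2 impI)
    fix x assume "x \<in> space (\<L> U)" "x \<notin> N"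
    then show "(\<lambda>n. g n x) \<longlonglongrightarrow> f x" using N(3)[of x] by (simp add: space_restrict_space)
  qed
  then show thesis using that N(2) by blast
qed

lemma test_dense:
  fixes f :: "real^'d \<Rightarrow> real"
  assumes U: "bounded U" "open U" and f: "sqint (\<L> U) f"
  obtains \<phi> where "\<And>n. \<phi> n \<in> \<D> U" "L2_conv (\<L> U) \<phi> f"
proof -
  let ?M = "\<L> U"
  have [measurable]: "f \<in> borel_measurable ?M" using f by (rule sqint_measurable)
  \<comment> \<open>Truncation at height \<open>k\<close> provides a constant majorant on the
    bounded domain, so that almost everywhere approximation by continuous functions becomes
    approximation in L2.\<close>
  define cl where "cl k t = max (- real k) (min (real k) t)" for k and t :: real
  have clb: "\<bar>cl k t\<bar> \<le> real k" for k t by (auto simp: cl_def)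
  have cls: "\<bar>cl k t\<bar> \<le> \<bar>t\<bar>" for k t by (auto simp: cl_def)
  have clc: "continuous_on UNIV (cl k)" for k unfolding cl_def by (intro continuous_intros)
  obtain g where g: "\<And>n. continuous_on UNIV (g n)" "AE x in ?M. (\<lambda>n. g n x) \<longlonglongrightarrow> f x"
    using continuous_approximation[OF U(2), of f] by auto
  obtain c :: "nat \<Rightarrow> real^'d \<Rightarrow> real" and K where c: "\<And>n. continuous_on UNIV (c n)" "\<And>n. compact (K n)" "\<And>n. K n \<subseteq> U"
    "\<And>n x. x \<notin> K n \<Longrightarrow> c n x = 0" "\<And>n x. 0 \<le> c n x" "\<And>n x. c n x \<le> 1" "\<And>x. x \<in> U \<Longrightarrow> (\<lambda>n. c n x) \<longlonglongrightarrow> 1"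
    using interior_cutoffs[OF U] by blast
  have A: "test_approx U (\<lambda>x. cl k (f x))" for k
  proof -
    let ?s = "\<lambda>n x. c n x * cl k (g n x)"
    have sc: "continuous_on UNIV (?s n)" for n
      by (intro continuous_intros c continuous_on_compose2[OF clc g(1)]) simp
    have "test_approx U (?s n)" for n
      by (rule test_approx_continuous[OF U sc c(2,3)[of n]]) (simp add: c(4)[of _ n])
    moreover have "L2_conv ?M ?s (\<lambda>x. cl k (f x))"
    proof (rule L2_conv_dominated)
      show "?s n \<in> borel_measurable ?M" for n
        by (rule continuous_measurable_lebesgue_on[OF U(2) continuous_on_subset[OF sc]]) simp
      show "(\<lambda>x. cl k (f x)) \<in> borel_measurable ?M" unfolding cl_def by measurable
      show "sqint ?M (\<lambda>x. real k)" by (rule sqint_bounded[OF U]) auto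
      have "c n x * \<bar>cl k (g n x)\<bar> \<le> 1 * real k" for n x
        by (intro mult_mono) (use c clb in auto)
      then have "\<bar>?s n x\<bar> \<le> real k" for n x using c(5)[of n x] by (simp add: abs_mult)
      then show "AE x in ?M. \<bar>?s n x\<bar> \<le> real k" for n by simp
      have "AE x in ?M. x \<in> U" by (rule AE_I2) (simp add: space_restrict_space)
      with g(2) show "AE x in ?M. (\<lambda>n. ?s n x) \<longlonglongrightarrow> cl k (f x)"
      proof eventually_elim
        case (elim x)
        have "(\<lambda>n. cl k (g n x)) \<longlonglongrightarrow> cl k (f x)"
          using elim(1) clc[of k] by (intro continuous_on_tendsto_compose[OF clc elim(1)]) auto
        from tendsto_mult[OF c(7)[OF elim(2)] this] show ?case by simp
      qed
    qed
    ultimately show ?thesis by (rule test_approx_limit[OF U])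
  qed
  have "L2_conv ?M (\<lambda>k x. cl k (f x)) f"
  proof (rule L2_conv_dominated)
    show "(\<lambda>x. cl k (f x)) \<in> borel_measurable ?M" for k unfolding cl_def by measurable
    show "sqint ?M (\<lambda>x. \<bar>f x\<bar>)" using f by (auto simp: sqint_def)
    show "AE x in ?M. (\<lambda>k. cl k (f x)) \<longlonglongrightarrow> f x"
    proof (rule AE_I2, rule tendsto_eventually)
      fix x
      obtain N where "\<bar>f x\<bar> < real N" using reals_Archimedean2 by blast
      then show "\<forall>\<^sub>F k in sequentially. cl k (f x) = f x"
        unfolding eventually_sequentially by (intro exI[of _ N]) (auto simp: cl_def)
    qed
  qed (use cls in auto)
  then have "test_approx U f" using test_approx_limit[OF U, of "\<lambda>k x. cl k (f x)" f] A by blast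
  then have "\<exists>\<phi>\<in>\<D> U. nL2 ?M (\<lambda>x. \<phi> x - f x) < 1 / real (Suc n)" for n
    unfolding test_approx_def by simp
  then obtain \<phi> where \<phi>: "\<And>n. \<phi> n \<in> \<D> U" "\<And>n. nL2 ?M (\<lambda>x. \<phi> n x - f x) < 1 / real (Suc n)" by metis
  have "(\<lambda>n. nL2 ?M (\<lambda>x. \<phi> n x - f x)) \<longlonglongrightarrow> 0"
    by (rule tendsto_sandwich[OF _ _ tendsto_const LIMSEQ_Suc[OF lim_1_over_n]])
      (use \<phi>(2) in \<open>auto intro!: always_eventually less_imp_le\<close>)
  then have "L2_conv ?M \<phi> f" using f test_sqint[OF U \<phi>(1)] by (simp add: L2_conv_def)
  then show thesis using that \<phi>(1) by blast
qed

lemma AE_eq_of_test: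
  assumes U: "bounded U" "open U" and f: "sqint (\<L> U) f" "sqint (\<L> U) g"
    and "\<And>\<phi>. \<phi> \<in> \<D> U \<Longrightarrow> L2_inner U f \<phi> = L2_inner U g \<phi>"
  shows "AE x in \<L> U. f x = g x"
proof -
  let ?h = "\<lambda>x. f x - g x"
  have h: "sqint (\<L> U) ?h" by (rule sqint_diff[OF f])
  obtain \<phi> where \<phi>: "\<And>n. \<phi> n \<in> \<D> U" "L2_conv (\<L> U) \<phi> ?h" using test_dense[OF U h] by blast
  have "L2_inner U ?h (\<phi> n) = 0" for n
    using L2_inner_diff[OF f test_sqint[OF U \<phi>(1)]] assms(5)[OF \<phi>(1)] by simp
  then have "L2_inner U ?h ?h = 0"
    using L2_inner_limit[OF L2_conv_const[OF h] \<phi>(2)] by (simp add: LIMSEQ_const_iff)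
  then have "nL2 (\<L> U) ?h \<le> 0" by (simp add: L2_inner_self)
  then show ?thesis using AE_eq_of_nL2[OF f] by blast
qed

section \<open>Weak derivatives\<close>

lemma has_weak_pderiv_sqint:
  assumes "has_weak_pderiv U i u g"
  shows "sqint (\<L> U) u" "sqint (\<L> U) g"
  using assms by (auto simp: has_weak_pderiv_def L2_iff)

lemma has_weak_pderiv_test:
  assumes "has_weak_pderiv U i u g" "\<phi> \<in> \<D> U"
  shows "L2_inner U u (pd i \<phi>) = - L2_inner U g \<phi>"
  using assms by (auto simp: has_weak_pderiv_def)

lemma has_weak_pderiv_unique:
  assumes U: "bounded U" "open U" and "has_weak_pderiv U i u g" "has_weak_pderiv U i v h"
    "AE x in \<L> U. u x = v x"
  shows "AE x in \<L> U. g x = h x"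
proof (rule AE_eq_of_test[OF U])
  show "L2_inner U g \<phi> = L2_inner U h \<phi>" if "\<phi> \<in> \<D> U" for \<phi>
    using has_weak_pderiv_test[OF assms(3) that] has_weak_pderiv_test[OF assms(4) that]
      L2_inner_cong_AE[OF sqint_measurable[OF has_weak_pderiv_sqint(1)[OF assms(3)]]
        sqint_measurable[OF has_weak_pderiv_sqint(1)[OF assms(4)]]
        sqint_measurable[OF test_sqint[OF U test_pderiv[OF that, of i]]] assms(5)] by simp
qed (rule has_weak_pderiv_sqint(2)[OF assms(3)], rule has_weak_pderiv_sqint(2)[OF assms(4)])

lemma has_weak_pderiv_cong:
  assumes U: "bounded U" "open U" and "has_weak_pderiv U i u g" "sqint (\<L> U) v"
    "AE x in \<L> U. u x = v x"
  shows "has_weak_pderiv U i v g"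
  unfolding has_weak_pderiv_def
proof (intro conjI ballI)
  show "L2_inner U v (pd i \<phi>) = - L2_inner U g \<phi>" if "\<phi> \<in> \<D> U" for \<phi>
    using has_weak_pderiv_test[OF assms(3) that]
      L2_inner_cong_AE[OF sqint_measurable[OF has_weak_pderiv_sqint(1)[OF assms(3)]]
        sqint_measurable[OF assms(4)]
        sqint_measurable[OF test_sqint[OF U test_pderiv[OF that, of i]]] assms(5)] by simp
qed (use has_weak_pderiv_sqint[OF assms(3)] assms(4) in \<open>auto simp: L2_iff\<close>)

lemma has_weak_pderiv_add:
  assumes U: "bounded U" "open U" and "has_weak_pderiv U i u g" "has_weak_pderiv U i v h"
  shows "has_weak_pderiv U i (\<lambda>x. u x + v x) (\<lambda>x. g x + h x)"
  unfolding has_weak_pderiv_def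
proof (intro conjI ballI)
  note s = has_weak_pderiv_sqint[OF assms(3)] has_weak_pderiv_sqint[OF assms(4)]
  show "L2_inner U (\<lambda>x. u x + v x) (pd i \<phi>) = - L2_inner U (\<lambda>x. g x + h x) \<phi>"
    if "\<phi> \<in> \<D> U" for \<phi>
    using has_weak_pderiv_test[OF assms(3) that] has_weak_pderiv_test[OF assms(4) that]
      L2_inner_add[OF s(1,3) test_sqint[OF U test_pderiv[OF that, of i]]]
      L2_inner_add[OF s(2,4) test_sqint[OF U that]] by simp
  show "(\<lambda>x. u x + v x) \<in> L2 U" "(\<lambda>x. g x + h x) \<in> L2 U" using s by (auto simp: L2_iff intro: sqint_add)
qed

lemma has_weak_pderiv_scale:
  assumes "has_weak_pderiv U i u g"
  shows "has_weak_pderiv U i (\<lambda>x. c * u x) (\<lambda>x. c * g x)"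
  using assms by (auto simp: has_weak_pderiv_def L2_iff sqint_scale L2_inner_scale)

lemma has_weak_pderiv_diff:
  assumes U: "bounded U" "open U" and "has_weak_pderiv U i u g" "has_weak_pderiv U i v h"
  shows "has_weak_pderiv U i (\<lambda>x. u x - v x) (\<lambda>x. g x - h x)"
  using has_weak_pderiv_add[OF assms(1-3) has_weak_pderiv_scale[OF assms(4), of "-1"]] by simp

lemma has_weak_pderiv_limit:
  assumes U: "bounded U" "open U" and "\<And>n. has_weak_pderiv U i (s n) (t n)"
    "L2_conv (\<L> U) s u" "L2_conv (\<L> U) t g"
  shows "has_weak_pderiv U i u g"
  unfolding has_weak_pderiv_def
proof (intro conjI ballI)
  fix \<phi> assume \<phi>: "\<phi> \<in> \<D> U"
  have "(\<lambda>n. L2_inner U (s n) (pd i \<phi>)) \<longlonglongrightarrow> L2_inner U u (pd i \<phi>)"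
    by (rule L2_inner_limit[OF assms(4) L2_conv_const[OF test_sqint[OF U test_pderiv[OF \<phi>]]]])
  moreover have "(\<lambda>n. - L2_inner U (t n) \<phi>) \<longlonglongrightarrow> - L2_inner U g \<phi>"
    by (rule tendsto_minus[OF L2_inner_limit[OF assms(5) L2_conv_const[OF test_sqint[OF U \<phi>]]]])
  ultimately show "L2_inner U u (pd i \<phi>) = - L2_inner U g \<phi>"
    using has_weak_pderiv_test[OF assms(3) \<phi>] LIMSEQ_unique by auto
qed (use L2_convD assms in \<open>auto simp: L2_iff\<close>)

lemma test_L2_inner: "open U \<Longrightarrow> \<phi> \<in> \<D> U \<Longrightarrow> L2_inner U h \<phi> = (LINT x|lebesgue. h x * \<phi> x)"
  unfolding L2_inner_def by (rule test_inner_lebesgue)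

lemma has_weak_pderiv_test_function:
  assumes U: "bounded U" "open U" and "\<psi> \<in> \<D> U"
  shows "has_weak_pderiv U i \<psi> (pd i \<psi>)"
  unfolding has_weak_pderiv_def
proof (intro conjI ballI)
  show "L2_inner U \<psi> (pd i \<phi>) = - L2_inner U (pd i \<psi>) \<phi>" if "\<phi> \<in> \<D> U" for \<phi>
    using integral_by_parts_test[OF that test_smooth[OF assms(3)]] test_L2_inner[OF U(2)] that test_pderiv by metis
qed (use test_sqint[OF U assms(3)] test_sqint[OF U test_pderiv[OF assms(3)]] in \<open>auto simp: L2_iff\<close>)

lemma weak_pderiv_works:
  "has_weak_pderiv U i u g \<Longrightarrow> has_weak_pderiv U i u (weak_pderiv U i u)"
  unfolding weak_pderiv_def by (rule someI[where P="has_weak_pderiv U i u"])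

lemma weak_pderiv_AE:
  assumes "bounded U" "open U" "has_weak_pderiv U i u g"
  shows "AE x in \<L> U. weak_pderiv U i u x = g x"
  using has_weak_pderiv_unique[OF assms(1,2) weak_pderiv_works[OF assms(3)] assms(3)] by simp

text \<open>\<open>conv_Fubini\<close> moves the mollification to the test function, where it
  converges pointwise with a uniform bound; integrability of \<open>f\<close> then suffices for
  dominated convergence.\<close>

lemma conv_weak_limit:
  assumes f: "integrable lebesgue f" and \<phi>: "\<phi> \<in> \<D> X"
    and r: "\<And>n. 0 < r n" "r \<longlonglongrightarrow> 0"
  shows "(\<lambda>n. LINT x|lebesgue. conv f (mol (r n)) x * \<phi> x) \<longlonglongrightarrow> (LINT x|lebesgue. f x * \<phi> x)"
  unfolding conv_Fubini[OF r(1) f \<phi>]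
proof -
  obtain L where L: "0 \<le> L" "\<And>x y. \<bar>\<phi> x - \<phi> y\<bar> \<le> L * norm (x - y)" using test_Lipschitz[OF \<phi>] by blast
  obtain B where B: "\<And>x. \<bar>\<phi> x\<bar> \<le> B" using test_bounded[OF \<phi>] by metis
  obtain R where R: "\<And>n. norm (r n) \<le> R" using BseqE[OF convergent_imp_Bseq[OF convergentI[OF r(2)]]] by metis
  note \<phi>c = test_continuous[OF \<phi>] and \<phi>i = test_integrable[OF \<phi>]
  have [measurable]: "f \<in> borel_measurable lebesgue" "\<phi> \<in> borel_measurable lebesgue" "conv \<phi> (mol (r n)) \<in> borel_measurable lebesgue" for n
    by (use f in auto, intro continuous_measurable_lebesgue \<phi>c, intro continuous_measurable_lebesgue smooth_continuous conv_smooth[OF \<phi>i mol_test[OF r(1)]])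
  show "(\<lambda>n. LINT x|lebesgue. f x * conv \<phi> (mol (r n)) x) \<longlonglongrightarrow> (LINT x|lebesgue. f x * \<phi> x)"
  proof (rule integral_dominated_convergence)
    show "integrable lebesgue (\<lambda>x. (B + L * R) * \<bar>f x\<bar>)" using f by auto
    show "AE x in lebesgue. (\<lambda>n. f x * conv \<phi> (mol (r n)) x) \<longlonglongrightarrow> f x * \<phi> x"
      by (intro AE_I2 tendsto_intros conv_mol_pointwise[OF \<phi>c \<phi>i r])
    show "AE x in lebesgue. norm (f x * conv \<phi> (mol (r n)) x) \<le> (B + L * R) * \<bar>f x\<bar>" for n
    proof (rule AE_I2)
      fix x
      have "\<bar>conv \<phi> (mol (r n)) x\<bar> \<le> B + L * R"
        using conv_mol_Lipschitz[OF r(1) \<phi>i L, of n x] B[of x] R[of n] r(1)[of n] mult_left_mono[OF _ L(1), of "r n" R]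
        by simp
      then show "norm (f x * conv \<phi> (mol (r n)) x) \<le> (B + L * R) * \<bar>f x\<bar>"
        by (simp add: abs_mult mult.commute[of "\<bar>f x\<bar>"] mult_right_mono)
    qed
  qed measurable
qed

text \<open>\<open>g\<close> is the weak gradient of \<open>z\<close>, carried along explicitly.
  This avoids the choice hidden in \<open>weak_pderiv\<close> and lets limits be taken of a function
  and its gradient along one sequence of test functions.\<close>

definition H10 :: "(real^'d) set \<Rightarrow> (real^'d \<Rightarrow> real) \<Rightarrow> ('d \<Rightarrow> real^'d \<Rightarrow> real) \<Rightarrow> bool" where
  "H10 U z g \<longleftrightarrow> (\<exists>\<phi>. (\<forall>n. \<phi> n \<in> \<D> U) \<and> L2_conv (\<L> U) \<phi> z \<and>
     (\<forall>i. L2_conv (\<L> U) (\<lambda>n. pd i (\<phi> n)) (g i)))"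

text \<open>The space \<open>V_space\<close> with gradient \<open>g\<close> and Hessian
  \<open>h\<close> displayed: \<open>h i j\<close> is the derivative of \<open>g i\<close> in
  direction \<open>j\<close>.\<close>

definition V0 :: "(real^'d) set \<Rightarrow> (real^'d \<Rightarrow> real) \<Rightarrow> ('d \<Rightarrow> real^'d \<Rightarrow> real) \<Rightarrow> ('d \<Rightarrow> 'd \<Rightarrow> real^'d \<Rightarrow> real) \<Rightarrow> bool" where
  "V0 U z g h \<longleftrightarrow> H10 U z g \<and> (\<forall>i j. has_weak_pderiv U j (g i) (h i j))"

lemma H10E:
  assumes "H10 U z g"
  obtains \<phi> where "\<And>n. \<phi> n \<in> \<D> U" "L2_conv (\<L> U) \<phi> z"
    "\<And>i. L2_conv (\<L> U) (\<lambda>n. pd i (\<phi> n)) (g i)"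
  using assms by (auto simp: H10_def)

lemma H10_sqint:
  assumes "H10 U z g" shows "sqint (\<L> U) z" "sqint (\<L> U) (g i)"
  using assms by (auto elim!: H10E dest: L2_convD(2))

lemma H10_weak:
  assumes "bounded U" "open U" "H10 U z g" shows "has_weak_pderiv U i z (g i)"
  using assms(3)
proof (rule H10E)
  fix \<phi> assume "\<And>n. \<phi> n \<in> \<D> U" "L2_conv (\<L> U) \<phi> z"
    "\<And>i. L2_conv (\<L> U) (\<lambda>n. pd i (\<phi> n)) (g i)"
  then show ?thesis
    using has_weak_pderiv_limit[OF assms(1,2), of i \<phi> "\<lambda>n. pd i (\<phi> n)"]
      has_weak_pderiv_test_function[OF assms(1,2)] by blast
qed

lemma H10_test: "bounded U \<Longrightarrow> open U \<Longrightarrow> \<phi> \<in> \<D> U \<Longrightarrow> H10 U \<phi> (\<lambda>i. pd i \<phi>)"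
  unfolding H10_def by (intro exI[of _ "\<lambda>n. \<phi>"]) (auto intro!: L2_conv_const test_sqint test_pderiv)

lemma H10_add:
  assumes "H10 U u g" "H10 U v h" shows "H10 U (\<lambda>x. u x + v x) (\<lambda>i x. g i x + h i x)"
proof -
  obtain \<phi> where \<phi>: "\<And>n. \<phi> n \<in> \<D> U" "L2_conv (\<L> U) \<phi> u"
    "\<And>i. L2_conv (\<L> U) (\<lambda>n. pd i (\<phi> n)) (g i)" using H10E[OF assms(1)] by metis
  obtain \<psi> where \<psi>: "\<And>n. \<psi> n \<in> \<D> U" "L2_conv (\<L> U) \<psi> v"
    "\<And>i. L2_conv (\<L> U) (\<lambda>n. pd i (\<psi> n)) (h i)" using H10E[OF assms(2)] by metis
  have "(\<lambda>n. pd i (\<lambda>x. \<phi> n x + \<psi> n x)) = (\<lambda>n x. pd i (\<phi> n) x + pd i (\<psi> n) x)" for i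
    using smooth_pderiv_add[OF test_smooth[OF \<phi>(1)] test_smooth[OF \<psi>(1)]] by auto
  then show ?thesis unfolding H10_def using \<phi> \<psi>
    by (intro exI[of _ "\<lambda>n x. \<phi> n x + \<psi> n x"]) (auto intro: test_add L2_conv_add)
qed

lemma H10_scale:
  assumes "H10 U u g" shows "H10 U (\<lambda>x. c * u x) (\<lambda>i x. c * g i x)"
proof -
  obtain \<phi> where \<phi>: "\<And>n. \<phi> n \<in> \<D> U" "L2_conv (\<L> U) \<phi> u"
    "\<And>i. L2_conv (\<L> U) (\<lambda>n. pd i (\<phi> n)) (g i)" using H10E[OF assms(1)] by metis
  have "(\<lambda>n. pd i (\<lambda>x. c * \<phi> n x)) = (\<lambda>n x. c * pd i (\<phi> n) x)" for i
    using smooth_pderiv_scale[OF test_smooth[OF \<phi>(1)]] by auto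
  then show ?thesis unfolding H10_def using \<phi>
    by (intro exI[of _ "\<lambda>n x. c * \<phi> n x"]) (auto intro: test_scale L2_conv_scale)
qed

lemma H10_diff:
  assumes "H10 U u g" "H10 U v h" shows "H10 U (\<lambda>x. u x - v x) (\<lambda>i x. g i x - h i x)"
  using H10_add[OF assms(1) H10_scale[OF assms(2), of "-1"]] by simp

lemma V0_add:
  assumes "bounded U" "open U" "V0 U u g h" "V0 U v g' h'"
  shows "V0 U (\<lambda>x. u x + v x) (\<lambda>i x. g i x + g' i x) (\<lambda>i j x. h i j x + h' i j x)"
  using assms unfolding V0_def by (auto intro: H10_add has_weak_pderiv_add)

lemma V0_scale:
  assumes "V0 U u g h"
  shows "V0 U (\<lambda>x. c * u x) (\<lambda>i x. c * g i x) (\<lambda>i j x. c * h i j x)"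
  using assms unfolding V0_def by (auto intro: H10_scale has_weak_pderiv_scale)

lemma V0_diff:
  assumes "bounded U" "open U" "V0 U u g h" "V0 U v g' h'"
  shows "V0 U (\<lambda>x. u x - v x) (\<lambda>i x. g i x - g' i x) (\<lambda>i j x. h i j x - h' i j x)"
  using V0_add[OF assms(1-3) V0_scale[OF assms(4), of "-1"]] by simp

lemma V0_sqint:
  assumes "V0 U z g h"
  shows "sqint (\<L> U) z" "sqint (\<L> U) (g i)" "sqint (\<L> U) (h i j)"
  using assms H10_sqint[of U z g] has_weak_pderiv_sqint(2) unfolding V0_def by blast+

lemma H1_norm_sq: "(H1_norm U u)\<^sup>2 = (nL2 (\<L> U) u)\<^sup>2 + (\<Oplus>i. (nL2 (\<L> U) (weak_pderiv U i u))\<^sup>2)"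
  unfolding H1_norm_def L2_norm_eq by (subst real_sqrt_pow2) (auto intro!: add_nonneg_nonneg sum_nonneg)

text \<open>Passage from the function spaces of the theorem to the relation \<open>V0\<close>;
  \<open>V0_V_space\<close> leads back. \<open>weak_pderiv\<close> of a difference is some
  representative, so the \<open>H1_norm\<close> in the definition of \<open>H1_0\<close> is compared
  with the carried derivatives up to null sets only.\<close>

lemma V_space_V0:
  assumes U: "bounded U" "open U" and z: "z \<in> V_space U"
  shows "V0 U z (\<lambda>i. weak_pderiv U i z) (\<lambda>i j. weak_pderiv U j (weak_pderiv U i z))"
proof -
  let ?M = "\<L> U"
  have w1: "has_weak_pderiv U i z (weak_pderiv U i z)" for i
    using z weak_pderiv_works by (force simp: V_space_def H2_def H1_def)
  have w2: "has_weak_pderiv U j (weak_pderiv U i z) (weak_pderiv U j (weak_pderiv U i z))" for i j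
    using z weak_pderiv_works unfolding V_space_def H2_def H1_def by blast
  obtain \<phi> where \<phi>: "\<And>n. \<phi> n \<in> \<D> U" "(\<lambda>n. H1_norm U (\<lambda>x. \<phi> n x - z x)) \<longlonglongrightarrow> 0"
    using z unfolding V_space_def H1_0_def by blast
  have le: "nL2 ?M (\<lambda>x. \<phi> n x - z x) \<le> H1_norm U (\<lambda>x. \<phi> n x - z x)"
    "nL2 ?M (\<lambda>x. pd i (\<phi> n) x - weak_pderiv U i z x) \<le> H1_norm U (\<lambda>x. \<phi> n x - z x)" for n i
  proof -
    have nn: "0 \<le> H1_norm U (\<lambda>x. \<phi> n x - z x)"
      unfolding H1_norm_def by (intro real_sqrt_ge_zero add_nonneg_nonneg sum_nonneg) auto
    show "nL2 ?M (\<lambda>x. \<phi> n x - z x) \<le> H1_norm U (\<lambda>x. \<phi> n x - z x)"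
      by (rule power2_le_imp_le[OF _ nn]) (simp add: H1_norm_sq sum_nonneg)
    have d: "has_weak_pderiv U i (\<lambda>x. \<phi> n x - z x) (\<lambda>x. pd i (\<phi> n) x - weak_pderiv U i z x)"
      by (rule has_weak_pderiv_diff[OF U has_weak_pderiv_test_function[OF U \<phi>(1)] w1])
    have "nL2 ?M (\<lambda>x. pd i (\<phi> n) x - weak_pderiv U i z x) = nL2 ?M (weak_pderiv U i (\<lambda>x. \<phi> n x - z x))"
      by (intro nL2_cong_AE sqint_measurable has_weak_pderiv_sqint(2)[OF d] has_weak_pderiv_sqint(2)[OF weak_pderiv_works[OF d]])
        (use weak_pderiv_AE[OF U d] in \<open>auto elim: eventually_mono\<close>)
    moreover have "nL2 ?M (weak_pderiv U i (\<lambda>x. \<phi> n x - z x)) \<le> H1_norm U (\<lambda>x. \<phi> n x - z x)"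
    proof (rule power2_le_imp_le[OF _ nn])
      have "(nL2 ?M (weak_pderiv U i (\<lambda>x. \<phi> n x - z x)))\<^sup>2 \<le> (\<Oplus>i. (nL2 ?M (weak_pderiv U i (\<lambda>x. \<phi> n x - z x)))\<^sup>2)"
        by (rule member_le_sum) auto
      then show "(nL2 ?M (weak_pderiv U i (\<lambda>x. \<phi> n x - z x)))\<^sup>2 \<le> (H1_norm U (\<lambda>x. \<phi> n x - z x))\<^sup>2"
        by (simp add: H1_norm_sq add_increasing)
    qed
    ultimately show "nL2 ?M (\<lambda>x. pd i (\<phi> n) x - weak_pderiv U i z x) \<le> H1_norm U (\<lambda>x. \<phi> n x - z x)" by simp
  qed
  have "H10 U z (\<lambda>i. weak_pderiv U i z)"
    unfolding H10_def L2_conv_def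
  proof (intro exI[of _ \<phi>] conjI allI)
    show "(\<lambda>n. nL2 ?M (\<lambda>x. \<phi> n x - z x)) \<longlonglongrightarrow> 0"
      by (rule tendsto_sandwich[OF _ _ tendsto_const \<phi>(2)]) (use le in auto)
    show "(\<lambda>n. nL2 ?M (\<lambda>x. pd i (\<phi> n) x - weak_pderiv U i z x)) \<longlonglongrightarrow> 0" for i
      by (rule tendsto_sandwich[OF _ _ tendsto_const \<phi>(2)]) (use le in auto)
  qed (use \<phi>(1) test_sqint[OF U] test_pderiv has_weak_pderiv_sqint w1 in blast)+
  then show ?thesis using w2 by (simp add: V0_def)
qed

lemma V0_V_space:
  assumes U: "bounded U" "open U" and z: "V0 U z g h"
  shows "z \<in> V_space U" "AE x in \<L> U. \<forall>i j. weak_hessian U z x $ i $ j = h i j x"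
proof -
  let ?M = "\<L> U"
  have H: "H10 U z g" and w2: "\<And>i j. has_weak_pderiv U j (g i) (h i j)" using z by (auto simp: V0_def)
  have w1: "has_weak_pderiv U i z (g i)" for i by (rule H10_weak[OF U H])
  have w3: "has_weak_pderiv U j (weak_pderiv U i z) (h i j)" for i j
  proof (rule has_weak_pderiv_cong[OF U w2])
    show "AE x in ?M. g i x = weak_pderiv U i z x"
      using weak_pderiv_AE[OF U w1, of i] by (auto elim: eventually_mono)
    show "sqint ?M (weak_pderiv U i z)" by (rule has_weak_pderiv_sqint(2)[OF weak_pderiv_works[OF w1]])
  qed
  have H1: "z \<in> H1 U" using w1 H10_sqint[OF H] by (auto simp: H1_def L2_iff)
  have H2: "z \<in> H2 U" using H1 w3 has_weak_pderiv_sqint(1)[OF w3] by (auto simp: H2_def H1_def L2_iff)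
  obtain \<phi> where \<phi>: "\<And>n. \<phi> n \<in> \<D> U" "L2_conv ?M \<phi> z"
    "\<And>i. L2_conv ?M (\<lambda>n. pd i (\<phi> n)) (g i)" using H10E[OF H] by metis
  have eq: "nL2 ?M (weak_pderiv U i (\<lambda>x. \<phi> n x - z x)) = nL2 ?M (\<lambda>x. pd i (\<phi> n) x - g i x)" for n i
  proof -
    have d: "has_weak_pderiv U i (\<lambda>x. \<phi> n x - z x) (\<lambda>x. pd i (\<phi> n) x - g i x)"
      by (rule has_weak_pderiv_diff[OF U has_weak_pderiv_test_function[OF U \<phi>(1)] w1])
    show ?thesis
      by (intro nL2_cong_AE sqint_measurable has_weak_pderiv_sqint(2)[OF d] has_weak_pderiv_sqint(2)[OF weak_pderiv_works[OF d]]
          weak_pderiv_AE[OF U d])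
  qed
  have "(\<lambda>n. sqrt ((nL2 ?M (\<lambda>x. \<phi> n x - z x))\<^sup>2 + (\<Oplus>i. (nL2 ?M (\<lambda>x. pd i (\<phi> n) x - g i x))\<^sup>2)))
      \<longlonglongrightarrow> sqrt (0\<^sup>2 + (\<Sum>i\<in>(UNIV::'a set). 0\<^sup>2))"
    by (intro tendsto_intros L2_convD(3)[OF \<phi>(2)] L2_convD(3)[OF \<phi>(3)])
  then have "(\<lambda>n. H1_norm U (\<lambda>x. \<phi> n x - z x)) \<longlonglongrightarrow> 0"
    by (simp add: H1_norm_def L2_norm_eq eq)
  then have "z \<in> H1_0 U" using \<phi>(1) H1 by (auto simp: H1_0_def)
  then show "z \<in> V_space U" using H2 by (simp add: V_space_def)
  have "AE x in ?M. weak_hessian U z x $ i $ j = h i j x" for i j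
    using weak_pderiv_AE[OF U w3, of j i] by (simp add: weak_hessian_def)
  then show "AE x in ?M. \<forall>i j. weak_hessian U z x $ i $ j = h i j x" by (simp add: AE_all_countable)
qed

lemma V0_symmetric:
  assumes U: "bounded U" "open U" and z: "V0 U z g h"
  shows "AE x in \<L> U. h i j x = h j i x"
proof (rule AE_eq_of_test[OF U V0_sqint(3)[OF z] V0_sqint(3)[OF z]])
  have H: "H10 U z g" and w2: "\<And>i j. has_weak_pderiv U j (g i) (h i j)" using z by (auto simp: V0_def)
  fix \<phi> assume \<phi>: "\<phi> \<in> \<D> U"
  have e: "L2_inner U (h i j) \<phi> = L2_inner U z (pd i (pd j \<phi>))" for i j
    using has_weak_pderiv_test[OF w2[of j i] \<phi>] has_weak_pderiv_test[OF H10_weak[OF U H, of i] test_pderiv[OF \<phi>, of j]] by simp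
  have "pd i (pd j \<phi>) = pd j (pd i \<phi>)"
    using pderiv_commute[OF test_smooth[OF \<phi>]] by blast
  then show "L2_inner U (h i j) \<phi> = L2_inner U (h j i) \<phi>" by (simp add: e)
qed

lemma Poincare_H10:
  fixes U :: "(real^'d) set"
  assumes U: "bounded U" "open U"
  obtains C where "0 < C" "\<And>z g i. H10 U z g \<Longrightarrow> nL2 (\<L> U) z \<le> C * nL2 (\<L> U) (g i)"
proof -
  obtain R where R: "\<And>x. x \<in> U \<Longrightarrow> norm x \<le> R" "0 < R" using U(1) unfolding bounded_pos by blast
  show thesis
  proof (rule that[of "2 * R"])
    fix z and g :: "'d \<Rightarrow> real^'d \<Rightarrow> real" and i assume H: "H10 U z g"
    obtain \<phi> where \<phi>: "\<And>n. \<phi> n \<in> \<D> U" "L2_conv (\<L> U) \<phi> z"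
      "\<And>i. L2_conv (\<L> U) (\<lambda>n. pd i (\<phi> n)) (g i)" using H10E[OF H] by metis
    show "nL2 (\<L> U) z \<le> 2 * R * nL2 (\<L> U) (g i)"
    proof (rule tendsto_le[OF sequentially_bot tendsto_mult[OF tendsto_const L2_conv_norm[OF \<phi>(3)]] L2_conv_norm[OF \<phi>(2)]])
      show "\<forall>\<^sub>F n in sequentially. nL2 (\<L> U) (\<phi> n) \<le> 2 * R * nL2 (\<L> U) (pd i (\<phi> n))"
        using Poincare_test[OF U less_imp_le[OF R(2)] R(1) \<phi>(1)] by simp
    qed
  qed (use R in simp)
qed

text \<open>Extends a weak equation from test functions to all elements of \<open>H10\<close>, so
  that solutions and nonlinear functions of solutions become admissible in it.\<close>

lemma H10_test_limit:
  assumes U: "bounded U" "open U" and H: "H10 U z g" and G: "\<And>i. sqint (\<L> U) (G i)" "sqint (\<L> U) f"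
    and eq: "\<And>\<phi>. \<phi> \<in> \<D> U \<Longrightarrow> (\<Oplus>i. L2_inner U (G i) (pd i \<phi>)) = L2_inner U f \<phi>"
  shows "(\<Oplus>i. L2_inner U (G i) (g i)) = L2_inner U f z"
proof -
  obtain \<phi> where \<phi>: "\<And>n. \<phi> n \<in> \<D> U" "L2_conv (\<L> U) \<phi> z"
    "\<And>i. L2_conv (\<L> U) (\<lambda>n. pd i (\<phi> n)) (g i)" using H10E[OF H] by metis
  have "(\<lambda>n. \<Oplus>i. L2_inner U (G i) (pd i (\<phi> n))) \<longlonglongrightarrow> (\<Oplus>i. L2_inner U (G i) (g i))"
    by (intro tendsto_sum L2_inner_limit[OF L2_conv_const[OF G(1)] \<phi>(3)])
  moreover have "(\<lambda>n. L2_inner U f (\<phi> n)) \<longlonglongrightarrow> L2_inner U f z"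
    by (rule L2_inner_limit[OF L2_conv_const[OF G(2)] \<phi>(2)])
  ultimately show ?thesis using eq[OF \<phi>(1)] LIMSEQ_unique by auto
qed

text \<open>The resolvent equation: minus the Laplacian of \<open>z\<close> plus
  \<open>\<mu> * z\<close> equals \<open>f\<close>, with zero boundary values.\<close>

definition weak_sol :: "(real^'d) set \<Rightarrow> real \<Rightarrow> (real^'d \<Rightarrow> real) \<Rightarrow> ('d \<Rightarrow> real^'d \<Rightarrow> real) \<Rightarrow> (real^'d \<Rightarrow> real) \<Rightarrow> bool" where
  "weak_sol U \<mu> z g f \<longleftrightarrow> H10 U z g \<and> sqint (\<L> U) f \<and>
     (\<forall>\<phi>\<in>\<D> U. (\<Oplus>i. L2_inner U (g i) (pd i \<phi>)) + \<mu> * L2_inner U z \<phi> = L2_inner U f \<phi>)"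

lemma weak_sol_diff:
  assumes U: "bounded U" "open U" and "weak_sol U \<mu> z g f" "weak_sol U \<mu> z' g' f'"
  shows "weak_sol U \<mu> (\<lambda>x. z x - z' x) (\<lambda>i x. g i x - g' i x) (\<lambda>x. f x - f' x)"
  unfolding weak_sol_def
proof (intro conjI ballI)
  note a = assms(3)[unfolded weak_sol_def] and b = assms(4)[unfolded weak_sol_def]
  show "H10 U (\<lambda>x. z x - z' x) (\<lambda>i x. g i x - g' i x)" using a b H10_diff by blast
  show "sqint (\<L> U) (\<lambda>x. f x - f' x)" using a b sqint_diff by blast
  fix \<phi> assume \<phi>: "\<phi> \<in> \<D> U"
  have sq: "sqint (\<L> U) \<phi>" "\<And>i. sqint (\<L> U) (pd i \<phi>)"
    using test_sqint[OF U] \<phi> test_pderiv by blast+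
  have s: "sqint (\<L> U) z" "sqint (\<L> U) z'" "\<And>i. sqint (\<L> U) (g i)" "\<And>i. sqint (\<L> U) (g' i)"
    "sqint (\<L> U) f" "sqint (\<L> U) f'" using a b H10_sqint by blast+
  show "(\<Oplus>i. L2_inner U (\<lambda>x. g i x - g' i x) (pd i \<phi>)) + \<mu> * L2_inner U (\<lambda>x. z x - z' x) \<phi> = L2_inner U (\<lambda>x. f x - f' x) \<phi>"
    using a b \<phi> by (simp add: L2_inner_diff sq s sum_subtractf algebra_simps)
qed

lemma weak_sol_energy:
  assumes U: "bounded U" "open U" and w: "weak_sol U \<mu> z g f"
  shows "(\<Oplus>i. (nL2 (\<L> U) (g i))\<^sup>2) = L2_inner U (\<lambda>x. f x - \<mu> * z x) z"
proof -
  have H: "H10 U z g" and f: "sqint (\<L> U) f" using w by (auto simp: weak_sol_def)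
  have "(\<Oplus>i. L2_inner U (g i) (g i)) = L2_inner U (\<lambda>x. f x - \<mu> * z x) z"
  proof (rule H10_test_limit[OF U H H10_sqint(2)[OF H] sqint_diff[OF f sqint_scale[OF H10_sqint(1)[OF H]]]])
    fix \<phi> assume \<phi>: "\<phi> \<in> \<D> U"
    have "L2_inner U (\<lambda>x. f x - \<mu> * z x) \<phi> = L2_inner U f \<phi> - \<mu> * L2_inner U z \<phi>"
      using L2_inner_diff[OF f sqint_scale[OF H10_sqint(1)[OF H]] test_sqint[OF U \<phi>]] L2_inner_scale by metis
    then show "(\<Oplus>i. L2_inner U (g i) (pd i \<phi>)) = L2_inner U (\<lambda>x. f x - \<mu> * z x) \<phi>"
      using w \<phi> by (force simp: weak_sol_def)
  qed
  then show ?thesis by (simp add: L2_inner_self)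
qed

text \<open>Riesz representation for the energy form on test functions. Poincare's inequality bounds
  the functional given by \<open>f\<close> and makes the sequence, which is Cauchy in its gradients,
  Cauchy in L2 as well.\<close>

lemma weak_sol_exists:
  fixes U :: "(real^'d) set"
  assumes U: "bounded U" "open U" and \<mu>: "0 \<le> \<mu>" and f: "sqint (\<L> U) f"
  obtains z g where "weak_sol U \<mu> z g f"
proof -
  let ?M = "\<L> U"
  let ?T = "\<D> U"
  obtain C where C: "0 < C" "\<And>z g i. H10 U z g \<Longrightarrow> nL2 ?M z \<le> C * nL2 ?M (g (i::'d))" using Poincare_H10[OF U] by metis
  define B where "B \<phi> \<psi> = (\<Oplus>i. L2_inner U (pd i \<phi>) (pd i \<psi>)) + \<mu> * L2_inner U \<phi> \<psi>" for \<phi> \<psi>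
  have sq: "sqint ?M \<phi>" "sqint ?M (pd i \<phi>)" if "\<phi> \<in> ?T" for \<phi> i
    using test_sqint[OF U] that test_pderiv by blast+
  have Bge: "(nL2 ?M (pd i \<phi>))\<^sup>2 \<le> B \<phi> \<phi>" if "\<phi> \<in> ?T" for \<phi> i
  proof -
    have "(nL2 ?M (pd i \<phi>))\<^sup>2 \<le> (\<Oplus>i. (nL2 ?M (pd i \<phi>))\<^sup>2)" by (rule member_le_sum) auto
    then show ?thesis using \<mu> by (simp add: B_def L2_inner_self add_increasing2)
  qed
  have P: "nL2 ?M \<phi> \<le> C * nL2 ?M (pd i \<phi>)" if "\<phi> \<in> ?T" for \<phi> i
    using C(2)[OF H10_test[OF U that]] .
  have root: "nL2 ?M (pd i \<phi>) \<le> sqrt (B \<phi> \<phi>)" if "\<phi> \<in> ?T" for \<phi> i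
    using Bge[OF that] by (simp add: real_le_rsqrt)
  obtain s where s: "\<And>n. s n \<in> ?T"
    "\<And>e. 0 < e \<Longrightarrow> \<exists>N. \<forall>m\<ge>N. \<forall>n\<ge>N. B (\<lambda>x. s m x - s n x) (\<lambda>x. s m x - s n x) < e"
    "\<And>v. v \<in> ?T \<Longrightarrow> (\<lambda>n. B (s n) v) \<longlonglongrightarrow> L2_inner U f v"
  proof (rule Riesz_sequence[of ?T B "\<lambda>v. L2_inner U f v" "nL2 ?M f * C"])
    show "B \<phi> \<psi> = B \<psi> \<phi>" for \<phi> \<psi> by (simp add: B_def L2_inner_commute)
    show "B (\<lambda>x. u x + v x) w = B u w + B v w" if "u \<in> ?T" "v \<in> ?T" "w \<in> ?T" for u v w
      unfolding B_def smooth_pderiv_add[OF test_smooth[OF that(1)] test_smooth[OF that(2)]]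
      by (simp add: L2_inner_add sq that sum.distrib algebra_simps)
    show "B (\<lambda>x. c * u x) w = c * B u w" if "u \<in> ?T" for c u w
      unfolding B_def smooth_pderiv_scale[OF test_smooth[OF that]]
      by (simp add: L2_inner_scale sum_distrib_left algebra_simps)
    show "0 \<le> B u u" if "u \<in> ?T" for u
      unfolding B_def L2_inner_self by (intro add_nonneg_nonneg sum_nonneg mult_nonneg_nonneg \<mu>) auto
    show "L2_inner U f (\<lambda>x. u x + v x) = L2_inner U f u + L2_inner U f v" if "u \<in> ?T" "v \<in> ?T" for u v
      using L2_inner_add[OF sq(1)[OF that(1)] sq(1)[OF that(2)] f] by (simp add: L2_inner_commute)
    show "L2_inner U f (\<lambda>x. c * u x) = c * L2_inner U f u" for c u
      using L2_inner_scale[of U c u f] by (simp add: L2_inner_commute)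
    show "\<bar>L2_inner U f u\<bar> \<le> nL2 ?M f * C * sqrt (B u u)" if "u \<in> ?T" for u
    proof -
      \<comment> \<open>\<open>undefined\<close> stands for an arbitrary coordinate direction;
        Poincare's inequality holds in each of them.\<close>
      have "nL2 ?M u \<le> C * sqrt (B u u)"
        by (rule order.trans[OF P[OF that, of undefined] mult_left_mono[OF root[OF that, of undefined] less_imp_le[OF C(1)]]])
      then have "nL2 ?M f * nL2 ?M u \<le> nL2 ?M f * (C * sqrt (B u u))" by (rule mult_left_mono) simp
      then show ?thesis using L2_inner_bound[OF f sq(1)[OF that]] by (simp add: mult.assoc)
    qed
  qed (auto intro: test_add test_scale)
  have dT: "(\<lambda>x. s m x - s n x) \<in> ?T" for m n by (intro test_diff s)
  have pd: "pd i (\<lambda>x. s m x - s n x) = (\<lambda>x. pd i (s m) x - pd i (s n) x)" for i m n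
    using smooth_pderiv_diff[OF test_smooth[OF s(1)] test_smooth[OF s(1)]] .
  have cau1: "\<exists>N. \<forall>m\<ge>N. \<forall>n\<ge>N. nL2 ?M (\<lambda>x. pd i (s m) x - pd i (s n) x) < e" if e: "0 < e" for e i
  proof -
    obtain N where N: "\<And>m n. N \<le> m \<Longrightarrow> N \<le> n \<Longrightarrow> B (\<lambda>x. s m x - s n x) (\<lambda>x. s m x - s n x) < e\<^sup>2"
      using s(2)[of "e\<^sup>2"] e by (meson zero_less_power)
    have "nL2 ?M (\<lambda>x. pd i (s m) x - pd i (s n) x) < e" if "N \<le> m" "N \<le> n" for m n
      using le_less_trans[OF Bge[OF dT, of i m n] N[OF that]] e unfolding pd by (rule power2_less_imp_less[OF _ less_imp_le])
    then show ?thesis by blast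
  qed
  have cau0: "\<exists>N. \<forall>m\<ge>N. \<forall>n\<ge>N. nL2 ?M (\<lambda>x. s m x - s n x) < e" if e: "0 < e" for e
  proof -
    obtain N where N: "\<And>m n. N \<le> m \<Longrightarrow> N \<le> n \<Longrightarrow> nL2 ?M (\<lambda>x. pd undefined (s m) x - pd undefined (s n) x) < e / C"
      using cau1[OF divide_pos_pos[OF e C(1)], of undefined] by blast
    have "nL2 ?M (\<lambda>x. s m x - s n x) < e" if "N \<le> m" "N \<le> n" for m n
      using P[OF dT, of m n undefined] N[OF that] C(1) unfolding pd by (simp add: pos_less_divide_eq mult.commute)
    then show ?thesis by blast
  qed
  obtain z where z: "L2_conv ?M s z"
    using L2_complete[OF lebesgue_on_finite[OF U] sq(1)[OF s(1)] cau0] by blast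
  have "\<exists>g. L2_conv ?M (\<lambda>n. pd i (s n)) g" for i
    using L2_complete[OF lebesgue_on_finite[OF U] sq(2)[OF s(1)] cau1] by metis
  then obtain g where g: "\<And>i. L2_conv ?M (\<lambda>n. pd i (s n)) (g i)" by metis
  have "weak_sol U \<mu> z g f" unfolding weak_sol_def
  proof (intro conjI ballI f)
    show "H10 U z g" unfolding H10_def using s(1) z g by blast
    fix \<phi> assume \<phi>: "\<phi> \<in> ?T"
    have "(\<lambda>n. B (s n) \<phi>) \<longlonglongrightarrow> (\<Oplus>i. L2_inner U (g i) (pd i \<phi>)) + \<mu> * L2_inner U z \<phi>"
      unfolding B_def by (intro tendsto_intros L2_inner_limit g z L2_conv_const sq \<phi>)
    then show "(\<Oplus>i. L2_inner U (g i) (pd i \<phi>)) + \<mu> * L2_inner U z \<phi> = L2_inner U f \<phi>"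
      using s(3)[OF \<phi>] LIMSEQ_unique by blast
  qed
  then show thesis by (rule that)
qed

section \<open>A barrier estimate on convex domains\<close>

text \<open>A smooth substitute for the positive part: t exp(-1/t), vanishing exactly for t <= 0,
  with derivative between 0 and 1. Its composition with a smooth function is smooth, so test
  functions can be truncated without a chain rule for Lipschitz functions.\<close>

definition ramp :: "real \<Rightarrow> real" where
  "ramp t = t * expinv 0 t"

lemma ramp_DERIV: "(ramp has_real_derivative expinv 0 t + expinv 1 t) (at t)"
proof -
  have "(ramp has_real_derivative 1 * expinv 0 t + expinv 2 t * t) (at t)"
    unfolding ramp_def[abs_def] using DERIV_mult[OF DERIV_ident expinv_DERIV[of 0 t]] by (simp add: numeral_2_eq_2)
  moreover have "expinv 2 t * t = expinv 1 t" by (simp add: expinv_def power2_eq_square)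
  ultimately show ?thesis by simp
qed

lemma ramp_bounds:
  shows ramp_deriv_bounds: "expinv 0 t \<le> expinv 0 t + expinv 1 t" "0 \<le> expinv 0 t + expinv 1 t" "expinv 0 t + expinv 1 t \<le> 1"
    and ramp_Lipschitz: "\<bar>ramp s - ramp t\<bar> \<le> \<bar>s - t\<bar>" and ramp_nonneg: "0 \<le> ramp t" and ramp_le: "\<bar>ramp t\<bar> \<le> \<bar>t\<bar>"
proof -
  show b1: "0 \<le> expinv 0 t + expinv 1 t" and "expinv 0 t \<le> expinv 0 t + expinv 1 t" for t by (auto simp: expinv_def)
  show b2: "expinv 0 t + expinv 1 t \<le> 1" for t
  proof (cases "0 < t")
    case True
    \<comment> \<open>The inequality 1 + s <= exp s at s = 1 / t.\<close>
    have "exp (- (1 / t)) * (1 + 1 / t) \<le> exp (- (1 / t)) * exp (1 / t)"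
      by (intro mult_left_mono) auto
    also have "\<dots> = 1" by (simp add: exp_minus)
    finally show ?thesis using True by (simp add: expinv_def distrib_left)
  qed (simp add: expinv_def)
  show L: "\<bar>ramp s - ramp t\<bar> \<le> \<bar>s - t\<bar>" for s t
    using field_differentiable_bound[of UNIV ramp "\<lambda>t. expinv 0 t + expinv 1 t" 1 s t] ramp_DERIV b1 b2
    by (simp add: abs_of_nonneg)
  show "0 \<le> ramp t" by (simp add: ramp_def expinv_def)
  show "\<bar>ramp t\<bar> \<le> \<bar>t\<bar>" using L[of t 0] by (simp add: ramp_def)
qed

lemma smooth_sqint:
  assumes U: "bounded U" "open U" and h: "smooth h" shows "sqint (\<L> U) h"
proof -
  obtain c where c: "c \<in> \<D> UNIV" "\<And>x. x \<in> closure U \<Longrightarrow> c x = 1"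
    using cutoff_exists[of "closure U" UNIV] U(1) by (metis compact_closure open_UNIV subset_UNIV)
  have "AE x in \<L> U. h x * c x = h x" using c(2) closure_subset[of U] by (intro AE_I2) (auto simp: space_restrict_space)
  then show ?thesis
    by (rule sqint_cong_AE[OF test_sqint[OF U test_smooth_mult[OF c(1) h]] continuous_measurable_lebesgue_on[OF U(2) smooth_continuous[OF h]]])
qed

lemma smooth_ramp: "smooth f \<Longrightarrow> smooth (\<lambda>x. ramp (f x))"
  unfolding ramp_def by (intro smooth_mult smooth_expinv)

text \<open>Because \<open>b\<close> is nonnegative on \<open>U\<close>, the function
  \<open>ramp (\<phi> - b)\<close> vanishes in \<open>U\<close> wherever the test function
  \<open>\<phi>\<close> does. Nothing is known about \<open>b\<close> outside \<open>U\<close>, so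
  it is multiplied by a cutoff equal to 1 where \<open>\<phi>\<close> is nonzero; this yields test
  functions approximating \<open>ramp (z - b)\<close>.\<close>

lemma H10_ramp:
  assumes U: "bounded U" "open U" and H: "H10 U z g" and b: "smooth b" "\<And>x. x \<in> U \<Longrightarrow> 0 \<le> b x"
  shows "H10 U (\<lambda>x. ramp (z x - b x)) (\<lambda>i x. (expinv 0 (z x - b x) + expinv 1 (z x - b x)) * (g i x - pd i b x))"
proof -
  let ?M = "\<L> U"
  let ?d = "\<lambda>t. expinv 0 t + expinv 1 t"
  note zs = H10_sqint(1)[OF H] and gs = H10_sqint(2)[OF H]
  have inU: "AE x in ?M. x \<in> U" by (rule AE_I2) (simp add: space_restrict_space)
  obtain \<phi>' where \<phi>': "\<And>n. \<phi>' n \<in> \<D> U" "L2_conv ?M \<phi>' z" "\<And>i. L2_conv ?M (\<lambda>n. pd i (\<phi>' n)) (g i)" using H10E[OF H] by metis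
  obtain r where r: "strict_mono r" "AE x in ?M. (\<lambda>n. \<phi>' (r n) x) \<longlonglongrightarrow> z x" using L2_conv_AE_subseq[OF \<phi>'(2)] by blast
  define \<phi> where "\<phi> n = \<phi>' (r n)" for n
  have \<phi>: "\<phi> n \<in> \<D> U" for n by (simp add: \<phi>_def \<phi>'(1))
  have cz: "(\<lambda>n. nL2 ?M (\<lambda>x. \<phi> n x - z x)) \<longlonglongrightarrow> 0" and cg: "(\<lambda>n. nL2 ?M (\<lambda>x. pd i (\<phi> n) x - g i x)) \<longlonglongrightarrow> 0" for i
    using LIMSEQ_subseq_LIMSEQ[OF L2_convD(3)[OF \<phi>'(2)] r(1)] LIMSEQ_subseq_LIMSEQ[OF L2_convD(3)[OF \<phi>'(3)] r(1)] by (simp_all add: \<phi>_def o_def)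
  have "\<exists>c\<in>\<D> U. \<forall>x. \<phi> n x \<noteq> 0 \<longrightarrow> c x = 1" for n
  proof -
    obtain K where K: "compact K" "K \<subseteq> U" "\<And>x. x \<notin> K \<Longrightarrow> \<phi> n x = 0" using \<phi> by (metis test_functionsE)
    show ?thesis using cutoff_exists[OF K(1) U(2) K(2)] K(3) by metis
  qed
  then obtain c where c: "\<And>n. c n \<in> \<D> U" "\<And>n x. \<phi> n x \<noteq> 0 \<Longrightarrow> c n x = 1" by metis
  define y where "y n x = \<phi> n x - b x" for n x
  have ys: "smooth (y n)" for n unfolding y_def by (intro smooth_diff b test_smooth[OF \<phi>])
  define \<eta> where "\<eta> n x = ramp (y n x) * c n x" for n x
  have \<eta>: "\<eta> n \<in> \<D> U" for n unfolding \<eta>_def by (rule test_smooth_mult[OF c(1) smooth_ramp[OF ys]])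
  have \<eta>y: "\<eta> n x = ramp (y n x)" if "x \<in> U" for n x
    using c(2)[of n x] b(2)[OF that] by (cases "\<phi> n x = 0") (auto simp: \<eta>_def y_def ramp_def expinv_nonpos)
  have d\<eta>: "pd i (\<eta> n) x = ?d (y n x) * (pd i (\<phi> n) x - pd i b x)" if "x \<in> U" for n i x
  proof -
    have "pd i (\<eta> n) x = pd i (\<lambda>x. ramp (y n x)) x" by (rule pderiv_at_cong_open[OF U(2) that \<eta>y])
    also have "\<dots> = ?d (y n x) * pd i (y n) x" by (rule pderiv_at_real_comp[OF smooth_differentiable[OF ys] ramp_DERIV])
    also have "pd i (y n) x = pd i (\<phi> n) x - pd i b x"
      unfolding y_def[abs_def] using smooth_pderiv_diff[OF test_smooth[OF \<phi>] b(1)] by metis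
    finally show ?thesis .
  qed
  note \<eta>s = test_sqint[OF U \<eta>] and d\<eta>s = test_sqint[OF U test_pderiv[OF \<eta>]]
  define q where "q x = ramp (z x - b x)" for x
  have cont: "continuous_on UNIV ramp" "continuous_on UNIV ?d"
    by (intro continuous_at_imp_continuous_on ballI DERIV_isCont[OF ramp_DERIV] continuous_intros DERIV_isCont[OF expinv_DERIV])+
  have zbm: "(\<lambda>x. z x - b x) \<in> borel_measurable ?M" by (intro sqint_measurable sqint_diff zs smooth_sqint[OF U b(1)])
  have qm: "q \<in> borel_measurable ?M" and dm: "(\<lambda>x. ?d (z x - b x)) \<in> borel_measurable ?M"
    unfolding q_def by (rule measurable_compose[OF zbm borel_measurable_continuous_onI], rule cont)+
  have qs: "sqint ?M q"
    unfolding sqint_def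
  proof
    show "integrable ?M (\<lambda>x. (q x)\<^sup>2)"
    proof (rule Bochner_Integration.integrable_bound[OF sqint_square[OF zs]])
      show "(\<lambda>x. (q x)\<^sup>2) \<in> borel_measurable ?M" using qm by measurable
      show "AE x in ?M. norm ((q x)\<^sup>2) \<le> norm ((z x)\<^sup>2)"
        using inU
      proof eventually_elim
        case (elim x)
        have "\<bar>q x\<bar> \<le> \<bar>z x\<bar>"
          using ramp_le[of "z x - b x"] b(2)[OF elim] by (cases "0 < z x - b x") (auto simp: q_def ramp_def expinv_nonpos)
        then show ?case by (simp add: abs_le_square_iff)
      qed
    qed
  qed (rule qm)
  have "L2_conv ?M \<eta> q"
    unfolding L2_conv_def
  proof (intro conjI allI \<eta>s qs)
    have "nL2 ?M (\<lambda>x. \<eta> n x - q x) \<le> nL2 ?M (\<lambda>x. \<phi> n x - z x)" for n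
    proof (rule nL2_mono)
      show "AE x in ?M. \<bar>\<eta> n x - q x\<bar> \<le> \<bar>\<phi> n x - z x\<bar>"
        using inU
      proof eventually_elim
        case (elim x)
        then show ?case using ramp_Lipschitz[of "\<phi> n x - b x" "z x - b x"] by (simp add: \<eta>y q_def y_def)
      qed
    qed (intro sqint_measurable sqint_diff \<eta>s qs zs test_sqint[OF U \<phi>])+
    then show "(\<lambda>n. nL2 ?M (\<lambda>x. \<eta> n x - q x)) \<longlonglongrightarrow> 0" by (intro tendsto_sandwich[OF _ _ tendsto_const cz]) simp_all
  qed
  moreover have "L2_conv ?M (\<lambda>n. pd i (\<eta> n)) (\<lambda>x. ?d (z x - b x) * (g i x - pd i b x))" for i
  proof -
    define v where "v x = g i x - pd i b x" for x
    have v: "sqint ?M v" unfolding v_def by (intro sqint_diff gs smooth_sqint[OF U smooth_pderiv[OF b(1)]])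
    have d01: "\<bar>?d t\<bar> \<le> 1" for t using ramp_deriv_bounds(2,3)[of t] by simp
    have ym: "(\<lambda>x. ?d (y n x)) \<in> borel_measurable ?M" for n
      by (rule measurable_compose[OF sqint_measurable[OF smooth_sqint[OF U ys]] borel_measurable_continuous_onI[OF cont(2)]])
    \<comment> \<open>The gradient converges in two parts. In this one the coefficient is bounded by
      1 and converges almost everywhere along the chosen subsequence; in the other
      \<open>pd i (\<phi> n) - g i\<close> tends to zero in norm.\<close>
    have c2: "L2_conv ?M (\<lambda>n x. ?d (y n x) * v x) (\<lambda>x. ?d (z x - b x) * v x)"
    proof (rule L2_conv_dominated)
      show "sqint ?M (\<lambda>x. \<bar>v x\<bar>)" using v by (auto simp: sqint_def)
      show "AE x in ?M. \<bar>?d (y n x) * v x\<bar> \<le> \<bar>v x\<bar>" for n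
        unfolding abs_mult by (intro AE_I2 mult_left_le_one_le) (use d01 in auto)
      show "AE x in ?M. (\<lambda>n. ?d (y n x) * v x) \<longlonglongrightarrow> ?d (z x - b x) * v x"
        using r(2)
      proof eventually_elim
        case (elim x)
        have "(\<lambda>n. y n x) \<longlonglongrightarrow> z x - b x" unfolding y_def \<phi>_def by (intro tendsto_diff elim tendsto_const)
        then show ?case
          by (intro tendsto_mult tendsto_const continuous_on_tendsto_compose[OF cont(2)]) auto
      qed
    qed (use ym dm sqint_measurable[OF v] in measurable)
    have 1: "sqint ?M (\<lambda>x. ?d (y n x) * (pd i (\<phi> n) x - g i x))" for n
      by (rule sqint_bound_mult[OF sqint_diff[OF test_sqint[OF U test_pderiv[OF \<phi>]] gs] ym, where C = 1]) (use d01 in simp)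
    have "L2_conv ?M (\<lambda>n x. ?d (y n x) * (pd i (\<phi> n) x - g i x)) (\<lambda>x. 0)"
      unfolding L2_conv_def
    proof (intro conjI allI 1 sqint_zero)
      have "nL2 ?M (\<lambda>x. ?d (y n x) * (pd i (\<phi> n) x - g i x) - 0) \<le> nL2 ?M (\<lambda>x. pd i (\<phi> n) x - g i x)" for n
        using d01 by (intro nL2_mono sqint_measurable sqint_diff test_sqint[OF U test_pderiv[OF \<phi>]] gs 1 sqint_zero AE_I2)
          (simp add: abs_mult mult_left_le_one_le)
      then show "(\<lambda>n. nL2 ?M (\<lambda>x. ?d (y n x) * (pd i (\<phi> n) x - g i x) - 0)) \<longlonglongrightarrow> 0"
        by (intro tendsto_sandwich[OF _ _ tendsto_const cg[of i]]) simp_all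
    qed
    from L2_conv_add[OF this c2]
    have s: "L2_conv ?M (\<lambda>n x. ?d (y n x) * (pd i (\<phi> n) x - pd i b x)) (\<lambda>x. ?d (z x - b x) * v x)"
      by (simp add: v_def flip: distrib_left)
    have "nL2 ?M (\<lambda>x. pd i (\<eta> n) x - ?d (z x - b x) * v x) = nL2 ?M (\<lambda>x. ?d (y n x) * (pd i (\<phi> n) x - pd i b x) - ?d (z x - b x) * v x)" for n
    proof (rule nL2_cong_AE)
      show "AE x in ?M. pd i (\<eta> n) x - ?d (z x - b x) * v x = ?d (y n x) * (pd i (\<phi> n) x - pd i b x) - ?d (z x - b x) * v x"
        using inU by eventually_elim (simp only: d\<eta>)
    qed (intro sqint_measurable sqint_diff d\<eta>s L2_convD[OF s])+
    then show ?thesis using s d\<eta>s by (simp add: L2_conv_def v_def)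
  qed
  ultimately show ?thesis unfolding H10_def q_def using \<eta> by (intro exI[of _ \<eta>]) blast
qed

lemma ramp_zero_iff: "ramp t = 0 \<longleftrightarrow> t \<le> 0"
  by (auto simp: ramp_def expinv_def)

text \<open>Testing the equation of \<open>z - b\<close> with \<open>ramp (z - b)\<close> shows that
  the integral of ramp' |grad (z - b)|^2 is at most 0. As 0 <= ramp' <= 1, the gradient ramp' grad
  (z - b) vanishes, and Poincare's inequality gives \<open>ramp (z - b) = 0\<close>.\<close>

lemma comparison_principle:
  assumes U: "bounded U" "open U" and w: "weak_sol U 0 z g f" and b: "smooth b" "\<And>x. x \<in> U \<Longrightarrow> 0 \<le> b x"
    and fb: "\<And>x. x \<in> U \<Longrightarrow> f x \<le> - (\<Oplus>i. pd i (pd i b) x)"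
  shows "AE x in \<L> U. z x \<le> b x"
proof -
  let ?M = "\<L> U"
  let ?d = "\<lambda>t. expinv 0 t + expinv 1 t"
  have H: "H10 U z g" and fs: "sqint ?M f" using w by (auto simp: weak_sol_def)
  note zs = H10_sqint(1)[OF H] and gs = H10_sqint(2)[OF H]
  have R: "H10 U (\<lambda>x. ramp (z x - b x)) (\<lambda>i x. ?d (z x - b x) * (g i x - pd i b x))" by (rule H10_ramp[OF U H b])
  define v where "v i x = g i x - pd i b x" for i x
  define l where "l x = (\<Oplus>i. - 1 * pd i (pd i b) x)" for x
  have bs: "sqint ?M (pd i b)" "sqint ?M (pd i (pd i b))" for i by (intro smooth_sqint[OF U] smooth_pderiv b(1))+
  have vs: "sqint ?M (v i)" for i unfolding v_def by (rule sqint_diff[OF gs bs(1)])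
  have ls: "sqint ?M l" unfolding l_def by (intro sqint_sum sqint_scale bs)
  have inU: "AE x in ?M. x \<in> U" by (rule AE_I2) (simp add: space_restrict_space)
  have "(\<Oplus>i. L2_inner U (v i) (pd i \<phi>)) = L2_inner U (\<lambda>x. f x - l x) \<phi>" if p: "\<phi> \<in> \<D> U" for \<phi>
  proof -
    note ps = test_sqint[OF U p] test_sqint[OF U test_pderiv[OF p]]
    have "L2_inner U (pd i b) (pd i \<phi>) = - 1 * L2_inner U (pd i (pd i b)) \<phi>" for i
      using integral_by_parts_test[OF p smooth_pderiv[OF b(1)]] test_L2_inner[OF U(2)] p test_pderiv[OF p] by simp
    then have "(\<Oplus>i. L2_inner U (v i) (pd i \<phi>)) = (\<Oplus>i. L2_inner U (g i) (pd i \<phi>)) - L2_inner U l \<phi>"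
      unfolding v_def l_def L2_inner_diff[OF gs bs(1) ps(2)] L2_inner_sum[OF sqint_scale[OF bs(2)] ps(1)] L2_inner_scale
      by (simp add: sum.distrib sum_negf)
    then show ?thesis using w p L2_inner_diff[OF fs ls ps(1)] by (simp add: weak_sol_def)
  qed
  from H10_test_limit[OF U R vs sqint_diff[OF fs ls] this]
  have "(\<Oplus>i. L2_inner U (v i) (\<lambda>x. ?d (z x - b x) * v i x)) = L2_inner U (\<lambda>x. f x - l x) (\<lambda>x. ramp (z x - b x))"
    by (simp add: v_def)
  also have "\<dots> = - (LINT x|?M. (l x - f x) * ramp (z x - b x))"
    unfolding L2_inner_def by (simp flip: integral_minus add: algebra_simps)
  also have "\<dots> \<le> 0"
    using inU by (simp, intro integral_nonneg_AE) (auto elim!: eventually_mono intro!: mult_nonneg_nonneg ramp_nonneg simp: l_def fb sum_negf)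
  finally have le: "(\<Oplus>i. L2_inner U (v i) (\<lambda>x. ?d (z x - b x) * v i x)) \<le> 0" .
  have dv: "sqint ?M (\<lambda>x. ?d (z x - b x) * v i x)" for i using H10_sqint(2)[OF R] by (simp add: v_def)
  have "(\<Oplus>i. (nL2 ?M (\<lambda>x. ?d (z x - b x) * v i x))\<^sup>2) \<le> (\<Oplus>i. L2_inner U (v i) (\<lambda>x. ?d (z x - b x) * v i x))"
    unfolding nL2_sq L2_inner_def
  proof (intro sum_mono integral_mono sqint_square[OF dv] sqint_mult[OF vs dv])
    fix i x
    have "?d (z x - b x) * (?d (z x - b x) * (v i x)\<^sup>2) \<le> 1 * (?d (z x - b x) * (v i x)\<^sup>2)"
      using ramp_deriv_bounds(2,3)[of "z x - b x"] by (intro mult_right_mono) auto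
    then show "(?d (z x - b x) * v i x)\<^sup>2 \<le> v i x * (?d (z x - b x) * v i x)" by (simp add: power2_eq_square mult_ac)
  qed
  moreover have "(nL2 ?M (\<lambda>x. ?d (z x - b x) * v undefined x))\<^sup>2 \<le> (\<Oplus>i. (nL2 ?M (\<lambda>x. ?d (z x - b x) * v i x))\<^sup>2)"
    by (rule member_le_sum) auto
  ultimately have "(nL2 ?M (\<lambda>x. ?d (z x - b x) * v undefined x))\<^sup>2 \<le> 0" using le by linarith
  then have 0: "nL2 ?M (\<lambda>x. ?d (z x - b x) * v undefined x) = 0" by simp
  obtain C where C: "\<And>z g i. H10 U z g \<Longrightarrow> nL2 ?M z \<le> C * nL2 ?M (g i)" using Poincare_H10[OF U] by metis
  have "nL2 ?M (\<lambda>x. ramp (z x - b x)) \<le> 0" using C[OF R, of undefined] 0 by (simp add: v_def)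
  then have "nL2 ?M (\<lambda>x. ramp (z x - b x)) = 0" using nL2_nonneg[of ?M "\<lambda>x. ramp (z x - b x)"] by linarith
  from nL2_eq_0_AE[OF H10_sqint(1)[OF R] this] show ?thesis by eventually_elim (simp add: ramp_zero_iff)
qed

lemma weak_sol_minus:
  assumes "weak_sol U \<mu> z g f"
  shows "weak_sol U \<mu> (\<lambda>x. - z x) (\<lambda>i x. - g i x) (\<lambda>x. - f x)"
proof -
  have L: "L2_inner U (\<lambda>x. - u x) v = - L2_inner U u v" for u v using L2_inner_scale[of U "-1" u v] by simp
  show ?thesis using assms H10_scale[of U z g "-1"] sqint_scale[of "\<L> U" f "-1"]
    by (auto simp: weak_sol_def L sum_negf)
qed

text \<open>Convexity provides a hyperplane through \<open>y\<close> with \<open>U\<close> on one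
  side. With \<open>l\<close> the distance to it, the barrier (M/2) (2 D l - l^2) has Laplacian -M
  because \<open>a\<close> is a unit vector, is nonnegative because 0 <= l <= D, and is at most M D
  l.\<close>

lemma halfspace_barrier:
  assumes U: "bounded U" "convex U" "open U" and w: "weak_sol U 0 z g f"
    and fM: "\<And>x. x \<in> U \<Longrightarrow> f x \<le> M" "0 \<le> M" and y: "y \<notin> U" and D: "\<And>x. x \<in> U \<Longrightarrow> norm (x - y) \<le> D" "0 < D"
  shows "AE x in \<L> U. z x \<le> M * D * norm (x - y)"
proof (cases "U = {}")
  case True
  then show ?thesis by (auto intro!: AE_I2 simp: space_restrict_space)
next
  case False
  obtain a' b' where ab: "a' \<noteq> 0" "\<And>x. x \<in> U \<Longrightarrow> inner a' x \<le> b'" "inner a' y \<ge> b'"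
    using separating_hyperplane_sets[OF U(2) convex_singleton[of y] False] y by auto
  define a where "a = (1 / norm a') *\<^sub>R a'"
  have an: "norm a = 1" using ab(1) by (simp add: a_def)
  define l where "l x = inner a y - inner a x" for x
  have l0: "0 \<le> l x" if "x \<in> U" for x
    using ab(2)[OF that] ab(3) ab(1) by (simp add: l_def a_def divide_right_mono)
  have ln: "l x \<le> norm (x - y)" for x
    using norm_cauchy_schwarz[of a "y - x"] an by (simp add: l_def inner_diff_right norm_minus_commute)
  define b where "b x = (M / 2) * (2 * D * l x - l x * l x)" for x
  have ls: "smooth l" unfolding l_def by (intro smooth_diff) auto
  have bs: "smooth b" unfolding b_def by (intro smooth_scale smooth_diff smooth_mult ls)
  have dl: "pd i l = (\<lambda>x. - a $ i)" for i
  proof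
    fix x
    have "(l has_derivative (\<lambda>h. 0 - inner a h)) (at x)" unfolding l_def by (auto intro!: derivative_eq_intros)
    from pderiv_at_eq[OF this, of i] show "pd i l x = - a $ i" by (simp add: inner_axis)
  qed
  have db: "pd i b = (\<lambda>x. (M * a $ i) * l x + (- (M * D * a $ i)))" for i
  proof -
    have "pd i b = (\<lambda>x. (M / 2) * (2 * D * - a $ i - (l x * - a $ i + - a $ i * l x)))"
      unfolding b_def smooth_pderiv_scale[OF smooth_diff[OF smooth_scale[OF ls] smooth_mult[OF ls ls]]]
        smooth_pderiv_diff[OF smooth_scale[OF ls] smooth_mult[OF ls ls]] smooth_pderiv_scale[OF ls]
        smooth_pderiv_mult[OF ls ls] dl ..
    then show ?thesis by (simp add: algebra_simps)
  qed
  have ddb: "pd i (pd i b) = (\<lambda>x. - (M * (a $ i * a $ i)))" for i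
    unfolding db smooth_pderiv_add[OF smooth_scale[OF ls] smooth_const] smooth_pderiv_scale[OF ls] dl by (simp add: mult.assoc)
  have "(\<Oplus>i. a $ i * a $ i) = 1" using an by (simp add: norm_eq_sqrt_inner inner_vec_def)
  then have lap: "(\<Oplus>i. pd i (pd i b) x) = - M" for x
    by (simp add: ddb sum_negf sum_distrib_left[symmetric])
  have b0: "0 \<le> b x" if "x \<in> U" for x
  proof -
    have "l x * l x \<le> D * l x" using l0[OF that] ln[of x] D(1)[OF that] by (intro mult_right_mono) auto
    moreover have "0 \<le> D * l x" using l0[OF that] D(2) by simp
    ultimately show ?thesis using fM(2) by (simp add: b_def)
  qed
  have "AE x in \<L> U. z x \<le> b x"
    by (rule comparison_principle[OF U(1,3) w bs b0]) (use fM lap in auto)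
  moreover have "AE x in \<L> U. x \<in> U" by (rule AE_I2) (simp add: space_restrict_space)
  ultimately show ?thesis
  proof eventually_elim
    case (elim x)
    have "b x \<le> (M / 2) * (2 * D * l x)" unfolding b_def using fM(2) by (intro mult_left_mono) auto
    also have "\<dots> = (M * D) * l x" by simp
    also have "\<dots> \<le> (M * D) * norm (x - y)" using fM(2) D(2) by (intro mult_left_mono ln) auto
    finally show ?case using elim by linarith
  qed
qed

text \<open>The half space bound fails on a null set that depends on \<open>y\<close>. Countably
  many \<open>y\<close>, dense in the frontier, leave a single null set, and continuity in
  \<open>y\<close> then admits the frontier point nearest to \<open>x\<close>.\<close>

lemma distance_barrier:
  assumes U: "bounded U" "convex U" "open U" and w: "weak_sol U 0 z g f"
    and fM: "\<And>x. x \<in> U \<Longrightarrow> \<bar>f x\<bar> \<le> M"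
  obtains C where "0 \<le> C" "AE x in \<L> U. \<bar>z x\<bar> \<le> C * infdist x (- U)"
proof -
  obtain R where R: "0 < R" "\<And>x. x \<in> closure U \<Longrightarrow> norm x \<le> R"
    using bounded_closure[OF U(1)] unfolding bounded_pos by blast
  define D where "D = 2 * R"
  have D: "0 < D" "norm (x - y) \<le> D" if "x \<in> U" "y \<in> frontier U" for x y
    using R(1) R(2)[of x] R(2)[of y] that closure_subset[of U] norm_triangle_ineq4[of x y]
    by (auto simp: D_def frontier_def)
  define M' where "M' = max M 0"
  have M': "0 \<le> M'" "\<And>x. x \<in> U \<Longrightarrow> f x \<le> M'" "\<And>x. x \<in> U \<Longrightarrow> - f x \<le> M'"
    using fM by (auto simp: M'_def abs_le_iff le_max_iff_disj)
  obtain T where T: "countable T" "T \<subseteq> frontier U" "frontier U \<subseteq> closure T" using separable[of "frontier U"] by metis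
  have "AE x in \<L> U. \<bar>z x\<bar> \<le> M' * D * norm (x - y)" if "y \<in> T" for y
  proof -
    have y: "y \<notin> U" "y \<in> frontier U" using that T(2) U(3) by (auto simp: frontier_def interior_open)
    have D0: "0 < D" using R by (simp add: D_def)
    have "AE x in \<L> U. z x \<le> M' * D * norm (x - y)"
      by (rule halfspace_barrier[OF U w M'(2,1) y(1) _ D0]) (use D y in auto)
    moreover have "AE x in \<L> U. - z x \<le> M' * D * norm (x - y)"
      by (rule halfspace_barrier[OF U weak_sol_minus[OF w] M'(3,1) y(1) _ D0]) (use D y in auto)
    ultimately show ?thesis by eventually_elim (simp add: abs_le_iff)
  qed
  then have "AE x in \<L> U. \<forall>y\<in>T. \<bar>z x\<bar> \<le> M' * D * norm (x - y)" by (simp add: AE_ball_countable[OF T(1)])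
  moreover have "AE x in \<L> U. x \<in> U" by (rule AE_I2) (simp add: space_restrict_space)
  ultimately have "AE x in \<L> U. \<bar>z x\<bar> \<le> M' * D * infdist x (- U)"
  proof eventually_elim
    case (elim x)
    have ne: "- U \<noteq> {}" using U(1) not_bounded_UNIV by (metis Compl_UNIV_eq double_complement)
    obtain y where y: "y \<in> - U" "infdist x (- U) = dist x y"
      using infdist_attains_inf[OF closed_Compl[OF U(3)] ne] by blast
    have d: "0 < dist x y" using elim(2) y(1) by auto
    have "ball x (dist x y) \<subseteq> U"
    proof
      fix v assume "v \<in> ball x (dist x y)"
      then show "v \<in> U" using infdist_le[of v "- U" x] y(2) by (cases "v \<in> U") auto
    qed
    then have "cball x (dist x y) \<subseteq> closure U" using closure_mono[of "ball x (dist x y)" U] closure_ball[OF d, of x] by simp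
    then have "y \<in> closure U" by auto
    then have "y \<in> frontier U" using y(1) U(3) by (simp add: frontier_def interior_open)
    then have yT: "y \<in> closure T" using T(3) by blast
    have "closed {v. \<bar>z x\<bar> \<le> M' * D * norm (x - v)}" by (intro closed_Collect_le continuous_intros)
    then have "closure T \<subseteq> {v. \<bar>z x\<bar> \<le> M' * D * norm (x - v)}" using elim(1) by (intro closure_minimal) auto
    then show ?case using yT y(2) by (auto simp: dist_norm)
  qed
  moreover have "0 \<le> M' * D" using M'(1) R by (simp add: D_def)
  ultimately show thesis using that by blast
qed

section \<open>The weighted Hessian estimate\<close>

text \<open>(t - \<delta>)^k t^\<beta> above \<delta> and zero below, for positive \<open>k\<close>.
  The inner \<open>max t \<delta>\<close> keeps the base of the real power positive everywhere; the
  two exponents are separate because the derivative is then a combination of two functions of the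
  same kind.\<close>

definition pw :: "real \<Rightarrow> nat \<Rightarrow> real \<Rightarrow> real \<Rightarrow> real" where
  "pw \<delta> k \<beta> t = (max (t - \<delta>) 0) ^ k * (max t \<delta>) powr \<beta>"

lemma pw_below: "t \<le> \<delta> \<Longrightarrow> 0 < k \<Longrightarrow> pw \<delta> k \<beta> t = 0"
  by (simp add: pw_def)

lemma pw_above: "\<delta> \<le> t \<Longrightarrow> pw \<delta> k \<beta> t = (t - \<delta>) ^ k * t powr \<beta>"
  by (simp add: pw_def max_absorb1)

lemma pw_continuous: "0 < \<delta> \<Longrightarrow> continuous_on UNIV (pw \<delta> k \<beta>)"
  unfolding pw_def by (intro continuous_intros) (auto simp: max_def)

lemma pw_DERIV:
  assumes \<delta>: "0 < \<delta>" and k: "2 \<le> k"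
  shows "(pw \<delta> k \<beta> has_real_derivative (real k * pw \<delta> (k - 1) \<beta> t + \<beta> * pw \<delta> k (\<beta> - 1) t)) (at t)"
proof -
  consider "t < \<delta>" | "t = \<delta>" | "\<delta> < t" by linarith
  then show ?thesis
  proof cases
    case 1
    have "((\<lambda>t. 0) has_real_derivative (real k * pw \<delta> (k - 1) \<beta> t + \<beta> * pw \<delta> k (\<beta> - 1) t)) (at t)"
      using 1 k by (simp add: pw_below)
    then show ?thesis
      by (rule has_field_derivative_transform_within_open[where S="{..<\<delta>}"]) (use 1 k in \<open>auto simp: pw_below\<close>)
  next
    case 2
    \<comment> \<open>Bounds \<open>s powr \<beta>\<close> for \<open>s\<close> between \<delta> and
      \<delta> + 1, whatever the sign of \<beta>.\<close>
    let ?C = "(\<delta> + 1) powr \<beta> + \<delta> powr \<beta>"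
    have b: "\<bar>pw \<delta> k \<beta> s\<bar> \<le> ?C * (s - \<delta>)\<^sup>2" if "s \<in> {..<\<delta> + 1}" for s
    proof (cases "s \<le> \<delta>")
      case True
      then show ?thesis using k by (simp add: pw_below)
    next
      case False
      have "(s - \<delta>) ^ k \<le> (s - \<delta>)\<^sup>2" using False that k by (intro power_decreasing) auto
      moreover have "s powr \<beta> \<le> ?C"
      proof (cases "0 \<le> \<beta>")
        case True
        have "s powr \<beta> \<le> (\<delta> + 1) powr \<beta>" using True False \<delta> that by (intro powr_mono2) auto
        then show ?thesis by (simp add: add_increasing2)
      next
        case neg: False
        have "s powr \<beta> \<le> \<delta> powr \<beta>" using neg False \<delta> by (intro powr_mono2') auto
        then show ?thesis by (simp add: add_increasing)
      qed
      ultimately have "(s - \<delta>) ^ k * s powr \<beta> \<le> (s - \<delta>)\<^sup>2 * ?C" by (intro mult_mono) auto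
      then show ?thesis using False by (simp add: pw_above mult.commute abs_mult)
    qed
    \<comment> \<open>The square bound is available only below \<delta> + 1, whereas
      \<open>DERIV_zero_of_square_bound\<close> asks for it everywhere; \<open>h\<close> agrees with
      the function near \<delta>.\<close>
    define h where "h s = (if s < \<delta> + 1 then pw \<delta> k \<beta> s else 0)" for s
    have C0: "0 \<le> ?C" by simp
    have "(h has_real_derivative 0) (at \<delta>)"
    proof (rule DERIV_zero_of_square_bound)
      show "\<bar>h t\<bar> \<le> ?C * (t - \<delta>)\<^sup>2" for t
        using b[of t] mult_nonneg_nonneg[OF C0, of "(t - \<delta>)\<^sup>2"] by (simp add: h_def)
    qed (use k in \<open>simp add: h_def pw_below\<close>)
    then have "(pw \<delta> k \<beta> has_real_derivative 0) (at \<delta>)"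
      by (rule has_field_derivative_transform_within_open[where S="{..<\<delta> + 1}"]) (auto simp: h_def)
    then show ?thesis using 2 k by (simp add: pw_below)
  next
    case 3
    have t: "0 < t" using 3 \<delta> by simp
    have "((\<lambda>t. (t - \<delta>) ^ k * t powr \<beta>) has_real_derivative
        real k * (t - \<delta>) ^ (k - 1) * t powr \<beta> + (\<beta> * t powr (\<beta> - 1)) * (t - \<delta>) ^ k) (at t)"
    proof (rule DERIV_mult)
      show "((\<lambda>t. (t - \<delta>) ^ k) has_real_derivative real k * (t - \<delta>) ^ (k - 1)) (at t)"
        by (auto intro!: derivative_eq_intros)
      show "((\<lambda>t. t powr \<beta>) has_real_derivative \<beta> * t powr (\<beta> - 1)) (at t)"
        by (rule has_real_derivative_powr[OF t])
    qed
    then have "((\<lambda>t. (t - \<delta>) ^ k * t powr \<beta>) has_real_derivative (real k * pw \<delta> (k - 1) \<beta> t + \<beta> * pw \<delta> k (\<beta> - 1) t)) (at t)"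
      using 3 by (simp add: pw_above mult_ac)
    then show ?thesis
      by (rule has_field_derivative_transform_within_open[where S="{\<delta><..}"]) (use 3 in \<open>auto simp: pw_above\<close>)
  qed
qed

text \<open>
  The weight is \<open>th0 (\<psi> x)\<close>, where \<open>\<psi>\<close> is comparable to the distance to the boundary. The exponent makes it
  behave like \<open>t powr (1 + \<alpha>)\<close> away from \<open>t = \<delta>\<close>, and smallness of the error as \<open>\<alpha> \<rightarrow> 0\<close> comes
  from \<open>t * th2 t \<approx> \<alpha> * th1 t\<close>.
\<close>

definition th0 :: "real \<Rightarrow> real \<Rightarrow> real \<Rightarrow> real" where
  "th0 \<delta> \<alpha> = pw \<delta> 5 (\<alpha> - 4)"
definition th1 :: "real \<Rightarrow> real \<Rightarrow> real \<Rightarrow> real" where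
  "th1 \<delta> \<alpha> t = 5 * pw \<delta> 4 (\<alpha> - 4) t + (\<alpha> - 4) * pw \<delta> 5 (\<alpha> - 5) t"
definition th2 :: "real \<Rightarrow> real \<Rightarrow> real \<Rightarrow> real" where
  "th2 \<delta> \<alpha> t = 5 * (4 * pw \<delta> 3 (\<alpha> - 4) t + (\<alpha> - 4) * pw \<delta> 4 (\<alpha> - 5) t)
     + (\<alpha> - 4) * (5 * pw \<delta> 4 (\<alpha> - 5) t + (\<alpha> - 5) * pw \<delta> 5 (\<alpha> - 6) t)"
definition th3 :: "real \<Rightarrow> real \<Rightarrow> real \<Rightarrow> real" where
  "th3 \<delta> \<alpha> t = 5 * (4 * (3 * pw \<delta> 2 (\<alpha> - 4) t + (\<alpha> - 4) * pw \<delta> 3 (\<alpha> - 5) t)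
       + (\<alpha> - 4) * (4 * pw \<delta> 3 (\<alpha> - 5) t + (\<alpha> - 5) * pw \<delta> 4 (\<alpha> - 6) t))
     + (\<alpha> - 4) * (5 * (4 * pw \<delta> 3 (\<alpha> - 5) t + (\<alpha> - 5) * pw \<delta> 4 (\<alpha> - 6) t)
       + (\<alpha> - 5) * (5 * pw \<delta> 4 (\<alpha> - 6) t + (\<alpha> - 6) * pw \<delta> 5 (\<alpha> - 7) t))"
text \<open>The quotient \<open>th2\<close>^2 t^2 / \<open>th1\<close> is at most
  \<open>800 * ze0\<close>. In the estimate \<open>ze0\<close> multiplies minus second derivatives
  of \<psi>, which are not bounded uniformly; integration by parts replaces them by
  \<open>ze1\<close> times squared first derivatives, and \<open>ze1 \<le> 2 * jd\<close>.\<close>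

definition ze0 :: "real \<Rightarrow> real \<Rightarrow> real \<Rightarrow> real" where
  "ze0 \<delta> \<alpha> t = \<alpha>\<^sup>2 * pw \<delta> 2 (\<alpha> - 2) t + \<delta> ^ 4 * pw \<delta> 2 (\<alpha> - 6) t"
definition ze1 :: "real \<Rightarrow> real \<Rightarrow> real \<Rightarrow> real" where
  "ze1 \<delta> \<alpha> t = \<alpha>\<^sup>2 * (2 * pw \<delta> 1 (\<alpha> - 2) t + (\<alpha> - 2) * pw \<delta> 2 (\<alpha> - 3) t)
     + \<delta> ^ 4 * (2 * pw \<delta> 1 (\<alpha> - 6) t + (\<alpha> - 6) * pw \<delta> 2 (\<alpha> - 7) t)"
text \<open>The error density: \<open>800 * jd\<close> bounds \<open>th2\<close>^2 t^2 /
  \<open>th0\<close>, the quotient produced by Young's inequality. The part with \<alpha>^2 becomes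
  small since the integral of the negative power grows only like 1 / \<alpha>; the part with
  (\<delta> / t)^4 is concentrated near t = \<delta>.\<close>

definition jd :: "real \<Rightarrow> real \<Rightarrow> real \<Rightarrow> real" where
  "jd \<delta> \<alpha> t = (if \<delta> < t then (\<alpha>\<^sup>2 + (\<delta> / t) ^ 4) * t powr (\<alpha> - 1) else 0)"

lemma th_DERIV:
  assumes "0 < \<delta>"
  shows "(th0 \<delta> \<alpha> has_real_derivative th1 \<delta> \<alpha> t) (at t)"
    "(th1 \<delta> \<alpha> has_real_derivative th2 \<delta> \<alpha> t) (at t)"
    "(th2 \<delta> \<alpha> has_real_derivative th3 \<delta> \<alpha> t) (at t)"
    "(ze0 \<delta> \<alpha> has_real_derivative ze1 \<delta> \<alpha> t) (at t)"
proof -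
  note P = pw_DERIV[OF assms]
  show "(th0 \<delta> \<alpha> has_real_derivative th1 \<delta> \<alpha> t) (at t)"
    unfolding th0_def th1_def using P[of 5 "\<alpha> - 4" t] by simp
  show "(th1 \<delta> \<alpha> has_real_derivative th2 \<delta> \<alpha> t) (at t)"
    unfolding th1_def th2_def
    using P[of 4 "\<alpha> - 4" t] P[of 5 "\<alpha> - 5" t] by (intro DERIV_add DERIV_cmult) simp_all
  show "(th2 \<delta> \<alpha> has_real_derivative th3 \<delta> \<alpha> t) (at t)"
    unfolding th2_def th3_def
    using P[of 3 "\<alpha> - 4" t] P[of 4 "\<alpha> - 5" t] P[of 5 "\<alpha> - 6" t] by (intro DERIV_add DERIV_cmult) simp_all
  show "(ze0 \<delta> \<alpha> has_real_derivative ze1 \<delta> \<alpha> t) (at t)"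
    unfolding ze0_def ze1_def
    using P[of 2 "\<alpha> - 2" t] P[of 2 "\<alpha> - 6" t] by (intro DERIV_add DERIV_cmult) simp_all
qed

lemma th_continuous:
  assumes "0 < \<delta>"
  shows "continuous_on UNIV (th0 \<delta> \<alpha>)" "continuous_on UNIV (th1 \<delta> \<alpha>)" "continuous_on UNIV (th2 \<delta> \<alpha>)"
    "continuous_on UNIV (th3 \<delta> \<alpha>)" "continuous_on UNIV (ze0 \<delta> \<alpha>)" "continuous_on UNIV (ze1 \<delta> \<alpha>)"
  unfolding th0_def th1_def th2_def th3_def ze0_def ze1_def
  by (intro continuous_intros pw_continuous assms)+

lemma th_below:
  assumes "t \<le> \<delta>"
  shows "th0 \<delta> \<alpha> t = 0" "th1 \<delta> \<alpha> t = 0" "th2 \<delta> \<alpha> t = 0" "th3 \<delta> \<alpha> t = 0" "ze0 \<delta> \<alpha> t = 0" "ze1 \<delta> \<alpha> t = 0" "jd \<delta> \<alpha> t = 0"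
  using assms by (auto simp: th0_def th1_def th2_def th3_def ze0_def ze1_def jd_def pw_below)

text \<open>With y = \<delta> / t and u = t - \<delta> = (1 - y) t, each function is a power of
  \<open>t\<close> times a polynomial in \<open>y\<close>. The polynomial \<open>q\<close> belonging
  to \<open>th2\<close> has no term free of \<alpha> below order y^2, whence \<open>q\<close> is at
  most 20 (\<alpha> + y^2); the constant 800 is 20^2 times the 2 of (a + b)^2 <= 2 (a^2 +
  b^2).\<close>

lemma th_bounds:
  assumes \<delta>: "0 < \<delta>" "\<delta> < t" and \<alpha>: "0 < \<alpha>" "\<alpha> < 1"
  shows "0 < th0 \<delta> \<alpha> t" "0 < th1 \<delta> \<alpha> t" "(th2 \<delta> \<alpha> t)\<^sup>2 * t\<^sup>2 \<le> 800 * jd \<delta> \<alpha> t * th0 \<delta> \<alpha> t"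
    "(th2 \<delta> \<alpha> t)\<^sup>2 * t\<^sup>2 \<le> 800 * ze0 \<delta> \<alpha> t * th1 \<delta> \<alpha> t" "ze1 \<delta> \<alpha> t \<le> 2 * jd \<delta> \<alpha> t" "0 \<le> ze0 \<delta> \<alpha> t" "0 \<le> jd \<delta> \<alpha> t"
proof -
  define u where "u = t - \<delta>"
  define y where "y = \<delta> / t"
  define p where "p = t powr (\<alpha> - 4)"
  have t: "0 < t" "0 < u" "u \<le> t" "t \<noteq> 0" using \<delta> by (auto simp: u_def)
  have y: "0 < y" "y < 1" "\<delta> = y * t" "u = (1 - y) * t" using \<delta> t by (auto simp: y_def u_def field_simps)
  have p: "0 < p" using t by (simp add: p_def)
  have pr: "t powr (\<alpha> - 5) = p / t" "t powr (\<alpha> - 6) = p / t\<^sup>2" "t powr (\<alpha> - 7) = p / t ^ 3"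
    "t powr (\<alpha> - 1) = p * t ^ 3" "t powr (\<alpha> - 2) = p * t\<^sup>2" "t powr (\<alpha> - 3) = p * t"
    using powr_diff[of t "\<alpha> - 4" 1] powr_diff[of t "\<alpha> - 4" 2] powr_diff[of t "\<alpha> - 4" 3]
      powr_add[of t "\<alpha> - 4" 1] powr_add[of t "\<alpha> - 4" 2] powr_add[of t "\<alpha> - 4" 3] t
    by (simp_all add: p_def powr_numeral)
  have T0: "th0 \<delta> \<alpha> t = u ^ 5 * p" using \<delta> by (simp add: th0_def pw_above u_def p_def)
  have T1: "th1 \<delta> \<alpha> t = u ^ 4 * p * (5 + (\<alpha> - 4) * (1 - y))"
  proof -
    have "th1 \<delta> \<alpha> t = 5 * (u ^ 4 * p) + (\<alpha> - 4) * (u ^ 5 * (p / t))"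
      using \<delta> by (simp add: th1_def pw_above u_def pr p_def[symmetric])
    also have "u ^ 5 * (p / t) = u ^ 4 * p * (1 - y)"
    proof -
      have "u ^ 5 = u ^ 4 * u" by (simp add: eval_nat_numeral)
      then have "u ^ 5 = u ^ 4 * ((1 - y) * t)" using y(4) by metis
      then show ?thesis using t by simp
    qed
    finally show ?thesis by (simp add: algebra_simps)
  qed
  define q where "q = 20 + 10 * (\<alpha> - 4) * (1 - y) + (\<alpha> - 4) * (\<alpha> - 5) * (1 - y)\<^sup>2"
  have T2: "th2 \<delta> \<alpha> t = u ^ 3 * p * q"
  proof -
    have "th2 \<delta> \<alpha> t = 20 * (u ^ 3 * p) + 10 * (\<alpha> - 4) * (u ^ 4 * (p / t)) + (\<alpha> - 4) * (\<alpha> - 5) * (u ^ 5 * (p / t\<^sup>2))"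
    proof -
      have "5 * (4 * a + k * b) + k * (5 * b + l * c) = 20 * a + 10 * k * b + k * l * c" for a b c k l :: real
        by (simp add: algebra_simps)
      then show ?thesis using \<delta> unfolding th2_def by (simp only: pw_above less_imp_le u_def pr p_def[symmetric])
    qed
    also have "u ^ 4 * (p / t) = u ^ 3 * p * (1 - y)"
    proof -
      have "u ^ 4 = u ^ 3 * u" by (simp add: eval_nat_numeral)
      then have "u ^ 4 = u ^ 3 * ((1 - y) * t)" using y(4) by metis
      then show ?thesis using t by simp
    qed
    also have "u ^ 5 * (p / t\<^sup>2) = u ^ 3 * p * (1 - y)\<^sup>2"
    proof -
      have "u ^ 5 = u ^ 3 * u\<^sup>2" by (simp add: power_add[symmetric])
      also have "\<dots> = u ^ 3 * ((1 - y)\<^sup>2 * t\<^sup>2)" using y(4) by (simp add: power_mult_distrib)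
      finally show ?thesis using t by simp
    qed
    finally show ?thesis by (simp add: q_def algebra_simps)
  qed
  have qe: "q = \<alpha>\<^sup>2 + \<alpha> + (2 * \<alpha> * (4 - \<alpha>)) * y + ((4 - \<alpha>) * (5 - \<alpha>)) * y\<^sup>2"
    by (simp add: q_def power2_eq_square algebra_simps)
  have q0: "0 \<le> q" unfolding qe using \<alpha> y by (intro add_nonneg_nonneg mult_nonneg_nonneg) auto
  have q1: "q \<le> 20 * (\<alpha> + y\<^sup>2)"
  proof -
    have "\<alpha>\<^sup>2 \<le> \<alpha>" using \<alpha> by (simp add: power2_eq_square mult_left_le_one_le)
    moreover have "(2 * \<alpha> * (4 - \<alpha>)) * y \<le> (2 * \<alpha> * 4) * 1" using \<alpha> y by (intro mult_mono) auto
    moreover have "((4 - \<alpha>) * (5 - \<alpha>)) * y\<^sup>2 \<le> (4 * 5) * y\<^sup>2" using \<alpha> by (intro mult_right_mono mult_mono) auto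
    ultimately have "q \<le> \<alpha> + \<alpha> + (2 * \<alpha> * 4) * 1 + (4 * 5) * y\<^sup>2"
      unfolding qe by (intro add_mono order.refl)
    then show ?thesis using \<alpha> by simp
  qed
  have qq: "q\<^sup>2 \<le> 800 * (\<alpha>\<^sup>2 + y ^ 4)"
  proof -
    have "q\<^sup>2 \<le> (20 * (\<alpha> + y\<^sup>2))\<^sup>2" using q0 q1 by (rule power_mono[rotated])
    also have "\<dots> = 400 * (\<alpha> + y\<^sup>2)\<^sup>2" unfolding power_mult_distrib by simp
    also have "(\<alpha> + y\<^sup>2)\<^sup>2 \<le> 2 * (\<alpha>\<^sup>2 + y ^ 4)"
    proof -
      have "0 \<le> (\<alpha> - y\<^sup>2)\<^sup>2" by simp
      then show ?thesis by (simp add: power2_sum power2_diff)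
    qed
    finally show ?thesis by simp
  qed
  have J: "jd \<delta> \<alpha> t = (\<alpha>\<^sup>2 + y ^ 4) * (p * t ^ 3)" using \<delta> by (simp add: jd_def pr y_def)
  have Z: "ze0 \<delta> \<alpha> t = u\<^sup>2 * (p * t\<^sup>2) * (\<alpha>\<^sup>2 + y ^ 4)"
  proof -
    have "ze0 \<delta> \<alpha> t = \<alpha>\<^sup>2 * (u\<^sup>2 * (p * t\<^sup>2)) + \<delta> ^ 4 * (u\<^sup>2 * (p / t\<^sup>2))"
      using \<delta> unfolding ze0_def by (simp only: pw_above less_imp_le u_def pr)
    also have "\<delta> ^ 4 * (u\<^sup>2 * (p / t\<^sup>2)) = y ^ 4 * (u\<^sup>2 * (p * t\<^sup>2))"
      unfolding y(3) using t by (simp add: eval_nat_numeral)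
    finally show ?thesis by (simp add: algebra_simps)
  qed
  have a1: "1 \<le> 5 + (\<alpha> - 4) * (1 - y)"
  proof -
    have "(4 - \<alpha>) * (1 - y) \<le> 4 * 1" using \<alpha> y by (intro mult_mono) auto
    then show ?thesis by (simp add: algebra_simps)
  qed
  show "0 < th0 \<delta> \<alpha> t" using t p by (simp add: T0)
  show "0 < th1 \<delta> \<alpha> t" unfolding T1 using t p a1 by (intro mult_pos_pos) auto
  show z0: "0 \<le> ze0 \<delta> \<alpha> t" unfolding Z using t p y by (intro mult_nonneg_nonneg add_nonneg_nonneg) auto
  show j0: "0 \<le> jd \<delta> \<alpha> t" unfolding J using t p y by (intro mult_nonneg_nonneg add_nonneg_nonneg) auto
  have e: "(th2 \<delta> \<alpha> t)\<^sup>2 * t\<^sup>2 \<le> 800 * (\<alpha>\<^sup>2 + y ^ 4) * (u ^ 6 * p\<^sup>2 * t\<^sup>2)"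
  proof -
    have "(th2 \<delta> \<alpha> t)\<^sup>2 * t\<^sup>2 = q\<^sup>2 * (u ^ 6 * p\<^sup>2 * t\<^sup>2)" by (simp add: T2 eval_nat_numeral mult_ac)
    also have "\<dots> \<le> 800 * (\<alpha>\<^sup>2 + y ^ 4) * (u ^ 6 * p\<^sup>2 * t\<^sup>2)" by (rule mult_right_mono[OF qq]) simp
    finally show ?thesis .
  qed
  have s0: "0 \<le> 800 * (\<alpha>\<^sup>2 + y ^ 4)" by simp
  show "(th2 \<delta> \<alpha> t)\<^sup>2 * t\<^sup>2 \<le> 800 * jd \<delta> \<alpha> t * th0 \<delta> \<alpha> t"
  proof -
    have "u ^ 6 * p\<^sup>2 * t\<^sup>2 = (u ^ 5 * p\<^sup>2 * t\<^sup>2) * u" by (simp add: eval_nat_numeral mult_ac)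
    also have "\<dots> \<le> (u ^ 5 * p\<^sup>2 * t\<^sup>2) * t" using t by (intro mult_left_mono) auto
    also have "\<dots> = (p * t ^ 3) * (u ^ 5 * p)" by (simp add: eval_nat_numeral mult_ac)
    finally have "800 * (\<alpha>\<^sup>2 + y ^ 4) * (u ^ 6 * p\<^sup>2 * t\<^sup>2) \<le> 800 * (\<alpha>\<^sup>2 + y ^ 4) * ((p * t ^ 3) * (u ^ 5 * p))"
      by (rule mult_left_mono[OF _ s0])
    from order.trans[OF e this] show ?thesis unfolding J T0 by (simp only: mult.assoc)
  qed
  show "(th2 \<delta> \<alpha> t)\<^sup>2 * t\<^sup>2 \<le> 800 * ze0 \<delta> \<alpha> t * th1 \<delta> \<alpha> t"
  proof -
    have "u ^ 4 * p * 1 \<le> th1 \<delta> \<alpha> t" unfolding T1 using t p a1 by (intro mult_left_mono) auto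
    then have "(u\<^sup>2 * (p * t\<^sup>2)) * (u ^ 4 * p * 1) \<le> (u\<^sup>2 * (p * t\<^sup>2)) * th1 \<delta> \<alpha> t" using t p by (intro mult_left_mono) auto
    moreover have "(u\<^sup>2 * (p * t\<^sup>2)) * (u ^ 4 * p * 1) = u ^ 6 * p\<^sup>2 * t\<^sup>2"
    proof -
      have "u ^ 6 = u\<^sup>2 * u ^ 4" by (simp add: power_add[symmetric])
      then show ?thesis by (simp add: power2_eq_square mult_ac)
    qed
    ultimately have "u ^ 6 * p\<^sup>2 * t\<^sup>2 \<le> (u\<^sup>2 * (p * t\<^sup>2)) * th1 \<delta> \<alpha> t" by (simp only:)
    then have "800 * (\<alpha>\<^sup>2 + y ^ 4) * (u ^ 6 * p\<^sup>2 * t\<^sup>2) \<le> 800 * (\<alpha>\<^sup>2 + y ^ 4) * ((u\<^sup>2 * (p * t\<^sup>2)) * th1 \<delta> \<alpha> t)"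
      by (rule mult_left_mono[OF _ s0])
    from order.trans[OF e this] show ?thesis unfolding Z by (simp only: mult_ac)
  qed
  show "ze1 \<delta> \<alpha> t \<le> 2 * jd \<delta> \<alpha> t"
  proof -
    have "ze1 \<delta> \<alpha> t = \<alpha>\<^sup>2 * (2 * (u * (p * t\<^sup>2)) + (\<alpha> - 2) * (u\<^sup>2 * (p * t))) + \<delta> ^ 4 * (2 * (u * (p / t\<^sup>2)) + (\<alpha> - 6) * (u\<^sup>2 * (p / t ^ 3)))"
      using \<delta> unfolding ze1_def by (simp only: pw_above less_imp_le u_def pr power_one_right)
    also have "\<dots> \<le> \<alpha>\<^sup>2 * (2 * (t * (p * t\<^sup>2))) + \<delta> ^ 4 * (2 * (t * (p / t\<^sup>2)))"
    proof (intro add_mono mult_left_mono)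
      have "(\<alpha> - 2) * (u\<^sup>2 * (p * t)) \<le> 0" using \<alpha> t p by (intro mult_nonpos_nonneg) auto
      moreover have "u * (p * t\<^sup>2) \<le> t * (p * t\<^sup>2)" using t p by (intro mult_right_mono) auto
      ultimately show "2 * (u * (p * t\<^sup>2)) + (\<alpha> - 2) * (u\<^sup>2 * (p * t)) \<le> 2 * (t * (p * t\<^sup>2))" by linarith
      have "(\<alpha> - 6) * (u\<^sup>2 * (p / t ^ 3)) \<le> 0" using \<alpha> t p by (intro mult_nonpos_nonneg) auto
      moreover have "u * (p / t\<^sup>2) \<le> t * (p / t\<^sup>2)" using t p by (intro mult_right_mono) auto
      ultimately show "2 * (u * (p / t\<^sup>2)) + (\<alpha> - 6) * (u\<^sup>2 * (p / t ^ 3)) \<le> 2 * (t * (p / t\<^sup>2))" by linarith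
    qed (use \<delta> in auto)
    also have "\<delta> ^ 4 * (2 * (t * (p / t\<^sup>2))) = 2 * y ^ 4 * (p * t ^ 3)"
      unfolding y(3) using t by (simp add: eval_nat_numeral)
    finally show ?thesis unfolding J by (simp add: algebra_simps eval_nat_numeral)
  qed
qed

section \<open>The estimate for a pair of coordinate directions\<close>

lemma dirderiv_add: "dirderiv i f f' \<Longrightarrow> dirderiv i g g' \<Longrightarrow> dirderiv i (\<lambda>x. f x + g x) (\<lambda>x. f' x + g' x)"
  unfolding dirderiv_def by (auto intro: DERIV_add)

lemma dirderiv_diff: "dirderiv i f f' \<Longrightarrow> dirderiv i g g' \<Longrightarrow> dirderiv i (\<lambda>x. f x - g x) (\<lambda>x. f' x - g' x)"
  unfolding dirderiv_def by (auto intro: DERIV_diff)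

lemma dirderiv_mult:
  assumes "dirderiv i f f'" "dirderiv i g g'" shows "dirderiv i (\<lambda>x. f x * g x) (\<lambda>x. f' x * g x + g' x * f x)"
  unfolding dirderiv_def
proof
  fix x
  show "((\<lambda>t. f (x + t *\<^sub>R axis i 1) * g (x + t *\<^sub>R axis i 1)) has_real_derivative f' x * g x + g' x * f x) (at 0)"
    using DERIV_mult[OF assms[unfolded dirderiv_def, rule_format, of x]] by simp
qed

lemma dirderiv_const: "dirderiv i (\<lambda>x. c) (\<lambda>x. 0)"
  by (simp add: dirderiv_def)

lemma dirderiv_comp:
  assumes "\<And>t. (h has_real_derivative h' t) (at t)" "dirderiv i f f'"
  shows "dirderiv i (\<lambda>x. h (f x)) (\<lambda>x. h' (f x) * f' x)"
  unfolding dirderiv_def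
proof
  fix x
  show "((\<lambda>t. h (f (x + t *\<^sub>R axis i 1))) has_real_derivative h' (f x) * f' x) (at 0)"
    using DERIV_chain2[OF assms(1) assms(2)[unfolded dirderiv_def, rule_format, of x]] by simp
qed

lemma dirderiv_cong: "dirderiv i f f' \<Longrightarrow> (\<And>x. f' x = f'' x) \<Longrightarrow> dirderiv i f f''"
  by (metis ext)

text \<open>Young's inequality splits the terms with \<open>w\<close> times second derivatives of
  \<open>w\<close> into a small multiple of the weighted squared Hessian and a multiple of
  \<open>J\<close>, using the barrier for \<open>w\<close>. The terms with second derivatives of
  \<psi> form a quadratic expression in the gradients of \<open>w\<close> and \<psi>, in which
  concavity allows one to complete the square.\<close>

lemma pair_pointwise:
  fixes w wi wj wii wjj wij pi pj pii pij pjj :: real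
  assumes e: "0 < e0" "0 < e1" and k: "0 < \<kappa>" and w: "\<bar>w\<bar> \<le> C0 * t" and n: "\<bar>pi\<bar> \<le> n" "\<bar>pj\<bar> \<le> n"
    and c: "\<And>a b. a\<^sup>2 * pii + 2 * a * b * pij + b\<^sup>2 * pjj \<le> 0"
    and J: "e2\<^sup>2 * t\<^sup>2 \<le> 800 * J * e0" and Z: "e2\<^sup>2 * t\<^sup>2 \<le> 800 * Z * e1" "0 \<le> Z"
  shows "- (1/2 * (e2 * w * (pi\<^sup>2 * wjj + pj\<^sup>2 * wii - 2 * pi * pj * wij))
      - 1/2 * (e2 * w * (pjj * pi * wi - pij * (pi * wj + pj * wi) + pii * pj * wj))
      - 1/2 * (e1 * (pjj * wi\<^sup>2 - 2 * pij * wi * wj + pii * wj\<^sup>2)))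
    \<le> \<kappa> * (e0 * (wii\<^sup>2 + wjj\<^sup>2 + 2 * wij\<^sup>2)) + 200 * n ^ 4 * C0\<^sup>2 / \<kappa> * J + 200 * C0\<^sup>2 * n\<^sup>2 * (Z * (- pii - pjj))"
proof -
  define S where "S = wii\<^sup>2 + wjj\<^sup>2 + 2 * wij\<^sup>2"
  define B where "B = pi\<^sup>2 * wjj + pj\<^sup>2 * wii - 2 * pi * pj * wij"
  define A where "A = \<bar>wjj\<bar> + \<bar>wii\<bar> + 2 * \<bar>wij\<bar>"
  define q where "q = \<bar>e2 * w\<bar> * n\<^sup>2"
  have n0: "0 \<le> n" using n(1) by linarith
  have nsq: "pi\<^sup>2 \<le> n\<^sup>2" "pj\<^sup>2 \<le> n\<^sup>2" using n n0 by (simp_all add: abs_le_square_iff[symmetric])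
  have w2: "w\<^sup>2 \<le> C0\<^sup>2 * t\<^sup>2"
    using abs_le_square_iff[of w "C0 * t"] w by (simp add: power_mult_distrib)
  have e2w: "e2\<^sup>2 * w\<^sup>2 \<le> C0\<^sup>2 * (e2\<^sup>2 * t\<^sup>2)"
    using mult_left_mono[OF w2, of "e2\<^sup>2"] by (simp add: mult_ac)
  have part1: "- (1/2 * (e2 * w * B)) \<le> \<kappa> * (e0 * S) + 200 * n ^ 4 * C0\<^sup>2 / \<kappa> * J"
  proof -
    have b3: "\<bar>2 * pi * pj * wij\<bar> \<le> n\<^sup>2 * (2 * \<bar>wij\<bar>)"
    proof -
      have "\<bar>pi\<bar> * \<bar>pj\<bar> \<le> n * n" using n n0 by (intro mult_mono) auto
      then have "(\<bar>pi\<bar> * \<bar>pj\<bar>) * (2 * \<bar>wij\<bar>) \<le> (n * n) * (2 * \<bar>wij\<bar>)" by (rule mult_right_mono) simp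
      then show ?thesis by (simp add: abs_mult power2_eq_square mult_ac)
    qed
    have b12: "\<bar>pi\<^sup>2 * wjj\<bar> \<le> n\<^sup>2 * \<bar>wjj\<bar>" "\<bar>pj\<^sup>2 * wii\<bar> \<le> n\<^sup>2 * \<bar>wii\<bar>"
      using nsq by (auto simp: abs_mult intro: mult_right_mono)
    have "\<bar>B\<bar> \<le> \<bar>pi\<^sup>2 * wjj\<bar> + \<bar>pj\<^sup>2 * wii\<bar> + \<bar>2 * pi * pj * wij\<bar>" unfolding B_def by linarith
    also have "\<dots> \<le> n\<^sup>2 * \<bar>wjj\<bar> + n\<^sup>2 * \<bar>wii\<bar> + n\<^sup>2 * (2 * \<bar>wij\<bar>)" using b3 b12 by linarith
    also have "\<dots> = n\<^sup>2 * A" by (simp add: A_def algebra_simps)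
    finally have BA: "\<bar>B\<bar> \<le> n\<^sup>2 * A" .
    have "- (1/2 * (e2 * w * B)) \<le> 1/2 * (\<bar>e2 * w\<bar> * \<bar>B\<bar>)"
      using abs_ge_minus_self[of "e2 * w * B"] by (simp add: abs_mult)
    also have "\<dots> \<le> 1/2 * (\<bar>e2 * w\<bar> * (n\<^sup>2 * A))" using BA by (intro mult_left_mono) auto
    also have "\<dots> = 1/2 * (q * A)" by (simp add: q_def)
    also have "\<dots> \<le> \<kappa> * e0 * A\<^sup>2 / 4 + q\<^sup>2 / (4 * (\<kappa> * e0))"
    proof -
      have "1/2 * (q * A) \<le> v * A\<^sup>2 / 4 + q\<^sup>2 / (4 * v)" if v: "0 < v" for v
      proof -
        have "0 \<le> (v * A - q)\<^sup>2 / (4 * v)" using v by simp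
        also have "(v * A - q)\<^sup>2 / (4 * v) = v * A\<^sup>2 / 4 - 1/2 * (q * A) + q\<^sup>2 / (4 * v)"
          using v by (simp add: power2_eq_square field_simps)
        finally show ?thesis by linarith
      qed
      from this[of "\<kappa> * e0"] show ?thesis using k e by simp
    qed
    also have "\<kappa> * e0 * A\<^sup>2 / 4 \<le> \<kappa> * (e0 * S)"
    proof -
      have sq: "0 \<le> (\<bar>wjj\<bar> - \<bar>wii\<bar>)\<^sup>2" "0 \<le> (\<bar>wjj\<bar> - \<bar>wij\<bar>)\<^sup>2" "0 \<le> (\<bar>wii\<bar> - \<bar>wij\<bar>)\<^sup>2" by simp_all
      have "A\<^sup>2 = wjj\<^sup>2 + wii\<^sup>2 + 4 * wij\<^sup>2 + 2 * (\<bar>wjj\<bar> * \<bar>wii\<bar>) + 4 * (\<bar>wjj\<bar> * \<bar>wij\<bar>) + 4 * (\<bar>wii\<bar> * \<bar>wij\<bar>)"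
        by (simp add: A_def power2_eq_square algebra_simps)
      also have "\<dots> \<le> 4 * S" using sq by (simp add: S_def power2_diff)
      finally have "\<kappa> * e0 * A\<^sup>2 \<le> \<kappa> * e0 * (4 * S)" using k e by (intro mult_left_mono) auto
      then show ?thesis by simp
    qed
    also have "q\<^sup>2 / (4 * (\<kappa> * e0)) \<le> 200 * n ^ 4 * C0\<^sup>2 / \<kappa> * J"
    proof -
      have "q\<^sup>2 = n ^ 4 * (e2\<^sup>2 * w\<^sup>2)" by (simp add: q_def power_mult_distrib power2_eq_square power4_eq_xxxx)
      also have "\<dots> \<le> n ^ 4 * (C0\<^sup>2 * (800 * J * e0))"
        using e2w mult_left_mono[OF J, of "C0\<^sup>2"] n0 by (intro mult_left_mono) auto
      also have "\<dots> = (200 * n ^ 4 * C0\<^sup>2 / \<kappa> * J) * (4 * (\<kappa> * e0))" using k by simp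
      finally show ?thesis using k e by (subst pos_divide_le_eq) auto
    qed
    finally show ?thesis by simp
  qed
  define Qww where "Qww = - (pjj * wi\<^sup>2 - 2 * pij * wi * wj + pii * wj\<^sup>2)"
  define Qpw where "Qpw = - (pjj * pi * wi - pij * (pi * wj + pj * wi) + pii * pj * wj)"
  define Qpp where "Qpp = - (pjj * pi\<^sup>2 - 2 * pij * pi * pj + pii * pj\<^sup>2)"
  have d: "0 \<le> - pii" "0 \<le> - pjj" using c[of 1 0] c[of 0 1] by auto
  have part2: "- (1/2 * (e2 * w * Qpw) + 1/2 * (e1 * Qww)) \<le> 200 * C0\<^sup>2 * n\<^sup>2 * (Z * (- pii - pjj))"
  proof -
    \<comment> \<open>By concavity, the cofactor form of minus the Hessian block of \<psi> is
      nonnegative. This is its value at \<open>e1\<close> grad w + (\<open>e2\<close> w / 2) grad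
      \<psi>; division by \<open>2 * e1\<close> leaves only \<open>Qpp\<close> to be
      estimated.\<close>
    have "0 \<le> e1\<^sup>2 * Qww + e1 * (e2 * w) * Qpw + (e2 * w)\<^sup>2 * Qpp / 4"
    proof -
      have "(e1 * wj + e2 * w * pj / 2)\<^sup>2 * pii + 2 * (e1 * wj + e2 * w * pj / 2) * (- (e1 * wi + e2 * w * pi / 2)) * pij
          + (- (e1 * wi + e2 * w * pi / 2))\<^sup>2 * pjj \<le> 0" by (rule c)
      also have "(e1 * wj + e2 * w * pj / 2)\<^sup>2 * pii + 2 * (e1 * wj + e2 * w * pj / 2) * (- (e1 * wi + e2 * w * pi / 2)) * pij
          + (- (e1 * wi + e2 * w * pi / 2))\<^sup>2 * pjj = - (e1\<^sup>2 * Qww + e1 * (e2 * w) * Qpw + (e2 * w)\<^sup>2 * Qpp / 4)"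
        by (simp add: Qww_def Qpw_def Qpp_def power2_eq_square field_simps)
      finally show ?thesis by simp
    qed
    then have "0 \<le> (e1\<^sup>2 * Qww + e1 * (e2 * w) * Qpw + (e2 * w)\<^sup>2 * Qpp / 4) / (2 * e1)" using e by simp
    also have "\<dots> = 1/2 * (e2 * w * Qpw) + 1/2 * (e1 * Qww) + (e2 * w)\<^sup>2 * Qpp / (8 * e1)"
      using e by (simp add: add_divide_distrib power2_eq_square)
    finally have 1: "- (1/2 * (e2 * w * Qpw) + 1/2 * (e1 * Qww)) \<le> (e2 * w)\<^sup>2 * Qpp / (8 * e1)" by linarith
    have "pj\<^sup>2 * pii + 2 * pj * pi * pij + pi\<^sup>2 * pjj \<le> 0" by (rule c)
    then have "Qpp \<le> 2 * (pi\<^sup>2 * (- pjj) + pj\<^sup>2 * (- pii))" by (simp add: Qpp_def algebra_simps)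
    also have "\<dots> \<le> 2 * (n\<^sup>2 * (- pjj) + n\<^sup>2 * (- pii))"
      using mult_right_mono[OF nsq(1) d(2)] mult_right_mono[OF nsq(2) d(1)] by (intro mult_left_mono add_mono) auto
    finally have Q: "Qpp \<le> 2 * n\<^sup>2 * (- pii - pjj)" by (simp add: algebra_simps)
    have r0: "0 \<le> 2 * n\<^sup>2 * (- pii - pjj)" using d by (intro mult_nonneg_nonneg) auto
    have "(e2 * w)\<^sup>2 / (8 * e1) \<le> 100 * C0\<^sup>2 * Z"
    proof -
      have "(e2 * w)\<^sup>2 \<le> C0\<^sup>2 * (800 * Z * e1)"
        using e2w mult_left_mono[OF Z(1), of "C0\<^sup>2"] by (simp add: power_mult_distrib)
      also have "\<dots> = (100 * C0\<^sup>2 * Z) * (8 * e1)" by simp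
      finally show ?thesis using e by (subst pos_divide_le_eq) auto
    qed
    then have 2: "(e2 * w)\<^sup>2 / (8 * e1) * Qpp \<le> (100 * C0\<^sup>2 * Z) * (2 * n\<^sup>2 * (- pii - pjj))"
      using Q e r0 Z(2) by (meson mult_left_mono mult_right_mono order.trans divide_nonneg_pos mult_pos_pos zero_le_power2 zero_less_numeral)
    have 3: "(100 * C0\<^sup>2 * Z) * (2 * n\<^sup>2 * m) = 200 * C0\<^sup>2 * n\<^sup>2 * (Z * m)" for m by simp
    have 4: "(e2 * w)\<^sup>2 * Qpp / (8 * e1) = (e2 * w)\<^sup>2 / (8 * e1) * Qpp" by simp
    show ?thesis using order.trans[OF 1[unfolded 4] 2[unfolded 3]] .
  qed
  have q: "pjj * pi * wi - pij * (pi * wj + pj * wi) + pii * pj * wj = - Qpw"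
    "pjj * wi\<^sup>2 - 2 * pij * wi * wj + pii * wj\<^sup>2 = - Qww" by (simp_all add: Qpw_def Qww_def)
  have eq: "- (1/2 * (e2 * w * B) - 1/2 * (e2 * w * (- Qpw)) - 1/2 * (e1 * (- Qww)))
      = - (1/2 * (e2 * w * B)) + - (1/2 * (e2 * w * Qpw) + 1/2 * (e1 * Qww))" by simp
  show ?thesis unfolding q B_def[symmetric] S_def[symmetric] eq using add_mono[OF part1 part2] by simp
qed

text \<open>The minor w_ii w_jj - w_ij^2 is a divergence, so against a weight only derivatives of
  the weight remain. Their contribution is put into a form controlled by the barrier and by
  concavity, then estimated pointwise by \<open>pair_pointwise\<close>.\<close>

lemma pair_estimate:
  fixes w \<psi> :: "real^'d \<Rightarrow> real" and i j :: 'd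
  assumes d: "0 < \<delta>" and \<alpha>: "0 < \<alpha>" "\<alpha> < 1" and k: "0 < \<kappa>" and w: "smooth w" and \<psi>: "\<psi> \<in> \<D> UNIV"
    and wb: "\<And>x. \<bar>w x\<bar> \<le> C0 * \<psi> x" and n: "\<And>k x. \<bar>pd k \<psi> x\<bar> \<le> n"
    and c: "\<And>x a b. \<delta> < \<psi> x \<Longrightarrow> a\<^sup>2 * pd i (pd i \<psi>) x + 2 * a * b * pd i (pd j \<psi>) x
      + b\<^sup>2 * pd j (pd j \<psi>) x \<le> 0"
  shows "- (LINT x|lebesgue. th0 \<delta> \<alpha> (\<psi> x) * (pd i (pd i w) x * pd j (pd j w) x - (pd i (pd j w) x)\<^sup>2))
    \<le> \<kappa> * (LINT x|lebesgue. th0 \<delta> \<alpha> (\<psi> x) * ((pd i (pd i w) x)\<^sup>2 + (pd j (pd j w) x)\<^sup>2 + 2 * (pd i (pd j w) x)\<^sup>2))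
      + (200 * n ^ 4 * C0\<^sup>2 / \<kappa> + 800 * n ^ 4 * C0\<^sup>2) * (LINT x|lebesgue. jd \<delta> \<alpha> (\<psi> x))"
    "integrable lebesgue (\<lambda>x. jd \<delta> \<alpha> (\<psi> x))"
proof -
  have \<psi>s: "smooth \<psi>" using \<psi> by (rule test_smooth)
  have n0: "0 \<le> n" using n by (meson abs_ge_zero order.trans)
  define K where "K = {x. \<delta> \<le> \<psi> x}"
  have K: "compact K"
  proof -
    obtain L where L: "compact L" "\<And>x. x \<notin> L \<Longrightarrow> \<psi> x = 0" using \<psi> by (metis test_functionsE)
    have "closed K" unfolding K_def by (intro closed_Collect_le continuous_intros smooth_continuous[OF \<psi>s])
    moreover have "K \<subseteq> L" using L(2) d by (force simp: K_def)
    ultimately show ?thesis using L(1) by (metis compact_Int_closed inf.absorb2 inf_commute)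
  qed
  have Kz: "\<psi> x \<le> \<delta>" if "x \<notin> K" for x using that by (simp add: K_def)
  define wi where "wi = pd i w"
  define wj where "wj = pd j w"
  define wii where "wii = pd i wi"
  define wij where "wij = pd i wj"
  define wjj where "wjj = pd j wj"
  define wijj where "wijj = pd i wjj"
  define pi where "pi = pd i \<psi>"
  define pj where "pj = pd j \<psi>"
  define pii where "pii = pd i pi"
  define pij where "pij = pd i pj"
  define pjj where "pjj = pd j pj"
  define e0 where "e0 x = th0 \<delta> \<alpha> (\<psi> x)" for x
  define e1 where "e1 x = th1 \<delta> \<alpha> (\<psi> x)" for x
  define e2 where "e2 x = th2 \<delta> \<alpha> (\<psi> x)" for x
  define e3 where "e3 x = th3 \<delta> \<alpha> (\<psi> x)" for x
  define z0 where "z0 x = ze0 \<delta> \<alpha> (\<psi> x)" for x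
  define z1 where "z1 x = ze1 \<delta> \<alpha> (\<psi> x)" for x
  have sm: "smooth wi" "smooth wj" "smooth wii" "smooth wij" "smooth wjj" "smooth wijj"
    "smooth pi" "smooth pj" "smooth pii" "smooth pij" "smooth pjj"
    unfolding wi_def wj_def wii_def wij_def wjj_def wijj_def pi_def pj_def pii_def pij_def pjj_def
    by (intro smooth_pderiv w \<psi>s)+
  have jwi: "wij = pd j wi" "wijj = pd j wij" "pij = pd j pi"
    unfolding wij_def wijj_def wjj_def wi_def pij_def pi_def pj_def
    using pderiv_commute[OF w, of i j] pderiv_commute[OF sm(2), of i j] pderiv_commute[OF \<psi>s, of i j]
    by (auto simp: wj_def)
  have dd: "dirderiv k v v'" if "smooth v" "v' = pd k v" for k v v' using smooth_dirderiv[OF that(1)] that(2) by simp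
  have Ds: "dirderiv i w wi" "dirderiv j w wj" "dirderiv i wi wii" "dirderiv j wi wij" "dirderiv i wj wij" "dirderiv j wj wjj"
    "dirderiv i wjj wijj" "dirderiv j wij wijj"
    "dirderiv i \<psi> pi" "dirderiv j \<psi> pj" "dirderiv i pi pii" "dirderiv j pi pij" "dirderiv i pj pij" "dirderiv j pj pjj"
    by (rule dd, rule w \<psi>s sm, rule jwi wi_def wj_def wii_def wij_def wjj_def wijj_def pi_def pj_def pii_def pij_def pjj_def)+
  have De: "dirderiv i e0 (\<lambda>x. e1 x * pi x)" "dirderiv j e0 (\<lambda>x. e1 x * pj x)" "dirderiv i e1 (\<lambda>x. e2 x * pi x)"
    "dirderiv j e1 (\<lambda>x. e2 x * pj x)" "dirderiv i e2 (\<lambda>x. e3 x * pi x)" "dirderiv j e2 (\<lambda>x. e3 x * pj x)"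
    "dirderiv i z0 (\<lambda>x. z1 x * pi x)" "dirderiv j z0 (\<lambda>x. z1 x * pj x)"
    unfolding e0_def e1_def e2_def e3_def z0_def z1_def
    by (rule th_DERIV[OF d, THEN dirderiv_comp], rule Ds)+
  note ct = smooth_continuous[OF w] sm[THEN smooth_continuous]
  have ce: "continuous_on UNIV e0" "continuous_on UNIV e1" "continuous_on UNIV e2" "continuous_on UNIV e3"
    "continuous_on UNIV z0" "continuous_on UNIV z1"
    unfolding e0_def e1_def e2_def e3_def z0_def z1_def
    by (rule continuous_on_compose2[OF _ smooth_continuous[OF \<psi>s]], rule th_continuous[OF d], simp)+
  have ez: "e0 x = 0" "e1 x = 0" "e2 x = 0" "e3 x = 0" "z0 x = 0" "z1 x = 0" if "x \<notin> K" for x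
    using th_below[OF Kz[OF that]] by (simp_all add: e0_def e1_def e2_def e3_def z0_def z1_def)
  note ints = dirderiv_add dirderiv_diff dirderiv_mult dirderiv_const Ds De
  \<comment> \<open>Without their last terms, \<open>F\<close> and \<open>G\<close> reduce the
    weighted minor to -1/2 \<open>e2\<close> (T w)^2 plus a term with the Hessian of \<psi>, where T
    = \<open>pi\<close> d_j - \<open>pj\<close> d_i differentiates along the level sets of \<psi>.
    The last terms integrate (T w)^2 by parts once more. As T annihilates functions of \<psi> and is
    divergence free, the terms with \<open>e3\<close> cancel in \<open>F' + G'\<close>.\<close>
  define F where "F x = e0 x * (wi x * wjj x) + 1/2 * (e1 x * (pi x * (wj x * wj x))) + 1/2 * (pj x * (e2 x * (w x * (pi x * wj x - pj x * wi x))))" for x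
  define G where "G x = 1/2 * (e1 x * (pj x * (wi x * wi x))) - e0 x * (wi x * wij x) - e1 x * (pi x * (wi x * wj x)) - 1/2 * (pi x * (e2 x * (w x * (pi x * wj x - pj x * wi x))))" for x
  define F' where "F' x = e1 x * pi x * (wi x * wjj x) + e0 x * (wii x * wjj x + wi x * wijj x)
    + 1/2 * (e2 x * pi x * (pi x * (wj x * wj x)) + e1 x * (pii x * (wj x * wj x)) + e1 x * (pi x * (2 * (wj x * wij x))))
    + 1/2 * (pij x * (e2 x * (w x * (pi x * wj x - pj x * wi x))) + pj x * (e3 x * pi x * (w x * (pi x * wj x - pj x * wi x)))
      + pj x * (e2 x * (wi x * (pi x * wj x - pj x * wi x))) + pj x * (e2 x * (w x * (pii x * wj x + pi x * wij x - pij x * wi x - pj x * wii x))))" for x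
  define G' where "G' x = 1/2 * (e2 x * pj x * (pj x * (wi x * wi x)) + e1 x * (pjj x * (wi x * wi x)) + e1 x * (pj x * (2 * (wi x * wij x))))
    - (e1 x * pj x * (wi x * wij x) + e0 x * (wij x * wij x + wi x * wijj x))
    - (e2 x * pj x * (pi x * (wi x * wj x)) + e1 x * (pij x * (wi x * wj x)) + e1 x * (pi x * (wij x * wj x + wi x * wjj x)))
    - 1/2 * (pij x * (e2 x * (w x * (pi x * wj x - pj x * wi x))) + pi x * (e3 x * pj x * (w x * (pi x * wj x - pj x * wi x)))
      + pi x * (e2 x * (wj x * (pi x * wj x - pj x * wi x))) + pi x * (e2 x * (w x * (pij x * wj x + pi x * wjj x - pjj x * wi x - pj x * wij x))))" for x
  have DF: "dirderiv i F F'" unfolding F_def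
    by (rule dirderiv_cong, (rule ints)+) (simp add: F'_def algebra_simps)
  have DG: "dirderiv j G G'" unfolding G_def
    by (rule dirderiv_cong, (rule ints)+) (simp add: G'_def algebra_simps)
  have cF: "continuous_on UNIV F" "continuous_on UNIV F'" "continuous_on UNIV G" "continuous_on UNIV G'"
    unfolding F_def F'_def G_def G'_def by (intro continuous_intros ct ce)+
  have zF: "F x = 0" "G x = 0" if "x \<notin> K" for x using ez[OF that] by (simp_all add: F_def G_def)
  note iF = integral_dirderiv_0[OF cF(1,2) DF K zF(1)] and iG = integral_dirderiv_0[OF cF(3,4) DG K zF(2)]
  \<comment> \<open>The first two lines together are 1/2 \<open>e2\<close> w T(T w), the third is
    the concavity term. All are free of derivatives of order three.\<close>
  define R where "R x = 1/2 * (e2 x * w x * ((pi x)\<^sup>2 * wjj x + (pj x)\<^sup>2 * wii x - 2 * pi x * pj x * wij x))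
      - 1/2 * (e2 x * w x * (pjj x * pi x * wi x - pij x * (pi x * wj x + pj x * wi x) + pii x * pj x * wj x))
      - 1/2 * (e1 x * (pjj x * (wi x)\<^sup>2 - 2 * pij x * wi x * wj x + pii x * (wj x)\<^sup>2))" for x
  have alg: "e0 x * (wii x * wjj x - (wij x)\<^sup>2) = F' x + G' x + R x" for x
    by (simp add: F'_def G'_def R_def field_simps power2_eq_square)
  have Ri: "integrable lebesgue R"
  proof (rule integrable_continuous_compact_support[OF _ K])
    show "continuous_on UNIV R" unfolding R_def by (intro continuous_intros ct ce)
  qed (use ez in \<open>simp add: R_def\<close>)
  have LR: "(LINT x|lebesgue. e0 x * (wii x * wjj x - (wij x)\<^sup>2)) = (LINT x|lebesgue. R x)"
    unfolding alg using iF iG Ri by simp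
  define S where "S x = e0 x * ((wii x)\<^sup>2 + (wjj x)\<^sup>2 + 2 * (wij x)\<^sup>2)" for x
  have Si: "integrable lebesgue S"
  proof (rule integrable_continuous_compact_support[OF _ K])
    show "continuous_on UNIV S" unfolding S_def by (intro continuous_intros ct ce)
  qed (use ez in \<open>simp add: S_def\<close>)
  have \<psi>m: "\<psi> \<in> borel_measurable lebesgue" by (rule continuous_measurable_lebesgue[OF smooth_continuous[OF \<psi>s]])
  have jdm: "jd \<delta> \<alpha> \<in> borel_measurable borel" unfolding jd_def by measurable
  \<comment> \<open>\<open>jd\<close> jumps at \<delta>, so integrability rests on a bound on the
    compact set \<open>K\<close> rather than on continuity.\<close>
  show Ji: "integrable lebesgue (\<lambda>x. jd \<delta> \<alpha> (\<psi> x))"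
  proof (rule Bochner_Integration.integrable_bound)
    have "K \<in> lmeasurable" by (rule lmeasurable_compact[OF K])
    then show "integrable lebesgue (\<lambda>x. ((\<alpha>\<^sup>2 + 1) * \<delta> powr (\<alpha> - 1)) * indicator K x)"
      unfolding fmeasurable_def by (intro integrable_mult_right integrable_real_indicator) blast+
    show "(\<lambda>x. jd \<delta> \<alpha> (\<psi> x)) \<in> borel_measurable lebesgue" by (rule measurable_compose[OF \<psi>m jdm])
    show "AE x in lebesgue. norm (jd \<delta> \<alpha> (\<psi> x)) \<le> norm (((\<alpha>\<^sup>2 + 1) * \<delta> powr (\<alpha> - 1)) * indicator K x)"
    proof (rule AE_I2)
      fix x
      show "norm (jd \<delta> \<alpha> (\<psi> x)) \<le> norm (((\<alpha>\<^sup>2 + 1) * \<delta> powr (\<alpha> - 1)) * indicator K x)"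
      proof (cases "\<delta> < \<psi> x")
        case True
        have "(\<delta> / \<psi> x) ^ 4 \<le> 1" using True d by (intro power_le_one) auto
        moreover have "\<psi> x powr (\<alpha> - 1) \<le> \<delta> powr (\<alpha> - 1)" using True d \<alpha> by (intro powr_mono2') auto
        ultimately have "(\<alpha>\<^sup>2 + (\<delta> / \<psi> x) ^ 4) * \<psi> x powr (\<alpha> - 1) \<le> (\<alpha>\<^sup>2 + 1) * \<delta> powr (\<alpha> - 1)"
          by (intro mult_mono) auto
        moreover have "0 \<le> (\<alpha>\<^sup>2 + (\<delta> / \<psi> x) ^ 4) * \<psi> x powr (\<alpha> - 1)" by (intro mult_nonneg_nonneg add_nonneg_nonneg) (auto simp: zero_le_even_power)
        ultimately show ?thesis using True by (simp add: jd_def K_def)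
      qed (simp add: jd_def)
    qed
  qed
  define X where "X x = z0 x * (- pii x - pjj x)" for x
  have Xi: "integrable lebesgue X"
  proof (rule integrable_continuous_compact_support[OF _ K])
    show "continuous_on UNIV X" unfolding X_def by (intro continuous_intros ct ce)
  qed (use ez in \<open>simp add: X_def\<close>)
  \<comment> \<open>Adding two integrals that vanish by the divergence theorem removes the second
    derivatives of \<psi> and leaves \<open>z1\<close> times the squared first derivatives. The 4 is
    2 from \<open>ze1 \<le> 2 * jd\<close> times two directions.\<close>
  have XJ: "(LINT x|lebesgue. X x) \<le> 4 * n\<^sup>2 * (LINT x|lebesgue. jd \<delta> \<alpha> (\<psi> x))"
  proof -
    have D1: "dirderiv i (\<lambda>x. z0 x * pi x) (\<lambda>x. z1 x * pi x * pi x + pii x * z0 x)" by (rule ints)+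
    have D2: "dirderiv j (\<lambda>x. z0 x * pj x) (\<lambda>x. z1 x * pj x * pj x + pjj x * z0 x)" by (rule ints)+
    have c1: "continuous_on UNIV (\<lambda>x. z0 x * pi x)" "continuous_on UNIV (\<lambda>x. z1 x * pi x * pi x + pii x * z0 x)"
      "continuous_on UNIV (\<lambda>x. z0 x * pj x)" "continuous_on UNIV (\<lambda>x. z1 x * pj x * pj x + pjj x * z0 x)"
      by (intro continuous_intros ct ce)+
    note j1 = integral_dirderiv_0[OF c1(1,2) D1 K] and j2 = integral_dirderiv_0[OF c1(3,4) D2 K]
    have j: "integrable lebesgue (\<lambda>x. z1 x * pi x * pi x + pii x * z0 x)" "(LINT x|lebesgue. z1 x * pi x * pi x + pii x * z0 x) = 0"
      "integrable lebesgue (\<lambda>x. z1 x * pj x * pj x + pjj x * z0 x)" "(LINT x|lebesgue. z1 x * pj x * pj x + pjj x * z0 x) = 0"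
      using j1 j2 ez by simp_all
    have "(LINT x|lebesgue. X x) = (LINT x|lebesgue. X x + (z1 x * pi x * pi x + pii x * z0 x) + (z1 x * pj x * pj x + pjj x * z0 x))"
      using j Xi by simp
    also have "\<dots> \<le> (LINT x|lebesgue. 4 * n\<^sup>2 * jd \<delta> \<alpha> (\<psi> x))"
    proof (rule integral_mono)
      show "integrable lebesgue (\<lambda>x. X x + (z1 x * pi x * pi x + pii x * z0 x) + (z1 x * pj x * pj x + pjj x * z0 x))"
        using j Xi by simp
      show "integrable lebesgue (\<lambda>x. 4 * n\<^sup>2 * jd \<delta> \<alpha> (\<psi> x))" using Ji by simp
      fix x
      have "X x + (z1 x * pi x * pi x + pii x * z0 x) + (z1 x * pj x * pj x + pjj x * z0 x) = z1 x * ((pi x)\<^sup>2 + (pj x)\<^sup>2)"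
        by (simp add: X_def algebra_simps power2_eq_square)
      also have "\<dots> \<le> 4 * n\<^sup>2 * jd \<delta> \<alpha> (\<psi> x)"
      proof (cases "\<delta> < \<psi> x")
        case True
        have sq: "(pi x)\<^sup>2 \<le> n\<^sup>2" "(pj x)\<^sup>2 \<le> n\<^sup>2" using n[of i x] n[of j x] n0 by (simp_all add: pi_def pj_def abs_le_square_iff[symmetric])
        note tb = th_bounds[OF d True \<alpha>]
        have "z1 x * ((pi x)\<^sup>2 + (pj x)\<^sup>2) \<le> (2 * jd \<delta> \<alpha> (\<psi> x)) * ((pi x)\<^sup>2 + (pj x)\<^sup>2)"
          using tb(5) by (intro mult_right_mono) (auto simp: z1_def)
        also have "\<dots> \<le> (2 * jd \<delta> \<alpha> (\<psi> x)) * (n\<^sup>2 + n\<^sup>2)" using tb(7) sq by (intro mult_left_mono) auto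
        finally show ?thesis by (simp add: mult_ac)
      next
        case False
        then show ?thesis using th_below[of "\<psi> x" \<delta> \<alpha>] by (simp add: z1_def)
      qed
      finally show "X x + (z1 x * pi x * pi x + pii x * z0 x) + (z1 x * pj x * pj x + pjj x * z0 x) \<le> 4 * n\<^sup>2 * jd \<delta> \<alpha> (\<psi> x)" .
    qed
    finally show ?thesis by simp
  qed
  have pt: "- R x \<le> \<kappa> * S x + 200 * n ^ 4 * C0\<^sup>2 / \<kappa> * jd \<delta> \<alpha> (\<psi> x) + 200 * C0\<^sup>2 * n\<^sup>2 * X x" for x
  proof (cases "\<delta> < \<psi> x")
    case True
    note tb = th_bounds[OF d True \<alpha>]
    show ?thesis unfolding R_def S_def X_def
      by (rule pair_pointwise[OF _ _ k wb[of x]])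
        (use tb n[of i x] n[of j x] c[OF True] in \<open>simp_all add: e0_def e1_def e2_def z0_def pi_def pj_def pii_def pij_def pjj_def\<close>)
  next
    case False
    then show ?thesis using th_below[of "\<psi> x" \<delta> \<alpha>] by (simp add: R_def S_def X_def e0_def e1_def e2_def z0_def)
  qed
  have "- (LINT x|lebesgue. R x) = (LINT x|lebesgue. - R x)" by simp
  also have "\<dots> \<le> (LINT x|lebesgue. \<kappa> * S x + 200 * n ^ 4 * C0\<^sup>2 / \<kappa> * jd \<delta> \<alpha> (\<psi> x) + 200 * C0\<^sup>2 * n\<^sup>2 * X x)"
    by (rule integral_mono) (use Ri Si Ji Xi pt in auto)
  also have "\<dots> = \<kappa> * (LINT x|lebesgue. S x) + 200 * n ^ 4 * C0\<^sup>2 / \<kappa> * (LINT x|lebesgue. jd \<delta> \<alpha> (\<psi> x)) + 200 * C0\<^sup>2 * n\<^sup>2 * (LINT x|lebesgue. X x)"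
    using Si Ji Xi by simp
  also have "200 * C0\<^sup>2 * n\<^sup>2 * (LINT x|lebesgue. X x) \<le> 200 * C0\<^sup>2 * n\<^sup>2 * (4 * n\<^sup>2 * (LINT x|lebesgue. jd \<delta> \<alpha> (\<psi> x)))"
    by (rule mult_left_mono[OF XJ]) simp
  finally have fin: "- (LINT x|lebesgue. R x) \<le> \<kappa> * (LINT x|lebesgue. S x) + (200 * n ^ 4 * C0\<^sup>2 / \<kappa> + 800 * n ^ 4 * C0\<^sup>2) * (LINT x|lebesgue. jd \<delta> \<alpha> (\<psi> x))"
    by (simp add: algebra_simps power2_eq_square power4_eq_xxxx)
  show "- (LINT x|lebesgue. th0 \<delta> \<alpha> (\<psi> x) * (pd i (pd i w) x * pd j (pd j w) x - (pd i (pd j w) x)\<^sup>2))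
    \<le> \<kappa> * (LINT x|lebesgue. th0 \<delta> \<alpha> (\<psi> x) * ((pd i (pd i w) x)\<^sup>2 + (pd j (pd j w) x)\<^sup>2 + 2 * (pd i (pd j w) x)\<^sup>2))
      + (200 * n ^ 4 * C0\<^sup>2 / \<kappa> + 800 * n ^ 4 * C0\<^sup>2) * (LINT x|lebesgue. jd \<delta> \<alpha> (\<psi> x))"
    using fin LR unfolding S_def e0_def wii_def wij_def wjj_def wi_def wj_def by simp
qed

text \<open>Summed over all pairs, the minors give (Laplacian of w)^2 - |D^2 w|^2. Each diagonal
  entry occurs \<open>2 * CARD('d)\<close> times in the error terms and the full Hessian twice,
  which explains the factor \<open>2 * real CARD('d) + 2\<close>.\<close>

lemma hessian_estimate:
  fixes w \<psi> :: "real^'d \<Rightarrow> real"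
  assumes d: "0 < \<delta>" and \<alpha>: "0 < \<alpha>" "\<alpha> < 1" and k: "0 < \<kappa>" and w: "smooth w" and \<psi>: "\<psi> \<in> \<D> UNIV"
    and wb: "\<And>x. \<bar>w x\<bar> \<le> C0 * \<psi> x" and n: "\<And>k x. \<bar>pd k \<psi> x\<bar> \<le> n"
    and c: "\<And>x a b i j. \<delta> < \<psi> x \<Longrightarrow> a\<^sup>2 * pd i (pd i \<psi>) x + 2 * a * b * pd i (pd j \<psi>) x
      + b\<^sup>2 * pd j (pd j \<psi>) x \<le> 0"
  shows "(1 - \<kappa> * (2 * real CARD('d) + 2)) * (LINT x|lebesgue. th0 \<delta> \<alpha> (\<psi> x) * (\<Oplus>i j. (pd i (pd j w) x)\<^sup>2))
    \<le> (LINT x|lebesgue. th0 \<delta> \<alpha> (\<psi> x) * (\<Oplus>i. pd i (pd i w) x)\<^sup>2)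
      + (real CARD('d))\<^sup>2 * ((200 * n ^ 4 * C0\<^sup>2 / \<kappa> + 800 * n ^ 4 * C0\<^sup>2) * (LINT x|lebesgue. jd \<delta> \<alpha> (\<psi> x)))"
proof -
  let ?N = "real CARD('d)"
  let ?e = "\<lambda>x. th0 \<delta> \<alpha> (\<psi> x)"
  define W where "W i j x = pd i (pd j w) x" for i j x
  define J where "J = (200 * n ^ 4 * C0\<^sup>2 / \<kappa> + 800 * n ^ 4 * C0\<^sup>2) * (LINT x|lebesgue. jd \<delta> \<alpha> (\<psi> x))"
  have \<psi>s: "smooth \<psi>" using \<psi> by (rule test_smooth)
  obtain L where L: "compact L" "\<And>x. x \<notin> L \<Longrightarrow> \<psi> x = 0" using \<psi> by (metis test_functionsE)
  have ce: "continuous_on UNIV ?e"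
    by (rule continuous_on_compose2[OF th_continuous(1)[OF d] smooth_continuous[OF \<psi>s]]) simp
  have cW: "continuous_on UNIV (W i j)" for i j
    unfolding W_def by (intro smooth_continuous smooth_pderiv w)
  have int: "integrable lebesgue (\<lambda>x. ?e x * h x)" if "continuous_on UNIV h" for h
    by (rule integrable_continuous_compact_support[OF continuous_on_mult[OF ce that] L(1)])
      (use L(2) d th_below(1)[of 0 \<delta>] in simp)
  note cI = continuous_intros cW
  have i1: "integrable lebesgue (\<lambda>x. ?e x * (W i j x)\<^sup>2)" for i j by (rule int) (intro cI)
  have i2: "integrable lebesgue (\<lambda>x. ?e x * (W i i x * W j j x))" for i j by (rule int) (intro cI)
  define I where "I i j = (LINT x|lebesgue. ?e x * (W i j x)\<^sup>2)" for i j
  define P where "P i j = (LINT x|lebesgue. ?e x * (W i i x * W j j x))" for i j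
  have e0: "0 \<le> ?e x" for x
    using th_bounds(1)[OF d _ \<alpha>, of "\<psi> x"] th_below(1)[of "\<psi> x" \<delta> \<alpha>] by (cases "\<delta> < \<psi> x") auto
  have I0: "0 \<le> I i j" for i j unfolding I_def by (intro integral_nonneg_AE AE_I2 mult_nonneg_nonneg e0) simp
  have pr: "I i j - P i j \<le> \<kappa> * (I i i + I j j + 2 * I i j) + J" for i j
  proof -
    have "- (LINT x|lebesgue. ?e x * (W i i x * W j j x - (W i j x)\<^sup>2))
      \<le> \<kappa> * (LINT x|lebesgue. ?e x * ((W i i x)\<^sup>2 + (W j j x)\<^sup>2 + 2 * (W i j x)\<^sup>2)) + J"
      unfolding W_def J_def by (rule pair_estimate(1)[OF d \<alpha> k w \<psi> wb n c])
    moreover have "(LINT x|lebesgue. ?e x * (W i i x * W j j x - (W i j x)\<^sup>2)) = P i j - I i j"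
      unfolding P_def I_def using i1 i2 by (simp add: right_diff_distrib)
    moreover have "(LINT x|lebesgue. ?e x * ((W i i x)\<^sup>2 + (W j j x)\<^sup>2 + 2 * (W i j x)\<^sup>2)) = I i i + I j j + 2 * I i j"
      unfolding I_def using i1 by (simp add: distrib_left mult.left_commute[of _ 2])
    ultimately show ?thesis by simp
  qed
  define T where "T = (\<Oplus>i j. I i j)"
  have TI: "(LINT x|lebesgue. ?e x * (\<Oplus>i j. (W i j x)\<^sup>2)) = T"
    unfolding T_def I_def using i1 by (simp add: sum_distrib_left)
  have TP: "(LINT x|lebesgue. ?e x * (\<Oplus>i. W i i x)\<^sup>2) = (\<Oplus>i j. P i j)"
  proof -
    have "?e x * (\<Oplus>i. W i i x)\<^sup>2 = (\<Oplus>i j. ?e x * (W i i x * W j j x))" for x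
      unfolding power2_eq_square sum_product unfolding sum_distrib_left ..
    then show ?thesis unfolding P_def using i2 by simp
  qed
  have diag: "(\<Oplus>i. I i i) \<le> T"
    unfolding T_def by (intro sum_mono member_le_sum I0) auto
  have "(\<Oplus>i j. I i j - P i j) \<le> (\<Oplus>i j. \<kappa> * (I i i + I j j + 2 * I i j) + J)"
    by (intro sum_mono pr)
  also have "\<dots> = \<kappa> * (2 * ?N * (\<Oplus>i. I i i) + 2 * T) + ?N\<^sup>2 * J"
  proof -
    have "(\<Oplus>j. \<kappa> * (I i i + I j j + 2 * I i j) + J) = \<kappa> * (?N * I i i + (\<Oplus>j. I j j) + 2 * (\<Oplus>j. I i j)) + ?N * J" for i
      by (simp add: sum.distrib sum_distrib_left[symmetric])
    then show ?thesis
      unfolding T_def by (simp add: sum.distrib sum_distrib_left[symmetric] power2_eq_square)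
  qed
  also have "\<dots> \<le> \<kappa> * (2 * ?N * T + 2 * T) + ?N\<^sup>2 * J"
    using k by (intro add_right_mono mult_left_mono[OF add_right_mono[OF mult_left_mono[OF diag]]]) auto
  finally have "T - (\<Oplus>i j. P i j) \<le> \<kappa> * (2 * ?N * T + 2 * T) + ?N\<^sup>2 * J"
    by (simp add: T_def sum_subtractf)
  then have "(1 - \<kappa> * (2 * ?N + 2)) * T \<le> (\<Oplus>i j. P i j) + ?N\<^sup>2 * J"
    by (simp add: algebra_simps)
  then show ?thesis unfolding TI[symmetric] TP[symmetric] W_def J_def .
qed

section \<open>The distance to the boundary of a convex domain\<close>

definition bdist :: "(real^'d) set \<Rightarrow> real^'d \<Rightarrow> real" where
  "bdist U x = infdist x (- U)"

definition cutdist :: "(real^'d) set \<Rightarrow> real \<Rightarrow> real^'d \<Rightarrow> real" where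
  "cutdist U n x = min 1 (n * bdist U x)"

lemma Compl_bounded_ne:
  fixes U :: "(real^'d) set"
  assumes "bounded U" shows "- U \<noteq> {}"
  using assms not_bounded_UNIV by (metis Compl_UNIV_eq double_complement)

lemma bdist_nonneg [simp]: "0 \<le> bdist U x"
  by (simp add: bdist_def infdist_nonneg)

lemma bdist_outside: "x \<notin> U \<Longrightarrow> bdist U x = 0"
  by (simp add: bdist_def)

lemma bdist_pos_imp: "0 < bdist U x \<Longrightarrow> x \<in> U"
  using bdist_outside by fastforce

lemma bdist_pos:
  assumes "bounded U" "open U" "x \<in> U" shows "0 < bdist U x"
  using in_closed_iff_infdist_zero[OF closed_Compl[OF assms(2)] Compl_bounded_ne[OF assms(1)], of x] assms(3)
    bdist_nonneg[of U x] by (simp add: bdist_def less_le)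

lemma bdist_Lipschitz: "\<bar>bdist U x - bdist U y\<bar> \<le> norm (x - y)"
  using infdist_triangle_abs[of x "- U" y] by (simp add: bdist_def dist_norm)

lemma bdist_continuous: "continuous_on S (bdist U)"
  unfolding bdist_def by (intro continuous_intros)

lemma bdist_ball:
  assumes "norm (x - y) < bdist U x" shows "y \<in> U"
  using bdist_Lipschitz[of U x y] assms by (intro bdist_pos_imp) linarith

lemma bdist_geI:
  assumes "bounded U" "\<And>y. norm (x - y) < r \<Longrightarrow> y \<in> U" shows "r \<le> bdist U x"
  unfolding bdist_def infdist_notempty[OF Compl_bounded_ne[OF assms(1)]]
  by (rule cINF_greatest[OF Compl_bounded_ne[OF assms(1)]]) (metis ComplD assms(2) dist_norm not_le)

text \<open>A displacement \<open>e\<close> shorter than the averaged radius \<open>s\<close> is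
  split into displacements of \<open>a\<close> and \<open>b\<close> proportional to their own
  distances. Both displaced points stay in \<open>U\<close>, and their convex combination is the
  displaced point.\<close>

lemma bdist_concave:
  assumes U: "bounded U" "convex U" "open U" and ab: "a \<in> U" "b \<in> U" and uv: "0 \<le> u" "0 \<le> v" "u + v = 1"
  shows "u * bdist U a + v * bdist U b \<le> bdist U (u *\<^sub>R a + v *\<^sub>R b)"
proof -
  define s where "s = u * bdist U a + v * bdist U b"
  note p = bdist_pos[OF U(1,3) ab(1)] bdist_pos[OF U(1,3) ab(2)]
  have "0 < u \<or> 0 < v" using uv by linarith
  then have s: "0 < s" using p uv unfolding s_def by (auto intro: add_pos_nonneg add_nonneg_pos)
  show ?thesis
    unfolding s_def[symmetric]
  proof (rule bdist_geI[OF U(1)])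
    fix y assume y: "norm (u *\<^sub>R a + v *\<^sub>R b - y) < s"
    define e where "e = y - (u *\<^sub>R a + v *\<^sub>R b)"
    have sc: "x + (bdist U x / s) *\<^sub>R e \<in> U" if "0 < bdist U x" for x
    proof (rule bdist_ball[of x])
      have "norm e < s" using y by (simp add: e_def norm_minus_commute)
      then have "bdist U x / s * norm e < bdist U x / s * s" using that s by (intro mult_strict_left_mono) auto
      then show "norm (x - (x + (bdist U x / s) *\<^sub>R e)) < bdist U x" using s that by simp
    qed
    have "u *\<^sub>R (a + (bdist U a / s) *\<^sub>R e) + v *\<^sub>R (b + (bdist U b / s) *\<^sub>R e) = u *\<^sub>R a + v *\<^sub>R b + ((u * bdist U a + v * bdist U b) / s) *\<^sub>R e"
      by (simp add: algebra_simps add_divide_distrib)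
    also have "\<dots> = y" using s by (simp add: s_def[symmetric] e_def)
    finally show "y \<in> U" using convexD[OF U(2) sc[OF p(1)] sc[OF p(2)] uv] by simp
  qed
qed

lemma cutdist_props:
  assumes "1 \<le> n"
  shows "0 \<le> cutdist U n x" "cutdist U n x \<le> 1" "x \<notin> U \<Longrightarrow> cutdist U n x = 0"
    "\<bar>cutdist U n x - cutdist U n y\<bar> \<le> n * norm (x - y)" "continuous_on S (cutdist U n)"
proof -
  show "0 \<le> cutdist U n x" "cutdist U n x \<le> 1" "x \<notin> U \<Longrightarrow> cutdist U n x = 0"
    using assms by (auto simp: cutdist_def bdist_outside)
  have "\<bar>n * bdist U x - n * bdist U y\<bar> = n * \<bar>bdist U x - bdist U y\<bar>"
    using assms by (simp add: abs_mult flip: right_diff_distrib)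
  also have "\<dots> \<le> n * norm (x - y)" using assms by (intro mult_left_mono bdist_Lipschitz) auto
  finally have "\<bar>n * bdist U x - n * bdist U y\<bar> \<le> n * norm (x - y)" .
  moreover have "\<bar>min 1 a - min 1 b\<bar> \<le> \<bar>a - b\<bar>" for a b :: real by (auto simp: min_def)
  ultimately show "\<bar>cutdist U n x - cutdist U n y\<bar> \<le> n * norm (x - y)" unfolding cutdist_def by (rule order.trans[rotated])
  show "continuous_on S (cutdist U n)" unfolding cutdist_def by (intro continuous_intros bdist_continuous)
qed

lemma cutdist_concave:
  assumes U: "bounded U" "convex U" "open U" and n: "1 \<le> n" and ab: "a \<in> U" "b \<in> U" and uv: "0 \<le> u" "0 \<le> v" "u + v = 1"
  shows "u * cutdist U n a + v * cutdist U n b \<le> cutdist U n (u *\<^sub>R a + v *\<^sub>R b)"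
proof -
  have "u * cutdist U n a + v * cutdist U n b \<le> u * 1 + v * 1"
    using uv by (intro add_mono mult_left_mono) (auto simp: cutdist_def)
  moreover have "u * cutdist U n a + v * cutdist U n b \<le> u * (n * bdist U a) + v * (n * bdist U b)"
    using uv by (intro add_mono mult_left_mono) (auto simp: cutdist_def)
  moreover have "n * (u * bdist U a + v * bdist U b) \<le> n * bdist U (u *\<^sub>R a + v *\<^sub>R b)"
    using n by (intro mult_left_mono bdist_concave[OF U ab uv]) auto
  ultimately show ?thesis using uv by (simp add: cutdist_def algebra_simps)
qed

section \<open>The mollified distance function\<close>

lemma conv_translate:
  assumes "continuous_on UNIV f" "\<phi> \<in> \<D> X"
  shows "conv f \<phi> (x + v) = conv (\<lambda>y. f (y + v)) \<phi> x"
proof -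
  have "continuous_on UNIV (\<lambda>y. f y * \<phi> (x + v - y))"
    by (intro continuous_intros assms(1) continuous_on_compose2[OF test_continuous[OF assms(2), of UNIV]]) auto
  from integral_translate[OF this, of v] show ?thesis by (simp add: conv_def algebra_simps)
qed

lemma conv_add:
  assumes "integrable lebesgue f" "integrable lebesgue g" "\<phi> \<in> \<D> X"
  shows "conv (\<lambda>y. f y + g y) \<phi> x = conv f \<phi> x + conv g \<phi> x"
  unfolding conv_def using conv_integrable[OF assms(1,3)] conv_integrable[OF assms(2,3)] by (simp add: distrib_right)

lemma conv_scale: "conv (\<lambda>y. c * f y) \<phi> x = c * conv f \<phi> x"
  unfolding conv_def by (simp add: mult.assoc)

lemma cutdist_integrable:
  assumes "bounded U" "1 \<le> n"
  shows "integrable lebesgue (cutdist U n)" "integrable lebesgue (\<lambda>y. cutdist U n (y + v))"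
proof -
  have 2: "integrable lebesgue (\<lambda>y. cutdist U n (y + v))" for v
  proof (rule integrable_continuous_compact_support)
    show "continuous_on UNIV (\<lambda>y. cutdist U n (y + v))"
      by (intro continuous_on_compose2[OF cutdist_props(5)[OF assms(2)]] continuous_intros) auto
    show "compact ((\<lambda>y. y - v) ` closure U)" using assms by (intro compact_continuous_image continuous_intros) (simp add: compact_closure)
    show "cutdist U n (x + v) = 0" if "x \<notin> (\<lambda>y. y - v) ` closure U" for x
    proof (rule cutdist_props(3)[OF assms(2)])
      show "x + v \<notin> U" using that closure_subset[of U] by (metis add_diff_cancel_right' image_eqI subsetD)
    qed
  qed
  show "integrable lebesgue (\<lambda>y. cutdist U n (y + v))" by (rule 2)
  show "integrable lebesgue (cutdist U n)" using 2[of 0] by simp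
qed

text \<open>If \<open>c\<close> were positive, \<open>\<phi> t + \<phi> (- t)\<close> would have a
  positive derivative for small positive \<open>t\<close> and would exceed its value at 0.\<close>

lemma second_derivative_nonpos:
  fixes \<phi> :: "real \<Rightarrow> real"
  assumes D: "\<And>t. (\<phi> has_real_derivative \<phi>' t) (at t)" "(\<phi>' has_real_derivative c) (at 0)"
    and e: "0 < e" "\<And>t. 0 < t \<Longrightarrow> t < e \<Longrightarrow> \<phi> t + \<phi> (- t) \<le> 2 * \<phi> 0"
  shows "c \<le> 0"
proof (rule ccontr)
  assume "\<not> c \<le> 0"
  have D2: "((\<lambda>t. \<phi>' t - \<phi>' (- t)) has_real_derivative 2 * c) (at 0)"
  proof -
    have "((\<lambda>t. \<phi>' (- t)) has_real_derivative c * (-1)) (at 0)"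
      by (rule DERIV_chain2[where f=\<phi>']) (use D(2) in \<open>auto intro!: derivative_eq_intros\<close>)
    from DERIV_diff[OF D(2) this] show ?thesis by simp
  qed
  obtain d where d: "0 < d" "\<And>h. 0 < h \<Longrightarrow> h < d \<Longrightarrow> 0 < \<phi>' h - \<phi>' (- h)"
    using DERIV_pos_inc_right[OF D2] \<open>\<not> c \<le> 0\<close> by auto
  define s where "s = min d e / 2"
  have s: "0 < s" "s < d" "s < e" using d e by (auto simp: s_def)
  have D1: "((\<lambda>t. \<phi> t + \<phi> (- t)) has_real_derivative \<phi>' t - \<phi>' (- t)) (at t)" for t
  proof -
    have "((\<lambda>t. \<phi> (- t)) has_real_derivative \<phi>' (- t) * (-1)) (at t)"
      by (rule DERIV_chain2[where f=\<phi>, OF D(1)]) (auto intro!: derivative_eq_intros)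
    from DERIV_add[OF D(1) this] show ?thesis by simp
  qed
  obtain u where u: "0 < u" "u < s" "(\<phi> s + \<phi> (- s)) - (\<phi> 0 + \<phi> (- 0)) = (s - 0) * (\<phi>' u - \<phi>' (- u))"
    using MVT2[OF s(1) D1] by blast
  have "0 < s * (\<phi>' u - \<phi>' (- u))" using d(2)[of u] u s by (intro mult_pos_pos) auto
  then show False using u(3) e(2)[OF s(1,3)] by simp
qed

lemma smooth_line_DERIV:
  fixes \<psi> :: "real^'d \<Rightarrow> real"
  assumes "smooth \<psi>"
  shows "((\<lambda>t. \<psi> (x + t *\<^sub>R (a *\<^sub>R axis i 1 + b *\<^sub>R axis j 1))) has_real_derivative
    a * pd i \<psi> (x + t *\<^sub>R (a *\<^sub>R axis i 1 + b *\<^sub>R axis j 1)) + b * pd j \<psi> (x + t *\<^sub>R (a *\<^sub>R axis i 1 + b *\<^sub>R axis j 1))) (at t)"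
proof -
  let ?v = "a *\<^sub>R axis i 1 + b *\<^sub>R axis j 1 :: real^'d"
  let ?D = "frechet_derivative \<psi> (at (x + t *\<^sub>R ?v))"
  have D: "(\<psi> has_derivative ?D) (at (x + t *\<^sub>R ?v))"
    using smooth_differentiable[OF assms] frechet_derivative_works by blast
  have "((\<lambda>t. \<psi> (x + t *\<^sub>R ?v)) has_derivative (\<lambda>s. ?D (s *\<^sub>R ?v))) (at t)"
    by (rule has_derivative_compose[of "\<lambda>t. x + t *\<^sub>R ?v" "\<lambda>s. s *\<^sub>R ?v" t UNIV \<psi>])
      (use D in \<open>auto intro!: derivative_eq_intros\<close>)
  moreover have eqf: "(\<lambda>s. ?D (s *\<^sub>R ?v)) = (*) (a * pd i \<psi> (x + t *\<^sub>R ?v) + b * pd j \<psi> (x + t *\<^sub>R ?v))"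
  proof -
    interpret linear ?D by (rule linear_frechet_derivative[OF smooth_differentiable[OF assms]])
    show ?thesis by (simp add: scale add pderiv_at_def fun_eq_iff)
  qed
  ultimately show ?thesis unfolding has_field_derivative_def by (simp only: eqf)
qed

text \<open>Lipschitz bounds and concavity are statements about first and second differences, which
  mollification averages. \<open>cutdist\<close> is concave only inside \<open>U\<close>, hence the
  second differences are considered only where the ball of radius \<rho>, slightly enlarged, stays
  in \<open>U\<close>.\<close>

lemma mollified_cutdist:
  fixes U :: "(real^'d) set" and i j :: 'd
  assumes U: "bounded U" "convex U" "open U" and n: "1 \<le> n" and r: "0 < \<rho>"
  defines "\<psi> \<equiv> conv (cutdist U n) (mol \<rho>)"
  shows "\<psi> \<in> \<D> UNIV" "\<bar>\<psi> x - cutdist U n x\<bar> \<le> n * \<rho>" "\<bar>pd k \<psi> x\<bar> \<le> n" "\<psi> x \<le> 1"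
    "\<rho> < bdist U x \<Longrightarrow> a\<^sup>2 * pd i (pd i \<psi>) x + 2 * a * b * pd i (pd j \<psi>) x + b\<^sup>2 * pd j (pd j \<psi>) x \<le> 0"
proof -
  let ?g = "cutdist U n"
  note gi = cutdist_integrable[OF U(1) n] and gp = cutdist_props[where U=U, OF n]
  note mt = mol_test[OF r, where 'd='d]
  have tr: "\<psi> (x + v) = conv (\<lambda>y. ?g (y + v)) (mol \<rho>) x" for x v
    unfolding \<psi>_def by (rule conv_translate[OF gp(5) mt])
  show \<psi>t: "\<psi> \<in> \<D> UNIV"
  proof (cases "U = {}")
    case True
    then have "?g = (\<lambda>x. 0)" using gp(3) by auto
    then have "\<psi> = (\<lambda>x. 0)" by (auto simp: \<psi>_def conv_def)
    then show ?thesis by simp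
  next
    case False
    have cc: "compact (closure U)" "closure U \<noteq> {}" using U(1) False by (auto simp: compact_closure)
    show ?thesis
    proof (rule test_functionsI[OF _ compact_infdist_le[OF cc, of \<rho>]])
      show "smooth \<psi>" unfolding \<psi>_def by (rule conv_smooth[OF gi(1) mt])
      show "\<psi> x = 0" if "x \<notin> {x. infdist x (closure U) \<le> \<rho>}" for x
        unfolding \<psi>_def
      proof (rule conv_mol_support_infdist[OF r, of 0 "closure U"])
        fix y assume "0 < infdist y (closure U)"
        then have "y \<notin> closure U" using infdist_zero by fastforce
        then show "?g y = 0" using gp(3) closure_subset by blast
      qed (use that in auto)
    qed simp
  qed
  have \<psi>s: "smooth \<psi>" by (rule test_smooth[OF \<psi>t])
  show "\<bar>\<psi> x - ?g x\<bar> \<le> n * \<rho>" unfolding \<psi>_def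
    by (rule conv_mol_Lipschitz[OF r gi(1)]) (use n gp(4) in auto)
  show "\<psi> x \<le> 1" unfolding \<psi>_def by (rule conv_mol_bound[OF r gi(1)]) (simp add: gp(2))
  have lip: "\<psi> (x + v) - \<psi> x \<le> n * norm v" for x v
  proof -
    have "conv (\<lambda>y. ?g (y + v) + (-1) * ?g y) (mol \<rho>) x \<le> n * norm v"
    proof (rule conv_mol_bound[OF r])
      show "AE y in lebesgue. norm (x - y) < \<rho> \<longrightarrow> ?g (y + v) + (-1) * ?g y \<le> n * norm v"
      proof (intro AE_I2 impI)
        fix y
        show "?g (y + v) + (-1) * ?g y \<le> n * norm v" using gp(4)[of "y + v" y] by (simp add: abs_le_iff)
      qed
    qed (use gi in auto)
    moreover have "conv (\<lambda>y. ?g (y + v) + (-1) * ?g y) (mol \<rho>) x = \<psi> (x + v) + (-1) * \<psi> x"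
      unfolding tr using conv_add[OF gi(2) integrable_mult_right[OF gi(1)] mt, of v "-1" x] by (simp add: conv_scale \<psi>_def conv_minus)
    ultimately show ?thesis by simp
  qed
  show "\<bar>pd k \<psi> x\<bar> \<le> n"
  proof -
    have D: "((\<lambda>t. \<psi> (x + t *\<^sub>R axis k 1)) has_real_derivative pd k \<psi> x) (at 0)"
      using smooth_dirderiv[OF \<psi>s, of k] by (simp add: dirderiv_def)
    have b: "\<bar>(\<psi> (x + t *\<^sub>R axis k 1) - \<psi> x) / t\<bar> \<le> n" if "t \<noteq> 0" for t
    proof -
      have "\<psi> (x + t *\<^sub>R axis k 1) - \<psi> x \<le> n * \<bar>t\<bar>" using lip[of x "t *\<^sub>R axis k 1"] by simp
      moreover have "\<psi> x - \<psi> (x + t *\<^sub>R axis k 1) \<le> n * \<bar>t\<bar>"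
        using lip[of "x + t *\<^sub>R axis k 1" "- (t *\<^sub>R axis k 1)"] by simp
      ultimately show ?thesis using that by (simp add: abs_divide divide_le_eq abs_le_iff)
    qed
    have "((\<lambda>t. \<bar>(\<psi> (x + t *\<^sub>R axis k 1) - \<psi> x) / t\<bar>) \<longlongrightarrow> \<bar>pd k \<psi> x\<bar>) (at 0)"
      using tendsto_rabs[OF D[unfolded DERIV_def]] by simp
    from tendsto_upperbound[OF this eventually_mono[OF eventually_neq_at_within[of 0] b]] show ?thesis by simp
  qed
  show "a\<^sup>2 * pd i (pd i \<psi>) x + 2 * a * b * pd i (pd j \<psi>) x + b\<^sup>2 * pd j (pd j \<psi>) x \<le> 0"
    if x: "\<rho> < bdist U x"
  proof -
    define v where "v = a *\<^sub>R axis i 1 + b *\<^sub>R (axis j 1 :: real^'d)"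
    define \<phi>' where "\<phi>' t = a * pd i \<psi> (x + t *\<^sub>R v) + b * pd j \<psi> (x + t *\<^sub>R v)" for t
    have D1: "((\<lambda>t. \<psi> (x + t *\<^sub>R v)) has_real_derivative \<phi>' t) (at t)" for t
      unfolding \<phi>'_def v_def by (rule smooth_line_DERIV[OF \<psi>s])
    have D2: "(\<phi>' has_real_derivative a * (a * pd i (pd i \<psi>) (x + 0 *\<^sub>R v) + b * pd j (pd i \<psi>) (x + 0 *\<^sub>R v))
        + b * (a * pd i (pd j \<psi>) (x + 0 *\<^sub>R v) + b * pd j (pd j \<psi>) (x + 0 *\<^sub>R v))) (at 0)"
      unfolding \<phi>'_def v_def by (intro DERIV_add DERIV_cmult smooth_line_DERIV smooth_pderiv \<psi>s)
    define e where "e = (bdist U x - \<rho>) / (norm v + 1)"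
    have e: "0 < e" using x by (simp add: e_def add_nonneg_pos)
    have "a * (a * pd i (pd i \<psi>) (x + 0 *\<^sub>R v) + b * pd j (pd i \<psi>) (x + 0 *\<^sub>R v))
        + b * (a * pd i (pd j \<psi>) (x + 0 *\<^sub>R v) + b * pd j (pd j \<psi>) (x + 0 *\<^sub>R v)) \<le> 0"
    proof (rule second_derivative_nonpos[OF D1 D2 e])
      fix t assume t: "0 < t" "t < e"
      define u where "u = t *\<^sub>R v"
      have un: "norm u < bdist U x - \<rho>"
      proof -
        have "norm u \<le> t * (norm v + 1)" using t by (simp add: u_def)
        also have "\<dots> < e * (norm v + 1)" using t by (intro mult_strict_right_mono) (auto simp: add_nonneg_pos)
        also have "\<dots> = bdist U x - \<rho>"
        proof -
          have "norm v + 1 \<noteq> 0" using norm_ge_zero[of v] by linarith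
          then show ?thesis by (simp add: e_def)
        qed
        finally show ?thesis .
      qed
      have "conv (\<lambda>y. (?g (y + u) + ?g (y + - u)) + (-2) * ?g y) (mol \<rho>) x \<le> 0"
      proof (rule conv_mol_bound[OF r])
        show "AE y in lebesgue. norm (x - y) < \<rho> \<longrightarrow> (?g (y + u) + ?g (y + - u)) + (-2) * ?g y \<le> 0"
        proof (intro AE_I2 impI)
          fix y assume y: "norm (x - y) < \<rho>"
          have "norm (x - (y + u)) < bdist U x" "norm (x - (y - u)) < bdist U x"
            using norm_triangle_ineq4[of "x - y" u] norm_triangle_ineq[of "x - y" u] y un by (simp_all add: algebra_simps)
          then have "y + u \<in> U" "y - u \<in> U" by (auto intro: bdist_ball)
          then show "(?g (y + u) + ?g (y + - u)) + (-2) * ?g y \<le> 0" using cutdist_concave[OF U n, of "y + u" "y - u" "1/2" "1/2"]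
            by (simp add: scaleR_2[symmetric] flip: scaleR_add_right)
        qed
      qed (use gi in \<open>intro Bochner_Integration.integrable_add integrable_mult_right\<close>)
      moreover have "conv (\<lambda>y. (?g (y + u) + ?g (y + - u)) + (-2) * ?g y) (mol \<rho>) x = (\<psi> (x + u) + \<psi> (x + - u)) + (-2) * \<psi> x"
        unfolding tr
        using conv_add[OF Bochner_Integration.integrable_add[OF gi(2)[of u] gi(2)[of "-u"]] integrable_mult_right[OF gi(1)] mt, of "-2" x]
          conv_add[OF gi(2)[of u] gi(2)[of "-u"] mt, of x] conv_scale[of "-2" ?g "mol \<rho>" x] by (simp add: \<psi>_def)
      ultimately show "\<psi> (x + t *\<^sub>R v) + \<psi> (x + (- t) *\<^sub>R v) \<le> 2 * \<psi> (x + 0 *\<^sub>R v)" by (simp add: u_def)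
    qed
    then show ?thesis using pderiv_commute[OF \<psi>s, of j i x] by (simp add: power2_eq_square algebra_simps)
  qed
qed

section \<open>Integrability of negative powers of the distance\<close>

lemma powr_concave:
  fixes a s \<alpha> :: real
  assumes "0 \<le> a" "0 \<le> s" "0 < a + s" "0 < \<alpha>" "\<alpha> < 1"
  shows "a powr \<alpha> + \<alpha> * s * (a + s) powr (\<alpha> - 1) \<le> (a + s) powr \<alpha>"
proof (cases "a = 0")
  case True
  have "s powr \<alpha> = s * s powr (\<alpha> - 1)" using assms True by (simp add: powr_diff)
  then show ?thesis using True assms mult_right_mono[of \<alpha> 1 "s powr \<alpha>"] by (simp add: mult.assoc)
next
  case False
  have "a powr \<alpha> * (a + s) powr (1 - \<alpha>) \<le> \<alpha> * a + (1 - \<alpha>) * (a + s)"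
    by (rule Youngs_inequality_0) (use assms False in auto)
  then have "a powr \<alpha> * (a + s) powr (1 - \<alpha>) * (a + s) powr (\<alpha> - 1) \<le> (\<alpha> * a + (1 - \<alpha>) * (a + s)) * (a + s) powr (\<alpha> - 1)"
    by (rule mult_right_mono) simp
  moreover have "a powr \<alpha> * (a + s) powr (1 - \<alpha>) * (a + s) powr (\<alpha> - 1) = a powr \<alpha>"
    using assms by (simp add: mult.assoc flip: powr_add)
  moreover have "(a + s) powr \<alpha> = (a + s) * (a + s) powr (\<alpha> - 1)" using assms by (simp add: powr_diff)
  moreover have "(\<alpha> * a + (1 - \<alpha>) * (a + s)) * p = (a + s) * p - \<alpha> * s * p" for p by (simp add: algebra_simps)
  ultimately show ?thesis by simp
qed

lemma nn_integral_dilation: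
  fixes g :: "real^'d \<Rightarrow> ennreal"
  assumes g: "g \<in> borel_measurable borel" and c: "0 < c"
  shows "(\<integral>\<^sup>+x. g x \<partial>lborel) = ennreal (c ^ CARD('d)) * (\<integral>\<^sup>+x. g (t + c *\<^sub>R x) \<partial>lborel)"
  using c g by (subst lborel_affine[of c t]) (auto simp: nn_integral_density nn_integral_distr nn_integral_cmult ennreal_power)

text \<open>Comparing the integral of \<open>d powr \<alpha>\<close> with that of its dilation towards a maximum point of the concave
  function \<open>d\<close> bounds the integral of its derivative in the direction of that point.\<close>

lemma cutdist_powr_integral:
  fixes U :: "(real^'d) set"
  assumes U: "bounded U" "convex U" "open U" and n: "1 \<le> n"
  obtains A where "0 \<le> A" "\<And>\<alpha>. 0 < \<alpha> \<Longrightarrow> \<alpha> < 1 \<Longrightarrow> integrable (\<L> U) (\<lambda>x. cutdist U n x powr (\<alpha> - 1))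
     \<and> (LINT x|\<L> U. cutdist U n x powr (\<alpha> - 1)) \<le> A / \<alpha>"
proof (cases "U = {}")
  case True
  have "integrable (\<L> {}) h" "(LINT x|\<L> {}. h x) = 0" for h :: "real^'d \<Rightarrow> real"
    using Lebesgue_Measure.integrable_restrict_UNIV[of "{}" h] Lebesgue_Measure.integral_restrict_UNIV[of "{}" h] by simp_all
  then show thesis using that[of 0] True by simp
next
  case False
  let ?g = "cutdist U n"
  note gp = cutdist_props[where U=U, OF n]
  define m where "m = measure lebesgue U"
  define d where "d = CARD('d)"
  have lm: "U \<in> lmeasurable" using U by (simp add: lmeasurable_open)
  obtain x0 where x0: "x0 \<in> U" "\<And>x. ?g x \<le> ?g x0"
  proof -
    obtain y where y: "y \<in> closure U" "\<And>x. x \<in> closure U \<Longrightarrow> ?g x \<le> ?g y"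
      using continuous_attains_sup[of "closure U" ?g] U(1) False gp(5) by (auto simp: compact_closure)
    have g: "?g x \<le> ?g y" for x using y(2)[of x] gp(1)[of y] gp(3)[of x] closure_subset[of U] by (cases "x \<in> U") auto
    obtain x where "x \<in> U" using False by blast
    then have "0 < ?g x" using bdist_pos[OF U(1,3)] n by (simp add: cutdist_def)
    then have "y \<in> U" using g[of x] gp(3)[of y] by fastforce
    then show thesis using that g by blast
  qed
  define c0 where "c0 = ?g x0"
  have gpos: "0 < ?g x" if "x \<in> U" for x using bdist_pos[OF U(1,3) that] n by (simp add: cutdist_def)
  have c0: "0 < c0" unfolding c0_def by (rule gpos[OF x0(1)])
  have gm: "?g \<in> borel_measurable borel" by (rule borel_measurable_continuous_onI[OF gp(5)])
  have Ub: "U \<in> sets borel" using U(3) by simp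
  have main: "(\<integral>\<^sup>+x. ennreal (?g x powr (\<alpha> - 1)) * indicator U x \<partial>lborel) \<le> ennreal ((d * 2 ^ d * m + m) / c0 / \<alpha>)" if \<alpha>: "0 < \<alpha>" "\<alpha> < 1" for \<alpha>
  proof -
    define G where "G x = ennreal (?g x powr \<alpha>)" for x
    have Gm: "G \<in> borel_measurable borel" unfolding G_def using gm by measurable
    have "(\<integral>\<^sup>+x. G x \<partial>lborel) \<le> (\<integral>\<^sup>+x. indicator U x \<partial>lborel)"
      using gp(1-3) \<alpha> by (intro nn_integral_mono) (auto simp: G_def indicator_def powr_le1)
    also have "\<dots> = ennreal m" using emeasure_eq_measure2[OF lm] Ub by (simp add: m_def emeasure_completion)
    finally have Gle: "(\<integral>\<^sup>+x. G x \<partial>lborel) \<le> ennreal m" .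
    define i where "i = enn2real (\<integral>\<^sup>+x. G x \<partial>lborel)"
    have i: "(\<integral>\<^sup>+x. G x \<partial>lborel) = ennreal i" "0 \<le> i" "i \<le> m"
      using Gle unfolding i_def by (auto simp: enn2real_leI m_def intro!: ennreal_enn2real[symmetric] le_less_trans[OF Gle])
    \<comment> \<open>\<open>\<alpha> * t * k t x\<close> is a lower bound for the gain of
      \<open>G\<close> when \<open>x\<close> moves the fraction \<open>t\<close> of the way to
      \<open>x0\<close>; it combines the concavity of \<open>cutdist\<close> with that of the
      power.\<close>
    define k where "k t x = ennreal ((c0 - ?g x) * (?g x + t * (c0 - ?g x)) powr (\<alpha> - 1)) * indicator U x" for t x
    have km: "k t \<in> borel_measurable lborel" for t unfolding k_def using gm Ub by measurable
    have kb: "(\<integral>\<^sup>+x. k t x \<partial>lborel) \<le> ennreal (d * 2 ^ d * m / \<alpha>)" if t: "0 < t" "t \<le> 1/2" for t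
    proof -
      have pt: "G x + ennreal (\<alpha> * t) * k t x \<le> G (t *\<^sub>R x0 + (1 - t) *\<^sub>R x)" for x
      proof (cases "x \<in> U")
        case True
        define s where "s = t * (c0 - ?g x)"
        have s: "0 \<le> s" "0 \<le> c0 - ?g x" using t x0(2)[of x] by (simp_all add: s_def c0_def)
        have "?g x + s = t * c0 + (1 - t) * ?g x" by (simp add: s_def algebra_simps)
        also have "\<dots> \<le> ?g (t *\<^sub>R x0 + (1 - t) *\<^sub>R x)"
          unfolding c0_def by (rule cutdist_concave[OF U n x0(1) True]) (use t in auto)
        finally have "(?g x + s) powr \<alpha> \<le> ?g (t *\<^sub>R x0 + (1 - t) *\<^sub>R x) powr \<alpha>" using \<alpha> s gp(1)[of x] by (intro powr_mono2) auto
        then have "?g x powr \<alpha> + \<alpha> * s * (?g x + s) powr (\<alpha> - 1) \<le> ?g (t *\<^sub>R x0 + (1 - t) *\<^sub>R x) powr \<alpha>"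
          using powr_concave[OF gp(1)[of x] s(1) _ \<alpha>] gpos[OF True] s by simp
        moreover have "\<alpha> * s * (?g x + s) powr (\<alpha> - 1) = \<alpha> * t * ((c0 - ?g x) * (?g x + t * (c0 - ?g x)) powr (\<alpha> - 1))" by (simp add: s_def)
        ultimately show ?thesis
          using True t \<alpha> s by (simp add: G_def k_def ennreal_mult[symmetric] ennreal_plus[symmetric] del: ennreal_plus)
      next
        case False
        then show ?thesis using gp(3) by (simp add: G_def k_def)
      qed
      have t1: "0 < 1 - t" using t by simp
      define e where "e = (\<integral>\<^sup>+x. G (t *\<^sub>R x0 + (1 - t) *\<^sub>R x) \<partial>lborel)"
      have e: "ennreal i = ennreal ((1 - t) ^ d) * e" unfolding e_def i(1)[symmetric] d_def by (rule nn_integral_dilation[OF Gm t1])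
      have "ennreal i + ennreal (\<alpha> * t) * (\<integral>\<^sup>+x. k t x \<partial>lborel) = (\<integral>\<^sup>+x. G x + ennreal (\<alpha> * t) * k t x \<partial>lborel)"
        using Gm km by (simp add: nn_integral_add nn_integral_cmult i(1))
      also have "\<dots> \<le> e" unfolding e_def by (intro nn_integral_mono pt)
      also have "e \<le> ennreal (i + \<alpha> * t * (d * 2 ^ d * m / \<alpha>))"
      proof -
        define c where "c = (1 - t) ^ d"
        have c: "0 < c" "(1/2) ^ d \<le> c" unfolding c_def using t by (auto intro: power_mono)
        \<comment> \<open>Since \<open>t \<le> 1/2\<close>, the Jacobian \<open>c\<close> is at
          least 2^-d, so Bernoulli's bound for \<open>1 - c\<close> can be stated relative to
          \<open>c\<close>. This is the origin of the factor \<open>2 ^ d\<close>.\<close>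
        have "1 + real d * (- t) \<le> (1 + (- t)) ^ d" by (rule Bernoulli_inequality) (use t in simp)
        then have "1 \<le> c + d * t * 1" by (simp add: c_def)
        also have "\<dots> \<le> c + d * t * (2 ^ d * c)"
        proof -
          have "(2 * (1/2)) ^ d \<le> 2 ^ d * c" unfolding power_mult_distrib using c by (intro mult_left_mono) auto
          then show ?thesis using t by (intro add_left_mono mult_left_mono) auto
        qed
        finally have "i * 1 \<le> i * (c * (1 + t * (d * 2 ^ d)))" using i(2) by (intro mult_left_mono) (auto simp: algebra_simps)
        also have "\<dots> = c * (i + t * (d * 2 ^ d) * i)" by (simp add: algebra_simps)
        also have "\<dots> \<le> c * (i + t * (d * 2 ^ d) * m)" using c t i by (intro mult_left_mono add_left_mono) auto
        finally have "ennreal i \<le> ennreal (c * (i + t * (d * 2 ^ d) * m))" by (simp add: ennreal_leI)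
        then have "ennreal c * e \<le> ennreal c * ennreal (i + t * (d * 2 ^ d) * m)"
          unfolding e[folded c_def] using c by (simp add: ennreal_mult')
        then have "e \<le> ennreal (i + t * (d * 2 ^ d) * m)" using c by (subst (asm) ennreal_mult_le_mult_iff) auto
        then show ?thesis using \<alpha> by (simp add: mult_ac)
      qed
      finally have "ennreal i + ennreal (\<alpha> * t) * (\<integral>\<^sup>+x. k t x \<partial>lborel) \<le> ennreal i + ennreal (\<alpha> * t) * ennreal (d * 2 ^ d * m / \<alpha>)"
        using i(2) \<alpha> t by (simp add: ennreal_mult'[symmetric] m_def)
      then show ?thesis using \<alpha> t by (simp add: ennreal_add_left_cancel_le ennreal_mult_le_mult_iff)
    qed
    define r where "r j = 1 / (2 + real j)" for j
    have r: "0 < r j" "r j \<le> 1/2" "r \<longlonglongrightarrow> 0" for j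
    proof -
      show "0 < r j" "r j \<le> 1/2" by (simp_all add: r_def)
      show "r \<longlonglongrightarrow> 0" unfolding r_def by real_asymp
    qed
    have "(\<integral>\<^sup>+x. k 0 x \<partial>lborel) = (\<integral>\<^sup>+x. liminf (\<lambda>j. k (r j) x) \<partial>lborel)"
    proof (rule nn_integral_cong)
      fix x
      have "(\<lambda>j. k (r j) x) \<longlonglongrightarrow> k 0 x"
      proof (cases "x \<in> U")
        case True
        then have "(\<lambda>j. (c0 - ?g x) * (?g x + r j * (c0 - ?g x)) powr (\<alpha> - 1)) \<longlonglongrightarrow> (c0 - ?g x) * (?g x + 0 * (c0 - ?g x)) powr (\<alpha> - 1)"
          using gpos[OF True] by (intro tendsto_intros r) auto
        then show ?thesis using True by (simp add: k_def tendsto_ennrealI)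
      qed (simp add: k_def)
      then show "k 0 x = liminf (\<lambda>j. k (r j) x)" by (simp add: lim_imp_Liminf)
    qed
    also have "\<dots> \<le> liminf (\<lambda>j. \<integral>\<^sup>+x. k (r j) x \<partial>lborel)" by (rule nn_integral_liminf[OF km])
    also have "\<dots> \<le> ennreal (d * 2 ^ d * m / \<alpha>)" using kb[OF r(1,2)] by (intro Liminf_le) auto
    finally have k0: "(\<integral>\<^sup>+x. k 0 x \<partial>lborel) \<le> ennreal (d * 2 ^ d * m / \<alpha>)" .
    \<comment> \<open>Writing \<open>c0\<close> as the sum of \<open>c0 - cutdist U n x\<close> and
      \<open>cutdist U n x\<close> splits the integrand into the limit \<open>k 0\<close> and
      \<open>G\<close>, both already bounded.\<close>
    have "ennreal c0 * (\<integral>\<^sup>+x. ennreal (?g x powr (\<alpha> - 1)) * indicator U x \<partial>lborel) = (\<integral>\<^sup>+x. ennreal c0 * (ennreal (?g x powr (\<alpha> - 1)) * indicator U x) \<partial>lborel)"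
      by (rule nn_integral_cmult[symmetric]) (use gm Ub in measurable)
    also have "\<dots> = (\<integral>\<^sup>+x. k 0 x + G x \<partial>lborel)"
    proof (rule nn_integral_cong)
      fix x
      show "ennreal c0 * (ennreal (?g x powr (\<alpha> - 1)) * indicator U x) = k 0 x + G x"
      proof (cases "x \<in> U")
        case True
        have "?g x powr \<alpha> = ?g x * ?g x powr (\<alpha> - 1)" using gpos[OF True] by (simp add: powr_diff)
        moreover have "ennreal ((c0 - ?g x) * q) + ennreal (?g x * q) = ennreal (c0 * q)" if "0 \<le> q" for q
          using x0(2)[of x] gp(1)[of x] that by (subst ennreal_plus[symmetric]) (auto simp: c0_def algebra_simps mult_left_mono)
        ultimately show ?thesis using True c0 by (simp add: k_def G_def ennreal_mult'[symmetric])
      qed (simp add: k_def G_def gp(3))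
    qed
    also have "\<dots> = (\<integral>\<^sup>+x. k 0 x \<partial>lborel) + ennreal i" using km Gm by (simp add: nn_integral_add i(1))
    also have "\<dots> \<le> ennreal (d * 2 ^ d * m / \<alpha>) + ennreal (m / \<alpha>)"
    proof (intro add_mono k0 ennreal_leI)
      have "m * \<alpha> \<le> m * 1" using \<alpha> by (intro mult_left_mono) (auto simp: m_def)
      then show "i \<le> m / \<alpha>" using i(3) \<alpha> by (simp add: pos_le_divide_eq) (meson mult_right_mono order.trans less_imp_le)
    qed
    also have "\<dots> = ennreal c0 * ennreal ((d * 2 ^ d * m + m) / c0 / \<alpha>)"
    proof -
      have "c0 * ((d * 2 ^ d * m + m) / c0 / \<alpha>) = d * 2 ^ d * m / \<alpha> + m / \<alpha>"
        using c0 by (simp add: add_divide_distrib[symmetric])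
      then show ?thesis using c0 \<alpha> by (simp add: m_def flip: ennreal_mult' ennreal_plus)
    qed
    finally show ?thesis using c0 by (simp add: ennreal_mult_le_mult_iff)
  qed
  show thesis
  proof (rule that[of "(d * 2 ^ d * m + m) / c0"])
    show A0: "0 \<le> (d * 2 ^ d * m + m) / c0" using c0 by (simp add: m_def)
    fix \<alpha> :: real assume \<alpha>: "0 < \<alpha>" "\<alpha> < 1"
    let ?M = "\<L> U"
    have bd: "(\<integral>\<^sup>+x. ennreal (?g x powr (\<alpha> - 1)) \<partial>?M) \<le> ennreal ((d * 2 ^ d * m + m) / c0 / \<alpha>)"
      using main[OF \<alpha>] by (simp add: nn_integral_restrict_space open_sets_lebesgue[OF U(3)] nn_integral_completion)
    have mm: "(\<lambda>x. ?g x powr (\<alpha> - 1)) \<in> borel_measurable ?M"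
      using continuous_measurable_lebesgue_on[OF U(3) gp(5)] by measurable
    have int: "integrable ?M (\<lambda>x. ?g x powr (\<alpha> - 1))"
      by (rule integrableI_nonneg[OF mm]) (auto intro: le_less_trans[OF bd])
    moreover have "(LINT x|?M. ?g x powr (\<alpha> - 1)) \<le> (d * 2 ^ d * m + m) / c0 / \<alpha>"
      using bd divide_nonneg_pos[OF A0 \<alpha>(1)] by (subst (asm) nn_integral_eq_integral[OF int]) (auto simp: ennreal_le_iff)
    ultimately show "integrable ?M (\<lambda>x. ?g x powr (\<alpha> - 1)) \<and> (LINT x|?M. ?g x powr (\<alpha> - 1)) \<le> (d * 2 ^ d * m + m) / c0 / \<alpha>" by blast
  qed
qed

section \<open>Regularity of weak solutions on convex domains\<close>

definition zext :: "(real^'d) set \<Rightarrow> (real^'d \<Rightarrow> real) \<Rightarrow> real^'d \<Rightarrow> real" where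
  "zext U z x = (if x \<in> U then z x else 0)"

lemma zext_integrable:
  assumes U: "bounded U" "open U" and z: "sqint (\<L> U) z"
  shows "integrable lebesgue (zext U z)"
proof -
  have "sqint (\<L> U) (\<lambda>x. 1)" by (rule sqint_bounded[OF U]) auto
  from sqint_mult[OF z this] show ?thesis
    unfolding zext_def[abs_def] Lebesgue_Measure.integrable_restrict_UNIV[OF open_sets_lebesgue[OF U(2)]] by simp
qed

lemma has_derivative_reflect:
  assumes "smooth \<phi>"
  shows "((\<lambda>y. \<phi> (x - y)) has_derivative (\<lambda>h. frechet_derivative \<phi> (at (x - y)) (- h))) (at y)"
  by (rule has_derivative_compose[of "\<lambda>y. x - y" uminus y UNIV \<phi>])
    (use smooth_differentiable[OF assms] frechet_derivative_works in \<open>auto intro!: derivative_eq_intros\<close>)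

lemma pderiv_reflect:
  assumes "smooth \<phi>"
  shows "pd i (\<lambda>y. \<phi> (x - y)) = (\<lambda>y. - pd i \<phi> (x - y))"
proof
  fix y
  interpret linear "frechet_derivative \<phi> (at (x - y))" by (rule linear_frechet_derivative[OF smooth_differentiable[OF assms]])
  show "pd i (\<lambda>y. \<phi> (x - y)) y = - pd i \<phi> (x - y)"
    using pderiv_at_eq[OF has_derivative_reflect[OF assms], of i x y] by (simp add: pderiv_at_def neg)
qed

lemma smooth_reflect:
  assumes "smooth \<phi>" shows "smooth (\<lambda>y. \<phi> (x - y))"
proof (rule smooth_coinduct[of _ "(\<lambda>\<phi> y. \<phi> (x - y)) ` Collect smooth"])
  show "f differentiable_on UNIV" if "f \<in> (\<lambda>\<phi> y. \<phi> (x - y)) ` Collect smooth" for f :: "real^'a \<Rightarrow> real"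
    using that has_derivative_reflect by (auto simp: differentiable_on_def differentiable_def)
  show "pd i f \<in> (\<lambda>\<phi> y. \<phi> (x - y)) ` Collect smooth"
    if f: "f \<in> (\<lambda>\<phi> y. \<phi> (x - y)) ` Collect smooth" for f :: "real^'a \<Rightarrow> real" and i
  proof -
    obtain \<psi> where \<psi>: "smooth \<psi>" "f = (\<lambda>y. \<psi> (x - y))" using f by blast
    show ?thesis unfolding \<psi>(2) pderiv_reflect[OF \<psi>(1)]
      by (rule image_eqI[of _ _ "\<lambda>y. - 1 * pd i \<psi> y"]) (use smooth_scale[OF smooth_pderiv[OF \<psi>(1)], of "-1" i] in auto)
  qed
qed (use assms in auto)

lemma mol_reflect_test:
  assumes "0 < \<rho>" "\<rho> < bdist U x" shows "(\<lambda>y. mol \<rho> (x - y)) \<in> \<D> U"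
proof (rule test_functionsI[OF smooth_reflect[OF test_smooth[OF mol_test[OF assms(1)]]] compact_cball[of x \<rho>]])
  show "cball x \<rho> \<subseteq> U" proof
    fix y assume "y \<in> cball x \<rho>"
    then show "y \<in> U" using assms(2) bdist_ball[of x y U] by (simp add: dist_norm)
  qed
  show "mol \<rho> (x - y) = 0" if "y \<notin> cball x \<rho>" for y
    using that by (intro mol_props(2)[OF assms(1)]) (auto simp: dist_norm)
qed

text \<open>At distance more than \<rho> from the boundary the reflected kernel is a test function
  on \<open>U\<close>, so the weak equation can be tested with it.\<close>

lemma mollified_laplacian:
  fixes U :: "(real^'d) set"
  assumes U: "bounded U" "open U" and w: "weak_sol U 0 z g f" and f: "f \<in> \<D> U"
    and r: "0 < \<rho>" "\<rho> < bdist U x"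
  shows "(\<Oplus>i. pd i (pd i (conv (zext U z) (mol \<rho>))) x) = - conv f (mol \<rho>) x"
proof -
  have H: "H10 U z g" using w by (simp add: weak_sol_def)
  note zi = zext_integrable[OF U H10_sqint(1)[OF H]]
  note mt = mol_test[OF r(1), where 'd='d]
  define \<eta> where "\<eta> y = mol \<rho> (x - y)" for y
  have \<eta>: "\<eta> \<in> \<D> U" unfolding \<eta>_def by (rule mol_reflect_test[OF r])
  have d1: "pd i \<eta> = (\<lambda>y. - pd i (mol \<rho>) (x - y))" for i
    unfolding \<eta>_def by (rule pderiv_reflect[OF test_smooth[OF mt]])
  have d2: "pd i (pd i \<eta>) = (\<lambda>y. pd i (pd i (mol \<rho>)) (x - y))" for i
  proof -
    have s: "smooth (\<lambda>y. pd i (mol \<rho>) (x - y))" by (intro smooth_reflect smooth_pderiv test_smooth[OF mt])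
    have "pd i (\<lambda>y. - 1 * pd i (mol \<rho>) (x - y)) = (\<lambda>y. - 1 * - pd i (pd i (mol \<rho>)) (x - y))"
      unfolding smooth_pderiv_scale[OF s] pderiv_reflect[OF smooth_pderiv[OF test_smooth[OF mt]]] ..
    then show ?thesis unfolding d1 by simp
  qed
  have "pd i (pd i (conv (zext U z) (mol \<rho>))) x = - L2_inner U (g i) (pd i \<eta>)" for i
  proof -
    have "pd i (pd i (conv (zext U z) (mol \<rho>))) x = (LINT y|lebesgue. zext U z y * pd i (pd i \<eta>) y)"
      unfolding conv_pderiv[OF zi mt] conv_pderiv[OF zi test_pderiv[OF mt]] d2 by (simp add: conv_def)
    also have "\<dots> = (LINT y|lebesgue. z y * pd i (pd i \<eta>) y)"
      using test_zero_outside[OF test_pderiv[OF test_pderiv[OF \<eta>]]] by (intro Bochner_Integration.integral_cong) (auto simp: zext_def)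
    also have "\<dots> = L2_inner U z (pd i (pd i \<eta>))"
      by (rule test_L2_inner[OF U(2) test_pderiv[OF test_pderiv[OF \<eta>]], symmetric])
    also have "\<dots> = - L2_inner U (g i) (pd i \<eta>)"
      by (rule has_weak_pderiv_test[OF H10_weak[OF U H] test_pderiv[OF \<eta>]])
    finally show ?thesis .
  qed
  then have "(\<Oplus>i. pd i (pd i (conv (zext U z) (mol \<rho>))) x) = - L2_inner U f \<eta>"
    using w \<eta> by (simp add: weak_sol_def sum_negf)
  also have "L2_inner U f \<eta> = conv f (mol \<rho>) x"
    unfolding test_L2_inner[OF U(2) \<eta>] conv_def \<eta>_def ..
  finally show ?thesis .
qed

text \<open>Mollification preserves the almost everywhere bound of \<open>z\<close> by the distance.
  \<open>C\<close> serves all \<open>n\<close> and \<rho>: the distance is at most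
  \<open>max 1 B\<close> times its minimum with 1, and \<open>cutdist\<close> increases with
  \<open>n\<close>.\<close>

lemma mollified_barrier:
  fixes U :: "(real^'d) set"
  assumes U: "bounded U" "convex U" "open U" and w: "weak_sol U 0 z g f" and f: "f \<in> \<D> U"
  obtains C where "0 \<le> C" "\<And>n \<rho> x. 1 \<le> n \<Longrightarrow> 0 < \<rho> \<Longrightarrow> \<bar>conv (zext U z) (mol \<rho>) x\<bar> \<le> C * conv (cutdist U n) (mol \<rho>) x"
proof -
  have z: "sqint (\<L> U) z" using w H10_sqint by (auto simp: weak_sol_def)
  note zi = zext_integrable[OF U(1,3) z]
  obtain M where M: "\<And>x. \<bar>f x\<bar> \<le> M" using test_bounded[OF f] by metis
  obtain C' where C': "0 \<le> C'" "AE x in \<L> U. \<bar>z x\<bar> \<le> C' * infdist x (- U)"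
    using distance_barrier[OF U w M] by blast
  obtain B where B: "0 \<le> B" "\<And>x. \<bar>bdist U x\<bar> \<le> B"
    using bounded_continuous_compact_support[OF bdist_continuous, of "closure U" U] U(1) bdist_outside closure_subset
    by (metis compact_closure subset_iff)
  define C where "C = C' * max 1 B"
  have le: "C' * bdist U x \<le> C * cutdist U n x" if n: "1 \<le> n" for n x
  proof -
    have "bdist U x \<le> max 1 B * min 1 (bdist U x)"
    proof (cases "bdist U x \<le> 1")
      case True
      have "1 * bdist U x \<le> max 1 B * bdist U x" by (intro mult_right_mono) auto
      then show ?thesis using True by simp
    next
      case False
      then show ?thesis using B(2)[of x] by simp
    qed
    also have "min 1 (bdist U x) \<le> cutdist U n x"
      using mult_right_mono[OF n bdist_nonneg[of U x]] by (simp add: cutdist_def min_def)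
    finally have "bdist U x \<le> max 1 B * cutdist U n x" by (simp add: mult_left_mono)
    then show ?thesis unfolding C_def mult.assoc by (rule mult_left_mono[OF _ C'(1)])
  qed
  have AE: "AE y in lebesgue. \<bar>zext U z y\<bar> \<le> C * cutdist U n y" if n: "1 \<le> n" for n
  proof -
    have "AE y in lebesgue. y \<in> U \<longrightarrow> \<bar>z y\<bar> \<le> C' * infdist y (- U)"
      using C'(2) by (simp add: AE_restrict_space_iff open_sets_lebesgue[OF U(3)])
    then show ?thesis
    proof eventually_elim
      case (elim y)
      then show ?case using le[OF n, of y] cutdist_props(3)[OF n, of y U] by (auto simp: zext_def bdist_def)
    qed
  qed
  have bd: "s * conv (zext U z) (mol \<rho>) x \<le> C * conv (cutdist U n) (mol \<rho>) x" if n: "1 \<le> n" and r: "0 < \<rho>" and s: "\<bar>s\<bar> = 1" for n \<rho> x s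
  proof -
    note gi = cutdist_integrable(1)[OF U(1) n] and mt = mol_test[OF r, where 'd='d]
    have "conv (\<lambda>y. s * zext U z y + (- C) * cutdist U n y) (mol \<rho>) x \<le> 0"
    proof (rule conv_mol_bound[OF r])
      show "AE y in lebesgue. norm (x - y) < \<rho> \<longrightarrow> s * zext U z y + (- C) * cutdist U n y \<le> 0"
        using AE[OF n]
      proof eventually_elim
        case (elim y)
        have "s * zext U z y \<le> \<bar>zext U z y\<bar>" using abs_ge_self[of "s * zext U z y"] s by (simp add: abs_mult)
        then show ?case using elim by simp
      qed
    qed (use gi zi in \<open>intro Bochner_Integration.integrable_add integrable_mult_right\<close>)
    then show ?thesis
      using conv_add[OF integrable_mult_right[OF zi] integrable_mult_right[OF gi] mt, of s "- C" x]
        conv_scale[of s "zext U z" "mol \<rho>" x] conv_scale[of "- C" "cutdist U n" "mol \<rho>" x] by simp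
  qed
  show thesis
  proof (rule that[of C])
    show "0 \<le> C" using C'(1) by (simp add: C_def)
    show "\<bar>conv (zext U z) (mol \<rho>) x\<bar> \<le> C * conv (cutdist U n) (mol \<rho>) x" if "1 \<le> n" "0 < \<rho>" for n \<rho> x
      using bd[OF that, of 1 x] bd[OF that, of "-1" x] by (simp add: abs_le_iff)
  qed
qed

text \<open>With \<delta> = 2 n r, the mollified function differs from \<open>cutdist\<close> by at
  most \<delta> / 2, so the two are comparable where the former exceeds \<delta>. There (\<delta> /
  \<psi>)^4 is at most (\<delta> / \<psi>)^(\<alpha>/2), which trades half of the exponent \<alpha>
  for a factor that tends to zero with \<delta>.\<close>

lemma jd_integral_bound:
  assumes U: "bounded U" "convex U" "open U" and n: "1 \<le> n" and \<alpha>: "0 < \<alpha>" "\<alpha> < 1" and r: "0 < r"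
    and A: "\<And>\<alpha>. 0 < \<alpha> \<Longrightarrow> \<alpha> < 1 \<Longrightarrow> integrable (\<L> U) (\<lambda>x. cutdist U n x powr (\<alpha> - 1))
      \<and> (LINT x|\<L> U. cutdist U n x powr (\<alpha> - 1)) \<le> A / \<alpha>"
    and ji: "integrable lebesgue (\<lambda>x. jd (2 * n * r) \<alpha> (conv (cutdist U n) (mol r) x))"
  shows "(LINT x|lebesgue. jd (2 * n * r) \<alpha> (conv (cutdist U n) (mol r) x)) \<le> 2 * \<alpha> * A + 4 * (2 * n * r) powr (\<alpha> / 2) * (A / \<alpha>)"
proof -
  let ?M = "\<L> U"
  let ?g = "cutdist U n"
  define \<delta> where "\<delta> = 2 * n * r"
  define \<psi> where "\<psi> = conv ?g (mol r)"
  have \<delta>: "0 < \<delta>" using n r by (simp add: \<delta>_def)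
  define h where "h x = 2 * \<alpha>\<^sup>2 * ?g x powr (\<alpha> - 1) + 2 * \<delta> powr (\<alpha> / 2) * ?g x powr (\<alpha> / 2 - 1)" for x
  have h0: "0 \<le> h x" for x by (simp add: h_def)
  note A1 = A[OF \<alpha>] and A2 = A[of "\<alpha> / 2"]
  have hi: "integrable ?M h" unfolding h_def using A1 A2 \<alpha> by simp
  have "(LINT x|lebesgue. jd \<delta> \<alpha> (\<psi> x)) \<le> (LINT x|lebesgue. (if x \<in> U then h x else 0))"
  proof (rule integral_mono)
    show "integrable lebesgue (\<lambda>x. jd \<delta> \<alpha> (\<psi> x))" using ji by (simp add: \<delta>_def \<psi>_def)
    show "integrable lebesgue (\<lambda>x. if x \<in> U then h x else 0)"
      unfolding Lebesgue_Measure.integrable_restrict_UNIV[OF open_sets_lebesgue[OF U(3)]] by (rule hi)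
    fix x
    show "jd \<delta> \<alpha> (\<psi> x) \<le> (if x \<in> U then h x else 0)"
    proof (cases "\<delta> < \<psi> x")
      case True
      have cl: "\<bar>\<psi> x - ?g x\<bar> \<le> n * r" unfolding \<psi>_def by (rule mollified_cutdist(2)[OF U n r])
      have g: "0 < ?g x" "?g x / 2 \<le> \<psi> x" using cl True \<delta> by (auto simp: \<delta>_def abs_le_iff)
      have x: "x \<in> U" using g(1) cutdist_props(3)[OF n, of x U] by fastforce
      have p: "\<psi> x powr (\<beta> - 1) \<le> 2 * ?g x powr (\<beta> - 1)" if \<beta>: "0 < \<beta>" "\<beta> < 1" for \<beta>
      proof -
        have "\<psi> x powr (\<beta> - 1) \<le> (?g x / 2) powr (\<beta> - 1)" using g \<beta> by (intro powr_mono2') auto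
        also have "\<dots> = ?g x powr (\<beta> - 1) * 2 powr (1 - \<beta>)"
          using g by (simp add: powr_divide powr_minus_divide[of 2 "1 - \<beta>", simplified] divide_simps)
        also have "\<dots> \<le> ?g x powr (\<beta> - 1) * 2" using powr_mono[of "1 - \<beta>" 1 "2::real"] \<beta> by (intro mult_left_mono) auto
        finally show ?thesis by simp
      qed
      have "(\<delta> / \<psi> x) ^ 4 * \<psi> x powr (\<alpha> - 1) \<le> (\<delta> / \<psi> x) powr (\<alpha> / 2) * \<psi> x powr (\<alpha> - 1)"
        using powr_mono'[of "\<alpha> / 2" 4 "\<delta> / \<psi> x"] True \<delta> \<alpha> by (intro mult_right_mono) auto
      also have "\<dots> = \<delta> powr (\<alpha> / 2) * \<psi> x powr (\<alpha> / 2 - 1)"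
        using True \<delta> powr_add[of "\<psi> x" "\<alpha> / 2" "\<alpha> / 2 - 1"] by (simp add: powr_divide)
      also have "\<dots> \<le> \<delta> powr (\<alpha> / 2) * (2 * ?g x powr (\<alpha> / 2 - 1))" using p[of "\<alpha> / 2"] \<alpha> by (intro mult_left_mono) auto
      finally have "(\<delta> / \<psi> x) ^ 4 * \<psi> x powr (\<alpha> - 1) \<le> 2 * \<delta> powr (\<alpha> / 2) * ?g x powr (\<alpha> / 2 - 1)" by simp
      moreover have "\<alpha>\<^sup>2 * \<psi> x powr (\<alpha> - 1) \<le> \<alpha>\<^sup>2 * (2 * ?g x powr (\<alpha> - 1))" by (intro mult_left_mono p \<alpha>) simp
      ultimately show ?thesis using True x by (simp add: jd_def h_def distrib_right)
    qed (use h0 in \<open>simp add: jd_def\<close>)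
  qed
  also have "\<dots> = (LINT x|?M. h x)" by (rule Lebesgue_Measure.integral_restrict_UNIV[OF open_sets_lebesgue[OF U(3)]])
  also have "\<dots> = 2 * \<alpha>\<^sup>2 * (LINT x|?M. ?g x powr (\<alpha> - 1)) + 2 * \<delta> powr (\<alpha> / 2) * (LINT x|?M. ?g x powr (\<alpha> / 2 - 1))"
    unfolding h_def using A1 A2 \<alpha> by simp
  also have "\<dots> \<le> 2 * \<alpha>\<^sup>2 * (A / \<alpha>) + 2 * \<delta> powr (\<alpha> / 2) * (A / (\<alpha> / 2))"
    using A1 A2 \<alpha> by (intro add_mono mult_left_mono) auto
  also have "\<dots> = 2 * \<alpha> * A + 4 * \<delta> powr (\<alpha> / 2) * (A / \<alpha>)" using \<alpha> by (simp add: power2_eq_square)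
  finally show ?thesis by (simp add: \<delta>_def \<psi>_def)
qed

text \<open>The parameters are fixed in the order of dependence: \<open>n\<close> by
  \<open>K\<close>, then \<kappa>, then \<alpha> in terms of \<open>Q\<close>, which contains
  \<open>n\<close> and \<kappa>. Only then does the mollification scale tend to zero, and with it
  the level \<delta> = 2 n r_k. At fixed \<alpha> the power of \<delta> disappears, leaving
  \<open>Q * (2 * \<alpha> * A)\<close>, which the choice of \<alpha> has made small.\<close>

lemma interior_hessian_bound:
  fixes U :: "(real^'d) set"
  assumes U: "bounded U" "convex U" "open U" and w: "weak_sol U 0 z g f" and f: "f \<in> \<D> U"
    and K: "compact K" "K \<subseteq> U" and r: "\<And>k. 0 < r k" "r \<longlonglongrightarrow> 0" and e: "0 < e"
  shows "\<forall>\<^sub>F k in sequentially. (LINT x|lebesgue. indicator K x * (\<Oplus>i j. (pd i (pd j (conv (zext U z) (mol (r k)))) x)\<^sup>2))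
     \<le> (nL2 (\<L> U) f)\<^sup>2 + e"
proof -
  let ?M = "\<L> U"
  define W where "W k = conv (zext U z) (mol (r k))" for k
  define Hs where "Hs k x = (\<Oplus>i j. (pd i (pd j (W k)) x)\<^sup>2)" for k x
  have z: "sqint ?M z" using w H10_sqint by (auto simp: weak_sol_def)
  note zi = zext_integrable[OF U(1,3) z]
  have Ws: "smooth (W k)" for k unfolding W_def by (rule conv_smooth[OF zi mol_test[OF r(1)]])
  have Hc: "continuous_on UNIV (Hs k)" for k
    unfolding Hs_def by (intro continuous_intros smooth_continuous smooth_pderiv Ws)
  obtain C where C: "0 \<le> C" "\<And>n \<rho> x. 1 \<le> n \<Longrightarrow> 0 < \<rho> \<Longrightarrow> \<bar>conv (zext U z) (mol \<rho>) x\<bar> \<le> C * conv (cutdist U n) (mol \<rho>) x"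
    using mollified_barrier[OF U w f] by blast
  obtain L where L: "0 \<le> L" "\<And>x y. \<bar>f x - f y\<bar> \<le> L * norm (x - y)" using test_Lipschitz[OF f] by blast
  \<comment> \<open>The 2, where 1 would make \<open>cutdist\<close> equal to 1 on \<open>K\<close>,
    leaves room for mollification: \<open>cutdist\<close> is 1 near \<open>K\<close>, so \<psi> is
    exactly 1 on \<open>K\<close>.\<close>
  obtain n where n: "1 \<le> n" "\<And>x. x \<in> K \<Longrightarrow> 2 \<le> n * bdist U x"
  proof (cases "K = {}")
    case True
    then show thesis using that[of 1] by simp
  next
    case False
    obtain x0 where x0: "x0 \<in> K" "\<And>x. x \<in> K \<Longrightarrow> bdist U x0 \<le> bdist U x"
      using continuous_attains_inf[OF K(1) False bdist_continuous] by blast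
    have p: "0 < bdist U x0" using bdist_pos[OF U(1,3)] K(2) x0(1) by blast
    define n where "n = max 1 (2 / bdist U x0)"
    have "2 \<le> n * bdist U x" if "x \<in> K" for x
    proof -
      have "2 = (2 / bdist U x0) * bdist U x0" using p by simp
      also have "\<dots> \<le> n * bdist U x" using x0(2)[OF that] p by (intro mult_mono) (auto simp: n_def)
      finally show ?thesis .
    qed
    then show thesis using that[of n] by (simp add: n_def)
  qed
  obtain A where A: "0 \<le> A" "\<And>\<alpha>. 0 < \<alpha> \<Longrightarrow> \<alpha> < 1 \<Longrightarrow> integrable ?M (\<lambda>x. cutdist U n x powr (\<alpha> - 1))
     \<and> (LINT x|?M. cutdist U n x powr (\<alpha> - 1)) \<le> A / \<alpha>" using cutdist_powr_integral[OF U n(1)] by blast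
  define F where "F = nL2 ?M f"
  define c where "c = 2 * real CARD('d) + 2"
  have c: "2 \<le> c" by (simp add: c_def)
  obtain \<kappa> where \<kappa>: "0 < \<kappa>" "\<kappa> * c < 1" "F\<^sup>2 / (1 - \<kappa> * c) < F\<^sup>2 + e"
  proof -
    have l: "((\<lambda>\<kappa>. F\<^sup>2 / (1 - \<kappa> * c)) \<longlongrightarrow> F\<^sup>2 / (1 - 0 * c)) (at_right 0)" "((\<lambda>\<kappa>. \<kappa> * c) \<longlongrightarrow> 0 * c) (at_right 0)"
      by (intro tendsto_intros; simp)+
    have "\<forall>\<^sub>F \<kappa> in at_right 0. F\<^sup>2 / (1 - \<kappa> * c) < F\<^sup>2 + e \<and> \<kappa> * c < 1 \<and> 0 < \<kappa>"
      using e order_tendstoD(2)[OF l(1), of "F\<^sup>2 + e"] order_tendstoD(2)[OF l(2), of 1] eventually_at_right_less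
      by (auto intro!: eventually_conj)
    from eventually_happens'[OF trivial_limit_at_right_real this] show thesis using that by blast
  qed
  define Q where "Q = (real CARD('d))\<^sup>2 * (200 * n ^ 4 * C\<^sup>2 / \<kappa> + 800 * n ^ 4 * C\<^sup>2)"
  have Q: "0 \<le> Q" using n \<kappa> by (simp add: Q_def)
  obtain \<alpha> where \<alpha>: "0 < \<alpha>" "\<alpha> < 1" "(F\<^sup>2 + Q * (2 * \<alpha> * A)) / (1 - \<kappa> * c) < F\<^sup>2 + e"
  proof -
    have l: "((\<lambda>\<alpha>. (F\<^sup>2 + Q * (2 * \<alpha> * A)) / (1 - \<kappa> * c)) \<longlongrightarrow> (F\<^sup>2 + Q * (2 * 0 * A)) / (1 - \<kappa> * c)) (at_right 0)"
      by (intro tendsto_intros) (use \<kappa> in simp)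
    have "\<forall>\<^sub>F \<alpha> in at_right 0. (F\<^sup>2 + Q * (2 * \<alpha> * A)) / (1 - \<kappa> * c) < F\<^sup>2 + e \<and> \<alpha> < 1 \<and> 0 < \<alpha>"
      using \<kappa>(3) order_tendstoD(2)[OF l, of "F\<^sup>2 + e"] order_tendstoD(2)[OF tendsto_ident_at[of "0::real" "{0<..}"], of 1] eventually_at_right_less
      by (auto intro!: eventually_conj)
    from eventually_happens'[OF trivial_limit_at_right_real this] show thesis using that by blast
  qed
  define J where "J k = 2 * \<alpha> * A + 4 * (2 * n * r k) powr (\<alpha> / 2) * (A / \<alpha>)" for k
  define S where "S = nL2 ?M (\<lambda>x. 1)"
  define I where "I k = (LINT x|lebesgue. indicator K x * Hs k x)" for k
  have step: "(1 - \<kappa> * c) * ((1 - 2 * n * r k) ^ 5 * I k) \<le> (F + L * r k * S)\<^sup>2 + Q * J k"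
    if rk: "2 * n * r k < 1" for k
  proof -
    define \<delta> where "\<delta> = 2 * n * r k"
    define \<psi> where "\<psi> = conv (cutdist U n) (mol (r k))"
    have \<delta>: "0 < \<delta>" "\<delta> < 1" using n(1) r(1)[of k] rk by (simp_all add: \<delta>_def)
    note mc = mollified_cutdist[OF U n(1) r(1)[of k], folded \<psi>_def]
    have inner: "r k < bdist U x" if "\<delta> < \<psi> x" for x
    proof -
      have "n * r k < cutdist U n x" using mc(2)[of x] that by (simp add: \<delta>_def abs_le_iff)
      also have "\<dots> \<le> n * bdist U x" by (simp add: cutdist_def)
      finally show ?thesis using n(1) by simp
    qed
    have wb: "\<bar>W k x\<bar> \<le> C * \<psi> x" for x unfolding W_def \<psi>_def by (rule C(2)[OF n(1) r(1)])
    have conc: "a\<^sup>2 * pd i (pd i \<psi>) x + 2 * a * b * pd i (pd j \<psi>) x + b\<^sup>2 * pd j (pd j \<psi>) x \<le> 0"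
      if "\<delta> < \<psi> x" for x a b i j by (rule mc(5)[OF inner[OF that]])
    define T where "T x = th0 \<delta> \<alpha> (\<psi> x)" for x
    have T01: "0 \<le> T x" "T x \<le> 1" for x
    proof -
      show "0 \<le> T x" using th_bounds(1)[OF \<delta>(1) _ \<alpha>(1,2), of "\<psi> x"] th_below(1)[of "\<psi> x" \<delta> \<alpha>] by (cases "\<delta> < \<psi> x") (auto simp: T_def)
      show "T x \<le> 1"
      proof (cases "\<delta> < \<psi> x")
        case True
        have "(\<psi> x - \<delta>) ^ 5 * \<psi> x powr (\<alpha> - 4) \<le> \<psi> x ^ 5 * \<psi> x powr (\<alpha> - 4)"
          using True \<delta> by (intro mult_right_mono power_mono) auto
        also have "\<dots> = \<psi> x powr (5 + (\<alpha> - 4))" using True \<delta> by (simp only: powr_add) simp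
        also have "\<dots> \<le> 1 powr (5 + (\<alpha> - 4))" using True \<delta> \<alpha> mc(4) by (intro powr_mono2) auto
        finally show ?thesis using True by (simp add: T_def th0_def pw_above)
      qed (simp add: T_def th_below)
    qed
    have Tz: "T x = 0" if "\<not> \<delta> < \<psi> x" for x using that by (simp add: T_def th_below)
    have Tc: "continuous_on UNIV T" unfolding T_def
      by (rule continuous_on_compose2[OF th_continuous(1)[OF \<delta>(1)] test_continuous[OF mc(1)]]) simp
    have main: "(1 - \<kappa> * c) * (LINT x|lebesgue. T x * Hs k x)
      \<le> (LINT x|lebesgue. T x * (\<Oplus>i. pd i (pd i (W k)) x)\<^sup>2) + Q * (LINT x|lebesgue. jd \<delta> \<alpha> (\<psi> x))"
      unfolding T_def Hs_def c_def Q_def mult.assoc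
      using hessian_estimate[OF \<delta>(1) \<alpha>(1,2) \<kappa>(1) Ws mc(1) wb mc(3) conc] by (simp add: mult.assoc)
    have jI: "integrable lebesgue (\<lambda>x. jd \<delta> \<alpha> (\<psi> x))"
      by (rule pair_estimate(2)[OF \<delta>(1) \<alpha>(1,2) \<kappa>(1) Ws mc(1) wb mc(3) conc])
    have jJ: "(LINT x|lebesgue. jd \<delta> \<alpha> (\<psi> x)) \<le> J k" using jd_integral_bound[OF U n(1) \<alpha>(1,2) r(1) A(2)] jI by (simp add: J_def \<delta>_def \<psi>_def)
    obtain LL where LL: "compact LL" "\<And>x. x \<notin> LL \<Longrightarrow> \<psi> x = 0" using mc(1) by (metis test_functionsE)
    have TI: "integrable lebesgue (\<lambda>x. T x * h x)" if "continuous_on UNIV h" for h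
      by (rule integrable_continuous_compact_support[OF continuous_on_mult[OF Tc that] LL(1)]) (use LL(2) \<delta>(1) in \<open>simp add: Tz\<close>)
    have lap: "(LINT x|lebesgue. T x * (\<Oplus>i. pd i (pd i (W k)) x)\<^sup>2) \<le> (F + L * r k * S)\<^sup>2"
    proof -
      have sf: "sqint ?M (\<lambda>x. \<bar>f x\<bar>)" using test_sqint[OF U(1,3) f] by (auto simp: sqint_def)
      have s1: "sqint ?M (\<lambda>x. 1)" by (rule sqint_bounded[OF U(1,3)]) auto
      define u where "u x = \<bar>f x\<bar> + L * r k * 1" for x
      have su: "sqint ?M u" unfolding u_def by (intro sqint_add sf sqint_scale s1)
      have "(LINT x|lebesgue. T x * (\<Oplus>i. pd i (pd i (W k)) x)\<^sup>2) \<le> (LINT x|lebesgue. (if x \<in> U then (u x)\<^sup>2 else 0))"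
      proof (rule integral_mono)
        show "integrable lebesgue (\<lambda>x. T x * (\<Oplus>i. pd i (pd i (W k)) x)\<^sup>2)"
          by (rule TI) (intro continuous_intros smooth_continuous smooth_pderiv Ws)
        show "integrable lebesgue (\<lambda>x. if x \<in> U then (u x)\<^sup>2 else 0)"
          unfolding Lebesgue_Measure.integrable_restrict_UNIV[OF open_sets_lebesgue[OF U(3)]] by (rule sqint_square[OF su])
        fix x
        show "T x * (\<Oplus>i. pd i (pd i (W k)) x)\<^sup>2 \<le> (if x \<in> U then (u x)\<^sup>2 else 0)"
        proof (cases "\<delta> < \<psi> x")
          case True
          have x: "x \<in> U" using inner[OF True] r(1)[of k] by (intro bdist_pos_imp) linarith
          have "\<bar>conv f (mol (r k)) x - f x\<bar> \<le> L * r k" by (rule conv_mol_Lipschitz[OF r(1) test_integrable[OF f] L])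
          then have "\<bar>conv f (mol (r k)) x\<bar> \<le> \<bar>u x\<bar>" using L(1) r(1)[of k] by (simp add: u_def)
          then have "(conv f (mol (r k)) x)\<^sup>2 \<le> (u x)\<^sup>2" by (rule abs_le_square_iff[THEN iffD1])
          moreover have "T x * (conv f (mol (r k)) x)\<^sup>2 \<le> 1 * (conv f (mol (r k)) x)\<^sup>2" using T01 by (intro mult_right_mono) auto
          moreover have "(\<Oplus>i. pd i (pd i (W k)) x)\<^sup>2 = (conv f (mol (r k)) x)\<^sup>2"
            unfolding W_def mollified_laplacian[OF U(1,3) w f r(1) inner[OF True]] by simp
          ultimately show ?thesis using x by simp
        qed (simp add: Tz)
      qed
      also have "\<dots> = (nL2 ?M u)\<^sup>2"
        unfolding nL2_sq by (rule Lebesgue_Measure.integral_restrict_UNIV[OF open_sets_lebesgue[OF U(3)]])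
      also have "\<dots> \<le> (F + L * r k * S)\<^sup>2"
      proof (rule power_mono)
        have "nL2 ?M u \<le> nL2 ?M (\<lambda>x. \<bar>f x\<bar>) + nL2 ?M (\<lambda>x. L * r k * 1)"
          unfolding u_def by (rule nL2_triangle[OF sf sqint_scale[OF s1]])
        also have "nL2 ?M (\<lambda>x. \<bar>f x\<bar>) = F" by (simp add: F_def nL2_def)
        also have "nL2 ?M (\<lambda>x. L * r k * 1) = L * r k * S" unfolding nL2_scale S_def using L(1) r(1)[of k] by simp
        finally show "nL2 ?M u \<le> F + L * r k * S" .
      qed simp
      finally show ?thesis .
    qed
    have low: "(1 - \<delta>) ^ 5 * I k \<le> (LINT x|lebesgue. T x * Hs k x)"
    proof -
      have H0: "0 \<le> Hs k x" for x unfolding Hs_def by (intro sum_nonneg) simp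
      have Ki: "integrable lebesgue (\<lambda>x. indicator K x * Hs k x)"
      proof -
        have "set_integrable lborel K (Hs k)"
          unfolding set_integrable_def by (rule borel_integrable_compact[OF K(1) continuous_on_subset[OF Hc]]) simp
        then have "integrable lborel (\<lambda>x. indicator K x * Hs k x)" by (simp add: set_integrable_def)
        then show ?thesis by (subst integrable_completion) (auto simp: borel_measurable_integrable)
      qed
      have "(1 - \<delta>) ^ 5 * I k = (LINT x|lebesgue. (1 - \<delta>) ^ 5 * (indicator K x * Hs k x))" by (simp add: I_def)
      also have "\<dots> \<le> (LINT x|lebesgue. T x * Hs k x)"
      proof (rule integral_mono)
        show "integrable lebesgue (\<lambda>x. (1 - \<delta>) ^ 5 * (indicator K x * Hs k x))" using Ki by simp
        show "integrable lebesgue (\<lambda>x. T x * Hs k x)" by (rule TI[OF Hc])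
        fix x
        show "(1 - \<delta>) ^ 5 * (indicator K x * Hs k x) \<le> T x * Hs k x"
        proof (cases "x \<in> K")
          case True
          have one: "cutdist U n y = 1" if "norm (x - y) < r k" for y
          proof -
            have "n * norm (x - y) \<le> n * r k" using that n(1) by (intro mult_left_mono) auto
            moreover have "n * bdist U x - n * norm (x - y) \<le> n * bdist U y"
              using mult_left_mono[of "bdist U x - norm (x - y)" "bdist U y" n] bdist_Lipschitz[of U x y] n(1)
              by (simp add: right_diff_distrib abs_le_iff)
            ultimately show ?thesis using n(2)[OF True] rk by (simp add: cutdist_def)
          qed
          have x1: "cutdist U n x = 1" using n(2)[OF True] by (simp add: cutdist_def)
          have "\<bar>\<psi> x - cutdist U n x\<bar> \<le> 0" unfolding \<psi>_def
            by (rule conv_mol_close[OF r(1) cutdist_integrable(1)[OF U(1) n(1)]]) (simp add: one x1)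
          then have "\<psi> x = 1" using x1 by simp
          then have "T x = (1 - \<delta>) ^ 5" using \<delta> by (simp add: T_def th0_def pw_above)
          then show ?thesis using True by simp
        next
          case False
          then show ?thesis using T01(1) H0 by simp
        qed
      qed
      finally show ?thesis .
    qed
    have "(1 - \<kappa> * c) * ((1 - \<delta>) ^ 5 * I k) \<le> (1 - \<kappa> * c) * (LINT x|lebesgue. T x * Hs k x)"
      using \<kappa>(2) by (intro mult_left_mono[OF low]) simp
    also have "\<dots> \<le> (F + L * r k * S)\<^sup>2 + Q * J k"
      using main lap mult_left_mono[OF jJ Q] by linarith
    finally show ?thesis by (simp add: \<delta>_def)
  qed
  define a where "a k = ((F + L * r k * S)\<^sup>2 + Q * J k) / ((1 - \<kappa> * c) * (1 - 2 * n * r k) ^ 5)" for k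
  have kc: "0 < 1 - \<kappa> * c" using \<kappa>(2) by linarith
  have "(\<lambda>k. 2 * n * r k) \<longlonglongrightarrow> 2 * n * 0" by (intro tendsto_intros r)
  then have l0: "(\<lambda>k. 2 * n * r k) \<longlonglongrightarrow> 0" by simp
  have "(\<lambda>k. (2 * n * r k) powr (\<alpha> / 2)) \<longlonglongrightarrow> 0 powr (\<alpha> / 2)"
    by (rule tendsto_powr'[OF l0 tendsto_const]) (use n(1) r(1) \<alpha>(1) in \<open>auto simp: less_imp_le\<close>)
  then have "J \<longlonglongrightarrow> 2 * \<alpha> * A + 4 * 0 powr (\<alpha> / 2) * (A / \<alpha>)" unfolding J_def by (intro tendsto_add tendsto_mult tendsto_const)
  then have Jl: "J \<longlonglongrightarrow> 2 * \<alpha> * A" by simp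
  have "a \<longlonglongrightarrow> ((F + L * 0 * S)\<^sup>2 + Q * (2 * \<alpha> * A)) / ((1 - \<kappa> * c) * (1 - 0) ^ 5)"
    unfolding a_def by (intro tendsto_intros Jl r(2) l0) (use kc in simp)
  from order_tendstoD(2)[OF this, of "F\<^sup>2 + e"] \<alpha>(3) have ev1: "\<forall>\<^sub>F k in sequentially. a k < F\<^sup>2 + e" by simp
  have ev2: "\<forall>\<^sub>F k in sequentially. 2 * n * r k < 1" using order_tendstoD(2)[OF l0, of 1] by simp
  have "\<forall>\<^sub>F k in sequentially. I k \<le> F\<^sup>2 + e"
    using ev1 ev2
  proof eventually_elim
    case (elim k)
    have p: "0 < (1 - \<kappa> * c) * (1 - 2 * n * r k) ^ 5" using kc elim(2) by (intro mult_pos_pos zero_less_power) auto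
    have "I k \<le> a k" unfolding a_def using step[OF elim(2)] p by (subst pos_le_divide_eq) (auto simp: mult_ac)
    then show ?case using elim(1) by linarith
  qed
  then show ?thesis unfolding I_def Hs_def W_def F_def .
qed

section \<open>Square integrable second derivatives by duality\<close>

lemma double_sum_Cauchy_Schwarz:
  fixes a b :: "'i::finite \<Rightarrow> 'j::finite \<Rightarrow> real"
  shows "(\<Oplus>i j. \<bar>a i j\<bar> * \<bar>b i j\<bar>) \<le> sqrt (\<Oplus>i j. (a i j)\<^sup>2) * sqrt (\<Oplus>i j. (b i j)\<^sup>2)"
  using L2_set_mult_ineq[of "\<lambda>(i, j). a i j" "\<lambda>(i, j). b i j" UNIV]
  by (simp add: L2_set_def sum.cartesian_product split_def)

lemma double_sum_term_le:
  fixes a :: "'i::finite \<Rightarrow> 'j::finite \<Rightarrow> real"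
  assumes "\<And>i j. 0 \<le> a i j" shows "a i j \<le> (\<Oplus>i j. a i j)"
proof -
  have "a i j \<le> (\<Oplus>j. a i j)" by (rule member_le_sum) (use assms in auto)
  also have "\<dots> \<le> (\<Oplus>i j. a i j)" by (rule member_le_sum[of i UNIV "\<lambda>i. \<Oplus>j. a i j"]) (use assms in \<open>auto intro: sum_nonneg\<close>)
  finally show ?thesis .
qed

lemma double_sum_delta:
  fixes c :: real and i :: "'i::finite" and j :: "'j::finite"
  shows "(\<Oplus>i' j'. if i' = i then (if j' = j then c else 0) else 0) = c"
proof -
  have "(\<Oplus>j'. if i' = i then (if j' = j then c else 0) else 0) = (if i' = i then c else 0)" for i' by simp
  then show ?thesis by simp
qed

text \<open>Two integrations by parts move the derivatives to the mollified solution, where the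
  interior bound applies on a compact set containing all supports. The limit bound no longer refers
  to this set. Testing all entries jointly preserves the constant one, which separate bounds for the
  entries would lose.\<close>

lemma hessian_duality:
  fixes U :: "(real^'d) set"
  assumes U: "bounded U" "convex U" "open U" and w: "weak_sol U 0 z g f" and f: "f \<in> \<D> U"
    and \<phi>: "\<And>i j. \<phi> i j \<in> \<D> U"
  shows "\<bar>\<Oplus>i j. L2_inner U z (pd i (pd j (\<phi> i j)))\<bar>
    \<le> nL2 (\<L> U) f * sqrt (\<Oplus>i j. (nL2 (\<L> U) (\<phi> i j))\<^sup>2)"
proof -
  let ?M = "\<L> U"
  define F where "F = nL2 ?M f"
  define B where "B = sqrt (\<Oplus>i j. (nL2 ?M (\<phi> i j))\<^sup>2)"
  have B0: "0 \<le> B" unfolding B_def by (intro real_sqrt_ge_zero sum_nonneg) simp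
  define r where "r k = inverse (real (Suc k))" for k
  have r: "0 < r k" "r \<longlonglongrightarrow> 0" for k unfolding r_def by (simp, rule LIMSEQ_inverse_real_of_nat)
  have z: "sqint ?M z" using w H10_sqint by (auto simp: weak_sol_def)
  note zi = zext_integrable[OF U(1,3) z]
  define W where "W k = conv (zext U z) (mol (r k))" for k
  have Ws: "smooth (W k)" for k unfolding W_def by (rule conv_smooth[OF zi mol_test[OF r(1)]])
  have "\<forall>i j. \<exists>K. compact K \<and> K \<subseteq> U \<and> (\<forall>x. x \<notin> K \<longrightarrow> \<phi> i j x = 0)" using \<phi> by (auto simp: test_functions_def)
  then obtain K' where K': "\<And>i j. compact (K' i j)" "\<And>i j. K' i j \<subseteq> U" "\<And>i j x. x \<notin> K' i j \<Longrightarrow> \<phi> i j x = 0" by metis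
  define K where "K = (\<Union>i. \<Union>j. K' i j)"
  have K: "compact K" "K \<subseteq> U" and Kz: "\<And>i j x. x \<notin> K \<Longrightarrow> \<phi> i j x = 0"
    unfolding K_def using K'(1) subsetD[OF K'(2)] K'(3) by (auto intro!: compact_UN)
  define D where "D k i j x = indicator K x * pd i (pd j (W k)) x" for k i j x
  have Dc: "continuous_on K (\<lambda>x. (pd i (pd j (W k)) x))" for i j k
    by (rule continuous_on_subset[OF smooth_continuous[OF smooth_pderiv[OF smooth_pderiv[OF Ws]]] subset_UNIV])
  have ind: "integrable lebesgue (\<lambda>x. indicator K x * h x)" if "continuous_on K h" for h :: "real^'d \<Rightarrow> real"
  proof -
    have "set_integrable lborel K h"
      unfolding set_integrable_def by (rule borel_integrable_compact[OF K(1) that])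
    then have "integrable lborel (\<lambda>x. indicator K x * h x)" by (simp add: set_integrable_def)
    then show ?thesis by (subst integrable_completion) (auto simp: borel_measurable_integrable)
  qed
  have D2: "(D k i j x)\<^sup>2 = indicator K x * (pd i (pd j (W k)) x)\<^sup>2" for k i j x
    by (simp add: D_def indicator_def)
  have Dsq: "sqint lebesgue (D k i j)" for k i j
    unfolding sqint_def D2 using ind[OF Dc] ind[OF continuous_on_power[OF Dc, where n = 2]]
    by (auto simp: D_def[abs_def] intro: borel_measurable_integrable)
  define I where "I k = (\<Oplus>i j. (nL2 lebesgue (D k i j))\<^sup>2)" for k
  have I: "I k = (LINT x|lebesgue. indicator K x * (\<Oplus>i j. (pd i (pd j (W k)) x)\<^sup>2))" for k
  proof -
    have "I k = (LINT x|lebesgue. (\<Oplus>i j. (D k i j x)\<^sup>2))"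
      unfolding I_def nL2_sq using sqint_square[OF Dsq] by (simp add: Bochner_Integration.integral_sum)
    then show ?thesis unfolding D2 by (simp add: sum_distrib_left)
  qed
  have ts: "sqint lebesgue (\<phi> i j)" "nL2 lebesgue (\<phi> i j) = nL2 ?M (\<phi> i j)" for i j
  proof -
    have *: "x \<notin> U \<Longrightarrow> (\<phi> i j x)\<^sup>2 = 0" for x using test_zero_outside[OF \<phi>] by simp
    show "nL2 lebesgue (\<phi> i j) = nL2 ?M (\<phi> i j)" 
      using integral_zero_extend(1)[of U "\<lambda>x. (\<phi> i j x)\<^sup>2", OF U(3) *] by (simp add: nL2_def)
    show "sqint lebesgue (\<phi> i j)"
      unfolding sqint_def using integral_zero_extend(2)[of U "\<lambda>x. (\<phi> i j x)\<^sup>2", OF U(3) *] sqint_square[OF test_sqint[OF U(1,3) \<phi>]]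
        borel_measurable_integrable[OF test_integrable[OF \<phi>]] by auto
  qed
  define a where "a k = (\<Oplus>i j. (LINT x|lebesgue. W k x * pd i (pd j (\<phi> i j)) x))" for k
  have ab: "\<bar>a k\<bar> \<le> sqrt (I k) * B" for k
  proof -
    have eq: "(LINT x|lebesgue. W k x * pd i (pd j (\<phi> i j)) x) = (LINT x|lebesgue. D k i j x * \<phi> i j x)" for i j
      unfolding integral_by_parts_test[OF test_pderiv[OF \<phi>] Ws] integral_by_parts_test[OF \<phi> smooth_pderiv[OF Ws]] minus_minus
      by (rule Bochner_Integration.integral_cong) (use Kz pderiv_commute[OF Ws] in \<open>auto simp: D_def indicator_def\<close>)
    have "\<bar>a k\<bar> \<le> (\<Oplus>i j. \<bar>LINT x|lebesgue. D k i j x * \<phi> i j x\<bar>)"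
      unfolding a_def eq by (rule order.trans[OF sum_abs], rule sum_mono, rule sum_abs)
    also have "\<dots> \<le> (\<Oplus>i j. \<bar>nL2 lebesgue (D k i j)\<bar> * \<bar>nL2 ?M (\<phi> i j)\<bar>)"
      using nL2_Cauchy_Schwarz[OF Dsq ts(1)] by (intro sum_mono) (simp add: ts(2))
    also have "\<dots> \<le> sqrt (I k) * B" unfolding I_def B_def by (rule double_sum_Cauchy_Schwarz)
    finally show ?thesis .
  qed
  define A where "A = (\<Oplus>i j. L2_inner U z (pd i (pd j (\<phi> i j))))"
  have lim: "a \<longlonglongrightarrow> A"
    unfolding a_def A_def
  proof (intro tendsto_sum)
    fix i j
    note t = test_pderiv[OF test_pderiv[OF \<phi>]]
    have "L2_inner U z (pd i (pd j (\<phi> i j))) = (LINT x|lebesgue. zext U z x * pd i (pd j (\<phi> i j)) x)"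
      unfolding test_L2_inner[OF U(3) t] using test_zero_outside[OF t]
      by (intro Bochner_Integration.integral_cong) (auto simp: zext_def)
    then show "(\<lambda>k. LINT x|lebesgue. W k x * pd i (pd j (\<phi> i j)) x) \<longlonglongrightarrow> L2_inner U z (pd i (pd j (\<phi> i j)))"
      unfolding W_def using conv_weak_limit[OF zi t r] by simp
  qed
  have bd: "\<bar>A\<bar> \<le> sqrt (F\<^sup>2 + e) * B" if e: "0 < e" for e
  proof (rule tendsto_upperbound[OF tendsto_rabs[OF lim]])
    show "\<forall>\<^sub>F k in sequentially. \<bar>a k\<bar> \<le> sqrt (F\<^sup>2 + e) * B"
      using interior_hessian_bound[OF U w f K r e]
    proof eventually_elim
      case (elim k)
      then have "I k \<le> F\<^sup>2 + e" unfolding I W_def F_def .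
      then show ?case using ab[of k] B0 by (meson mult_right_mono order.trans real_sqrt_le_mono)
    qed
  qed simp
  have "(\<lambda>n. sqrt (F\<^sup>2 + r n) * B) \<longlonglongrightarrow> sqrt (F\<^sup>2 + 0) * B" by (intro tendsto_intros r)
  then have "\<bar>A\<bar> \<le> sqrt (F\<^sup>2 + 0) * B" using bd[OF r(1)] by (intro LIMSEQ_le_const) auto
  then show ?thesis by (simp add: A_def F_def B_def)
qed

text \<open>Riesz representation, entry by entry, turns the distributional second derivatives into
  L2 functions. The sharp bound for the whole matrix is recovered afterwards from the joint duality
  estimate.\<close>

lemma weak_sol_test_H2:
  assumes U: "bounded U" "convex U" "open U" and w: "weak_sol U 0 z g f" and f: "f \<in> \<D> U"
  obtains h where "V0 U z g h" "(\<Oplus>i j. (nL2 (\<L> U) (h i j))\<^sup>2) \<le> (nL2 (\<L> U) f)\<^sup>2"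
proof -
  let ?M = "\<L> U"
  let ?T = "\<D> U"
  note U' = U(1,3)
  define F where "F = nL2 ?M f"
  note dual = hessian_duality[OF U w f, folded F_def]
  have z: "sqint ?M z" and H: "H10 U z g" using w H10_sqint by (auto simp: weak_sol_def)
  note ts = test_sqint[OF U']
  note tc = L2_inner_commute[of U z]
  define l where "l i j \<phi> = L2_inner U z (pd i (pd j \<phi>))" for i j \<phi>
  have ladd: "l i j (\<lambda>x. \<phi> x + \<psi> x) = l i j \<phi> + l i j \<psi>" if "\<phi> \<in> ?T" "\<psi> \<in> ?T" for i j \<phi> \<psi>
    unfolding l_def smooth_pderiv_add[OF that[THEN test_smooth]] smooth_pderiv_add[OF that[THEN test_pderiv, THEN test_smooth]] tc
    by (rule L2_inner_add) (use z in \<open>auto intro!: ts[where X = U] test_pderiv that\<close>)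
  have lsc: "l i j (\<lambda>x. c * \<phi> x) = c * l i j \<phi>" if "\<phi> \<in> ?T" for i j c \<phi>
    unfolding l_def smooth_pderiv_scale[OF that[THEN test_smooth]] smooth_pderiv_scale[OF that[THEN test_pderiv, THEN test_smooth]] tc
    by (rule L2_inner_scale)
  have lb: "\<bar>l i j \<phi>\<bar> \<le> F * sqrt (L2_inner U \<phi> \<phi>)" if p: "\<phi> \<in> ?T" for i j \<phi>
  proof -
    \<comment> \<open>A family with a single nonzero entry extracts from the joint estimate the
      bound for one functional \<open>l i j\<close>.\<close>
    define \<Phi> where "\<Phi> i' j' = (if i' = i \<and> j' = j then \<phi> else (\<lambda>x. 0))" for i' j'
    have \<Phi>: "\<Phi> i' j' \<in> ?T" for i' j' by (simp add: \<Phi>_def p test_zero)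
    have 0: "l i' j' (\<lambda>x. 0) = 0" for i' j' using lsc[OF test_zero, of i' j' 0] by simp
    have "(\<Oplus>i' j'. l i' j' (\<Phi> i' j')) = (\<Oplus>i' j'. if i' = i then (if j' = j then l i j \<phi> else 0) else 0)"
      by (intro sum.cong refl) (simp add: \<Phi>_def 0)
    also have "\<dots> = l i j \<phi>" by (rule double_sum_delta)
    finally have 1: "(\<Oplus>i' j'. l i' j' (\<Phi> i' j')) = l i j \<phi>" .
    have "(\<Oplus>i' j'. (nL2 ?M (\<Phi> i' j'))\<^sup>2) = (\<Oplus>i' j'. if i' = i then (if j' = j then (nL2 ?M \<phi>)\<^sup>2 else 0) else 0)"
      by (intro sum.cong refl) (simp add: \<Phi>_def nL2_def)
    also have "\<dots> = (nL2 ?M \<phi>)\<^sup>2" by (rule double_sum_delta)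
    finally show ?thesis using dual[of \<Phi>, OF \<Phi>] 1 by (simp add: l_def L2_inner_self)
  qed
  have "\<exists>s h. (\<forall>n. s n \<in> ?T) \<and> L2_conv ?M s h \<and> (\<forall>\<phi>\<in>?T. L2_inner U h \<phi> = l i j \<phi>)" for i j
  proof -
    obtain s where s: "\<And>n. s n \<in> ?T"
      "\<And>e. 0 < e \<Longrightarrow> \<exists>N. \<forall>m\<ge>N. \<forall>n\<ge>N. L2_inner U (\<lambda>x. s m x - s n x) (\<lambda>x. s m x - s n x) < e"
      "\<And>v. v \<in> ?T \<Longrightarrow> (\<lambda>n. L2_inner U (s n) v) \<longlonglongrightarrow> l i j v"
    proof (rule Riesz_sequence[of ?T "L2_inner U" "l i j" F])
      show "L2_inner U f g = L2_inner U g f" for f g by (rule L2_inner_commute)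
      show "0 \<le> L2_inner U f f" for f by (simp add: L2_inner_self)
    qed (use ladd lsc lb in \<open>auto intro: test_zero test_add test_scale L2_inner_add ts simp: L2_inner_scale\<close>)
    have "\<exists>N. \<forall>m\<ge>N. \<forall>n\<ge>N. nL2 ?M (\<lambda>x. s m x - s n x) < e" if e: "0 < e" for e
    proof -
      have "0 < e\<^sup>2" using e by simp
      from s(2)[OF this] obtain N where N: "\<And>m n. N \<le> m \<Longrightarrow> N \<le> n \<Longrightarrow> (nL2 ?M (\<lambda>x. s m x - s n x))\<^sup>2 < e\<^sup>2"
        unfolding L2_inner_self by blast
      then show ?thesis using e by (meson less_imp_le power_less_imp_less_base)
    qed
    then obtain h where h: "L2_conv ?M s h" using L2_complete[of ?M s, OF lebesgue_on_finite[OF U'] ts[OF s(1)]] by blast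
    have "L2_inner U h \<phi> = l i j \<phi>" if p: "\<phi> \<in> ?T" for \<phi>
      by (rule LIMSEQ_unique[OF L2_inner_limit[OF h L2_conv_const[OF ts[OF p]]] s(3)[OF p]])
    then show ?thesis using s(1) h by blast
  qed
  then have "\<forall>i j. \<exists>s h. (\<forall>n. s n \<in> ?T) \<and> L2_conv ?M s h \<and> (\<forall>\<phi>\<in>?T. L2_inner U h \<phi> = l i j \<phi>)" by blast
  then obtain s h where s: "\<And>i j n. s i j n \<in> ?T" and c: "\<And>i j. L2_conv ?M (s i j) (h i j)"
    and h: "\<And>i j \<phi>. \<phi> \<in> ?T \<Longrightarrow> L2_inner U (h i j) \<phi> = l i j \<phi>" by metis
  note hs = L2_convD(2)[OF c]
  have wp: "has_weak_pderiv U j (g i) (h i j)" for i j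
    unfolding has_weak_pderiv_def L2_iff
  proof (intro conjI ballI H10_sqint(2)[OF H] hs)
    fix \<phi> assume p: "\<phi> \<in> ?T"
    show "L2_inner U (g i) (pd j \<phi>) = - L2_inner U (h i j) \<phi>"
      using has_weak_pderiv_test[OF H10_weak[OF U' H] test_pderiv[OF p]] by (simp add: h[OF p] l_def)
  qed
  define N where "N = sqrt (\<Oplus>i j. (nL2 ?M (h i j))\<^sup>2)"
  have N0: "0 \<le> N" unfolding N_def by (intro real_sqrt_ge_zero sum_nonneg) simp
  have NN: "N\<^sup>2 = (\<Oplus>i j. (nL2 ?M (h i j))\<^sup>2)" unfolding N_def by (intro real_sqrt_pow2 sum_nonneg) simp
  \<comment> \<open>The joint estimate is tested with the approximations \<open>s i j n\<close> of
    the Hessian itself; in the limit it reads \<open>N * N \<le> F * N\<close>.\<close>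
  have "(\<Oplus>i j. L2_inner U (h i j) (h i j)) \<le> F * N"
  proof (rule LIMSEQ_le)
    show "(\<lambda>n. \<Oplus>i j. L2_inner U (h i j) (s i j n)) \<longlonglongrightarrow> (\<Oplus>i j. L2_inner U (h i j) (h i j))"
      by (intro tendsto_sum L2_inner_limit[OF L2_conv_const[OF hs] c])
    show "(\<lambda>n. F * sqrt (\<Oplus>i j. (nL2 ?M (s i j n))\<^sup>2)) \<longlonglongrightarrow> F * N"
      unfolding N_def by (intro tendsto_intros L2_conv_norm[OF c])
    show "\<exists>N. \<forall>n\<ge>N. (\<Oplus>i j. L2_inner U (h i j) (s i j n)) \<le> F * sqrt (\<Oplus>i j. (nL2 ?M (s i j n))\<^sup>2)"
      using dual[of "\<lambda>i j. s i j _", OF s] by (auto simp: h[OF s] l_def abs_le_iff)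
  qed
  then have "N * N \<le> F * N" by (simp add: L2_inner_self NN flip: power2_eq_square)
  then have "N \<le> F" using N0 by (cases "N = 0") (auto simp: F_def)
  then have "N\<^sup>2 \<le> F\<^sup>2" using N0 by (rule power_mono)
  then show thesis using that[of h] wp H by (simp add: V0_def NN F_def)
qed

section \<open>General right-hand sides\<close>

lemma weak_sol_bound:
  fixes U :: "(real^'d) set"
  assumes U: "bounded U" "open U"
  obtains C where "0 < C" "\<And>\<mu> z g f. 0 \<le> \<mu> \<Longrightarrow> weak_sol U \<mu> z g f \<Longrightarrow> nL2 (\<L> U) z \<le> C * nL2 (\<L> U) f"
    "\<And>\<mu> z g f i. 0 \<le> \<mu> \<Longrightarrow> weak_sol U \<mu> z g f \<Longrightarrow> nL2 (\<L> U) (g i) \<le> C * nL2 (\<L> U) f"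
proof -
  let ?M = "\<L> U"
  obtain P where P: "0 < P" "\<And>z g i. H10 U z g \<Longrightarrow> nL2 ?M z \<le> P * nL2 ?M (g i)" using Poincare_H10[OF U] by metis
  \<comment> \<open>\<open>P\<close> is the bound for the gradient and \<open>P * P\<close> the one
    for the function.\<close>
  define C where "C = P + P * P"
  have C: "0 < C" using P(1) by (simp add: C_def add_pos_pos)
  have g: "nL2 ?M (g i) \<le> P * nL2 ?M f" if m: "0 \<le> \<mu>" and w: "weak_sol U \<mu> z g f" for \<mu> z g f i
  proof -
    have H: "H10 U z g" and f: "sqint ?M f" using w by (auto simp: weak_sol_def)
    note z = H10_sqint(1)[OF H]
    have "(nL2 ?M (g i))\<^sup>2 \<le> (\<Oplus>i. (nL2 ?M (g i))\<^sup>2)" by (rule member_le_sum) auto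
    also have "\<dots> = L2_inner U f z - \<mu> * (nL2 ?M z)\<^sup>2"
      unfolding weak_sol_energy[OF U w] using L2_inner_diff[OF f sqint_scale[OF z, of \<mu>] z] by (simp add: L2_inner_scale L2_inner_self)
    also have "\<dots> \<le> nL2 ?M f * nL2 ?M z" using L2_inner_bound[OF f z] m by (smt (verit) mult_nonneg_nonneg zero_le_power2)
    also have "\<dots> \<le> nL2 ?M f * (P * nL2 ?M (g i))" by (intro mult_left_mono P(2)[OF H]) simp
    finally have "nL2 ?M (g i) * nL2 ?M (g i) \<le> (P * nL2 ?M f) * nL2 ?M (g i)" by (simp add: power2_eq_square mult_ac)
    then show ?thesis using P(1) nL2_nonneg[of ?M "g i"] by (cases "nL2 ?M (g i) = 0") (auto simp: mult_le_cancel_right)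
  qed
  show thesis
  proof (rule that[OF C])
    fix \<mu> z g f and i :: 'd assume m: "0 \<le> \<mu>" and w: "weak_sol U \<mu> z g f"
    have "P * nL2 ?M f \<le> C * nL2 ?M f" using P(1) by (intro mult_right_mono) (auto simp: C_def)
    then show "nL2 ?M (g i) \<le> C * nL2 ?M f" using g[OF m w, of i] by linarith
    have "nL2 ?M z \<le> P * nL2 ?M (g undefined)" using P(2) w by (simp add: weak_sol_def)
    also have "\<dots> \<le> P * (P * nL2 ?M f)" using P(1) by (intro mult_left_mono g[OF m w]) auto
    also have "\<dots> \<le> C * nL2 ?M f" unfolding mult.assoc[symmetric] using P(1) by (intro mult_right_mono) (auto simp: C_def)
    finally show "nL2 ?M z \<le> C * nL2 ?M f" .
  qed
qed

lemma V0_unique_hessian: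
  assumes U: "bounded U" "open U" and "V0 U z g h" "V0 U z g k"
  shows "AE x in \<L> U. h i j x = k i j x"
  by (rule has_weak_pderiv_unique[OF U, of j "g i" _ "g i"]) (use assms(3,4) in \<open>simp_all add: V0_def\<close>)

lemma V0_weak_sol:
  assumes U: "bounded U" "open U" and "V0 U z g h"
  shows "weak_sol U \<mu> z g (\<lambda>x. \<mu> * z x - (\<Oplus>i. h i i x))"
proof -
  note s = V0_sqint[OF assms(3)]
  have sum: "sqint (\<L> U) (\<lambda>x. \<Oplus>i. h i i x)" by (intro sqint_sum s)
  show ?thesis
    unfolding weak_sol_def
  proof (intro conjI ballI sqint_diff sqint_scale s sum)
    show "H10 U z g" using assms by (simp add: V0_def)
    fix \<phi> assume p: "\<phi> \<in> \<D> U"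
    note sp = test_sqint[OF U p]
    have "(\<Oplus>i. L2_inner U (g i) (pd i \<phi>)) = (\<Oplus>i. - L2_inner U (h i i) \<phi>)"
      using assms p by (intro sum.cong refl has_weak_pderiv_test) (auto simp: V0_def)
    then show "(\<Oplus>i. L2_inner U (g i) (pd i \<phi>)) + \<mu> * L2_inner U z \<phi> = L2_inner U (\<lambda>x. \<mu> * z x - (\<Oplus>i. h i i x)) \<phi>"
      unfolding L2_inner_diff[OF sqint_scale[OF s(1)] sum sp] L2_inner_scale
      using L2_inner_sum[of UNIV U "\<lambda>i. h i i" \<phi>, OF s(3) sp] by (simp add: sum_negf)
  qed
qed

lemma V0_weak_sol_source:
  assumes U: "bounded U" "open U" and z: "V0 U z g h" and w: "weak_sol U \<mu> z g f"
  shows "AE x in \<L> U. \<mu> * z x - (\<Oplus>i. h i i x) = f x"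
  using w V0_weak_sol[OF U z, of \<mu>] by (intro AE_eq_of_test[OF U]) (auto simp: weak_sol_def)

lemma weak_sol_shift:
  assumes U: "bounded U" "open U" and w: "weak_sol U \<mu> z g f"
  shows "weak_sol U 0 z g (\<lambda>x. f x - \<mu> * z x)"
proof -
  have H: "H10 U z g" and f: "sqint (\<L> U) f" using w by (auto simp: weak_sol_def)
  note z = sqint_scale[OF H10_sqint(1)[OF H], of \<mu>]
  show ?thesis
    unfolding weak_sol_def
  proof (intro conjI ballI H sqint_diff[OF f z])
    fix \<phi> assume p: "\<phi> \<in> \<D> U"
    show "(\<Oplus>i. L2_inner U (g i) (pd i \<phi>)) + 0 * L2_inner U z \<phi> = L2_inner U (\<lambda>x. f x - \<mu> * z x) \<phi>"
      using w p unfolding L2_inner_diff[OF f z test_sqint[OF U p]] L2_inner_scale by (auto simp: weak_sol_def algebra_simps)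
  qed
qed

text \<open>In the expansion of the squared norm of f = e + \<mu> z the mixed term is 2 \<mu> times
  the squared gradient norm, by the energy identity, and hence nonnegative.\<close>

lemma nL2_resolvent:
  assumes U: "bounded U" "open U" and m: "0 \<le> \<mu>" and w: "weak_sol U \<mu> z g f"
  shows "nL2 (\<L> U) (\<lambda>x. f x - \<mu> * z x) \<le> nL2 (\<L> U) f"
proof -
  let ?M = "\<L> U"
  have z: "sqint ?M z" and f: "sqint ?M f" using w H10_sqint by (auto simp: weak_sol_def)
  define e where "e x = f x - \<mu> * z x" for x
  have e: "sqint ?M e" unfolding e_def by (intro sqint_diff sqint_scale f z)
  have "0 \<le> L2_inner U e z" unfolding e_def weak_sol_energy[OF U w, symmetric] by (intro sum_nonneg) simp
  moreover have "L2_inner U f f = L2_inner U e e + 2 * \<mu> * L2_inner U e z + \<mu>\<^sup>2 * (nL2 ?M z)\<^sup>2"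
  proof -
    note mz = sqint_scale[OF z, of \<mu>]
    define y where "y x = \<mu> * z x" for x
    have ys: "sqint ?M y" unfolding y_def by (rule mz)
    have fe: "f = (\<lambda>x. e x + y x)" by (auto simp: e_def y_def)
    have ye: "L2_inner U y e = \<mu> * L2_inner U e z" unfolding y_def L2_inner_scale by (simp add: L2_inner_commute[of U z])
    have yy: "L2_inner U y y = \<mu>\<^sup>2 * (nL2 ?M z)\<^sup>2" unfolding L2_inner_self y_def nL2_scale by (simp add: power_mult_distrib)
    have "L2_inner U f f = L2_inner U e f + L2_inner U y f" using L2_inner_add[OF e ys f] fe by simp
    also have "L2_inner U e f = L2_inner U e e + L2_inner U y e"
      using L2_inner_add[OF e ys e] fe L2_inner_commute[of U e f] by simp
    also have "L2_inner U y f = L2_inner U y e + L2_inner U y y"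
      using L2_inner_add[OF e ys ys] fe L2_inner_commute[of U y f] L2_inner_commute[of U e y] by simp
    also have "L2_inner U e e + L2_inner U y e + (L2_inner U y e + L2_inner U y y)
      = L2_inner U e e + 2 * \<mu> * L2_inner U e z + \<mu>\<^sup>2 * (nL2 ?M z)\<^sup>2" by (simp add: ye yy)
    finally show ?thesis .
  qed
  ultimately have "(nL2 ?M e)\<^sup>2 \<le> (nL2 ?M f)\<^sup>2" using m by (simp add: L2_inner_self)
  then have "nL2 ?M e \<le> nL2 ?M f" by (rule power2_le_imp_le) simp
  then show ?thesis by (simp add: e_def[abs_def])
qed

lemma L2_conv_Cauchy:
  assumes "L2_conv M s f" "0 < e" shows "\<exists>N. \<forall>m\<ge>N. \<forall>n\<ge>N. nL2 M (\<lambda>x. s m x - s n x) < e"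
proof -
  note c = L2_convD[OF assms(1)]
  obtain N where N: "\<And>n. N \<le> n \<Longrightarrow> nL2 M (\<lambda>x. s n x - f x) < e / 2"
    using order_tendstoD(2)[OF c(3), of "e / 2"] assms(2) by (auto simp: eventually_sequentially)
  have "nL2 M (\<lambda>x. s m x - s n x) < e" if "N \<le> m" "N \<le> n" for m n
    using nL2_triangle_diff[OF c(1)[of m] c(2) c(1)[of n]] N[OF that(1)] N[OF that(2)] nL2_commute[of M f "s n"] by simp
  then show ?thesis by blast
qed

text \<open>The source is approximated by test functions; the bound applied to differences of
  solutions makes the Hessians Cauchy. For positive \<mu> the zero order term is moved to the right,
  and \<open>nL2_resolvent\<close> shows that this does not enlarge the norm of the source.\<close>

lemma weak_sol_H2:
  assumes U: "bounded U" "convex U" "open U" and m: "0 \<le> \<mu>" and w: "weak_sol U \<mu> z g f"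
  obtains h where "V0 U z g h" "(\<Oplus>i j. (nL2 (\<L> U) (h i j))\<^sup>2) \<le> (nL2 (\<L> U) f)\<^sup>2"
proof -
  let ?M = "\<L> U"
  note U' = U(1,3)
  define F where "F x = f x - \<mu> * z x" for x
  have w0: "weak_sol U 0 z g F" unfolding F_def by (rule weak_sol_shift[OF U' w])
  have H: "H10 U z g" and Fs: "sqint ?M F" using w0 by (auto simp: weak_sol_def)
  obtain \<phi> where p: "\<And>n. \<phi> n \<in> \<D> U" "L2_conv ?M \<phi> F" using test_dense[OF U' Fs] by blast
  note ps = test_sqint[OF U' p(1)]
  obtain C where C: "0 < C" "\<And>\<mu> z g f. 0 \<le> \<mu> \<Longrightarrow> weak_sol U \<mu> z g f \<Longrightarrow> nL2 ?M z \<le> C * nL2 ?M f"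
    "\<And>\<mu> z g f i. 0 \<le> \<mu> \<Longrightarrow> weak_sol U \<mu> z g f \<Longrightarrow> nL2 ?M (g i) \<le> C * nL2 ?M f" using weak_sol_bound[OF U'] by metis
  have "\<forall>n. \<exists>q. weak_sol U 0 (fst q) (snd q) (\<phi> n)"
    using weak_sol_exists[OF U' order_refl ps] by (metis fst_conv snd_conv)
  then obtain q where q: "\<And>n. weak_sol U 0 (fst (q n)) (snd (q n)) (\<phi> n)" by metis
  define Z where "Z n = fst (q n)" for n
  define G where "G n = snd (q n)" for n
  have ws: "weak_sol U 0 (Z n) (G n) (\<phi> n)" for n using q by (simp add: Z_def G_def)
  have "\<forall>n. \<exists>h. V0 U (Z n) (G n) h \<and> (\<Oplus>i j. (nL2 ?M (h i j))\<^sup>2) \<le> (nL2 ?M (\<phi> n))\<^sup>2"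
    using weak_sol_test_H2[OF U ws p(1)] by metis
  then obtain h where h: "\<And>n. V0 U (Z n) (G n) (h n)" "\<And>n. (\<Oplus>i j. (nL2 ?M (h n i j))\<^sup>2) \<le> (nL2 ?M (\<phi> n))\<^sup>2" by metis
  note hs = V0_sqint[OF h(1)]
  have diff: "nL2 ?M (\<lambda>x. h m i j x - h n i j x) \<le> nL2 ?M (\<lambda>x. \<phi> m x - \<phi> n x)" for m n i j
  proof -
    obtain k where k: "V0 U (\<lambda>x. Z m x - Z n x) (\<lambda>i x. G m i x - G n i x) k"
      "(\<Oplus>i j. (nL2 ?M (k i j))\<^sup>2) \<le> (nL2 ?M (\<lambda>x. \<phi> m x - \<phi> n x))\<^sup>2"
      
      by (rule weak_sol_test_H2[OF U weak_sol_diff[OF U' ws[of m] ws[of n]] test_diff[OF p(1)[of m] p(1)[of n]]])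
    have "AE x in ?M. h m i j x - h n i j x = k i j x"
      by (rule V0_unique_hessian[OF U' V0_diff[OF U' h(1)[of m] h(1)[of n]] k(1)])
    then have "nL2 ?M (\<lambda>x. h m i j x - h n i j x) = nL2 ?M (k i j)"
      by (intro nL2_cong_AE sqint_measurable sqint_diff hs V0_sqint[OF k(1)])
    moreover have "(nL2 ?M (k i j))\<^sup>2 \<le> (nL2 ?M (\<lambda>x. \<phi> m x - \<phi> n x))\<^sup>2"
      by (rule order.trans[OF double_sum_term_le[of "\<lambda>i j. (nL2 ?M (k i j))\<^sup>2"] k(2)]) simp
    ultimately show ?thesis by (metis nL2_nonneg power2_le_imp_le)
  qed
  have cau: "\<exists>N. \<forall>m\<ge>N. \<forall>n\<ge>N. nL2 ?M (\<lambda>x. \<phi> m x - \<phi> n x) < e" if "0 < e" for e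
    by (rule L2_conv_Cauchy[OF p(2) that])
  have "\<exists>k. L2_conv ?M (\<lambda>n. h n i j) k" for i j
  proof -
    have "\<exists>N. \<forall>m\<ge>N. \<forall>n\<ge>N. nL2 ?M (\<lambda>x. h m i j x - h n i j x) < e" if "0 < e" for e
      using cau[OF that] diff by (meson order.strict_trans1)
    then show ?thesis using L2_complete[of ?M "\<lambda>n. h n i j", OF lebesgue_on_finite[OF U'] hs(3)] by blast
  qed
  then have "\<forall>i j. \<exists>k. L2_conv ?M (\<lambda>n. h n i j) k" by blast
  then obtain k where k: "\<And>i j. L2_conv ?M (\<lambda>n. h n i j) (k i j)" by metis
  have gc: "L2_conv ?M (\<lambda>n. G n i) (g i)" for i
    unfolding L2_conv_def
  proof (intro conjI allI hs H10_sqint[OF H])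
    have l: "(\<lambda>n. C * nL2 ?M (\<lambda>x. \<phi> n x - F x)) \<longlonglongrightarrow> 0"
      using tendsto_mult[OF tendsto_const[of C] L2_convD(3)[OF p(2)]] by simp
    have b: "nL2 ?M (\<lambda>x. G n i x - g i x) \<le> C * nL2 ?M (\<lambda>x. \<phi> n x - F x)" for n
      by (rule C(3)[OF order_refl weak_sol_diff[OF U' ws[of n] w0]])
    show "(\<lambda>n. nL2 ?M (\<lambda>x. G n i x - g i x)) \<longlonglongrightarrow> 0"
      by (rule tendsto_sandwich[OF _ _ tendsto_const l]) (simp_all add: b)
  qed
  have V: "V0 U z g k"
    unfolding V0_def
  proof (intro conjI allI H)
    show "has_weak_pderiv U j (g i) (k i j)" for i j
      by (rule has_weak_pderiv_limit[OF U' _ gc k]) (use h(1) in \<open>simp add: V0_def\<close>)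
  qed
  have "(\<Oplus>i j. (nL2 ?M (k i j))\<^sup>2) \<le> (nL2 ?M F)\<^sup>2"
  proof (rule LIMSEQ_le)
    show "(\<lambda>n. \<Oplus>i j. (nL2 ?M (h n i j))\<^sup>2) \<longlonglongrightarrow> (\<Oplus>i j. (nL2 ?M (k i j))\<^sup>2)"
      by (intro tendsto_intros L2_conv_norm[OF k])
    show "(\<lambda>n. (nL2 ?M (\<phi> n))\<^sup>2) \<longlonglongrightarrow> (nL2 ?M F)\<^sup>2" by (intro tendsto_intros L2_conv_norm[OF p(2)])
  qed (use h(2) in blast)
  also have "\<dots> \<le> (nL2 ?M f)\<^sup>2"
    using nL2_resolvent[OF U' m w] unfolding F_def[abs_def] by (rule power_mono) simp
  finally show thesis by (rule that[OF V])
qed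

text \<open>Every function of \<open>V0\<close> is the weak solution of its own equation, and its
  Hessian is determined almost everywhere by its gradient, so the bound for weak solutions carries
  over.\<close>

lemma Miranda_Talenti:
  assumes U: "bounded U" "convex U" "open U" and m: "0 \<le> \<mu>" and z: "V0 U z g h"
  shows "(\<Oplus>i j. (nL2 (\<L> U) (h i j))\<^sup>2) \<le> (nL2 (\<L> U) (\<lambda>x. \<mu> * z x - (\<Oplus>i. h i i x)))\<^sup>2"
proof -
  note U' = U(1,3)
  obtain k where k: "V0 U z g k"
    "(\<Oplus>i j. (nL2 (\<L> U) (k i j))\<^sup>2) \<le> (nL2 (\<L> U) (\<lambda>x. \<mu> * z x - (\<Oplus>i. h i i x)))\<^sup>2"
    
    by (rule weak_sol_H2[OF U m V0_weak_sol[OF U' z, of \<mu>]])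
  have "AE x in \<L> U. h i j x = k i j x" for i j
    by (rule V0_unique_hessian[OF U' z k(1)])
  then have "nL2 (\<L> U) (h i j) = nL2 (\<L> U) (k i j)" for i j
    by (intro nL2_cong_AE sqint_measurable V0_sqint[OF z] V0_sqint[OF k(1)])
  then show ?thesis using k(2) by simp
qed

section \<open>Nondivergence form equations under the Cordes condition\<close>

text \<open>The coefficient matrix is \<open>I + E\<close>; after scaling, the Cordes condition says
  that \<open>E\<close> is smaller than one in the Frobenius norm, which is what
  \<open>Cordes_field\<close> records for \<open>q < 1\<close>. The zero order term serves the
  continuation in \<mu>.\<close>

definition strong_sol :: "(real^'d) set \<Rightarrow> ('d \<Rightarrow> 'd \<Rightarrow> real^'d \<Rightarrow> real) \<Rightarrow> real \<Rightarrow> (real^'d \<Rightarrow> real) \<Rightarrow> ('d \<Rightarrow> real^'d \<Rightarrow> real) \<Rightarrow>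
    ('d \<Rightarrow> 'd \<Rightarrow> real^'d \<Rightarrow> real) \<Rightarrow> (real^'d \<Rightarrow> real) \<Rightarrow> bool" where
  "strong_sol U E \<mu> z g h f \<longleftrightarrow> V0 U z g h \<and> sqint (\<L> U) f \<and>
     (AE x in \<L> U. \<mu> * z x - (\<Oplus>i. h i i x) - (\<Oplus>i j. E i j x * h i j x) = f x)"

definition Cordes_field :: "(real^'d) set \<Rightarrow> real \<Rightarrow> ('d \<Rightarrow> 'd \<Rightarrow> real^'d \<Rightarrow> real) \<Rightarrow> bool" where
  "Cordes_field U q E \<longleftrightarrow> (\<forall>i j. E i j \<in> borel_measurable (\<L> U)) \<and> (AE x in \<L> U. (\<Oplus>i j. (E i j x)\<^sup>2) \<le> q\<^sup>2)"

lemma L2_contraction: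
  fixes T :: "('a \<Rightarrow> real) \<Rightarrow> 'a \<Rightarrow> real"
  assumes M: "finite_measure M" and q: "0 \<le> q" "q < 1" and T: "\<And>f. sqint M f \<Longrightarrow> sqint M (T f)"
    and c: "\<And>f g. sqint M f \<Longrightarrow> sqint M g \<Longrightarrow> nL2 M (\<lambda>x. T f x - T g x) \<le> q * nL2 M (\<lambda>x. f x - g x)"
  obtains r where "sqint M r" "AE x in M. T r x = r x"
proof -
  define s where "s n = (T ^^ n) (\<lambda>x. 0)" for n
  have sS: "s (Suc n) = T (s n)" for n by (simp add: s_def)
  have s: "sqint M (s n)" for n by (induction n) (auto simp: s_def T)
  define D where "D = nL2 M (\<lambda>x. s 1 x - s 0 x)"
  define B where "B = D / (1 - q)"
  have B: "q * B + D = B" using q by (simp add: B_def field_simps)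
  have b: "nL2 M (\<lambda>x. s k x - s 0 x) \<le> B" for k
  proof (induction k)
    case 0
    show ?case using q by (simp add: nL2_def B_def D_def)
  next
    case (Suc k)
    have "nL2 M (\<lambda>x. s (Suc k) x - s 0 x) \<le> nL2 M (\<lambda>x. T (s k) x - T (s 0) x) + D"
      using nL2_triangle_diff[OF s[of "Suc k"] s[of 1] s[of 0]] sS[of 0] sS[of k] by (simp add: D_def)
    also have "\<dots> \<le> q * B + D" using c[OF s[of k] s[of 0]] mult_left_mono[OF Suc q(1)] by linarith
    finally show ?case by (simp add: B)
  qed
  have p: "nL2 M (\<lambda>x. s (n + k) x - s n x) \<le> q ^ n * B" for n k
  proof (induction n)
    case (Suc n)
    have "nL2 M (\<lambda>x. s (Suc n + k) x - s (Suc n) x) \<le> q * nL2 M (\<lambda>x. s (n + k) x - s n x)"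
      using c[OF s[of "n + k"] s[of n]] by (simp add: sS)
    also have "\<dots> \<le> q * (q ^ n * B)" by (rule mult_left_mono[OF Suc q(1)])
    finally show ?case by (simp add: mult.assoc)
  qed (use b in simp)
  have "\<exists>N. \<forall>m\<ge>N. \<forall>n\<ge>N. nL2 M (\<lambda>x. s m x - s n x) < e" if e: "0 < e" for e
  proof -
    have "(\<lambda>n. q ^ n * B) \<longlonglongrightarrow> 0 * B" by (intro tendsto_intros LIMSEQ_power_zero) (use q in auto)
    then obtain N where N: "q ^ N * B < e / 2"
      using order_tendstoD(2)[of "\<lambda>n. q ^ n * B" 0 sequentially "e / 2"] e by (auto simp: eventually_sequentially)
    have "nL2 M (\<lambda>x. s m x - s n x) < e" if "N \<le> m" "N \<le> n" for m n
      using nL2_triangle_diff[OF s[of m] s[of N] s[of n]] p[of N "m - N"] p[of N "n - N"] nL2_commute[of M "s N" "s n"] N that by simp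
    then show ?thesis by blast
  qed
  then obtain r where r: "L2_conv M s r" using L2_complete[of M s, OF M s] by blast
  note rs = L2_convD(2)[OF r]
  have "L2_conv M (\<lambda>n. s (Suc n)) (T r)"
    unfolding L2_conv_def
  proof (intro conjI allI s T rs)
    have l: "(\<lambda>n. q * nL2 M (\<lambda>x. s n x - r x)) \<longlonglongrightarrow> 0"
      using tendsto_mult[OF tendsto_const[of q] L2_convD(3)[OF r]] by simp
    show "(\<lambda>n. nL2 M (\<lambda>x. s (Suc n) x - T r x)) \<longlonglongrightarrow> 0"
      by (rule tendsto_sandwich[OF _ _ tendsto_const l]) (simp_all add: sS c[OF s rs])
  qed
  moreover have "L2_conv M (\<lambda>n. s (Suc n)) r"
    using r LIMSEQ_Suc[OF L2_convD(3)[OF r]] by (auto simp: L2_conv_def)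
  ultimately show thesis using that[OF rs] L2_conv_unique by blast
qed

lemma double_sum_bound:
  fixes E h :: "'i::finite \<Rightarrow> 'j::finite \<Rightarrow> real"
  assumes "0 \<le> q" "(\<Oplus>i j. (E i j)\<^sup>2) \<le> q\<^sup>2"
  shows "\<bar>\<Oplus>i j. E i j * h i j\<bar> \<le> q * sqrt (\<Oplus>i j. (h i j)\<^sup>2)"
proof -
  have "\<bar>\<Oplus>i j. E i j * h i j\<bar> \<le> (\<Oplus>i j. \<bar>E i j\<bar> * \<bar>h i j\<bar>)"
    unfolding abs_mult[symmetric] by (rule order.trans[OF sum_abs], rule sum_mono, rule sum_abs)
  also have "\<dots> \<le> sqrt (\<Oplus>i j. (E i j)\<^sup>2) * sqrt (\<Oplus>i j. (h i j)\<^sup>2)"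
    by (rule double_sum_Cauchy_Schwarz)
  also have "\<dots> \<le> q * sqrt (\<Oplus>i j. (h i j)\<^sup>2)"
    using assms real_sqrt_le_mono[OF assms(2)] by (intro mult_right_mono real_sqrt_ge_zero sum_nonneg) auto
  finally show ?thesis .
qed

lemma double_sum_nL2:
  fixes h :: "'i::finite \<Rightarrow> 'j::finite \<Rightarrow> 'a \<Rightarrow> real"
  assumes h: "\<And>i j. sqint M (h i j)" and E: "\<And>i j. E i j \<in> borel_measurable M"
    and q: "0 \<le> q" "AE x in M. (\<Oplus>i j. (E i j x)\<^sup>2) \<le> q\<^sup>2"
  shows "sqint M (\<lambda>x. \<Oplus>i j. E i j x * h i j x)"
    "(nL2 M (\<lambda>x. \<Oplus>i j. E i j x * h i j x))\<^sup>2 \<le> q\<^sup>2 * (\<Oplus>i j. (nL2 M (h i j))\<^sup>2)"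
proof -
  have "AE x in M. \<bar>E i j x\<bar> \<le> q" for i j
    using q(2)
  proof eventually_elim
    case (elim x)
    have "(E i j x)\<^sup>2 \<le> q\<^sup>2" by (rule order.trans[OF double_sum_term_le[of "\<lambda>i j. (E i j x)\<^sup>2"] elim]) simp
    then show ?case using q(1) by (metis abs_le_square_iff abs_of_nonneg)
  qed
  then show s: "sqint M (\<lambda>x. \<Oplus>i j. E i j x * h i j x)"
    by (intro sqint_sum sqint_bound_mult[OF h E])
  have hi: "integrable M (\<lambda>x. \<Oplus>i j. (h i j x)\<^sup>2)"
    by (intro Bochner_Integration.integrable_sum sqint_square h)
  have "(nL2 M (\<lambda>x. \<Oplus>i j. E i j x * h i j x))\<^sup>2 \<le> (LINT x|M. q\<^sup>2 * (\<Oplus>i j. (h i j x)\<^sup>2))"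
    unfolding nL2_sq
  proof (rule integral_mono_AE[OF sqint_square[OF s] integrable_mult_right[OF hi]])
    show "AE x in M. (\<Oplus>i j. E i j x * h i j x)\<^sup>2 \<le> q\<^sup>2 * (\<Oplus>i j. (h i j x)\<^sup>2)"
      using q(2)
    proof eventually_elim
      case (elim x)
      have n: "0 \<le> (\<Oplus>i j. (h i j x)\<^sup>2)" by (intro sum_nonneg) simp
      have "\<bar>\<Oplus>i j. E i j x * h i j x\<bar>\<^sup>2 \<le> (q * sqrt (\<Oplus>i j. (h i j x)\<^sup>2))\<^sup>2"
        by (rule power_mono[OF double_sum_bound[OF q(1) elim]]) simp
      then show ?case using n by (simp add: power_mult_distrib)
    qed
  qed
  also have "\<dots> = q\<^sup>2 * (\<Oplus>i j. (nL2 M (h i j))\<^sup>2)"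
    unfolding nL2_sq using sqint_square[OF h] by (simp add: Bochner_Integration.integral_sum Bochner_Integration.integrable_sum)
  finally show "(nL2 M (\<lambda>x. \<Oplus>i j. E i j x * h i j x))\<^sup>2 \<le> q\<^sup>2 * (\<Oplus>i j. (nL2 M (h i j))\<^sup>2)" .
qed

lemma Cordes_fieldD:
  assumes "Cordes_field U q E"
  shows "E i j \<in> borel_measurable (\<L> U)" "AE x in \<L> U. (\<Oplus>i j. (E i j x)\<^sup>2) \<le> q\<^sup>2"
  using assms by (auto simp: Cordes_field_def)

text \<open>Cauchy-Schwarz for the Frobenius product followed by the Miranda-Talenti inequality.
  Because the latter has constant one, \<open>q\<close> is the contraction factor of the
  perturbation.\<close>

lemma Cordes_perturbation:
  assumes U: "bounded U" "convex U" "open U" and q: "0 \<le> q" and E: "Cordes_field U q E"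
    and m: "0 \<le> \<mu>" and V: "V0 U z g h"
  shows "sqint (\<L> U) (\<lambda>x. \<Oplus>i j. E i j x * h i j x)"
    "nL2 (\<L> U) (\<lambda>x. \<Oplus>i j. E i j x * h i j x) \<le> q * nL2 (\<L> U) (\<lambda>x. \<mu> * z x - (\<Oplus>i. h i i x))"
proof -
  note d = double_sum_nL2[OF V0_sqint(3)[OF V] Cordes_fieldD(1)[OF E] q Cordes_fieldD(2)[OF E]]
  show "sqint (\<L> U) (\<lambda>x. \<Oplus>i j. E i j x * h i j x)" by (rule d(1))
  have "(nL2 (\<L> U) (\<lambda>x. \<Oplus>i j. E i j x * h i j x))\<^sup>2 \<le> (q * nL2 (\<L> U) (\<lambda>x. \<mu> * z x - (\<Oplus>i. h i i x)))\<^sup>2"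
    unfolding power_mult_distrib by (rule order.trans[OF d(2) mult_left_mono[OF Miranda_Talenti[OF U m V]]]) simp
  then show "nL2 (\<L> U) (\<lambda>x. \<Oplus>i j. E i j x * h i j x) \<le> q * nL2 (\<L> U) (\<lambda>x. \<mu> * z x - (\<Oplus>i. h i i x))"
    by (rule power2_le_imp_le) (use q in simp)
qed

lemma strong_sol_diff:
  assumes U: "bounded U" "open U" and s: "strong_sol U E \<mu> z g h f" "strong_sol U E \<mu> z' g' h' f'"
  shows "strong_sol U E \<mu> (\<lambda>x. z x - z' x) (\<lambda>i x. g i x - g' i x) (\<lambda>i j x. h i j x - h' i j x) (\<lambda>x. f x - f' x)"
  unfolding strong_sol_def
proof (intro conjI sqint_diff)
  show "V0 U (\<lambda>x. z x - z' x) (\<lambda>i x. g i x - g' i x) (\<lambda>i j x. h i j x - h' i j x)"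
    using V0_diff[OF U] s by (simp add: strong_sol_def)
  have "AE x in \<L> U. \<mu> * z x - (\<Oplus>i. h i i x) - (\<Oplus>i j. E i j x * h i j x) = f x"
    "AE x in \<L> U. \<mu> * z' x - (\<Oplus>i. h' i i x) - (\<Oplus>i j. E i j x * h' i j x) = f' x"
    using s by (auto simp: strong_sol_def)
  then show "AE x in \<L> U. \<mu> * (z x - z' x) - (\<Oplus>i. h i i x - h' i i x) -
      (\<Oplus>i j. E i j x * (h i j x - h' i j x)) = f x - f' x"
    by eventually_elim (simp add: sum_subtractf right_diff_distrib)
qed (use s in \<open>auto simp: strong_sol_def\<close>)

lemma strong_sol_add:
  assumes U: "bounded U" "open U" and s: "strong_sol U E \<mu> z g h f" "strong_sol U E \<mu> z' g' h' f'"
  shows "strong_sol U E \<mu> (\<lambda>x. z x + z' x) (\<lambda>i x. g i x + g' i x) (\<lambda>i j x. h i j x + h' i j x) (\<lambda>x. f x + f' x)"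
  unfolding strong_sol_def
proof (intro conjI sqint_add)
  show "V0 U (\<lambda>x. z x + z' x) (\<lambda>i x. g i x + g' i x) (\<lambda>i j x. h i j x + h' i j x)"
    using V0_add[OF U] s by (simp add: strong_sol_def)
  have "AE x in \<L> U. \<mu> * z x - (\<Oplus>i. h i i x) - (\<Oplus>i j. E i j x * h i j x) = f x"
    "AE x in \<L> U. \<mu> * z' x - (\<Oplus>i. h' i i x) - (\<Oplus>i j. E i j x * h' i j x) = f' x"
    using s by (auto simp: strong_sol_def)
  then show "AE x in \<L> U. \<mu> * (z x + z' x) - (\<Oplus>i. h i i x + h' i i x) -
      (\<Oplus>i j. E i j x * (h i j x + h' i j x)) = f x + f' x"
    by eventually_elim (simp add: sum.distrib distrib_left)
qed (use s in \<open>auto simp: strong_sol_def\<close>)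

text \<open>The constant depends on \<open>E\<close> only through \<open>q\<close>, and not on
  \<mu>. This uniformity makes the steps of the continuation in \<mu> equally long and permits
  limits of coefficients.\<close>

lemma strong_sol_bound:
  assumes U: "bounded U" "convex U" "open U" and q: "0 \<le> q" "q < 1"
  obtains C where "0 < C" "\<And>E \<mu> z g h f. Cordes_field U q E \<Longrightarrow> 0 \<le> \<mu> \<Longrightarrow> strong_sol U E \<mu> z g h f \<Longrightarrow> nL2 (\<L> U) z \<le> C * nL2 (\<L> U) f"
proof -
  let ?M = "\<L> U"
  obtain P where P: "0 < P" "\<And>\<mu> z g f. 0 \<le> \<mu> \<Longrightarrow> weak_sol U \<mu> z g f \<Longrightarrow> nL2 ?M z \<le> P * nL2 ?M f"
    using weak_sol_bound[OF U(1,3)] by metis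
  show thesis
  proof (rule that)
    show "0 < P / (1 - q)" using P q by simp
    fix E \<mu> z g h f
    assume E: "Cordes_field U q E" and m: "0 \<le> \<mu>" and s: "strong_sol U E \<mu> z g h f"
    have V: "V0 U z g h" and f: "sqint ?M f" using s by (auto simp: strong_sol_def)
    define R where "R x = \<mu> * z x - (\<Oplus>i. h i i x)" for x
    define Y where "Y x = (\<Oplus>i j. E i j x * h i j x)" for x
    have R: "sqint ?M R" unfolding R_def by (intro sqint_diff sqint_scale sqint_sum V0_sqint[OF V])
    have Y: "sqint ?M Y" and Yq: "nL2 ?M Y \<le> q * nL2 ?M R"
      unfolding Y_def R_def using Cordes_perturbation[OF U q(1) E m V] by auto
    have "AE x in ?M. R x = f x + Y x" using s unfolding strong_sol_def R_def Y_def by (auto elim: eventually_mono)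
    then have "nL2 ?M R = nL2 ?M (\<lambda>x. f x + Y x)" by (intro nL2_cong_AE sqint_measurable R sqint_add f Y)
    also have "\<dots> \<le> nL2 ?M f + q * nL2 ?M R" using nL2_triangle[OF f Y] Yq by linarith
    finally have "nL2 ?M R * (1 - q) \<le> nL2 ?M f" by (simp add: algebra_simps)
    then have R1: "nL2 ?M R \<le> nL2 ?M f / (1 - q)" using q by (simp add: pos_le_divide_eq)
    have "nL2 ?M z \<le> P * nL2 ?M R" unfolding R_def by (rule P(2)[OF m V0_weak_sol[OF U(1,3) V]])
    also have "\<dots> \<le> P * (nL2 ?M f / (1 - q))" using P by (intro mult_left_mono R1) auto
    finally show "nL2 ?M z \<le> P / (1 - q) * nL2 ?M f" by simp
  qed
qed

text \<open>The fixed point is sought for the source \<open>r\<close> of the resolvent equation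
  rather than for \<open>z\<close>: the map from \<open>r\<close> to \<open>f + E : D^2 z\<close>,
  with \<open>z\<close> the solution for \<open>r\<close>, acts on all of L2 and contracts by
  \<open>q\<close>.\<close>

lemma strong_sol_exists:
  assumes U: "bounded U" "convex U" "open U" and q: "0 \<le> q" "q < 1" and E: "Cordes_field U q E" and m: "0 \<le> \<mu>" and f: "sqint (\<L> U) f"
  obtains z g h where "strong_sol U E \<mu> z g h f"
proof -
  let ?M = "\<L> U"
  note U' = U(1,3)
  have "\<forall>f. \<exists>p. sqint ?M f \<longrightarrow> (case p of (z, g, h) \<Rightarrow> V0 U z g h \<and> weak_sol U \<mu> z g f)"
  proof
    fix f show "\<exists>p. sqint ?M f \<longrightarrow> (case p of (z, g, h) \<Rightarrow> V0 U z g h \<and> weak_sol U \<mu> z g f)"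
    proof (cases "sqint ?M f")
      case True
      obtain z g where w: "weak_sol U \<mu> z g f" by (rule weak_sol_exists[OF U' m True])
      obtain h where "V0 U z g h" by (rule weak_sol_H2[OF U m w])
      then show ?thesis using w by (intro exI[of _ "(z, g, h)"]) simp
    qed simp
  qed
  from choice[OF this] obtain p where p: "\<forall>f. sqint ?M f \<longrightarrow> (case p f of (z, g, h) \<Rightarrow> V0 U z g h \<and> weak_sol U \<mu> z g f)" ..
  define Z where "Z f = fst (p f)" for f
  define G where "G f = fst (snd (p f))" for f
  define K where "K f = snd (snd (p f))" for f
  have V: "V0 U (Z f) (G f) (K f)" and w: "weak_sol U \<mu> (Z f) (G f) f" if "sqint ?M f" for f
    using p that by (auto simp: Z_def G_def K_def split_def)
  note src = V0_weak_sol_source[OF U' V w]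
  define T where "T r x = f x + (\<Oplus>i j. E i j x * K r i j x)" for r x
  have Ys: "sqint ?M (\<lambda>x. \<Oplus>i j. E i j x * K r i j x)" if "sqint ?M r" for r
    by (rule Cordes_perturbation(1)[OF U q(1) E m V[OF that]])
  obtain r where r: "sqint ?M r" "AE x in ?M. T r x = r x"
  proof (rule L2_contraction[OF lebesgue_on_finite[OF U'] q(1,2), of T])
    show "sqint ?M (T r)" if "sqint ?M r" for r
      unfolding T_def[abs_def] by (intro sqint_add f Ys that)
    show "nL2 ?M (\<lambda>x. T r x - T s x) \<le> q * nL2 ?M (\<lambda>x. r x - s x)" if r: "sqint ?M r" and s: "sqint ?M s" for r s
    proof -
      note V' = V0_diff[OF U' V[OF r] V[OF s]]
      have "(\<lambda>x. T r x - T s x) = (\<lambda>x. \<Oplus>i j. E i j x * (K r i j x - K s i j x))"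
        by (simp add: T_def right_diff_distrib sum_subtractf)
      then have "nL2 ?M (\<lambda>x. T r x - T s x) \<le> q * nL2 ?M (\<lambda>x. \<mu> * (Z r x - Z s x) - (\<Oplus>i. K r i i x - K s i i x))"
        using Cordes_perturbation(2)[OF U q(1) E m V'] by simp
      also have "nL2 ?M (\<lambda>x. \<mu> * (Z r x - Z s x) - (\<Oplus>i. K r i i x - K s i i x)) = nL2 ?M (\<lambda>x. r x - s x)"
      proof (rule nL2_cong_AE)
        show "AE x in ?M. \<mu> * (Z r x - Z s x) - (\<Oplus>i. K r i i x - K s i i x) = r x - s x"
          using src[OF r r] src[OF s s] by eventually_elim (simp add: right_diff_distrib sum_subtractf)
        show "(\<lambda>x. r x - s x) \<in> borel_measurable ?M" by (rule sqint_measurable[OF sqint_diff[OF r s]])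
        show "(\<lambda>x. \<mu> * (Z r x - Z s x) - (\<Oplus>i. K r i i x - K s i i x)) \<in> borel_measurable ?M"
          by (intro sqint_measurable sqint_diff sqint_scale sqint_sum V0_sqint[OF V[OF r]] V0_sqint[OF V[OF s]])
      qed
      finally show ?thesis .
    qed
  qed
  have "strong_sol U E \<mu> (Z r) (G r) (K r) f"
    unfolding strong_sol_def
  proof (intro conjI V[OF r(1)] f)
    show "AE x in ?M. \<mu> * Z r x - (\<Oplus>i. K r i i x) - (\<Oplus>i j. E i j x * K r i j x) = f x"
      using src[OF r(1) r(1)] r(2) by eventually_elim (simp add: T_def)
  qed
  then show thesis by (rule that)
qed

text \<open>The second order part is at most -(1 - q) r |d|^2. Young's inequality absorbs the first
  order part into it; what is left carries exp(-1/p) p^2 = p * ramp p, which is exactly the form of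
  the zero order term.\<close>

lemma energy_pointwise:
  fixes d :: "'d::finite \<Rightarrow> real" and p :: real
  assumes q: "0 \<le> q" "q < 1" and E: "(\<Oplus>i j. (E i j)\<^sup>2) \<le> q\<^sup>2" and b: "\<And>i. \<bar>\<Oplus>j. D i j\<bar> \<le> B"
  defines "r \<equiv> expinv 0 p + expinv 1 p"
  shows "(\<Oplus>i j. d i * ((if i = j then 1 else 0) * (- r * d j) + E i j * (- r * d j) + D i j * ramp p))
    \<le> real CARD('d) * B\<^sup>2 / (4 * (1 - q)) * (p * ramp p)"
proof -
  define S where "S = (\<Oplus>i. (d i)\<^sup>2)"
  define e where "e = expinv 0 p"
  have r: "e \<le> r" "0 \<le> r" and e: "0 \<le> e" unfolding r_def e_def using ramp_deriv_bounds(1,2) by (auto simp: expinv_def)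
  have S: "0 \<le> S" unfolding S_def by (intro sum_nonneg) simp
  have "(\<Oplus>i j. (d i * d j)\<^sup>2) = S\<^sup>2"
    unfolding S_def power2_eq_square[of "sum _ _"] sum_product power_mult_distrib ..
  then have Q: "\<bar>\<Oplus>i j. E i j * (d i * d j)\<bar> \<le> q * S"
    using double_sum_bound[OF q(1) E, of "\<lambda>i j. d i * d j"] S by simp
  have one: "ramp p * (d i * (\<Oplus>j. D i j)) \<le> (1 - q) * r * (d i)\<^sup>2 + B\<^sup>2 / (4 * (1 - q)) * (p * ramp p)" for i
  proof -
    define y where "y = (\<Oplus>j. D i j)"
    have y: "y\<^sup>2 \<le> B\<^sup>2" using power_mono[OF b[of i], of 2] by (simp add: y_def)
    have "0 \<le> (2 * (1 - q) * d i - p * y)\<^sup>2 / (4 * (1 - q))" using q by simp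
    also have "\<dots> = (1 - q) * (d i)\<^sup>2 - p * (d i * y) + y\<^sup>2 / (4 * (1 - q)) * p\<^sup>2"
      using q by (simp add: field_simps power2_eq_square)
    finally have "p * (d i * y) \<le> (1 - q) * (d i)\<^sup>2 + y\<^sup>2 / (4 * (1 - q)) * p\<^sup>2" by simp
    also have "y\<^sup>2 / (4 * (1 - q)) * p\<^sup>2 \<le> B\<^sup>2 / (4 * (1 - q)) * p\<^sup>2"
      using q by (intro mult_right_mono divide_right_mono y) auto
    finally have "e * (p * (d i * y)) \<le> e * ((1 - q) * (d i)\<^sup>2 + B\<^sup>2 / (4 * (1 - q)) * p\<^sup>2)" using e by (intro mult_left_mono) auto
    also have "\<dots> = (1 - q) * (d i)\<^sup>2 * e + B\<^sup>2 / (4 * (1 - q)) * (p * ramp p)"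
      by (simp add: ramp_def e_def power2_eq_square distrib_left mult_ac)
    also have "(1 - q) * (d i)\<^sup>2 * e \<le> (1 - q) * (d i)\<^sup>2 * r" using q r by (intro mult_left_mono) auto
    finally show ?thesis by (simp add: ramp_def e_def y_def mult_ac)
  qed
  have "(\<Oplus>i j. d i * ((if i = j then 1 else 0) * (- r * d j) + E i j * (- r * d j) + D i j * ramp p))
    = (\<Oplus>i j. (if i = j then - r * (d i)\<^sup>2 else 0) - r * (E i j * (d i * d j)) + ramp p * (d i * D i j))"
    by (intro sum.cong refl) (simp add: power2_eq_square algebra_simps)
  also have "\<dots> = - r * S - r * (\<Oplus>i j. E i j * (d i * d j)) + (\<Oplus>i. ramp p * (d i * (\<Oplus>j. D i j)))"
    by (simp add: sum.distrib sum_subtractf sum_distrib_left S_def)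
  also have "\<dots> \<le> - r * S + r * (q * S) + (\<Oplus>i. (1 - q) * r * (d i)\<^sup>2 + B\<^sup>2 / (4 * (1 - q)) * (p * ramp p))"
  proof (rule add_mono)
    have "r * - (\<Oplus>i j. E i j * (d i * d j)) \<le> r * (q * S)" using Q r(2) by (intro mult_left_mono) auto
    then show "- r * S - r * (\<Oplus>i j. E i j * (d i * d j)) \<le> - r * S + r * (q * S)" by simp
  qed (intro sum_mono one)
  also have "\<dots> = real CARD('d) * B\<^sup>2 / (4 * (1 - q)) * (p * ramp p)"
  proof -
    have *: "(\<Oplus>i. (1 - q) * r * (d i)\<^sup>2 + c) = (1 - q) * r * S + real CARD('d) * c" for c
      by (simp add: sum.distrib sum_distrib_left S_def)
    show ?thesis unfolding * by (simp add: algebra_simps)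
  qed
  finally show ?thesis .
qed

text \<open>One derivative is moved from the Hessian to the test function times the coefficient. The
  cost is a first order term with derivatives of \<open>E\<close>, which is why smooth coefficients
  are treated first.\<close>

lemma weak_form:
  assumes U: "bounded U" "open U" and E: "\<And>i j. E i j \<in> \<D> UNIV" and s: "strong_sol U E \<mu> z g h f"
    and \<eta>: "\<eta> \<in> \<D> U"
  shows "L2_inner U f \<eta> = \<mu> * L2_inner U z \<eta> +
    (\<Oplus>i j. L2_inner U (g i) (\<lambda>x. (if i = j then 1 else 0) * pd j \<eta> x + E i j x * pd j \<eta> x + pd j (E i j) x * \<eta> x))"
proof -
  let ?M = "\<L> U"
  have V: "V0 U z g h" and f: "sqint ?M f" using s by (auto simp: strong_sol_def)
  note ts = test_sqint[OF U]
  define A where "A i j x = (if i = j then 1 else 0) + E i j x" for i j x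
  have As: "smooth (A i j)" for i j unfolding A_def by (intro smooth_add smooth_const test_smooth[OF E])
  have dA: "pd k (A i j) = pd k (E i j)" for i j k
    unfolding A_def[abs_def] smooth_pderiv_add[OF smooth_const test_smooth[OF E]]
    using pderiv_at_eq[of "\<lambda>x. if i = j then 1 else 0" "\<lambda>h. 0"] by (simp add: fun_eq_iff)
  have \<eta>A: "(\<lambda>x. A i j x * \<eta> x) \<in> \<D> U" for i j by (rule test_smooth_mult[OF \<eta> As])
  have 1: "L2_inner U (h i j) (\<lambda>x. A i j x * \<eta> x) = - L2_inner U (g i) (\<lambda>x. (if i = j then 1 else 0) * pd j \<eta> x + E i j x * pd j \<eta> x + pd j (E i j) x * \<eta> x)" for i j
  proof -
    have "has_weak_pderiv U j (g i) (h i j)" using V by (simp add: V0_def)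
    from has_weak_pderiv_test[OF this \<eta>A[of i j]]
    have "L2_inner U (h i j) (\<lambda>x. A i j x * \<eta> x) = - L2_inner U (g i) (pd j (\<lambda>x. A i j x * \<eta> x))" by simp
    also have "pd j (\<lambda>x. A i j x * \<eta> x) = (\<lambda>x. (if i = j then 1 else 0) * pd j \<eta> x + E i j x * pd j \<eta> x + pd j (E i j) x * \<eta> x)"
      unfolding smooth_pderiv_mult[OF As test_smooth[OF \<eta>]] dA by (simp add: A_def fun_eq_iff distrib_right)
    finally show ?thesis .
  qed
  have hA: "integrable ?M (\<lambda>x. h i j x * (A i j x * \<eta> x))" for i j by (rule sqint_mult[OF V0_sqint(3)[OF V] ts[OF \<eta>A]])
  have "L2_inner U f \<eta> = (LINT x|?M. \<mu> * (z x * \<eta> x) - (\<Oplus>i j. h i j x * (A i j x * \<eta> x)))"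
    unfolding L2_inner_def
  proof (rule integral_cong_AE)
    have "AE x in ?M. \<mu> * z x - (\<Oplus>i. h i i x) - (\<Oplus>i j. E i j x * h i j x) = f x"
      using s by (simp add: strong_sol_def)
    then show "AE x in ?M. f x * \<eta> x = \<mu> * (z x * \<eta> x) - (\<Oplus>i j. h i j x * (A i j x * \<eta> x))"
    proof eventually_elim
      case (elim x)
      have "(\<Oplus>i j. h i j x * (A i j x * \<eta> x)) = (\<Oplus>i j. (if i = j then h i i x * \<eta> x else 0) + E i j x * h i j x * \<eta> x)"
        by (intro sum.cong refl) (simp add: A_def algebra_simps)
      also have "\<dots> = ((\<Oplus>i. h i i x) + (\<Oplus>i j. E i j x * h i j x)) * \<eta> x"
        by (simp add: sum.distrib distrib_right sum_distrib_right)
      finally show ?case unfolding elim[symmetric] by (simp add: algebra_simps)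
    qed
  qed (use sqint_measurable[OF f] sqint_measurable[OF ts[OF \<eta>]] sqint_measurable[OF V0_sqint(1)[OF V]] sqint_measurable[OF V0_sqint(3)[OF V]] sqint_measurable[OF ts[OF \<eta>A]] in measurable)
  also have "\<dots> = \<mu> * L2_inner U z \<eta> - (\<Oplus>i j. L2_inner U (h i j) (\<lambda>x. A i j x * \<eta> x))"
    using hA sqint_mult[OF V0_sqint(1)[OF V] ts[OF \<eta>]]
    by (simp add: L2_inner_def Bochner_Integration.integral_sum Bochner_Integration.integrable_sum)
  finally show ?thesis unfolding 1 by (simp add: sum_negf)
qed

text \<open>Testing with \<open>ramp (- z)\<close>: for \<mu> above the constant of
  \<open>energy_pointwise\<close> the zero order term dominates and forces the negative part of
  \<open>z\<close> to vanish. The threshold \<open>m\<close> depends on the derivatives of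
  \<open>E\<close>, but only its finiteness matters for the continuation.\<close>

lemma strong_sol_positive_large:
  fixes U :: "(real^'d) set"
  assumes U: "bounded U" "open U" and E: "\<And>i j. E i j \<in> \<D> UNIV"
    and q: "0 \<le> q" "q < 1" "\<And>x. (\<Oplus>i j. (E i j x)\<^sup>2) \<le> q\<^sup>2"
  obtains m where "\<And>\<mu> z g h f. m < \<mu> \<Longrightarrow> strong_sol U E \<mu> z g h f \<Longrightarrow> AE x in \<L> U. 0 \<le> f x \<Longrightarrow> AE x in \<L> U. 0 \<le> z x"
proof -
  let ?M = "\<L> U"
  note ts = test_sqint[OF U]
  have "\<forall>i j. \<exists>B. \<forall>x. \<bar>E i j x\<bar> \<le> B \<and> \<bar>pd j (E i j) x\<bar> \<le> B"
  proof (intro allI)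
    fix i j
    obtain B1 where B1: "\<And>x. \<bar>E i j x\<bar> \<le> B1" using test_bounded[OF E] by metis
    obtain B2 where B2: "\<And>x. \<bar>pd j (E i j) x\<bar> \<le> B2" using test_bounded[OF test_pderiv[OF E]] by metis
    show "\<exists>B. \<forall>x. \<bar>E i j x\<bar> \<le> B \<and> \<bar>pd j (E i j) x\<bar> \<le> B"
      using B1 B2 by (intro exI[of _ "max B1 B2"]) (simp add: le_max_iff_disj)
  qed
  then obtain B' where B': "\<And>i j x. \<bar>E i j x\<bar> \<le> B' i j" "\<And>i j x. \<bar>pd j (E i j) x\<bar> \<le> B' i j" by metis
  define B where "B = (\<Oplus>i j. B' i j)"
  have B'0: "0 \<le> B' i j" for i j using B'(1)[of i j undefined] by linarith
  have B: "\<bar>E i j x\<bar> \<le> B" "\<bar>pd j (E i j) x\<bar> \<le> B" for i j x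
    unfolding B_def by (rule order.trans[OF B'(1) double_sum_term_le[OF B'0]], rule order.trans[OF B'(2) double_sum_term_le[OF B'0]])
  have B0: "0 \<le> B" unfolding B_def by (intro sum_nonneg B'0)
  have Bs: "\<bar>\<Oplus>j. pd j (E i j) x\<bar> \<le> B" for i x
  proof -
    have "\<bar>\<Oplus>j. pd j (E i j) x\<bar> \<le> (\<Oplus>j. B' i j)"
      by (rule order.trans[OF sum_abs sum_mono]) (use B'(2) in blast)
    also have "\<dots> \<le> B" unfolding B_def by (rule member_le_sum[of i UNIV "\<lambda>i. \<Oplus>j. B' i j"]) (auto intro: sum_nonneg B'0)
    finally show ?thesis .
  qed
  define m where "m = real CARD('d) * B\<^sup>2 / (4 * (1 - q))"
  have m: "0 \<le> m" using q by (simp add: m_def)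
  show thesis
  proof (rule that[of m])
    fix \<mu> z g h f
    assume mu: "m < \<mu>" and s: "strong_sol U E \<mu> z g h f" and fp: "AE x in ?M. 0 \<le> f x"
    have f: "sqint ?M f" and H: "H10 U z g" using s by (auto simp: strong_sol_def V0_def)
    note zs = H10_sqint(1)[OF H] and gs = H10_sqint(2)[OF H]
    define p where "p x = - z x" for x
    let ?d = "\<lambda>t. expinv 0 t + expinv 1 t"
    have "H10 U p (\<lambda>i x. - g i x)" unfolding p_def using H10_scale[OF H, of "-1"] by simp
    from H10_ramp[OF U this smooth_const[of 0]]
    have R: "H10 U (\<lambda>x. ramp (p x)) (\<lambda>i x. ?d (p x) * - g i x)" by simp
    note rs = H10_sqint(1)[OF R]
    have Em: "E i j \<in> borel_measurable ?M" "pd j (E i j) \<in> borel_measurable ?M" for i j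
      using sqint_measurable[OF ts[OF E]] sqint_measurable[OF ts[OF test_pderiv[OF E]]] by auto
    define A where "A i j x = (if i = j then 1 else 0) + E i j x" for i j x
    have Ag: "sqint ?M (\<lambda>x. A i j x * g i x)" for i j
    proof (rule sqint_bound_mult[OF gs])
      show "A i j \<in> borel_measurable ?M" unfolding A_def[abs_def] using Em by measurable
      show "AE x in ?M. \<bar>A i j x\<bar> \<le> 1 + B" using B(1)[of i j] B0
        by (intro AE_I2) (smt (verit, ccfv_threshold) A_def)
    qed
    have Dg: "sqint ?M (\<lambda>x. pd j (E i j) x * g i x)" for i j
      by (rule sqint_bound_mult[OF gs Em(2) AE_I2[OF B(2)]])
    define G where "G j x = (\<Oplus>i. A i j x * g i x)" for j x
    define F where "F x = f x - \<mu> * z x - (\<Oplus>i j. pd j (E i j) x * g i x)" for x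
    have Gs: "sqint ?M (G j)" for j unfolding G_def by (intro sqint_sum Ag)
    have Fs: "sqint ?M F" unfolding F_def by (intro sqint_diff sqint_sum sqint_scale f zs Dg)
    have eq: "(\<Oplus>j. L2_inner U (G j) (pd j \<eta>)) = L2_inner U F \<eta>" if \<eta>: "\<eta> \<in> \<D> U" for \<eta>
    proof -
      note \<eta>s = ts[OF \<eta>] and d\<eta>s = ts[OF test_pderiv[OF \<eta>]]
      have "L2_inner U (g i) (\<lambda>x. (if i = j then 1 else 0) * pd j \<eta> x + E i j x * pd j \<eta> x + pd j (E i j) x * \<eta> x)
        = L2_inner U (\<lambda>x. A i j x * g i x) (pd j \<eta>) + L2_inner U (\<lambda>x. pd j (E i j) x * g i x) \<eta>" for i j
        unfolding L2_inner_def using sqint_mult[OF Ag d\<eta>s, of i j j] sqint_mult[OF Dg \<eta>s, of j i]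
        by (simp add: A_def algebra_simps flip: Bochner_Integration.integral_add)
      then have "L2_inner U f \<eta> = \<mu> * L2_inner U z \<eta> + (\<Oplus>i j. L2_inner U (\<lambda>x. A i j x * g i x) (pd j \<eta>)) + (\<Oplus>i j. L2_inner U (\<lambda>x. pd j (E i j) x * g i x) \<eta>)"
        using weak_form[OF U E s \<eta>] by (simp add: sum.distrib)
      moreover have "(\<Oplus>j. L2_inner U (G j) (pd j \<eta>)) = (\<Oplus>i j. L2_inner U (\<lambda>x. A i j x * g i x) (pd j \<eta>))"
        unfolding G_def L2_inner_sum[OF Ag d\<eta>s] by (rule sum.swap)
      moreover have "L2_inner U F \<eta> = L2_inner U f \<eta> - \<mu> * L2_inner U z \<eta> - (\<Oplus>i j. L2_inner U (\<lambda>x. pd j (E i j) x * g i x) \<eta>)"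
      proof -
        have D: "sqint ?M (\<lambda>x. \<Oplus>j. pd j (E i j) x * g i x)" for i by (intro sqint_sum Dg)
        show ?thesis unfolding F_def L2_inner_diff[OF sqint_diff[OF f sqint_scale[OF zs]] sqint_sum[OF D] \<eta>s]
          L2_inner_diff[OF f sqint_scale[OF zs] \<eta>s] L2_inner_scale L2_inner_sum[OF D \<eta>s] L2_inner_sum[OF Dg \<eta>s] ..
      qed
      ultimately show ?thesis by simp
    qed
    have "(\<Oplus>j. L2_inner U (G j) (\<lambda>x. ?d (p x) * - g j x)) = L2_inner U F (\<lambda>x. ramp (p x))"
      by (rule H10_test_limit[OF U R Gs Fs eq])
    moreover have "(\<Oplus>j. L2_inner U (G j) (\<lambda>x. ?d (p x) * - g j x)) = (LINT x|?M. (\<Oplus>j. G j x * (?d (p x) * - g j x)))"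
      unfolding L2_inner_def using sqint_mult[OF Gs H10_sqint(2)[OF R]] by (simp add: Bochner_Integration.integral_sum)
    ultimately have 0: "(LINT x|?M. F x * ramp (p x) - (\<Oplus>j. G j x * (?d (p x) * - g j x))) = 0"
      using sqint_mult[OF Gs H10_sqint(2)[OF R]] sqint_mult[OF Fs rs] by (simp add: L2_inner_def)
    have ps: "sqint ?M p" unfolding p_def using sqint_scale[OF zs, of "-1"] by simp
    have pi: "integrable ?M (\<lambda>x. (\<mu> - m) * (p x * ramp (p x)))" using sqint_mult[OF ps rs] by simp
    have "(LINT x|?M. (\<mu> - m) * (p x * ramp (p x))) \<le> (LINT x|?M. F x * ramp (p x) - (\<Oplus>j. G j x * (?d (p x) * - g j x)))"
    proof (rule integral_mono_AE[OF pi])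
      show "integrable ?M (\<lambda>x. F x * ramp (p x) - (\<Oplus>j. G j x * (?d (p x) * - g j x)))"
        by (intro Bochner_Integration.integrable_diff Bochner_Integration.integrable_sum sqint_mult[OF Fs rs] sqint_mult[OF Gs H10_sqint(2)[OF R]])
      show "AE x in ?M. (\<mu> - m) * (p x * ramp (p x)) \<le> F x * ramp (p x) - (\<Oplus>j. G j x * (?d (p x) * - g j x))"
        using fp
      proof eventually_elim
        case (elim x)
        have "(\<Oplus>j. G j x * (?d (p x) * - g j x)) + (\<Oplus>i j. pd j (E i j) x * g i x) * ramp (p x)
          = (\<Oplus>i j. g i x * ((if i = j then 1 else 0) * (- ?d (p x) * g j x) + E i j x * (- ?d (p x) * g j x) + pd j (E i j) x * ramp (p x)))"
        proof -
          have 1: "(\<Oplus>j. G j x * (?d (p x) * - g j x)) = (\<Oplus>i j. A i j x * g i x * (?d (p x) * - g j x))"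
            unfolding G_def sum_distrib_right by (rule sum.swap)
          show ?thesis
            unfolding 1 sum_distrib_right sum.distrib[symmetric] by (simp add: A_def algebra_simps)
        qed
        also have "\<dots> \<le> m * (p x * ramp (p x))"
          using energy_pointwise[OF q(1,2) q(3)[of x] Bs[of _ x], of "\<lambda>i. g i x" "p x"] unfolding m_def .
        finally show ?case using mult_nonneg_nonneg[OF elim ramp_nonneg[of "p x"]]
          by (simp add: F_def p_def left_diff_distrib)
      qed
    qed
    then have "(\<mu> - m) * (LINT x|?M. p x * ramp (p x)) \<le> 0" unfolding 0 by simp
    then have le: "(LINT x|?M. p x * ramp (p x)) \<le> 0" using mu by (simp add: mult_le_0_iff)
    have pr: "0 \<le> p x * ramp (p x)" for x by (simp add: ramp_def expinv_def)
    have "(LINT x|?M. p x * ramp (p x)) = 0" using le pr by (intro antisym) (auto intro: integral_nonneg_AE)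
    then have "AE x in ?M. p x * ramp (p x) = 0"
      using integral_nonneg_eq_0_iff_AE[OF sqint_mult[OF ps rs]] pr by simp
    then show "AE x in ?M. 0 \<le> z x"
      by eventually_elim (auto simp: ramp_zero_iff p_def)
  qed
qed

text \<open>Step from \<mu> + \<delta> to \<mu>: let \<open>w\<close> be the negative part of
  \<open>z\<close>, and let \<open>y\<close> solve the equation at \<mu> + \<delta> with source
  \<open>\<delta> * w\<close>. Both \<open>y\<close> and \<open>z + y\<close> have nonnegative
  sources at \<mu> + \<delta>, hence are nonnegative, so \<open>w \<le> y\<close>. But the norm of
  \<open>y\<close> is at most C \<delta> = 1/2 times that of \<open>w\<close>, so \<open>w\<close>
  vanishes.\<close>

lemma strong_sol_positive:
  assumes U: "bounded U" "convex U" "open U" and E: "\<And>i j. E i j \<in> \<D> UNIV"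
    and q: "0 \<le> q" "q < 1" "\<And>x. (\<Oplus>i j. (E i j x)\<^sup>2) \<le> q\<^sup>2"
    and s: "strong_sol U E 0 z g h f" and f: "AE x in \<L> U. 0 \<le> f x"
  shows "AE x in \<L> U. 0 \<le> z x"
proof -
  let ?M = "\<L> U"
  note U' = U(1,3)
  have Ef: "Cordes_field U q E" unfolding Cordes_field_def using sqint_measurable[OF test_sqint[OF U' E]] q(3) by simp
  define P where "P \<mu> \<longleftrightarrow> (\<forall>z g h f. strong_sol U E \<mu> z g h f \<longrightarrow> (AE x in ?M. 0 \<le> f x) \<longrightarrow> (AE x in ?M. 0 \<le> z x))" for \<mu>
  obtain m where m: "\<And>\<mu> z g h f. m < \<mu> \<Longrightarrow> strong_sol U E \<mu> z g h f \<Longrightarrow> AE x in ?M. 0 \<le> f x \<Longrightarrow> AE x in ?M. 0 \<le> z x"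
    by (rule strong_sol_positive_large[OF U' E q]) blast
  obtain C where C: "0 < C" "\<And>E \<mu> z g h f. Cordes_field U q E \<Longrightarrow> 0 \<le> \<mu> \<Longrightarrow> strong_sol U E \<mu> z g h f \<Longrightarrow> nL2 ?M z \<le> C * nL2 ?M f"
    by (rule strong_sol_bound[OF U q(1,2)]) blast
  define \<delta> where "\<delta> = 1 / (2 * C)"
  have \<delta>: "0 < \<delta>" using C by (simp add: \<delta>_def)
  have step: "P \<mu>" if m0: "0 \<le> \<mu>" and IH: "P (\<mu> + \<delta>)" for \<mu>
    unfolding P_def
  proof (intro allI impI)
    fix z g h f assume s: "strong_sol U E \<mu> z g h f" and f: "AE x in ?M. 0 \<le> f x"
    have V: "V0 U z g h" and fs: "sqint ?M f" using s by (auto simp: strong_sol_def)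
    note zs = V0_sqint(1)[OF V]
    define w where "w x = max 0 (- z x)" for x
    have ws: "sqint ?M w"
      unfolding sqint_def
    proof
      show wm: "w \<in> borel_measurable ?M" unfolding w_def using sqint_measurable[OF zs] by measurable
      show "integrable ?M (\<lambda>x. (w x)\<^sup>2)"
      proof (rule Bochner_Integration.integrable_bound[OF sqint_square[OF zs]])
        show "(\<lambda>x. (w x)\<^sup>2) \<in> borel_measurable ?M" using wm by measurable
        show "AE x in ?M. norm ((w x)\<^sup>2) \<le> norm ((z x)\<^sup>2)" by (rule AE_I2) (simp add: w_def max_def)
      qed
    qed
    have m1: "0 \<le> \<mu> + \<delta>" using m0 \<delta> by simp
    obtain y g' h' where y: "strong_sol U E (\<mu> + \<delta>) y g' h' (\<lambda>x. \<delta> * w x)"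
      by (rule strong_sol_exists[OF U q(1,2) Ef m1 sqint_scale[OF ws]])
    have y0: "AE x in ?M. 0 \<le> y x"
      using IH y \<delta> unfolding P_def by (auto simp: w_def)
    have "strong_sol U E (\<mu> + \<delta>) z g h (\<lambda>x. f x + \<delta> * z x)"
      unfolding strong_sol_def
    proof (intro conjI V sqint_add sqint_scale fs zs)
      have "AE x in ?M. \<mu> * z x - (\<Oplus>i. h i i x) - (\<Oplus>i j. E i j x * h i j x) = f x"
        using s by (simp add: strong_sol_def)
      then show "AE x in ?M. (\<mu> + \<delta>) * z x - (\<Oplus>i. h i i x) - (\<Oplus>i j. E i j x * h i j x) = f x + \<delta> * z x"
        by eventually_elim (simp add: distrib_right)
    qed
    from strong_sol_add[OF U' this y]
    have "strong_sol U E (\<mu> + \<delta>) (\<lambda>x. z x + y x) (\<lambda>i x. g i x + g' i x) (\<lambda>i j x. h i j x + h' i j x) (\<lambda>x. f x + \<delta> * z x + \<delta> * w x)" .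
    moreover have "AE x in ?M. 0 \<le> f x + \<delta> * z x + \<delta> * w x"
      using f
    proof eventually_elim
      case (elim x)
      have "0 \<le> \<delta> * (z x + w x)" using \<delta> by (intro mult_nonneg_nonneg) (auto simp: w_def)
      then show ?case using elim by (simp add: distrib_left)
    qed
    ultimately have zy: "AE x in ?M. 0 \<le> z x + y x" using IH unfolding P_def by blast
    have "nL2 ?M w \<le> nL2 ?M y"
    proof (rule nL2_mono)
      show "sqint ?M y" using y V0_sqint(1) by (auto simp: strong_sol_def)
      show "AE x in ?M. \<bar>w x\<bar> \<le> \<bar>y x\<bar>" using y0 zy by eventually_elim (simp add: w_def)
    qed (rule sqint_measurable[OF ws])
    also have "\<dots> \<le> C * nL2 ?M (\<lambda>x. \<delta> * w x)" by (rule C(2)[OF Ef m1 y])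
    also have "\<dots> = nL2 ?M w / 2" unfolding nL2_scale using C(1) by (simp add: \<delta>_def)
    finally have "nL2 ?M w = 0" using nL2_nonneg[of ?M w] by linarith
    from nL2_eq_0_AE[OF ws this] show "AE x in ?M. 0 \<le> z x"
      by eventually_elim (simp add: w_def max_def split: if_splits)
  qed
  \<comment> \<open>\<open>N\<close> steps of length \<delta> lead from the range of the energy
    argument down to \<mu> = 0.\<close>
  obtain N :: nat where N: "m / \<delta> < real N" using reals_Archimedean2 by blast
  have "P (real N * \<delta>)" using m N \<delta> unfolding P_def by (meson pos_divide_less_eq)
  moreover have "P (real n * \<delta>) \<Longrightarrow> P 0" for n
  proof (induction n)
    case (Suc n)
    have "P (real n * \<delta>)" by (rule step) (use Suc.prems \<delta> in \<open>auto simp: algebra_simps\<close>)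
    then show ?case by (rule Suc.IH)
  qed simp
  ultimately show ?thesis using s f unfolding P_def by blast
qed

lemma double_sum_entry_bound:
  fixes E :: "'i::finite \<Rightarrow> 'j::finite \<Rightarrow> real"
  assumes "0 \<le> q" "(\<Oplus>i j. (E i j)\<^sup>2) \<le> q\<^sup>2" shows "\<bar>E i j\<bar> \<le> q"
proof -
  have "(E i j)\<^sup>2 \<le> q\<^sup>2" by (rule order.trans[OF double_sum_term_le[of "\<lambda>i j. (E i j)\<^sup>2"] assms(2)]) simp
  then show ?thesis using assms(1) by (metis abs_le_square_iff abs_of_nonneg)
qed

text \<open>\<open>z\<close> solves the equations with coefficients \<open>E' n\<close> for the
  sources \<open>f + Y n\<close>, so its distance to their nonnegative solutions with source
  \<open>f\<close> is at most \<open>C\<close> times the norm of \<open>Y n\<close>. Pointwise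
  convergence of the coefficients suffices because they act on the fixed Hessian of
  \<open>z\<close>.\<close>

lemma strong_sol_positive_limit:
  assumes U: "bounded U" "convex U" "open U" and q: "0 \<le> q" "q < 1"
    and En: "\<And>n. Cordes_field U q (E' n)" and E: "Cordes_field U q E"
    and lim: "AE x in \<L> U. \<forall>i j. (\<lambda>n. E' n i j x) \<longlonglongrightarrow> E i j x"
    and pos: "\<And>n z g h f. strong_sol U (E' n) 0 z g h f \<Longrightarrow> AE x in \<L> U. 0 \<le> f x \<Longrightarrow> AE x in \<L> U. 0 \<le> z x"
    and s: "strong_sol U E 0 z g h f" and f: "AE x in \<L> U. 0 \<le> f x"
  shows "AE x in \<L> U. 0 \<le> z x"
proof -
  let ?M = "\<L> U"
  note U' = U(1,3)
  have V: "V0 U z g h" and fs: "sqint ?M f" using s by (auto simp: strong_sol_def)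
  note zs = V0_sqint(1)[OF V] and hs = V0_sqint(3)[OF V]
  define Y where "Y n x = (\<Oplus>i j. (E i j x - E' n i j x) * h i j x)" for n x
  define w where "w x = (\<Oplus>i j. 2 * q * \<bar>h i j x\<bar>)" for x
  have ws: "sqint ?M w"
    unfolding w_def by (intro sqint_sum sqint_scale) (use sqint_measurable[OF hs] sqint_square[OF hs] in \<open>simp add: sqint_def\<close>)
  have Ym: "Y n \<in> borel_measurable ?M" for n
    unfolding Y_def[abs_def] using Cordes_fieldD(1)[OF E] Cordes_fieldD(1)[OF En] sqint_measurable[OF hs] by measurable
  have Yc: "L2_conv ?M Y (\<lambda>x. 0)"
  proof (rule L2_conv_dominated[OF Ym _ ws])
    show "AE x in ?M. \<bar>Y n x\<bar> \<le> w x" for n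
      using Cordes_fieldD(2)[OF E] Cordes_fieldD(2)[OF En[of n]]
    proof eventually_elim
      case (elim x)
      have 1: "\<bar>(E i j x - E' n i j x) * h i j x\<bar> \<le> 2 * q * \<bar>h i j x\<bar>" for i j
        unfolding abs_mult
        using double_sum_entry_bound[OF q(1) elim(1), of i j] double_sum_entry_bound[OF q(1) elim(2), of i j] by (intro mult_right_mono) auto
      show ?case unfolding Y_def w_def
        by (rule order.trans[OF sum_abs sum_mono], rule order.trans[OF sum_abs sum_mono], rule 1)
    qed
    show "AE x in ?M. (\<lambda>n. Y n x) \<longlonglongrightarrow> 0"
      using lim
    proof eventually_elim
      case (elim x)
      then have "(\<lambda>n. Y n x) \<longlonglongrightarrow> (\<Oplus>i j. (E i j x - E i j x) * h i j x)"
        unfolding Y_def by (intro tendsto_sum tendsto_mult tendsto_diff tendsto_const) auto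
      then show ?case by simp
    qed
  qed simp
  obtain C where C: "0 < C" "\<And>E \<mu> z g h f. Cordes_field U q E \<Longrightarrow> 0 \<le> \<mu> \<Longrightarrow> strong_sol U E \<mu> z g h f \<Longrightarrow> nL2 ?M z \<le> C * nL2 ?M f"
    by (rule strong_sol_bound[OF U q]) blast
  have "\<exists>v. sqint ?M v \<and> (AE x in ?M. 0 \<le> v x) \<and> nL2 ?M (\<lambda>x. v x - z x) \<le> C * nL2 ?M (Y n)" for n
  proof -
    obtain v g' h' where v: "strong_sol U (E' n) 0 v g' h' f"
      by (rule strong_sol_exists[OF U q En order_refl fs])
    have "strong_sol U (E' n) 0 z g h (\<lambda>x. f x + Y n x)"
      unfolding strong_sol_def
    proof (intro conjI V sqint_add fs L2_convD(1)[OF Yc])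
      have "AE x in ?M. 0 * z x - (\<Oplus>i. h i i x) - (\<Oplus>i j. E i j x * h i j x) = f x"
        using s by (simp add: strong_sol_def)
      then show "AE x in ?M. 0 * z x - (\<Oplus>i. h i i x) - (\<Oplus>i j. E' n i j x * h i j x) = f x + Y n x"
        by eventually_elim (simp add: Y_def left_diff_distrib sum_subtractf)
    qed
    from C(2)[OF En order_refl strong_sol_diff[OF U' this v]]
    have "nL2 ?M (\<lambda>x. z x - v x) \<le> C * nL2 ?M (Y n)" by simp
    moreover have "sqint ?M v" using v V0_sqint(1) by (auto simp: strong_sol_def)
    ultimately show ?thesis using pos[OF v f] nL2_commute[of ?M v z] by auto
  qed
  then have "\<forall>n. \<exists>v. sqint ?M v \<and> (AE x in ?M. 0 \<le> v x) \<and> nL2 ?M (\<lambda>x. v x - z x) \<le> C * nL2 ?M (Y n)" by blast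
  from choice[OF this] obtain v where v: "\<And>n. sqint ?M (v n)" "\<And>n. AE x in ?M. 0 \<le> v n x"
    "\<And>n. nL2 ?M (\<lambda>x. v n x - z x) \<le> C * nL2 ?M (Y n)" by blast
  have "L2_conv ?M v z"
    unfolding L2_conv_def
  proof (intro conjI allI v zs)
    have "(\<lambda>n. C * nL2 ?M (Y n)) \<longlonglongrightarrow> C * nL2 ?M (\<lambda>x. 0)" by (intro tendsto_intros L2_conv_norm[OF Yc])
    then have l: "(\<lambda>n. C * nL2 ?M (Y n)) \<longlonglongrightarrow> 0" by (simp add: nL2_def)
    show "(\<lambda>n. nL2 ?M (\<lambda>x. v n x - z x)) \<longlonglongrightarrow> 0"
      by (rule tendsto_sandwich[OF _ _ tendsto_const l]) (simp_all add: v)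
  qed
  then show ?thesis using v(2) by (rule AE_nonneg_L2_limit)
qed

text \<open>Jensen's inequality for the Frobenius norm, obtained by pairing with the mollified
  matrix itself; in this way the bound \<open>q\<close> is preserved exactly.\<close>

lemma conv_mol_Frobenius:
  fixes C :: "'i::finite \<Rightarrow> 'j::finite \<Rightarrow> real^'d \<Rightarrow> real"
  assumes r: "0 < r" and C: "\<And>i j. integrable lebesgue (C i j)" and q: "0 \<le> q" "\<And>x. (\<Oplus>i j. (C i j x)\<^sup>2) \<le> q\<^sup>2"
  shows "(\<Oplus>i j. (conv (C i j) (mol r) x)\<^sup>2) \<le> q\<^sup>2"
proof -
  define e where "e i j = conv (C i j) (mol r) x" for i j
  define N where "N = sqrt (\<Oplus>i j. (e i j)\<^sup>2)"
  have N: "0 \<le> N" "N\<^sup>2 = (\<Oplus>i j. (e i j)\<^sup>2)"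
    unfolding N_def by (auto intro!: real_sqrt_ge_zero real_sqrt_pow2 sum_nonneg)
  note ci = conv_integrable[OF C mol_test[OF r]]
  have "conv (\<lambda>y. \<Oplus>i j. C i j y * e i j) (mol r) x \<le> q * N"
  proof (rule conv_mol_bound[OF r])
    show "integrable lebesgue (\<lambda>y. \<Oplus>i j. C i j y * e i j)" using C by simp
    show "AE y in lebesgue. norm (x - y) < r \<longrightarrow> (\<Oplus>i j. C i j y * e i j) \<le> q * N"
      using double_sum_bound[OF q(1) q(2), of _ e] by (auto simp: N_def abs_le_iff)
  qed
  moreover have "conv (\<lambda>y. \<Oplus>i j. C i j y * e i j) (mol r) x = (\<Oplus>i j. e i j * e i j)"
  proof -
    have "conv (\<lambda>y. \<Oplus>i j. C i j y * e i j) (mol r) x = (LINT y|lebesgue. (\<Oplus>i j. e i j * (C i j y * mol r (x - y))))"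
      unfolding conv_def sum_distrib_right by (simp add: mult_ac)
    also have "\<dots> = (\<Oplus>i j. e i j * (LINT y|lebesgue. C i j y * mol r (x - y)))"
      using ci by (simp add: Bochner_Integration.integral_sum Bochner_Integration.integrable_sum)
    finally show ?thesis by (simp add: e_def conv_def)
  qed
  ultimately have "N * N \<le> q * N" using N(2) by (simp add: power2_eq_square)
  then have "N \<le> q" using N(1) q(1) by (cases "N = 0") auto
  then have "N\<^sup>2 \<le> q\<^sup>2" using N(1) by (rule power_mono)
  then show ?thesis by (simp add: N(2) e_def)
qed

lemma strong_sol_positive_continuous:
  assumes U: "bounded U" "convex U" "open U" and q: "0 \<le> q" "q < 1" "\<And>x. (\<Oplus>i j. (E i j x)\<^sup>2) \<le> q\<^sup>2"
    and E: "\<And>i j. continuous_on UNIV (E i j)" "compact K" "\<And>i j x. x \<notin> K \<Longrightarrow> E i j x = 0"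
    and s: "strong_sol U E 0 z g h f" and f: "AE x in \<L> U. 0 \<le> f x"
  shows "AE x in \<L> U. 0 \<le> z x"
proof -
  let ?M = "\<L> U"
  define r where "r k = inverse (real (Suc k))" for k
  have r: "0 < r k" "r k \<le> 1" "r \<longlonglongrightarrow> 0" for k
  proof -
    show "0 < r k" "r k \<le> 1" by (simp_all add: r_def inverse_eq_divide divide_le_eq)
    show "r \<longlonglongrightarrow> 0" unfolding r_def by (rule LIMSEQ_inverse_real_of_nat)
  qed
  note Ei = integrable_continuous_compact_support[OF E(1,2,3)]
  define E' where "E' n i j = conv (E i j) (mol (r n))" for n i j
  have t: "E' n i j \<in> \<D> UNIV" for n i j
  proof (cases "K = {}")
    case True
    then have "E' n i j = (\<lambda>x. 0)" using E(3) by (simp add: E'_def conv_def fun_eq_iff)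
    then show ?thesis by simp
  next
    case False
    show ?thesis
    proof (rule test_functionsI[OF _ compact_infdist_le[OF E(2) False, of 1] subset_UNIV])
      show "smooth (E' n i j)" unfolding E'_def by (rule conv_smooth[OF Ei mol_test[OF r(1)]])
      fix x assume x: "x \<notin> {x. infdist x K \<le> 1}"
      have "E i j y = 0" if "0 < infdist y K" for y
        using that infdist_zero[of y K] by (intro E(3)) auto
      then show "E' n i j x = 0" unfolding E'_def
        using x r(2)[of n] by (intro conv_mol_support_infdist[OF r(1), of 0 K]) auto
    qed
  qed
  have b: "(\<Oplus>i j. (E' n i j x)\<^sup>2) \<le> q\<^sup>2" for n x
    unfolding E'_def by (rule conv_mol_Frobenius[OF r(1) Ei q(1,3)])
  show ?thesis
  proof (rule strong_sol_positive_limit[OF U q(1,2) _ _ _ _ s f, of E'])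
    show "Cordes_field U q (E' n)" for n
      unfolding Cordes_field_def using sqint_measurable[OF test_sqint[OF U(1,3) t]] b by simp
    show "Cordes_field U q E"
      unfolding Cordes_field_def using continuous_measurable_lebesgue_on[OF U(3) continuous_on_subset[OF E(1) subset_UNIV]] q(3) by simp
    show "AE x in ?M. \<forall>i j. (\<lambda>n. E' n i j x) \<longlonglongrightarrow> E i j x"
      unfolding E'_def using conv_mol_pointwise[OF E(1) Ei r(1,3)] by simp
    show "AE x in ?M. 0 \<le> z x" if "strong_sol U (E' n) 0 z g h f" "AE x in ?M. 0 \<le> f x" for n z g h f
      by (rule strong_sol_positive[OF U t q(1,2) b that])
  qed
qed

lemma strong_sol_positive_measurable:
  fixes U :: "(real^'d) set"
  assumes U: "bounded U" "convex U" "open U" and q: "0 < q" "q < 1"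
    and Ef: "Cordes_field U q E" and s: "strong_sol U E 0 z g h f" and f: "AE x in \<L> U. 0 \<le> f x"
  shows "AE x in \<L> U. 0 \<le> z x"
proof -
  let ?M = "\<L> U"
  note E = Cordes_fieldD[OF Ef]
  obtain c :: "nat \<Rightarrow> real^'d \<Rightarrow> real" and K where c: "\<And>n. continuous_on UNIV (c n)" "\<And>n. compact (K n)"
    "\<And>n x. x \<notin> K n \<Longrightarrow> c n x = 0" "\<And>n x. 0 \<le> c n x" "\<And>n x. c n x \<le> 1" "\<And>x. x \<in> U \<Longrightarrow> (\<lambda>n. c n x) \<longlonglongrightarrow> 1"
    using interior_cutoffs[OF U(1,3)] by metis
  have "\<forall>i j. \<exists>g. (\<forall>n. continuous_on UNIV (g n)) \<and> (AE x in ?M. (\<lambda>n. g n x) \<longlonglongrightarrow> E i j x)"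
    using continuous_approximation[OF U(3) E(1)] by metis
  then obtain G where G: "\<And>i j n. continuous_on UNIV (G i j n)" "\<And>i j. AE x in ?M. (\<lambda>n. G i j n x) \<longlonglongrightarrow> E i j x" by metis
  define R where "R n x = sqrt (\<Oplus>i j. (G i j n x)\<^sup>2)" for n x
  \<comment> \<open>The second factor is the radial projection onto the Frobenius ball of radius
    \<open>q\<close>. It is continuous and fixes the limit \<open>E\<close>, so the approximations
    satisfy the Cordes bound and still converge to \<open>E\<close>.\<close>
  define E' where "E' n i j x = c n x * (q / max q (R n x) * G i j n x)" for n i j x
  have R: "0 \<le> R n x" "(R n x)\<^sup>2 = (\<Oplus>i j. (G i j n x)\<^sup>2)" for n x
    unfolding R_def by (auto intro!: real_sqrt_ge_zero real_sqrt_pow2 sum_nonneg)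
  have Ec: "continuous_on UNIV (E' n i j)" for n i j
    unfolding E'_def R_def using q by (intro continuous_intros c G continuous_on_max) auto
  have b: "(\<Oplus>i j. (E' n i j x)\<^sup>2) \<le> q\<^sup>2" for n x
  proof -
    define t where "t = c n x * (R n x / max q (R n x))"
    have 1: "0 \<le> R n x / max q (R n x)" "R n x / max q (R n x) \<le> 1" using R(1)[of n x] q by (auto simp: divide_le_eq_1 less_max_iff_disj)
    have t: "0 \<le> t" "t \<le> 1" unfolding t_def using mult_nonneg_nonneg[OF c(4) 1(1)] mult_le_one[OF c(5) 1] by auto
    have "(\<Oplus>i j. (E' n i j x)\<^sup>2) = (c n x * (q / max q (R n x)))\<^sup>2 * (R n x)\<^sup>2"
      unfolding R(2) sum_distrib_left by (simp add: E'_def mult.assoc flip: power_mult_distrib)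
    also have "\<dots> = q\<^sup>2 * t\<^sup>2" by (simp add: t_def power_mult_distrib power_divide)
    also have "\<dots> \<le> q\<^sup>2 * 1" using t by (intro mult_left_mono) (auto simp: power_le_one)
    finally show ?thesis by simp
  qed
  have lim: "AE x in ?M. \<forall>i j. (\<lambda>n. E' n i j x) \<longlonglongrightarrow> E i j x"
  proof -
    have "AE x in ?M. \<forall>i j. (\<lambda>n. G i j n x) \<longlonglongrightarrow> E i j x" using G(2) by (simp add: AE_all_countable)
    moreover have "AE x in ?M. x \<in> U" by (rule AE_I2) (simp add: space_restrict_space)
    ultimately show ?thesis
      using E(2)
    proof eventually_elim
      case (elim x)
      have "(\<lambda>n. R n x) \<longlonglongrightarrow> sqrt (\<Oplus>i j. (E i j x)\<^sup>2)"
        unfolding R_def using elim(1) by (intro tendsto_real_sqrt tendsto_sum tendsto_power) auto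
      then have "(\<lambda>n. max q (R n x)) \<longlonglongrightarrow> max q (sqrt (\<Oplus>i j. (E i j x)\<^sup>2))"
        by (intro tendsto_max tendsto_const)
      moreover have "sqrt (\<Oplus>i j. (E i j x)\<^sup>2) \<le> q" using real_sqrt_le_mono[OF elim(3)] q by simp
      ultimately have m: "(\<lambda>n. max q (R n x)) \<longlonglongrightarrow> q" by (simp add: max_absorb1)
      have "(\<lambda>n. E' n i j x) \<longlonglongrightarrow> 1 * (q / q * E i j x)" for i j
        unfolding E'_def using q elim(1) by (intro tendsto_mult tendsto_divide c(6)[OF elim(2)] m tendsto_const) auto
      then show ?case using q by simp
    qed
  qed
  show ?thesis
  proof (rule strong_sol_positive_limit[OF U less_imp_le[OF q(1)] q(2) _ Ef lim _ s f])
    show "Cordes_field U q (E' n)" for n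
      unfolding Cordes_field_def using continuous_measurable_lebesgue_on[OF U(3) continuous_on_subset[OF Ec subset_UNIV]] b by simp
    show "AE x in ?M. 0 \<le> z x" if "strong_sol U (E' n) 0 z g h f" "AE x in ?M. 0 \<le> f x" for n z g h f
      by (rule strong_sol_positive_continuous[OF U less_imp_le[OF q(1)] q(2) b Ec c(2)[of n] _ that]) (simp add: E'_def c(3))
  qed
qed

section \<open>The Hamiltonian and uniqueness\<close>

lemma inner_matrix: "A \<bullet> B = (\<Oplus>i j. A $ i $ j * B $ i $ j)" for A B :: "real^'d^'d"
  by (simp add: inner_vec_def)

lemma norm_matrix: "(norm A)\<^sup>2 = (\<Oplus>i j. (A $ i $ j)\<^sup>2)" for A :: "real^'d^'d"
  unfolding power2_norm_eq_inner inner_matrix by (simp add: power2_eq_square)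

lemma inner_mat_1: "A \<bullet> mat 1 = trace A" for A :: "real^'d^'d"
  by (simp add: inner_matrix mat_def trace_def if_distrib cong: if_cong)

lemma norm_mat_1: "(norm (mat 1 :: real^'d^'d))\<^sup>2 = real CARD('d)"
  unfolding power2_norm_eq_inner inner_mat_1 by (simp add: trace_def mat_def)

lemma trace_bound_iff:
  fixes A :: "real^'d^'d"
  assumes "0 < \<epsilon>" "0 < trace A"
  shows "norm A / trace A \<le> 1 / sqrt (real CARD('d) - 1 + \<epsilon>) \<longleftrightarrow> sqrt (real CARD('d) - 1 + \<epsilon>) * norm A \<le> trace A"
proof -
  have "1 \<le> real CARD('d)" by simp
  then have "0 < real CARD('d) - 1 + \<epsilon>" using assms(1) by linarith
  then have "0 < sqrt (real CARD('d) - 1 + \<epsilon>)" by simp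
  then show ?thesis using assms(2) by (simp add: field_simps)
qed

lemma cordes_class_trace:
  fixes A :: "real^'d^'d"
  assumes A: "A \<in> cordes_class \<nu>l \<nu>u \<epsilon>" and "0 < \<nu>l" "0 < \<epsilon>"
  shows "0 < trace A" "sqrt (real CARD('d) - 1 + \<epsilon>) * norm A \<le> trace A"
proof -
  have "\<nu>l \<le> A $ i $ i" for i
  proof -
    have "\<nu>l * (norm (axis i 1 :: real^'d))\<^sup>2 \<le> axis i 1 \<bullet> (A *v axis i 1)" using A unfolding cordes_class_def by blast
    moreover have "axis i 1 \<bullet> (A *v axis i 1) = A $ i $ i"
      by (simp add: inner_axis' matrix_vector_mul_component inner_axis)
    ultimately show ?thesis by simp
  qed
  then have "0 < A $ i $ i" for i using assms(2) by (rule less_le_trans[rotated])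
  then show 1: "0 < trace A" unfolding trace_def by (intro sum_pos) auto
  show "sqrt (real CARD('d) - 1 + \<epsilon>) * norm A \<le> trace A"
    using A trace_bound_iff[OF assms(3) 1] by (simp add: cordes_class_def)
qed

text \<open>The factor tr A / |A|^2 brings A closest to the identity. The squared distance is then d
  - (tr A)^2 / |A|^2, and the Cordes condition is what bounds it by 1 - \<epsilon>.\<close>

lemma Cordes_scaling:
  fixes A :: "real^'d^'d"
  assumes t: "0 < trace A" "sqrt (real CARD('d) - 1 + \<epsilon>) * norm A \<le> trace A" and e: "0 < \<epsilon>"
  shows "(norm ((trace A / (norm A)\<^sup>2) *\<^sub>R A - mat 1))\<^sup>2 \<le> 1 - \<epsilon>"
proof -
  have "A \<noteq> 0" using t(1) by (auto simp: trace_def)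
  then have n: "0 < norm A" by simp
  have "1 \<le> real CARD('d)" by simp
  then have d: "0 \<le> real CARD('d) - 1 + \<epsilon>" using e by linarith
  have "(sqrt (real CARD('d) - 1 + \<epsilon>) * norm A)\<^sup>2 \<le> (trace A)\<^sup>2" using d by (intro power_mono[OF t(2)]) simp
  then have 1: "real CARD('d) - 1 + \<epsilon> \<le> (trace A)\<^sup>2 / (norm A)\<^sup>2"
    using d n by (simp add: power_mult_distrib pos_le_divide_eq)
  define c where "c = trace A / (norm A)\<^sup>2"
  have "(norm (c *\<^sub>R A - mat 1))\<^sup>2 = c\<^sup>2 * (norm A)\<^sup>2 - 2 * c * trace A + real CARD('d)"
    unfolding power2_norm_eq_inner inner_diff_left inner_diff_right
    by (simp add: inner_mat_1[of A] inner_commute[of "mat 1" A] norm_mat_1[unfolded power2_norm_eq_inner] power2_eq_square algebra_simps)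
  also have "\<dots> = real CARD('d) - (trace A)\<^sup>2 / (norm A)\<^sup>2"
    using n by (simp add: c_def power2_eq_square field_simps)
  finally show ?thesis using 1 by (simp add: c_def)
qed

lemma hamiltonian_attained:
  fixes a :: "real^'d \<Rightarrow> 'a::metric_space \<Rightarrow> real^'d^'d"
  assumes A: "compact \<A>" "\<A> \<noteq> {}" and c: "continuous_on (closure U \<times> \<A>) (\<lambda>(x, \<alpha>). a x \<alpha>)"
    "continuous_on (closure U \<times> \<A>) (\<lambda>(x, \<alpha>). f x \<alpha>)" and x: "x \<in> closure U"
  obtains \<alpha> where "\<alpha> \<in> \<A>" "hamiltonian \<A> a f x M = - (a x \<alpha> \<bullet> M) - f x \<alpha>"
    "\<And>\<beta> N. \<beta> \<in> \<A> \<Longrightarrow> - (a x \<beta> \<bullet> N) - f x \<beta> \<le> hamiltonian \<A> a f x N"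
proof -
  have p: "continuous_on \<A> (\<lambda>\<alpha>. (x, \<alpha>))" by (intro continuous_intros)
  have s: "(\<lambda>\<alpha>. (x, \<alpha>)) ` \<A> \<subseteq> closure U \<times> \<A>" using x by auto
  have ac: "continuous_on \<A> (a x)" and fc: "continuous_on \<A> (f x)"
    using continuous_on_compose2[OF c(1) p s] continuous_on_compose2[OF c(2) p s] by simp_all
  have cN: "continuous_on \<A> (\<lambda>\<alpha>. - (a x \<alpha> \<bullet> N) - f x \<alpha>)" for N by (intro continuous_intros ac fc)
  have bdd: "bdd_above ((\<lambda>\<alpha>. - (a x \<alpha> \<bullet> N) - f x \<alpha>) ` \<A>)" for N
    by (intro bounded_imp_bdd_above compact_imp_bounded compact_continuous_image cN A)
  have ub: "- (a x \<beta> \<bullet> N) - f x \<beta> \<le> hamiltonian \<A> a f x N" if "\<beta> \<in> \<A>" for \<beta> N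
    unfolding hamiltonian_def by (rule cSUP_upper[OF that bdd])
  obtain \<alpha> where \<alpha>: "\<alpha> \<in> \<A>" "\<And>\<beta>. \<beta> \<in> \<A> \<Longrightarrow> - (a x \<beta> \<bullet> M) - f x \<beta> \<le> - (a x \<alpha> \<bullet> M) - f x \<alpha>"
    using continuous_attains_sup[OF A cN] by blast
  have "hamiltonian \<A> a f x M \<le> - (a x \<alpha> \<bullet> M) - f x \<alpha>"
    unfolding hamiltonian_def by (rule cSUP_least[OF A(2) \<alpha>(2)])
  then show thesis using that[OF \<alpha>(1) _ ub] ub[OF \<alpha>(1), of M] by simp
qed

text \<open>The Hamiltonian is a supremum of affine functions, hence sublinear up to its value at \<open>M\<close>; so a subgradient
  inherits from the coefficients every lower bound for a linear functional, in particular the Cordes condition.\<close>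

lemma subdifferential_Cordes:
  fixes a :: "real^'d \<Rightarrow> 'a::metric_space \<Rightarrow> real^'d^'d"
  assumes A: "compact \<A>" "\<A> \<noteq> {}" and c: "continuous_on (closure U \<times> \<A>) (\<lambda>(x, \<alpha>). a x \<alpha>)"
    "continuous_on (closure U \<times> \<A>) (\<lambda>(x, \<alpha>). f x \<alpha>)" and x: "x \<in> closure U"
    and \<nu>: "0 < \<nu>l" "0 < \<epsilon>" and a: "\<And>\<alpha>. \<alpha> \<in> \<A> \<Longrightarrow> a x \<alpha> \<in> cordes_class \<nu>l \<nu>u \<epsilon>"
    and B: "- B \<in> partial_subdifferential (hamiltonian \<A> a f) x M" and M: "M \<in> sym_matrices"
  shows "0 < trace B" "sqrt (real CARD('d) - 1 + \<epsilon>) * norm B \<le> trace B"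
proof -
  let ?H = "hamiltonian \<A> a f x"
  have Bs: "B \<in> sym_matrices"
    using B by (simp add: partial_subdifferential_def sym_matrices_def transpose_def vec_eq_iff)
  have key: "\<exists>\<alpha>\<in>\<A>. a x \<alpha> \<bullet> N \<le> B \<bullet> N" if N: "N \<in> sym_matrices" for N
  proof -
    obtain \<alpha> where \<alpha>: "\<alpha> \<in> \<A>" "?H (M + N) = - (a x \<alpha> \<bullet> (M + N)) - f x \<alpha>" "- (a x \<alpha> \<bullet> M) - f x \<alpha> \<le> ?H M"
      using hamiltonian_attained[OF A c x, of "M + N"] by metis
    have "M + N \<in> sym_matrices" using M N by (simp add: sym_matrices_def transpose_def vec_eq_iff)
    then have "?H M + (- B) \<bullet> (M + N - M) \<le> ?H (M + N)" using B unfolding partial_subdifferential_def by blast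
    then have "a x \<alpha> \<bullet> N \<le> B \<bullet> N" using \<alpha>(2,3) by (simp add: inner_add_right)
    then show ?thesis using \<alpha>(1) by blast
  qed
  have "(mat 1 :: real^'d^'d) \<in> sym_matrices" by (simp add: sym_matrices_def)
  from key[OF this] show t: "0 < trace B" using cordes_class_trace(1)[OF a \<nu>] by (force simp: inner_mat_1)
  define s where "s = sqrt (real CARD('d) - 1 + \<epsilon>)"
  have "1 \<le> real CARD('d)" by simp
  then have s: "0 \<le> s" unfolding s_def using \<nu>(2) by (intro real_sqrt_ge_zero) linarith
  have "B \<noteq> 0" using t by (auto simp: trace_def)
  then have n: "0 < norm B" by simp
  define N where "N = mat 1 - (s / norm B) *\<^sub>R B"
  have "N \<in> sym_matrices" using Bs by (simp add: N_def sym_matrices_def transpose_def vec_eq_iff mat_def)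
  from key[OF this] obtain \<alpha> where \<alpha>: "\<alpha> \<in> \<A>" "a x \<alpha> \<bullet> N \<le> B \<bullet> N" by blast
  have "s / norm B * (a x \<alpha> \<bullet> B) \<le> s / norm B * (norm (a x \<alpha>) * norm B)"
    using s n by (intro mult_left_mono norm_cauchy_schwarz) simp
  also have "\<dots> \<le> trace (a x \<alpha>)" using n cordes_class_trace(2)[OF a[OF \<alpha>(1)] \<nu>] by (simp add: s_def)
  finally have "0 \<le> a x \<alpha> \<bullet> N" by (simp add: N_def inner_diff_right inner_mat_1)
  also note \<alpha>(2)
  also have "B \<bullet> N = trace B - s * norm B"
    using n by (simp add: N_def inner_diff_right inner_mat_1 power2_norm_eq_inner[symmetric] power2_eq_square)
  finally show "sqrt (real CARD('d) - 1 + \<epsilon>) * norm B \<le> trace B" by (simp add: s_def)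
qed

text \<open>A maximizer at \<open>M\<close> competes at \<open>N\<close>, so equality of the values
  gives a : (M - N) <= 0. After scaling this bounds the trace of M - N by the perturbation
  \<open>E\<close> paired with it, and exchanging \<open>M\<close> and \<open>N\<close> gives the
  absolute value. The maximizer is taken at a single \<open>x\<close>, so no measurable selection is
  involved.\<close>

lemma equal_hamiltonian_trace_bound:
  fixes a :: "real^'d \<Rightarrow> 'a::metric_space \<Rightarrow> real^'d^'d"
  assumes A: "compact \<A>" "\<A> \<noteq> {}" and c: "continuous_on (closure U \<times> \<A>) (\<lambda>(x, \<alpha>). a x \<alpha>)"
    "continuous_on (closure U \<times> \<A>) (\<lambda>(x, \<alpha>). f x \<alpha>)" and x: "x \<in> closure U"
    and \<nu>: "0 < \<nu>l" "0 < \<epsilon>" and a: "\<And>\<alpha>. \<alpha> \<in> \<A> \<Longrightarrow> a x \<alpha> \<in> cordes_class \<nu>l \<nu>u \<epsilon>"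
    and eq: "hamiltonian \<A> a f x M = hamiltonian \<A> a f x N"
  shows "(trace (M - N))\<^sup>2 \<le> (1 - \<epsilon>) * (norm (M - N))\<^sup>2"
proof -
  have one: "trace (M - N) \<le> sqrt (1 - \<epsilon>) * norm (M - N)" if "hamiltonian \<A> a f x M = hamiltonian \<A> a f x N" for M N
  proof -
    obtain \<alpha> where \<alpha>: "\<alpha> \<in> \<A>" "hamiltonian \<A> a f x M = - (a x \<alpha> \<bullet> M) - f x \<alpha>"
      "- (a x \<alpha> \<bullet> N) - f x \<alpha> \<le> hamiltonian \<A> a f x N"
      using hamiltonian_attained[OF A c x, of M] by metis
    note t = cordes_class_trace[OF a[OF \<alpha>(1)] \<nu>]
    have le: "a x \<alpha> \<bullet> (M - N) \<le> 0" using \<alpha>(2,3) that by (simp add: inner_diff_right)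
    define E where "E = (trace (a x \<alpha>) / (norm (a x \<alpha>))\<^sup>2) *\<^sub>R a x \<alpha> - mat 1"
    have E: "norm E \<le> sqrt (1 - \<epsilon>)" using Cordes_scaling[OF t \<nu>(2)] unfolding E_def by (rule real_le_rsqrt)
    have "trace (M - N) = (trace (a x \<alpha>) / (norm (a x \<alpha>))\<^sup>2) * (a x \<alpha> \<bullet> (M - N)) - E \<bullet> (M - N)"
      by (simp add: E_def inner_diff_left inner_commute[of "mat 1"] inner_mat_1)
    also have "\<dots> \<le> - E \<bullet> (M - N)" using mult_nonneg_nonpos[OF _ le, of "trace (a x \<alpha>) / (norm (a x \<alpha>))\<^sup>2"] t(1) by simp
    also have "\<dots> \<le> norm (- E) * norm (M - N)" by (rule norm_cauchy_schwarz)
    also have "\<dots> \<le> sqrt (1 - \<epsilon>) * norm (M - N)" using E by (intro mult_right_mono) auto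
    finally show ?thesis .
  qed
  have "trace (N - M) = - trace (M - N)" by (simp add: trace_def sum_negf[symmetric])
  then have ab: "\<bar>trace (M - N)\<bar> \<le> sqrt (1 - \<epsilon>) * norm (M - N)"
    using one[OF eq] one[OF eq[symmetric]] by (simp add: norm_minus_commute abs_le_iff)
  show ?thesis
  proof (cases "\<epsilon> \<le> 1")
    case True
    then show ?thesis using power_mono[OF ab, of 2] by (simp add: power_mult_distrib)
  next
    \<comment> \<open>The scaling inequality bounds a square by 1 - \<epsilon>, so this case is
      contradictory.\<close>
    case False
    obtain \<alpha> where "\<alpha> \<in> \<A>" using A(2) by blast
    from Cordes_scaling[OF cordes_class_trace[OF a[OF this] \<nu>] \<nu>(2)]
    have "0 \<le> 1 - \<epsilon>" using order.trans zero_le_power2 by blast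
    then show ?thesis using False by simp
  qed
qed

lemma weak_hessian_diff:
  assumes U: "bounded U" "open U" and v: "v1 \<in> V_space U" "v2 \<in> V_space U"
  shows "(\<lambda>x. v1 x - v2 x) \<in> V_space U"
    "AE x in \<L> U. weak_hessian U (\<lambda>x. v1 x - v2 x) x = weak_hessian U v1 x - weak_hessian U v2 x"
proof -
  note V = V0_diff[OF U V_space_V0[OF U v(1)] V_space_V0[OF U v(2)]]
  show "(\<lambda>x. v1 x - v2 x) \<in> V_space U" by (rule V0_V_space(1)[OF U V])
  show "AE x in \<L> U. weak_hessian U (\<lambda>x. v1 x - v2 x) x = weak_hessian U v1 x - weak_hessian U v2 x"
    using V0_V_space(2)[OF U V] by eventually_elim (simp add: vec_eq_iff weak_hessian_def)
qed

lemma weak_hessian_symmetric: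
  assumes U: "bounded U" "open U" and v: "v \<in> V_space U"
  shows "AE x in \<L> U. weak_hessian U v x \<in> sym_matrices"
proof -
  have "AE x in \<L> U. \<forall>i j. weak_pderiv U j (weak_pderiv U i v) x = weak_pderiv U i (weak_pderiv U j v) x"
    using V0_symmetric[OF U V_space_V0[OF U v]] by (simp add: AE_all_countable)
  then show ?thesis by eventually_elim (simp add: sym_matrices_def transpose_def weak_hessian_def vec_eq_iff)
qed

lemma weak_hessian_sqint:
  assumes U: "bounded U" "open U" and v: "v \<in> V_space U"
  shows "sqint (\<L> U) (\<lambda>x. weak_hessian U v x $ i $ j)"
  using V0_sqint(3)[OF V_space_V0[OF U v]] by (simp add: weak_hessian_def)

lemma Linf_sym_components:
  assumes "A \<in> Linf_sym U"
  obtains C where "\<And>i j. (\<lambda>x. A x $ i $ j) \<in> borel_measurable (\<L> U)" "A \<in> borel_measurable (\<L> U)"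
    "0 \<le> C" "AE x in \<L> U. norm (A x) \<le> C" "\<And>i j. AE x in \<L> U. \<bar>A x $ i $ j\<bar> \<le> C"
proof -
  have Am: "A \<in> borel_measurable (\<L> U)" using assms by (simp add: Linf_sym_def)
  obtain C' where C': "AE x in \<L> U. norm (A x) \<le> C'" using assms by (auto simp: Linf_sym_def)
  define C where "C = max 0 C'"
  have C: "AE x in \<L> U. norm (A x) \<le> C" using C' by eventually_elim (simp add: C_def)
  have "(\<lambda>x. A x $ i $ j) \<in> borel_measurable (\<L> U)" for i j
    by (rule measurable_compose[OF Am borel_measurable_continuous_onI]) (intro continuous_intros)
  moreover have "AE x in \<L> U. \<bar>A x $ i $ j\<bar> \<le> C" for i j
    using C
  proof eventually_elim
    case (elim x)
    have "\<bar>A x $ i $ j\<bar> \<le> norm (A x $ i)" by (rule component_le_norm_cart)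
    also have "\<dots> \<le> norm (A x)" by (rule Finite_Cartesian_Product.norm_nth_le)
    finally show ?case using elim by simp
  qed
  ultimately show thesis using that[of C] Am C by (simp add: C_def)
qed

text \<open>The function \<open>w\<close> undoes the scaling: w (I + E) = A. Let \<open>z\<close>
  solve the scaled equation with the negative part \<open>f\<close> of \<open>w * m\<close> as
  source. Then \<open>G z\<close> equals the integral of w m f, which is minus the integral of f^2,
  whereas positivity of \<open>z\<close> gives \<open>0 \<le> G z\<close>. Hence \<open>f\<close>
  vanishes.\<close>

lemma density_nonneg:
  fixes U :: "(real^'d) set"
  assumes U: "bounded U" "convex U" "open U" and e: "0 < \<epsilon>" "\<epsilon> \<le> 1" and G: "nonneg_distribution U G" and m: "sqint (\<L> U) m"
    and A: "A \<in> Linf_sym U" "AE x in \<L> U. 0 < trace (A x) \<and> sqrt (real CARD('d) - 1 + \<epsilon>) * norm (A x) \<le> trace (A x)"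
    and eq: "\<And>v. v \<in> V_space U \<Longrightarrow> L2_inner U m (\<lambda>x. - (A x \<bullet> weak_hessian U v x)) = G v"
  shows "AE x in \<L> U. 0 \<le> m x"
proof -
  let ?M = "\<L> U"
  note U' = U(1,3)
  obtain C where Am: "\<And>i j. (\<lambda>x. A x $ i $ j) \<in> borel_measurable ?M" "A \<in> borel_measurable ?M"
    and C: "0 \<le> C" "AE x in ?M. norm (A x) \<le> C" using Linf_sym_components[OF A(1)] by metis
  define s where "s = sqrt (real CARD('d) - 1 + \<epsilon>)"
  have "1 \<le> real CARD('d)" by simp
  then have s: "0 < s" unfolding s_def using e(1) by (intro real_sqrt_gt_zero) linarith
  \<comment> \<open>\<open>\<epsilon> / 2\<close> in place of \<epsilon> keeps \<open>q\<close>
    positive when \<epsilon> = 1, as the radial projection in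
    \<open>strong_sol_positive_measurable\<close> requires.\<close>
  define q where "q = sqrt (1 - \<epsilon> / 2)"
  have q: "0 < q" "q < 1" "q\<^sup>2 = 1 - \<epsilon> / 2" using e by (simp_all add: q_def)
  have tm: "(\<lambda>x. trace (A x)) \<in> borel_measurable ?M" unfolding trace_def using Am(1) by measurable
  have nm: "(\<lambda>x. norm (A x)) \<in> borel_measurable ?M" using Am(2) by measurable
  define E where "E i j x = trace (A x) / (norm (A x))\<^sup>2 * (A x $ i $ j) - (if i = j then 1 else 0)" for i j x
  have Em: "E i j \<in> borel_measurable ?M" for i j
    unfolding E_def[abs_def] using tm nm Am(1)[of i j] by measurable
  have "AE x in ?M. (\<Oplus>i j. (E i j x)\<^sup>2) \<le> q\<^sup>2"
    using A(2)
  proof eventually_elim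
    case (elim x)
    have "(\<Oplus>i j. (E i j x)\<^sup>2) = (norm ((trace (A x) / (norm (A x))\<^sup>2) *\<^sub>R A x - mat 1))\<^sup>2"
      unfolding norm_matrix[of "_ - _"] by (simp add: E_def mat_def)
    also have "\<dots> \<le> 1 - \<epsilon>" using elim by (intro Cordes_scaling e) auto
    finally show ?case using e by (simp add: q(3))
  qed
  then have Ef: "Cordes_field U q E" using Em by (simp add: Cordes_field_def)
  define w where "w x = (norm (A x))\<^sup>2 / trace (A x)" for x
  have wm: "w \<in> borel_measurable ?M" unfolding w_def[abs_def] using tm nm by measurable
  have wb: "AE x in ?M. \<bar>w x\<bar> \<le> C / s"
    using A(2) C(2)
  proof eventually_elim
    case (elim x)
    have "(norm (A x))\<^sup>2 * s \<le> norm (A x) * trace (A x)"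
      using elim(1) mult_left_mono[of "s * norm (A x)" "trace (A x)" "norm (A x)"] by (simp add: s_def power2_eq_square mult_ac)
    also have "\<dots> \<le> C * trace (A x)" using elim by (intro mult_right_mono) auto
    finally show ?case using elim(1) s by (simp add: w_def field_simps)
  qed
  define m' where "m' x = w x * m x" for x
  have m's: "sqint ?M m'" unfolding m'_def by (rule sqint_bound_mult[OF m wm wb])
  define f where "f x = max 0 (- m' x)" for x
  have fs: "sqint ?M f"
    unfolding sqint_def
  proof
    show fm: "f \<in> borel_measurable ?M" unfolding f_def using sqint_measurable[OF m's] by measurable
    show "integrable ?M (\<lambda>x. (f x)\<^sup>2)"
    proof (rule Bochner_Integration.integrable_bound[OF sqint_square[OF m's]])
      show "(\<lambda>x. (f x)\<^sup>2) \<in> borel_measurable ?M" using fm by measurable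
      show "AE x in ?M. norm ((f x)\<^sup>2) \<le> norm ((m' x)\<^sup>2)" by (rule AE_I2) (simp add: f_def max_def)
    qed
  qed
  obtain z g h where z: "strong_sol U E 0 z g h f"
    by (rule strong_sol_exists[OF U less_imp_le[OF q(1)] q(2) Ef order_refl fs])
  have V: "V0 U z g h" using z by (simp add: strong_sol_def)
  have z0: "AE x in ?M. 0 \<le> z x" by (rule strong_sol_positive_measurable[OF U q(1,2) Ef z]) (simp add: f_def)
  note zV = V0_V_space[OF U' V]
  have "0 \<le> G z" using G zV(1) z0 unfolding nonneg_distribution_def by blast
  also have "G z = L2_inner U m (\<lambda>x. - (A x \<bullet> weak_hessian U z x))" by (rule eq[OF zV(1), symmetric])
  also have "\<dots> = (LINT x|?M. - (f x)\<^sup>2)"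
    unfolding L2_inner_def
  proof (rule integral_cong_AE)
    have "AE x in ?M. 0 * z x - (\<Oplus>i. h i i x) - (\<Oplus>i j. E i j x * h i j x) = f x" using z by (simp add: strong_sol_def)
    then show "AE x in ?M. m x * - (A x \<bullet> weak_hessian U z x) = - (f x)\<^sup>2"
      using zV(2) A(2)
    proof eventually_elim
      case (elim x)
      have "A x \<noteq> 0" using elim(3) by (auto simp: trace_def)
      then have n: "0 < norm (A x)" by simp
      have we: "w x * (E i j x + (if i = j then 1 else 0)) = A x $ i $ j" for i j
        using elim(3) n by (simp add: w_def E_def)
      have "A x \<bullet> weak_hessian U z x = (\<Oplus>i j. w x * (E i j x * h i j x) + (if i = j then w x * h i i x else 0))"
        unfolding inner_matrix by (intro sum.cong refl) (use elim(2) in \<open>simp add: we[symmetric] algebra_simps\<close>)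
      also have "\<dots> = w x * ((\<Oplus>i. h i i x) + (\<Oplus>i j. E i j x * h i j x))"
        by (simp add: sum.distrib sum_distrib_left distrib_left)
      also have "\<dots> = - (w x * f x)" unfolding elim(1)[symmetric] by (simp add: algebra_simps)
      finally have "m x * - (A x \<bullet> weak_hessian U z x) = m' x * f x" by (simp add: m'_def)
      also have "\<dots> = - (f x)\<^sup>2" by (simp add: f_def max_def power2_eq_square)
      finally show ?case .
    qed
    show "(\<lambda>x. m x * - (A x \<bullet> weak_hessian U z x)) \<in> borel_measurable ?M"
      unfolding inner_matrix using sqint_measurable[OF m] Am(1) sqint_measurable[OF weak_hessian_sqint[OF U' zV(1)]] by measurable
    show "(\<lambda>x. - (f x)\<^sup>2) \<in> borel_measurable ?M" using sqint_measurable[OF fs] by measurable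
  qed
  finally have "(nL2 ?M f)\<^sup>2 \<le> 0" by (simp add: nL2_sq)
  then have "nL2 ?M f = 0" by simp
  from nL2_eq_0_AE[OF fs this] show ?thesis
    using A(2)
  proof eventually_elim
    case (elim x)
    have "A x \<noteq> 0" using elim(2) by (auto simp: trace_def)
    then have "0 < w x" using elim(2) by (simp add: w_def)
    moreover have "0 \<le> w x * m x" using elim(1) max.cobounded2[of "- (w x * m x)" 0] by (simp add: f_def m'_def)
    ultimately show ?case by (simp add: zero_le_mult_iff)
  qed
qed

text \<open>Completeness of Lebesgue measure. Measurability of the Hamiltonian along a solution is
  obtained in this way from its equality with \<open>F m\<close>.\<close>

lemma borel_measurable_AE_lebesgue_on:
  fixes f g :: "real^'d \<Rightarrow> real"
  assumes "open U" "f \<in> borel_measurable (\<L> U)" "AE x in \<L> U. f x = g x"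
  shows "g \<in> borel_measurable (\<L> U)"
proof -
  note S = open_sets_lebesgue[OF assms(1)]
  have "AE x in lebesgue. x \<in> U \<longrightarrow> f x = g x" using assms(3) S by (simp add: AE_restrict_space_iff)
  then have "AE x in lebesgue. (if x \<in> U then f x else 0) = (if x \<in> U then g x else 0)" by eventually_elim simp
  from borel_measurable_AE[OF iffD2[OF borel_measurable_if[OF S] assms(2)] this] show ?thesis
    by (rule iffD1[OF borel_measurable_if[OF S]])
qed

lemma subdifferential_variational_inequality:
  assumes U: "bounded U" "open U" and m: "m \<in> L2_plus U" and u: "u \<in> V_space U" and v: "v \<in> V_space U"
    and H: "sqint (\<L> U) (\<lambda>x. hamiltonian_op U H v x - hamiltonian_op U H u x)"
    and A: "(\<lambda>x. - A x) \<in> DH U H u"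
    and eq: "\<And>v. v \<in> V_space U \<Longrightarrow> L2_inner U m (\<lambda>x. - (A x \<bullet> weak_hessian U v x)) = G v"
  shows "G (\<lambda>x. v x - u x) \<le> L2_inner U m (\<lambda>x. hamiltonian_op U H v x - hamiltonian_op U H u x)"
proof -
  let ?M = "\<L> U"
  define B where "B x = - A x" for x
  have B: "B \<in> Linf_sym U" "AE x in ?M. B x \<in> partial_subdifferential H x (weak_hessian U u x)"
    using A unfolding DH_def B_def by auto
  obtain C where Bm: "\<And>i j. (\<lambda>x. B x $ i $ j) \<in> borel_measurable ?M" and C: "\<And>i j. AE x in ?M. \<bar>B x $ i $ j\<bar> \<le> C"
    using Linf_sym_components[OF B(1)] by metis
  have ms: "sqint ?M m" and m0: "AE x in ?M. 0 \<le> m x" using m by (auto simp: L2_plus_def L2_iff)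
  note d = weak_hessian_diff[OF U v u]
  have "sqint ?M (\<lambda>x. B x \<bullet> weak_hessian U (\<lambda>x. v x - u x) x)"
    unfolding inner_matrix by (intro sqint_sum sqint_bound_mult[where C = C] weak_hessian_sqint[OF U d(1)] Bm C)
  then have i: "integrable ?M (\<lambda>x. m x * (B x \<bullet> weak_hessian U (\<lambda>x. v x - u x) x))" by (rule sqint_mult[OF ms])
  have "G (\<lambda>x. v x - u x) = (LINT x|?M. m x * (B x \<bullet> weak_hessian U (\<lambda>x. v x - u x) x))"
    using eq[OF d(1)] by (simp add: L2_inner_def B_def)
  also have "\<dots> \<le> (LINT x|?M. m x * (hamiltonian_op U H v x - hamiltonian_op U H u x))"
  proof (rule integral_mono_AE[OF i sqint_mult[OF ms H]])
    show "AE x in ?M. m x * (B x \<bullet> weak_hessian U (\<lambda>x. v x - u x) x) \<le> m x * (hamiltonian_op U H v x - hamiltonian_op U H u x)"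
      using B(2) m0 d(2) weak_hessian_symmetric[OF U v]
    proof eventually_elim
      case (elim x)
      then have "H x (weak_hessian U u x) + B x \<bullet> (weak_hessian U v x - weak_hessian U u x) \<le> H x (weak_hessian U v x)"
        unfolding partial_subdifferential_def by blast
      then show ?case using elim(2,3) by (intro mult_left_mono) (auto simp: hamiltonian_op_def)
    qed
  qed
  finally show ?thesis by (simp add: L2_inner_def)
qed

text \<open>Each inequality is assumed only for the test with the other solution, so both problems
  can make use of it. In the sum the two values of \<open>G\<close> cancel by linearity.\<close>

lemma uniqueness_from_variational_inequalities:
  fixes U :: "(real^'d) set" and a :: "real^'d \<Rightarrow> 'a::metric_space \<Rightarrow> real^'d^'d"
  assumes U: "bounded U" "convex U" "open U" and \<A>: "compact \<A>" "\<A> \<noteq> {}"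
    and c: "continuous_on (closure U \<times> \<A>) (\<lambda>(x, \<alpha>). a x \<alpha>)" "continuous_on (closure U \<times> \<A>) (\<lambda>(x, \<alpha>). f x \<alpha>)"
    and \<nu>: "0 < \<nu>l" "0 < \<epsilon>" and a: "\<And>x \<alpha>. x \<in> closure U \<Longrightarrow> \<alpha> \<in> \<A> \<Longrightarrow> a x \<alpha> \<in> cordes_class \<nu>l \<nu>u \<epsilon>"
    and G: "G \<in> V_dual U" and F: "L2_operator U F" "strictly_monotone_on_L2_plus U F"
    and u: "u1 \<in> V_space U" "u2 \<in> V_space U" and m: "m1 \<in> L2_plus U" "m2 \<in> L2_plus U"
    and H: "ae_eq U (hamiltonian_op U (hamiltonian \<A> a f) u1) (F m1)" "ae_eq U (hamiltonian_op U (hamiltonian \<A> a f) u2) (F m2)"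
    and le: "G (\<lambda>x. u2 x - u1 x) \<le> L2_inner U m1 (\<lambda>x. hamiltonian_op U (hamiltonian \<A> a f) u2 x - hamiltonian_op U (hamiltonian \<A> a f) u1 x)"
      "G (\<lambda>x. u1 x - u2 x) \<le> L2_inner U m2 (\<lambda>x. hamiltonian_op U (hamiltonian \<A> a f) u1 x - hamiltonian_op U (hamiltonian \<A> a f) u2 x)"
  shows "ae_eq U u1 u2 \<and> ae_eq U m1 m2"
proof -
  let ?M = "\<L> U"
  note U' = U(1,3)
  define h1 where "h1 = hamiltonian_op U (hamiltonian \<A> a f) u1"
  define h2 where "h2 = hamiltonian_op U (hamiltonian \<A> a f) u2"
  have mL: "m1 \<in> L2 U" "m2 \<in> L2 U" using m by (auto simp: L2_plus_def)
  then have ms: "sqint ?M m1" "sqint ?M m2" by (auto simp: L2_iff)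
  have Fs: "sqint ?M (F m1)" "sqint ?M (F m2)" using F(1) mL by (auto simp: L2_operator_def L2_iff)
  have hF: "AE x in ?M. F m1 x = h1 x" "AE x in ?M. F m2 x = h2 x" using H by (auto simp: ae_eq_def h1_def h2_def elim: eventually_mono)
  have hm: "h1 \<in> borel_measurable ?M" "h2 \<in> borel_measurable ?M"
    using borel_measurable_AE_lebesgue_on[OF U(3) sqint_measurable[OF Fs(1)] hF(1)] borel_measurable_AE_lebesgue_on[OF U(3) sqint_measurable[OF Fs(2)] hF(2)] by auto
  have hs: "sqint ?M h1" "sqint ?M h2" using sqint_cong_AE[OF Fs(1) hm(1) hF(1)] sqint_cong_AE[OF Fs(2) hm(2) hF(2)] by auto
  define e where "e x = h1 x - h2 x" for x
  have es: "sqint ?M e" unfolding e_def by (rule sqint_diff[OF hs])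
  note ud = weak_hessian_diff[OF U' u]
  have "G (\<lambda>x. u2 x - u1 x) = - G (\<lambda>x. u1 x - u2 x)"
  proof -
    have "\<forall>c. \<forall>v\<in>V_space U. G (\<lambda>x. c * v x) = c * G v" using G by (simp add: V_dual_def)
    from bspec[OF spec[OF this, of "-1"] ud(1)] show ?thesis by simp
  qed
  moreover have "L2_inner U m1 (\<lambda>x. h2 x - h1 x) = - L2_inner U m1 e"
    unfolding L2_inner_def e_def by (simp flip: integral_minus add: algebra_simps)
  ultimately have "L2_inner U m1 e \<le> L2_inner U m2 e" using le by (simp add: h1_def h2_def e_def[abs_def])
  then have "L2_inner U (\<lambda>x. m1 x - m2 x) e \<le> 0" by (simp add: L2_inner_diff[OF ms es])
  moreover have "L2_inner U (\<lambda>x. F m1 x - F m2 x) (\<lambda>x. m1 x - m2 x) = L2_inner U e (\<lambda>x. m1 x - m2 x)"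
  proof (rule L2_inner_cong_AE)
    show "AE x in ?M. F m1 x - F m2 x = e x" using hF by eventually_elim (simp add: e_def)
  qed (intro sqint_measurable sqint_diff Fs ms es)+
  ultimately have "L2_inner U (\<lambda>x. F m1 x - F m2 x) (\<lambda>x. m1 x - m2 x) \<le> 0" by (simp add: L2_inner_commute)
  then have meq: "ae_eq U m1 m2" using F(2) m unfolding strictly_monotone_on_L2_plus_def by blast
  then have "ae_eq U (F m1) (F m2)" using F(1) mL unfolding L2_operator_def by blast
  then have heq: "AE x in ?M. h1 x = h2 x"
    using hF unfolding ae_eq_def by eventually_elim simp
  define w where "w x = u1 x - u2 x" for x
  have wV: "w \<in> V_space U" unfolding w_def by (rule ud(1))
  note V = V_space_V0[OF U' wV]
  define h where "h i j = weak_pderiv U j (weak_pderiv U i w)" for i j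
  have hsq: "sqint ?M (h i j)" for i j unfolding h_def by (rule V0_sqint(3)[OF V])
  \<comment> \<open>The summand \<open>0 * w x\<close> gives the source the shape it has in
    \<open>Miranda_Talenti\<close> at \<mu> = 0.\<close>
  define T where "T x = 0 * w x - (\<Oplus>i. h i i x)" for x
  have Ts: "sqint ?M T" unfolding T_def by (intro sqint_diff sqint_scale sqint_sum hsq V0_sqint(1)[OF V])
  define S where "S = (\<Oplus>i j. (nL2 ?M (h i j))\<^sup>2)"
  have MT: "S \<le> (nL2 ?M T)\<^sup>2" unfolding S_def T_def h_def by (rule Miranda_Talenti[OF U order_refl V])
  have hi: "integrable ?M (\<lambda>x. \<Oplus>i j. (h i j x)\<^sup>2)" by (intro Bochner_Integration.integrable_sum sqint_square hsq)
  have "(nL2 ?M T)\<^sup>2 \<le> (LINT x|?M. (1 - \<epsilon>) * (\<Oplus>i j. (h i j x)\<^sup>2))"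
    unfolding nL2_sq
  proof (rule integral_mono_AE[OF sqint_square[OF Ts] integrable_mult_right[OF hi]])
    have "AE x in ?M. x \<in> U" by (rule AE_I2) (simp add: space_restrict_space)
    then show "AE x in ?M. (T x)\<^sup>2 \<le> (1 - \<epsilon>) * (\<Oplus>i j. (h i j x)\<^sup>2)"
      using heq ud(2)
    proof eventually_elim
      case (elim x)
      have x: "x \<in> closure U" using elim(1) closure_subset by blast
      have D: "weak_hessian U u1 x - weak_hessian U u2 x = (\<chi> i j. h i j x)"
        using elim(3) by (simp add: weak_hessian_def h_def w_def[abs_def])
      have "hamiltonian \<A> a f x (weak_hessian U u1 x) = hamiltonian \<A> a f x (weak_hessian U u2 x)"
        using elim(2) by (simp add: h1_def h2_def hamiltonian_op_def)
      from equal_hamiltonian_trace_bound[OF \<A> c x \<nu> a[OF x] this]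
      show ?case unfolding D norm_matrix by (simp add: T_def trace_def)
    qed
  qed
  also have "\<dots> = (1 - \<epsilon>) * S"
    unfolding S_def nL2_sq using sqint_square[OF hsq] by (simp add: Bochner_Integration.integral_sum Bochner_Integration.integrable_sum)
  finally have T2: "(nL2 ?M T)\<^sup>2 \<le> (1 - \<epsilon>) * S" .
  have "S * \<epsilon> \<le> 0" using MT T2 by (simp add: algebra_simps)
  then have "S \<le> 0" using \<nu>(2) by (simp add: mult_le_0_iff)
  moreover have "0 \<le> S" unfolding S_def by (intro sum_nonneg) simp
  ultimately have "S = 0" by simp
  then have "nL2 ?M T = 0" using T2 by simp
  moreover obtain C where "\<And>\<mu> z g f. 0 \<le> \<mu> \<Longrightarrow> weak_sol U \<mu> z g f \<Longrightarrow> nL2 ?M z \<le> C * nL2 ?M f" using weak_sol_bound[OF U'] by metis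
  moreover have "weak_sol U 0 w (\<lambda>i. weak_pderiv U i w) T" unfolding T_def h_def by (rule V0_weak_sol[OF U' V])
  ultimately have "nL2 ?M w \<le> 0" by force
  then have "nL2 ?M w = 0" using nL2_nonneg[of ?M w] by linarith
  from nL2_eq_0_AE[OF V0_sqint(1)[OF V] this] have "ae_eq U u1 u2"
    unfolding ae_eq_def by eventually_elim (simp add: w_def)
  then show ?thesis using meq by blast
qed

theorem theorem3p5:
  fixes \<Omega> :: "(real^'d) set"
    and \<A> :: "'a::metric_space set"
    and a :: "real^'d \<Rightarrow> 'a \<Rightarrow> real^'d^'d"
    and f :: "real^'d \<Rightarrow> 'a \<Rightarrow> real"
    and \<nu>l \<nu>u \<epsilon> :: real
    and F :: "(real^'d \<Rightarrow> real) \<Rightarrow> real^'d \<Rightarrow> real"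
    and G :: "(real^'d \<Rightarrow> real) \<Rightarrow> real"
  assumes "bounded \<Omega>" and "convex \<Omega>" and "open \<Omega>"
    and "compact \<A>" and "\<A> \<noteq> {}"
    and "continuous_on (closure \<Omega> \<times> \<A>) (\<lambda>(x, \<alpha>). a x \<alpha>)"
    and "0 < \<nu>l" and "\<nu>l \<le> \<nu>u" and "0 < \<epsilon>" and "\<epsilon> \<le> 1"
    and "\<And>x \<alpha>. x \<in> closure \<Omega> \<Longrightarrow> \<alpha> \<in> \<A> \<Longrightarrow> a x \<alpha> \<in> cordes_class \<nu>l \<nu>u \<epsilon>"
    and "continuous_on (closure \<Omega> \<times> \<A>) (\<lambda>(x, \<alpha>). f x \<alpha>)"
    and "G \<in> V_dual \<Omega>" and "nonneg_distribution \<Omega> G"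
    and "L2_operator \<Omega> F" and "strictly_monotone_on_L2_plus \<Omega> F"
  shows "at_most_one_solution \<Omega> (PDI_solution \<Omega> (hamiltonian \<A> a f) F G) \<and>
         at_most_one_solution \<Omega> (VI_solution \<Omega> (hamiltonian \<A> a f) F G)"
proof -
  let ?H = "hamiltonian \<A> a f"
  let ?M = "lebesgue_on \<Omega>"
  note \<Omega>' = assms(1,3)
  note unique = uniqueness_from_variational_inequalities[OF assms(1,2,3,4,5,6,12,7,9,11,13,15,16)]
  have VI: "at_most_one_solution \<Omega> (VI_solution \<Omega> ?H F G)"
    unfolding at_most_one_solution_def VI_solution_def using unique by blast
  \<comment> \<open>\<open>- A x\<close> is a subgradient, so \<open>A x\<close> inherits the Cordes
    bound of the coefficients, and the duality argument yields the sign of \<open>m\<close>.\<close>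
  have dens: "m \<in> L2_plus \<Omega>"
    if u: "u \<in> V_space \<Omega>" and m: "m \<in> L2 \<Omega>" and A: "(\<lambda>x. - A x) \<in> DH \<Omega> ?H u"
      and eq: "\<And>v. v \<in> V_space \<Omega> \<Longrightarrow> L2_inner \<Omega> m (\<lambda>x. - (A x \<bullet> weak_hessian \<Omega> v x)) = G v" for u m A
  proof -
    have "(\<lambda>x. - (- A x)) \<in> borel_measurable ?M" using A unfolding DH_def Linf_sym_def by (intro borel_measurable_uminus) auto
    moreover have "AE x in ?M. - A x \<in> sym_matrices" using A unfolding DH_def Linf_sym_def by auto
    then have "AE x in ?M. A x \<in> sym_matrices" by eventually_elim (simp add: sym_matrices_def transpose_def vec_eq_iff)
    moreover have "\<exists>C. AE x in ?M. norm (A x) \<le> C" using A unfolding DH_def Linf_sym_def by auto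
    ultimately have AL: "A \<in> Linf_sym \<Omega>" by (simp add: Linf_sym_def)
    have "AE x in ?M. - A x \<in> partial_subdifferential ?H x (weak_hessian \<Omega> u x)" using A by (simp add: DH_def)
    moreover have "AE x in ?M. x \<in> \<Omega>" by (rule AE_I2) (simp add: space_restrict_space)
    ultimately have "AE x in ?M. 0 < trace (A x) \<and> sqrt (real CARD('d) - 1 + \<epsilon>) * norm (A x) \<le> trace (A x)"
      using weak_hessian_symmetric[OF \<Omega>' u]
    proof eventually_elim
      case (elim x)
      have x: "x \<in> closure \<Omega>" using elim(2) closure_subset by blast
      from subdifferential_Cordes[OF assms(4,5,6,12) x assms(7,9) assms(11)[OF x] elim(1,3)] show ?case by blast
    qed
    from density_nonneg[OF assms(1,2,3,9,10,14) _ AL this eq] m show ?thesis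
      by (simp add: L2_plus_def L2_iff)
  qed
  have "at_most_one_solution \<Omega> (PDI_solution \<Omega> ?H F G)"
    unfolding at_most_one_solution_def
  proof (intro allI impI)
    fix u1 m1 u2 m2
    assume "PDI_solution \<Omega> ?H F G u1 m1 \<and> PDI_solution \<Omega> ?H F G u2 m2"
    then obtain A1 A2 where u: "u1 \<in> V_space \<Omega>" "u2 \<in> V_space \<Omega>" and mL: "m1 \<in> L2 \<Omega>" "m2 \<in> L2 \<Omega>"
      and H: "ae_eq \<Omega> (hamiltonian_op \<Omega> ?H u1) (F m1)" "ae_eq \<Omega> (hamiltonian_op \<Omega> ?H u2) (F m2)"
      and A: "(\<lambda>x. - A1 x) \<in> DH \<Omega> ?H u1" "(\<lambda>x. - A2 x) \<in> DH \<Omega> ?H u2"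
      and eq: "\<And>v. v \<in> V_space \<Omega> \<Longrightarrow> L2_inner \<Omega> m1 (\<lambda>x. - (A1 x \<bullet> weak_hessian \<Omega> v x)) = G v"
        "\<And>v. v \<in> V_space \<Omega> \<Longrightarrow> L2_inner \<Omega> m2 (\<lambda>x. - (A2 x \<bullet> weak_hessian \<Omega> v x)) = G v"
      unfolding PDI_solution_def by blast
    have m: "m1 \<in> L2_plus \<Omega>" "m2 \<in> L2_plus \<Omega>"
      using dens[OF u(1) mL(1) A(1) eq(1)] dens[OF u(2) mL(2) A(2) eq(2)] by blast+
    \<comment> \<open>Square integrability of the Hamiltonian along \<open>u\<close> is inherited
      from \<open>F m\<close>; the integral comparison in
      \<open>subdifferential_variational_inequality\<close> depends on it.\<close>
    have hs: "sqint ?M (hamiltonian_op \<Omega> ?H u)" if "m \<in> L2 \<Omega>" "ae_eq \<Omega> (hamiltonian_op \<Omega> ?H u) (F m)" for u m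
    proof -
      have Fs: "sqint ?M (F m)" using assms(15) that(1) by (auto simp: L2_operator_def L2_iff)
      have e: "AE x in ?M. F m x = hamiltonian_op \<Omega> ?H u x" using that(2) by (auto simp: ae_eq_def elim: eventually_mono)
      show ?thesis by (rule sqint_cong_AE[OF Fs borel_measurable_AE_lebesgue_on[OF assms(3) sqint_measurable[OF Fs] e] e])
    qed
    note h = hs[OF mL(1) H(1)] hs[OF mL(2) H(2)]
    show "ae_eq \<Omega> u1 u2 \<and> ae_eq \<Omega> m1 m2"
      by (rule unique[OF _ _ u m H
          subdifferential_variational_inequality[OF \<Omega>' m(1) u(1,2) sqint_diff[OF h(2,1)] A(1) eq(1)]
          subdifferential_variational_inequality[OF \<Omega>' m(2) u(2,1) sqint_diff[OF h] A(2) eq(2)]])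
  qed
  then show ?thesis using VI by blast
qed

end
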